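(* Let $U\subseteq\mathbb{C}$ be open and connected, and let $f$ be complex analytic on $U$. Suppose $f(z)$ is a solution, not algebraic over $\mathbb{C}(z)$, of an algebraic differential equation of order $h>1$ with respect to $\frac{d}{dz}$, with coefficients in $\mathbb{C}(z)$, which is strongly minimal. Identify $\mathbb{C}$ with $\mathbb{R}^2$ via $z=x+iy$. Then there is no (real) Pfaffian chain $(f_1,\ldots,f_l)$ (on a nonempty open subset of $U$) such that both $\operatorname{Re}(f(z))$ and $\operatorname{Im}(f(z))$ are algebraic over $\mathbb{C}(z,f_1,\ldots,f_l)$.
   Context: A Pfaffian chain on a domain $V\subseteq\mathbb{R}^n$ is a tuple $(f_1,\ldots,f_l)$ of real analytic functions on $V$ for which there exist polynomials $p_{ij}(u_1,\ldots,u_n,v_1,\ldots,v_i)$ with real coefficients such that $\frac{\partial f_i}{\partial x_j}=p_{ij}(\bar x,f_1(\bar x),\ldots,f_i(\bar x))$ for all $i,j$. Here $n=2$ with coordinates $(x,y)$. All differential fields have characteristic zero; $K\langle a\rangle$ is the differential field generated by $a$ over $K$. An algebraic differential equation $P(y,y',\ldots,y^{(h)})=0$ with coefficients in a differential field $K$ is strongly minimal if its solution set, as a definable set in a differentially closed field extending $K$, is strongly minimal; equivalently: (1) $P$ is irreducible over $K^{alg}$ as a polynomial in several variables, and (2) for every solution $a$ and every differential field extension $F$ of $K$, $\operatorname{trdeg}_F F\langle a\rangle$ equals either $\operatorname{trdeg}_K K\langle a\rangle$ or $0$. *)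

theory Defs
  imports
    "HOL-Complex_Analysis.Complex_Analysis"
    "HOL-Computational_Algebra.Computational_Algebra"
    "HOL-Algebra.Algebraic_Closure_Type"
    "HOL-Library.Poly_Mapping"
begin

section \<open>Polynomials in several variables\<close>

type_synonym 'a mpoly = "(nat \<Rightarrow>\<^sub>0 nat) \<Rightarrow>\<^sub>0 'a"

definition mpoly_vars :: "'a::zero mpoly \<Rightarrow> nat set" where
  "mpoly_vars p = (\<Union>m\<in>Poly_Mapping.keys p. Poly_Mapping.keys m)"

definition mpoly_eval :: "'a::comm_semiring_1 mpoly \<Rightarrow> (nat \<Rightarrow> 'a) \<Rightarrow> 'a" where
  "mpoly_eval p x =
     (\<Sum>m\<in>Poly_Mapping.keys p.
        Poly_Mapping.lookup p m * (\<Prod>i\<in>Poly_Mapping.keys m. x i ^ Poly_Mapping.lookup m i))"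


section \<open>Pfaffian chains in two real variables\<close>

text \<open>The plane is the type of complex numbers, the point \<open>(x, y)\<close> being \<open>Complex x y\<close>.\<close>

definition real_analytic_on :: "(complex \<Rightarrow> real) \<Rightarrow> complex set \<Rightarrow> bool" where
  "real_analytic_on g V \<longleftrightarrow>
     (\<forall>a\<in>V. \<exists>r>0. \<exists>c :: nat \<times> nat \<Rightarrow> real. \<forall>w\<in>ball a r.
        ((\<lambda>(j, k). c (j, k) * (Re w - Re a) ^ j * (Im w - Im a) ^ k) has_sum g w) UNIV)"

text \<open>
  In the polynomials, variables 0 and 1 stand for \<open>x\<close> and \<open>y\<close>, and variable \<open>k + 2\<close> stands
  for \<open>fs ! k\<close>; so \<open>fs ! i\<close> (numbered from 0) may involve the variables up to \<open>i + 2\<close>.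
\<close>

definition pfaffian_point :: "(complex \<Rightarrow> real) list \<Rightarrow> complex \<Rightarrow> nat \<Rightarrow> real" where
  "pfaffian_point fs w k = (if k = 0 then Re w else if k = 1 then Im w else (fs ! (k - 2)) w)"

definition pfaffian_chain :: "complex set \<Rightarrow> (complex \<Rightarrow> real) list \<Rightarrow> bool" where
  "pfaffian_chain V fs \<longleftrightarrow>
     open V \<and> connected V \<and> V \<noteq> {} \<and>
     (\<forall>i<length fs. real_analytic_on (fs ! i) V) \<and>
     (\<exists>p q :: nat \<Rightarrow> real mpoly. \<forall>i<length fs.
        mpoly_vars (p i) \<subseteq> {..i + 2} \<and> mpoly_vars (q i) \<subseteq> {..i + 2} \<and>
        (\<forall>w\<in>V.
           ((\<lambda>t. (fs ! i) (Complex t (Im w))) has_real_derivative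
              mpoly_eval (p i) (pfaffian_point fs w)) (at (Re w)) \<and>
           ((\<lambda>t. (fs ! i) (Complex (Re w) t)) has_real_derivative
              mpoly_eval (q i) (pfaffian_point fs w)) (at (Im w))))"


section \<open>Algebraicity over a field generated by functions\<close>

text \<open>
  \<open>algebraic_over_funs V gs h\<close>: on the domain \<open>V\<close>, the function \<open>h\<close> is algebraic over the field
  generated over the complex numbers by the functions in \<open>gs\<close>.  An element of that field is a
  quotient \<open>a(gs) / b(gs)\<close> with \<open>a, b\<close> polynomials and \<open>b(gs)\<close> not identically zero on \<open>V\<close>;
  the polynomial equation for \<open>h\<close> with coefficients \<open>a k(gs) / b k(gs)\<close>, not all zero, is required
  wherever no denominator vanishes.  This is meant for analytic functions (real or complex) and
  \<open>V\<close> open and connected, where products of nonzero functions are nonzero.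
\<close>

definition algebraic_over_funs ::
    "complex set \<Rightarrow> (complex \<Rightarrow> complex) list \<Rightarrow> (complex \<Rightarrow> complex) \<Rightarrow> bool" where
  "algebraic_over_funs V gs h \<longleftrightarrow>
     (\<exists>(d :: nat) (a :: nat \<Rightarrow> complex mpoly) (b :: nat \<Rightarrow> complex mpoly).
        (\<forall>k\<le>d. mpoly_vars (a k) \<subseteq> {..<length gs} \<and> mpoly_vars (b k) \<subseteq> {..<length gs}) \<and>
        (\<forall>k\<le>d. \<exists>w\<in>V. mpoly_eval (b k) (\<lambda>i. (gs ! i) w) \<noteq> 0) \<and>
        (\<exists>k\<le>d. \<exists>w\<in>V. mpoly_eval (a k) (\<lambda>i. (gs ! i) w) \<noteq> 0) \<and>
        (\<forall>w\<in>V. (\<forall>k\<le>d. mpoly_eval (b k) (\<lambda>i. (gs ! i) w) \<noteq> 0) \<longrightarrow>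
           (\<Sum>k\<le>d. mpoly_eval (a k) (\<lambda>i. (gs ! i) w) / mpoly_eval (b k) (\<lambda>i. (gs ! i) w)
                     * h w ^ k) = 0))"


section \<open>Algebraic differential equations over the rational functions\<close>

type_synonym ratfun = "complex poly fract"

definition rat_deriv :: "ratfun \<Rightarrow> ratfun" where
  "rat_deriv r = (case quot_of_fract r of (p, q) \<Rightarrow> Fract (pderiv p * q - p * pderiv q) (q ^ 2))"

definition rat_pole :: "ratfun \<Rightarrow> complex \<Rightarrow> bool" where
  "rat_pole r z \<longleftrightarrow> poly (snd (quot_of_fract r)) z = 0"

definition rat_eval :: "ratfun \<Rightarrow> complex \<Rightarrow> complex" where
  "rat_eval r z = (case quot_of_fract r of (p, q) \<Rightarrow> poly p z / poly q z)"

text \<open>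
  A differential polynomial in one differential indeterminate is a polynomial in which variable
  \<open>i\<close> stands for the \<open>i\<close>-th derivative.
\<close>

definition ade_order :: "ratfun mpoly \<Rightarrow> nat \<Rightarrow> bool" where
  "ade_order P h \<longleftrightarrow> h \<in> mpoly_vars P \<and> mpoly_vars P \<subseteq> {..h}"

text \<open>
  The equation is an identity of meromorphic functions on \<open>U\<close>, hence it is tested away from the
  poles of the coefficients.
\<close>

definition ade_solution_on :: "ratfun mpoly \<Rightarrow> (complex \<Rightarrow> complex) \<Rightarrow> complex set \<Rightarrow> bool" where
  "ade_solution_on P f U \<longleftrightarrow>
     (\<forall>z\<in>U. (\<forall>m\<in>Poly_Mapping.keys P. \<not> rat_pole (Poly_Mapping.lookup P m) z) \<longrightarrow>
        (\<Sum>m\<in>Poly_Mapping.keys P. rat_eval (Poly_Mapping.lookup P m) z *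
           (\<Prod>i\<in>Poly_Mapping.keys m. (deriv ^^ i) f z ^ Poly_Mapping.lookup m i)) = 0)"


section \<open>Differential fields\<close>

locale differential_field = field M for M (structure) +
  fixes D :: "'a \<Rightarrow> 'a"
  assumes D_closed: "x \<in> carrier M \<Longrightarrow> D x \<in> carrier M"
    and D_add: "x \<in> carrier M \<Longrightarrow> y \<in> carrier M \<Longrightarrow> D (x \<oplus> y) = D x \<oplus> D y"
    and D_mult: "x \<in> carrier M \<Longrightarrow> y \<in> carrier M \<Longrightarrow>
                   D (x \<otimes> y) = D x \<otimes> y \<oplus> x \<otimes> D y"
    and char_zero: "(n :: nat) \<noteq> 0 \<Longrightarrow> [n] \<cdot> \<one> \<noteq> \<zero>"

text \<open>
  Differential polynomials over \<open>M\<close> are coefficient functions on monomials; the type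
  \<^typ>\<open>'a mpoly\<close> cannot be used since the zero of \<open>M\<close> is not that of a type class.
\<close>

definition dpoly_support :: "('a, 'b) ring_scheme \<Rightarrow> ((nat \<Rightarrow>\<^sub>0 nat) \<Rightarrow> 'a) \<Rightarrow> (nat \<Rightarrow>\<^sub>0 nat) set" where
  "dpoly_support M p = {m. p m \<noteq> \<zero>\<^bsub>M\<^esub>}"

definition dpolys :: "('a, 'b) ring_scheme \<Rightarrow> ((nat \<Rightarrow>\<^sub>0 nat) \<Rightarrow> 'a) set" where
  "dpolys M = {p. range p \<subseteq> carrier M \<and> finite (dpoly_support M p)}"

definition dpoly_vars :: "('a, 'b) ring_scheme \<Rightarrow> ((nat \<Rightarrow>\<^sub>0 nat) \<Rightarrow> 'a) \<Rightarrow> nat set" where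
  "dpoly_vars M p = (\<Union>m\<in>dpoly_support M p. Poly_Mapping.keys m)"

definition dpoly_eval ::
    "('a, 'b) ring_scheme \<Rightarrow> ('a \<Rightarrow> 'a) \<Rightarrow> ((nat \<Rightarrow>\<^sub>0 nat) \<Rightarrow> 'a) \<Rightarrow> 'a \<Rightarrow> 'a" where
  "dpoly_eval M D p x =
     (\<Oplus>\<^bsub>M\<^esub>m\<in>dpoly_support M p.
        p m \<otimes>\<^bsub>M\<^esub> (\<Otimes>\<^bsub>M\<^esub>i\<in>Poly_Mapping.keys m. ((D ^^ i) x) [^]\<^bsub>M\<^esub> Poly_Mapping.lookup m i))"

text \<open>
  Blum's axioms.  The condition on \<open>g\<close> says that its order is less than \<open>n\<close>, the order of \<open>p\<close>,
  where nonzero constants have order \<open>-1\<close>; for \<open>n = 0\<close> the axiom is algebraic closedness.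
\<close>

locale differentially_closed_field = differential_field +
  assumes blum: "\<lbrakk>p \<in> dpolys M; g \<in> dpolys M; n \<in> dpoly_vars M p; dpoly_vars M p \<subseteq> {..n};
                  dpoly_support M g \<noteq> {}; dpoly_vars M g \<subseteq> {..<n}\<rbrakk> \<Longrightarrow>
                 \<exists>x\<in>carrier M. dpoly_eval M D p x = \<zero> \<and> dpoly_eval M D g x \<noteq> \<zero>"


section \<open>Definable sets\<close>

text \<open>First-order formulas in the language of differential rings, with parameters.\<close>

datatype 'a dterm =
    Var nat
  | Param 'a
  | Plus "'a dterm" "'a dterm"
  | Times "'a dterm" "'a dterm"
  | Deriv "'a dterm"

datatype 'a dform =
    Equal "'a dterm" "'a dterm"
  | Not "'a dform"
  | And "'a dform" "'a dform"
  | Exists nat "'a dform"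

primrec dterm_val ::
    "('a, 'b) ring_scheme \<Rightarrow> ('a \<Rightarrow> 'a) \<Rightarrow> (nat \<Rightarrow> 'a) \<Rightarrow> 'a dterm \<Rightarrow> 'a" where
  "dterm_val M D s (Var n) = s n"
| "dterm_val M D s (Param c) = c"
| "dterm_val M D s (Plus t u) = dterm_val M D s t \<oplus>\<^bsub>M\<^esub> dterm_val M D s u"
| "dterm_val M D s (Times t u) = dterm_val M D s t \<otimes>\<^bsub>M\<^esub> dterm_val M D s u"
| "dterm_val M D s (Deriv t) = D (dterm_val M D s t)"

primrec dform_sat ::
    "('a, 'b) ring_scheme \<Rightarrow> ('a \<Rightarrow> 'a) \<Rightarrow> (nat \<Rightarrow> 'a) \<Rightarrow> 'a dform \<Rightarrow> bool" where
  "dform_sat M D s (Equal t u) \<longleftrightarrow> dterm_val M D s t = dterm_val M D s u"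
| "dform_sat M D s (Not \<phi>) \<longleftrightarrow> \<not> dform_sat M D s \<phi>"
| "dform_sat M D s (And \<phi> \<psi>) \<longleftrightarrow> dform_sat M D s \<phi> \<and> dform_sat M D s \<psi>"
| "dform_sat M D s (Exists n \<phi>) \<longleftrightarrow> (\<exists>x\<in>carrier M. dform_sat M D (s(n := x)) \<phi>)"

text \<open>All free variables of the formula are read as the one variable of the definable set.\<close>

definition definable_set :: "('a, 'b) ring_scheme \<Rightarrow> ('a \<Rightarrow> 'a) \<Rightarrow> 'a set \<Rightarrow> bool" where
  "definable_set M D S \<longleftrightarrow>
     (\<exists>\<phi>. set_dform \<phi> \<subseteq> carrier M \<and> S = {x \<in> carrier M. dform_sat M D (\<lambda>_. x) \<phi>})"

definition minimal_set :: "('a, 'b) ring_scheme \<Rightarrow> ('a \<Rightarrow> 'a) \<Rightarrow> 'a set \<Rightarrow> bool" where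
  "minimal_set M D S \<longleftrightarrow>
     definable_set M D S \<and> infinite S \<and>
     (\<forall>T. definable_set M D T \<longrightarrow> finite (S \<inter> T) \<or> finite (S - T))"


section \<open>Strongly minimal equations\<close>

text \<open>\<open>M\<close> is a differentially closed field extending the rational functions via \<open>\<iota>\<close>.\<close>

definition dcf_over_ratfun :: "('a, 'b) ring_scheme \<Rightarrow> ('a \<Rightarrow> 'a) \<Rightarrow> (ratfun \<Rightarrow> 'a) \<Rightarrow> bool" where
  "dcf_over_ratfun M D \<iota> \<longleftrightarrow>
     differentially_closed_field M D \<and>
     \<iota> \<in> ring_hom (ring_of_type_algebra :: ratfun ring) M \<and>
     (\<forall>r. \<iota> (rat_deriv r) = D (\<iota> r))"

definition solution_set ::
    "('a, 'b) ring_scheme \<Rightarrow> ('a \<Rightarrow> 'a) \<Rightarrow> (ratfun \<Rightarrow> 'a) \<Rightarrow> ratfun mpoly \<Rightarrow> 'a set" where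
  "solution_set M D \<iota> P =
     {x \<in> carrier M. dpoly_eval M D (\<lambda>m. \<iota> (Poly_Mapping.lookup P m)) x = \<zero>\<^bsub>M\<^esub>}"

text \<open>
  A formula is strongly minimal for a complete theory if it defines a minimal set in every model.
  The theory here is that of differentially closed fields extending the field of rational
  functions; it is complete (and model complete, so that its models extending a given one are
  exactly the elementary extensions of that one).  The models have to live on subsets of a fixed
  type.  By the downward Loewenheim-Skolem theorem any type with at least continuum many elements,
  that being the cardinality of the language with constants for the rational functions, yields
  the same notion.
\<close>

type_synonym universe = "complex set"

definition strongly_minimal_ade :: "ratfun mpoly \<Rightarrow> bool" where
  "strongly_minimal_ade P \<longleftrightarrow>
     (\<forall>(M :: universe ring) D \<iota>. dcf_over_ratfun M D \<iota> \<longrightarrow>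
        minimal_set M D (solution_set M D \<iota> P))"

end

theory Submission
  imports Defs
begin

text \<open>
  Restrict everything to a horizontal line on which the coefficients of the two algebraic relations
  do not vanish. There all functions involved extend holomorphically to a disc, with the
  \<open>x\<close>-derivative becoming the complex derivative, and one gets a tower of differential fields, starting
  with the rational functions, that adjoins the members of the chain one at a time. At one step \<open>f\<close>
  turns from transcendental to algebraic over the field, which is generated over the previous field \<open>K\<close>
  by one element; hence \<open>f\<close> satisfies over \<open>K\<close> a differential equation \<open>Q\<close> of order exactly one. Modulo \<open>Q\<close>, the
  equation \<open>P\<close> reduces to a first-order polynomial divisible by \<open>Q\<close> up to a factor free of derivatives,
  so \<open>P\<close> and \<open>Q\<close> have infinitely many common solutions in any differentially closed field; but as
  the order of \<open>P\<close> exceeds one, infinitely many solutions of \<open>P\<close> do not solve \<open>Q\<close>. So \<open>Q\<close> splits the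
  solution set of \<open>P\<close> into two infinite parts.

  This needs one differentially closed field that contains the given functions: the germs of
  holomorphic functions along a maximal filter of open subsets of the plane. Solutions of
  differential equations there are glued from local analytic ones, on a dense open set.
\<close>

section \<open>Polynomial functions\<close>

text \<open>\<open>strongly_minimal_ade\<close> speaks about models only, so the germ of
  \<open>f\<close> has to be an element of one, and that model must live on the type
  \<open>universe\<close>. Meromorphic germs at a fixed point are not even algebraically closed. The
  generic filter removes this obstacle: it decides every open set, so a holomorphic function on a
  member is either zero or without zeros on a smaller member, which makes the germs a field; and an
  equation has to be solved on a dense open set only, where initial values can be taken off the
  zeros of the separant. Neither real nor imaginary part of \<open>f\<close> is holomorphic, but on
  a horizontal line both are restrictions of holomorphic functions, by Schwarz reflection, and so
  are the members of the chain, by their power series. The order of the equation \<open>Q\<close> is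
  one because the decisive step of the tower adjoins a single element: by exchange, it and
  \<open>f\<close> are algebraic over each other, so the derivative of \<open>f\<close> is algebraic
  over \<open>f\<close>. Splitting the solution set of \<open>P\<close> into two infinite parts
  requires \<open>P\<close> and \<open>Q\<close> to share infinitely many solutions, and this comes
  from \<open>Q\<close> being of least degree in the derivative of \<open>f\<close>, hence as good
  as irreducible.\<close>

text \<open>A predicate on subsets of one ambient type, so that all fields of the tower are
  comparable as sets. Since \<open>inverse 0 = 0\<close>, closure under \<open>inverse\<close> needs
  no exception for zero.\<close>

definition field_subset :: "'a::field set \<Rightarrow> bool" where
  "field_subset K \<longleftrightarrow> 1 \<in> K \<and> (\<forall>x\<in>K. \<forall>y\<in>K. x + y \<in> K \<and> x * y \<in> K) \<and> (\<forall>x\<in>K. - x \<in> K \<and> inverse x \<in> K)"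

lemma field_subset_UNIV: "field_subset UNIV"
  by (auto simp: field_subset_def)

context
  fixes K :: "'a::field set"
  assumes K: "field_subset K"
begin

lemma field_subset_one: "1 \<in> K"
  and field_subset_add: "x \<in> K \<Longrightarrow> y \<in> K \<Longrightarrow> x + y \<in> K"
  and field_subset_mult: "x \<in> K \<Longrightarrow> y \<in> K \<Longrightarrow> x * y \<in> K"
  and field_subset_minus: "x \<in> K \<Longrightarrow> - x \<in> K"
  and field_subset_inverse: "x \<in> K \<Longrightarrow> inverse x \<in> K"
  using K by (auto simp: field_subset_def)

lemma field_subset_zero: "0 \<in> K"
  using field_subset_add[OF field_subset_one field_subset_minus[OF field_subset_one]] by simp

lemma field_subset_divide: "x \<in> K \<Longrightarrow> y \<in> K \<Longrightarrow> x / y \<in> K"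
  using field_subset_mult[of x "inverse y"] field_subset_inverse[of y] by (simp add: divide_inverse)

lemma field_subset_of_nat: "of_nat n \<in> K"
  by (induction n) (auto intro: field_subset_zero field_subset_add field_subset_one)

lemma field_subset_power: "x \<in> K \<Longrightarrow> x ^ n \<in> K"
  by (induction n) (auto intro: field_subset_one field_subset_mult)

lemma field_subset_sum: "(\<And>i. i \<in> A \<Longrightarrow> g i \<in> K) \<Longrightarrow> sum g A \<in> K"
  by (induction A rule: infinite_finite_induct) (auto intro: field_subset_zero field_subset_add)

lemma field_subset_prod: "(\<And>i. i \<in> A \<Longrightarrow> g i \<in> K) \<Longrightarrow> prod g A \<in> K"
  by (induction A rule: infinite_finite_induct) (auto intro: field_subset_one field_subset_mult)

end


text \<open>
  Over the infinite fields at hand, polynomials are identified with the functions they define;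
  \<open>upoly n d a\<close> below is the polynomial in the variable \<open>n\<close> whose coefficients \<open>a k\<close> are
  polynomials in the variables less than \<open>n\<close>.
\<close>

inductive_set polyfun :: "'a::comm_ring_1 set \<Rightarrow> nat \<Rightarrow> ((nat \<Rightarrow> 'a) \<Rightarrow> 'a) set"
  for K :: "'a set" and n :: nat where
  polyfun_const: "c \<in> K \<Longrightarrow> (\<lambda>\<xi>. c) \<in> polyfun K n"
| polyfun_var: "i < n \<Longrightarrow> (\<lambda>\<xi>. \<xi> i) \<in> polyfun K n"
| polyfun_add: "\<phi> \<in> polyfun K n \<Longrightarrow> \<psi> \<in> polyfun K n \<Longrightarrow> (\<lambda>\<xi>. \<phi> \<xi> + \<psi> \<xi>) \<in> polyfun K n"
| polyfun_mult: "\<phi> \<in> polyfun K n \<Longrightarrow> \<psi> \<in> polyfun K n \<Longrightarrow> (\<lambda>\<xi>. \<phi> \<xi> * \<psi> \<xi>) \<in> polyfun K n"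

lemma polyfun_mono: "\<phi> \<in> polyfun K n \<Longrightarrow> K \<subseteq> L \<Longrightarrow> n \<le> m \<Longrightarrow> \<phi> \<in> polyfun L m"
  by (induction rule: polyfun.induct) (auto intro: polyfun.intros)

lemma polyfun_Suc: "\<phi> \<in> polyfun K n \<Longrightarrow> \<phi> \<in> polyfun K (Suc n)"
  by (erule polyfun_mono) auto

lemma polyfun_cong: "\<phi> \<in> polyfun K n \<Longrightarrow> (\<And>i. i < n \<Longrightarrow> \<xi> i = Y i) \<Longrightarrow> \<phi> \<xi> = \<phi> Y"
  by (induction rule: polyfun.induct) auto

context
  fixes K :: "'a::field set"
  assumes K: "field_subset K"
begin

lemma polyfun_of_nat: "(\<lambda>\<xi>. of_nat k) \<in> polyfun K n"
  by (rule polyfun_const) (rule field_subset_of_nat[OF K])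

lemma polyfun_zero: "(\<lambda>\<xi>. 0) \<in> polyfun K n"
  by (rule polyfun_const) (rule field_subset_zero[OF K])

lemma polyfun_one: "(\<lambda>\<xi>. 1) \<in> polyfun K n"
  by (rule polyfun_const) (rule field_subset_one[OF K])

lemma polyfun_minus: "\<phi> \<in> polyfun K n \<Longrightarrow> (\<lambda>\<xi>. - \<phi> \<xi>) \<in> polyfun K n"
  using polyfun_mult[OF polyfun_const[OF field_subset_minus[OF K field_subset_one[OF K]]], of \<phi> n]
  by simp

lemma polyfun_diff: "\<phi> \<in> polyfun K n \<Longrightarrow> \<psi> \<in> polyfun K n \<Longrightarrow> (\<lambda>\<xi>. \<phi> \<xi> - \<psi> \<xi>) \<in> polyfun K n"
  using polyfun_add[OF _ polyfun_minus, of \<phi> n \<psi>] by simp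

lemma polyfun_power: "\<phi> \<in> polyfun K n \<Longrightarrow> (\<lambda>\<xi>. \<phi> \<xi> ^ m) \<in> polyfun K n"
  by (induction m) (auto intro: polyfun_one polyfun_mult)

lemma polyfun_sum: "(\<And>i. i \<in> A \<Longrightarrow> \<phi> i \<in> polyfun K n) \<Longrightarrow> (\<lambda>\<xi>. \<Sum>i\<in>A. \<phi> i \<xi>) \<in> polyfun K n"
  by (induction A rule: infinite_finite_induct) (auto intro: polyfun_zero polyfun_add)

lemma polyfun_prod: "(\<And>i. i \<in> A \<Longrightarrow> \<phi> i \<in> polyfun K n) \<Longrightarrow> (\<lambda>\<xi>. \<Prod>i\<in>A. \<phi> i \<xi>) \<in> polyfun K n"
  by (induction A rule: infinite_finite_induct) (auto intro: polyfun_one polyfun_mult)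

text \<open>Multiplying a derivation by a constant \<kappa> multiplies entry \<open>i\<close> of a
  jet by \<open>\<kappa> ^ i\<close>; this is the corresponding substitution in polynomials.\<close>

lemma polyfun_scale: "\<phi> \<in> polyfun K n \<Longrightarrow> (\<And>i. c i \<in> K) \<Longrightarrow> (\<lambda>\<xi>. \<phi> (\<lambda>i. c i * \<xi> i)) \<in> polyfun K n"
  by (induction rule: polyfun.induct)
     (auto intro: polyfun_add polyfun_mult polyfun_const intro!: polyfun_mult[OF polyfun_const polyfun_var])

end

lemma polyfun_line:
  assumes "\<phi> \<in> polyfun K n"
  shows "\<exists>p. \<forall>t. \<phi> (\<lambda>i. a i + t * (b i - a i)) = poly p t"
  using assms
proof (induction rule: polyfun.induct)
  case (polyfun_const c)
  then show ?case by (intro exI[of _ "[:c:]"]) auto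
next
  case (polyfun_var i)
  then show ?case by (intro exI[of _ "[:a i, b i - a i:]"]) auto
next
  case (polyfun_add \<phi> \<psi>)
  then obtain p q where "\<forall>t. \<phi> (\<lambda>i. a i + t * (b i - a i)) = poly p t"
     "\<forall>t. \<psi> (\<lambda>i. a i + t * (b i - a i)) = poly q t" by blast
  then show ?case by (intro exI[of _ "p + q"]) auto
next
  case (polyfun_mult \<phi> \<psi>)
  then obtain p q where "\<forall>t. \<phi> (\<lambda>i. a i + t * (b i - a i)) = poly p t"
     "\<forall>t. \<psi> (\<lambda>i. a i + t * (b i - a i)) = poly q t" by blast
  then show ?case by (intro exI[of _ "p * q"]) auto
qed

text \<open>Restricting to the line through the two points reduces this to polynomials in one variable.\<close>

lemma polyfun_common_nonzero:
  fixes \<phi> :: "(nat \<Rightarrow> 'a::field_char_0) \<Rightarrow> 'a"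
  assumes "\<phi> \<in> polyfun K n" "\<psi> \<in> polyfun L m" "\<phi> a \<noteq> 0" "\<psi> b \<noteq> 0"
  shows "\<exists>\<xi>. \<phi> \<xi> \<noteq> 0 \<and> \<psi> \<xi> \<noteq> 0"
proof -
  obtain p where p: "\<And>t. \<phi> (\<lambda>i. a i + t * (b i - a i)) = poly p t"
    using polyfun_line[OF assms(1)] by blast
  obtain q where q: "\<And>t. \<psi> (\<lambda>i. a i + t * (b i - a i)) = poly q t"
    using polyfun_line[OF assms(2)] by blast
  have "p \<noteq> 0" using p[of 0] assms(3) by auto
  moreover have "q \<noteq> 0" using q[of 1] assms(4) by auto
  ultimately have "p * q \<noteq> 0" by simp
  then obtain t where "poly (p * q) t \<noteq> 0" using poly_all_0_iff_0 by blast
  then show ?thesis using p[of t] q[of t] by (metis mult_eq_0_iff poly_mult)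
qed

section \<open>Polynomials in the last variable: degree and pseudo-division\<close>

definition upoly :: "nat \<Rightarrow> nat \<Rightarrow> (nat \<Rightarrow> (nat \<Rightarrow> 'a) \<Rightarrow> 'a::comm_ring_1) \<Rightarrow> (nat \<Rightarrow> 'a) \<Rightarrow> 'a" where
  "upoly n d a \<xi> = (\<Sum>k\<le>d. a k \<xi> * \<xi> n ^ k)"

definition coef_funs :: "'a::comm_ring_1 set \<Rightarrow> nat \<Rightarrow> nat \<Rightarrow> (nat \<Rightarrow> (nat \<Rightarrow> 'a) \<Rightarrow> 'a) \<Rightarrow> bool" where
  "coef_funs K n d a \<longleftrightarrow> (\<forall>k\<le>d. a k \<in> polyfun K n)"

definition deg_le :: "'a::comm_ring_1 set \<Rightarrow> nat \<Rightarrow> nat \<Rightarrow> ((nat \<Rightarrow> 'a) \<Rightarrow> 'a) set" where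
  "deg_le K n d = {upoly n d a | a. coef_funs K n d a}"

text \<open>Degree exactly \<open>d\<close>: the leading coefficient is itself a polynomial function
  of the earlier variables, and for it to be nonzero means not to vanish at some point.\<close>

definition deg_eq :: "'a::comm_ring_1 set \<Rightarrow> nat \<Rightarrow> nat \<Rightarrow> ((nat \<Rightarrow> 'a) \<Rightarrow> 'a) set" where
  "deg_eq K n d = {upoly n d a | a. coef_funs K n d a \<and> (\<exists>\<xi>. a d \<xi> \<noteq> 0)}"

lemma coef_funs_mono: "coef_funs K n d a \<Longrightarrow> K \<subseteq> L \<Longrightarrow> coef_funs L n d a"
  by (auto simp: coef_funs_def intro: polyfun_mono)

text \<open>The coefficients do not see the variable \<open>n\<close>. Moving that variable alone
  gives a polynomial in one variable that vanishes on an infinite field.\<close>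

lemma upoly_coeffs_zero:
  fixes a :: "nat \<Rightarrow> (nat \<Rightarrow> 'a::field_char_0) \<Rightarrow> 'a"
  assumes a: "coef_funs K n d a" and z: "\<And>\<xi>. upoly n d a \<xi> = 0" and k: "k \<le> d"
  shows "a k \<xi> = 0"
proof -
  define p where "p = (\<Sum>k\<le>d. Polynomial.monom (a k \<xi>) k)"
  have "poly p t = 0" for t
  proof -
    have "a k (\<xi>(n := t)) = a k \<xi>" if "k \<le> d" for k
      by (rule polyfun_cong[of _ K n]) (use a that in \<open>auto simp: coef_funs_def\<close>)
    then have "upoly n d a (\<xi>(n := t)) = (\<Sum>k\<le>d. a k \<xi> * t ^ k)"
      unfolding upoly_def by (intro sum.cong) auto
    then have "upoly n d a (\<xi>(n := t)) = poly p t"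
      by (simp add: p_def poly_sum Polynomial.poly_monom)
    then show ?thesis using z by simp
  qed
  then have "p = 0" using poly_all_0_iff_0[of p] by simp
  then have "Polynomial.coeff p k = 0" by simp
  moreover have "Polynomial.coeff p k = (\<Sum>j\<le>d. if j = k then a j \<xi> else 0)"
    unfolding p_def Polynomial.coeff_sum by (simp add: Polynomial.coeff_monom)
  ultimately show ?thesis using k by simp
qed

lemma deg_le_0: "\<phi> \<in> deg_le K n 0 \<longleftrightarrow> \<phi> \<in> polyfun K n"
proof
  assume "\<phi> \<in> deg_le K n 0"
  then show "\<phi> \<in> polyfun K n" by (auto simp: deg_le_def upoly_def [abs_def] coef_funs_def)
next
  assume "\<phi> \<in> polyfun K n"
  then show "\<phi> \<in> deg_le K n 0" unfolding deg_le_def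
    by (auto simp: upoly_def [abs_def] coef_funs_def intro!: exI[of _ "\<lambda>_. \<phi>"])
qed

context
  fixes K :: "'a::field set"
  assumes K: "field_subset K"
begin

lemma deg_le_polyfun: "\<phi> \<in> deg_le K n d \<Longrightarrow> \<phi> \<in> polyfun K (Suc n)"
  unfolding deg_le_def coef_funs_def upoly_def [abs_def]
  by (auto intro!: polyfun_sum[OF K] polyfun_mult polyfun_power[OF K] polyfun_var intro: polyfun_Suc)

lemma deg_le_mono: "\<phi> \<in> deg_le K n d \<Longrightarrow> d \<le> e \<Longrightarrow> \<phi> \<in> deg_le K n e"
proof -
  assume "\<phi> \<in> deg_le K n d" "d \<le> e"
  then obtain a where a: "coef_funs K n d a" "\<phi> = upoly n d a" by (auto simp: deg_le_def)
  have "\<phi> = upoly n e (\<lambda>k. if k \<le> d then a k else (\<lambda>_. 0))"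
    unfolding a(2) upoly_def [abs_def] using \<open>d \<le> e\<close>
    by (intro ext sum.mono_neutral_cong_left) auto
  moreover have "coef_funs K n e (\<lambda>k. if k \<le> d then a k else (\<lambda>_. 0))"
    using a(1) by (auto simp: coef_funs_def intro: polyfun_zero[OF K])
  ultimately show ?thesis by (auto simp: deg_le_def)
qed

lemma deg_le_add: "\<phi> \<in> deg_le K n d \<Longrightarrow> \<psi> \<in> deg_le K n d \<Longrightarrow> (\<lambda>\<xi>. \<phi> \<xi> + \<psi> \<xi>) \<in> deg_le K n d"
proof -
  assume "\<phi> \<in> deg_le K n d" "\<psi> \<in> deg_le K n d"
  then obtain a b where a: "coef_funs K n d a" "\<phi> = upoly n d a"
    and b: "coef_funs K n d b" "\<psi> = upoly n d b" by (auto simp: deg_le_def)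
  have "(\<lambda>\<xi>. \<phi> \<xi> + \<psi> \<xi>) = upoly n d (\<lambda>k \<xi>. a k \<xi> + b k \<xi>)"
    by (auto simp: a b upoly_def fun_eq_iff sum.distrib algebra_simps)
  moreover have "coef_funs K n d (\<lambda>k \<xi>. a k \<xi> + b k \<xi>)"
    using a b by (auto simp: coef_funs_def intro: polyfun_add)
  ultimately show ?thesis by (auto simp: deg_le_def)
qed

lemma deg_le_scale: "\<phi> \<in> deg_le K n d \<Longrightarrow> c \<in> polyfun K n \<Longrightarrow> (\<lambda>\<xi>. c \<xi> * \<phi> \<xi>) \<in> deg_le K n d"
proof -
  assume "\<phi> \<in> deg_le K n d" and c: "c \<in> polyfun K n"
  then obtain a where a: "coef_funs K n d a" "\<phi> = upoly n d a" by (auto simp: deg_le_def)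
  have "(\<lambda>\<xi>. c \<xi> * \<phi> \<xi>) = upoly n d (\<lambda>k \<xi>. c \<xi> * a k \<xi>)"
    by (auto simp: a upoly_def fun_eq_iff sum_distrib_left algebra_simps)
  moreover have "coef_funs K n d (\<lambda>k \<xi>. c \<xi> * a k \<xi>)"
    using a c by (auto simp: coef_funs_def intro: polyfun_mult)
  ultimately show ?thesis by (auto simp: deg_le_def)
qed

lemma deg_le_diff: "\<phi> \<in> deg_le K n d \<Longrightarrow> \<psi> \<in> deg_le K n d \<Longrightarrow> (\<lambda>\<xi>. \<phi> \<xi> - \<psi> \<xi>) \<in> deg_le K n d"
  using deg_le_add[of \<phi> n d "\<lambda>\<xi>. (- 1) * \<psi> \<xi>"]
    deg_le_scale[OF _ polyfun_const[OF field_subset_minus[OF K field_subset_one[OF K]]], of \<psi> n d]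
  by simp

lemma deg_le_times_var: "\<phi> \<in> deg_le K n d \<Longrightarrow> (\<lambda>\<xi>. \<xi> n ^ j * \<phi> \<xi>) \<in> deg_le K n (d + j)"
proof -
  assume "\<phi> \<in> deg_le K n d"
  then obtain a where a: "coef_funs K n d a" "\<phi> = upoly n d a" by (auto simp: deg_le_def)
  have "\<xi> n ^ j * \<phi> \<xi> = upoly n (d + j) (\<lambda>k. if k < j then (\<lambda>_. 0) else a (k - j)) \<xi>" for \<xi>
  proof -
    have "upoly n (d + j) (\<lambda>k. if k < j then (\<lambda>_. 0) else a (k - j)) \<xi>
       = (\<Sum>k\<in>{j..d + j}. a (k - j) \<xi> * \<xi> n ^ k)"
      unfolding upoly_def by (intro sum.mono_neutral_cong_right) auto
    also have "\<dots> = (\<Sum>k\<le>d. a k \<xi> * \<xi> n ^ (k + j))"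
      by (rule sum.reindex_bij_witness[of _ "\<lambda>k. k + j" "\<lambda>k. k - j"]) auto
    also have "\<dots> = \<xi> n ^ j * \<phi> \<xi>"
      by (simp add: a upoly_def sum_distrib_left power_add mult_ac)
    finally show ?thesis by simp
  qed
  moreover have "coef_funs K n (d + j) (\<lambda>k. if k < j then (\<lambda>_. 0) else a (k - j))"
    using a by (auto simp: coef_funs_def intro: polyfun_zero[OF K])
  ultimately show ?thesis by (auto simp: deg_le_def fun_eq_iff)
qed

lemma deg_le_mult:
  assumes "\<phi> \<in> deg_le K n d" "\<psi> \<in> deg_le K n e"
  shows "(\<lambda>\<xi>. \<phi> \<xi> * \<psi> \<xi>) \<in> deg_le K n (d + e)"
proof -
  obtain a where a: "coef_funs K n d a" "\<phi> = upoly n d a" using assms by (auto simp: deg_le_def)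
  have "(\<lambda>\<xi>. \<Sum>k\<in>A. a k \<xi> * (\<xi> n ^ k * \<psi> \<xi>)) \<in> deg_le K n (d + e)" if "finite A" "A \<subseteq> {..d}" for A
    using that
  proof (induction A rule: finite_induct)
    case empty
    have "(\<lambda>\<xi>. 0) \<in> deg_le K n 0" unfolding deg_le_0 by (rule polyfun_zero[OF K])
    then show ?case using deg_le_mono by auto
  next
    case (insert k A)
    have "(\<lambda>\<xi>. \<xi> n ^ k * \<psi> \<xi>) \<in> deg_le K n (d + e)"
      using insert.prems by (intro deg_le_mono[OF deg_le_times_var[OF assms(2)]]) auto
    then have "(\<lambda>\<xi>. a k \<xi> * (\<xi> n ^ k * \<psi> \<xi>)) \<in> deg_le K n (d + e)"
      by (rule deg_le_scale) (use a insert.prems in \<open>auto simp: coef_funs_def\<close>)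
    from deg_le_add[OF this insert.IH] insert show ?case by simp
  qed
  from this[of "{..d}"] show ?thesis
    by (simp add: a upoly_def sum_distrib_right mult.assoc)
qed

lemma polyfun_deg_le: "\<phi> \<in> polyfun K (Suc n) \<Longrightarrow> \<exists>d. \<phi> \<in> deg_le K n d"
proof (induction rule: polyfun.induct)
  case (polyfun_const c)
  then show ?case by (intro exI[of _ 0]) (auto simp: deg_le_0 intro: polyfun.intros)
next
  case (polyfun_var i)
  show ?case
  proof (cases "i = n")
    case True
    have "(\<lambda>\<xi>. \<xi> n ^ 1 * 1) \<in> deg_le K n (0 + 1)"
      by (intro deg_le_times_var) (simp add: deg_le_0 polyfun_one[OF K])
    then show ?thesis using True by auto
  next
    case False
    with polyfun_var show ?thesis
      by (intro exI[of _ 0]) (auto simp: deg_le_0 intro: polyfun.intros)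
  qed
next
  case (polyfun_add \<phi> \<psi>)
  then obtain d e where "\<phi> \<in> deg_le K n d" "\<psi> \<in> deg_le K n e" by blast
  then show ?case
    by (intro exI[of _ "max d e"] deg_le_add) (auto elim: deg_le_mono)
next
  case (polyfun_mult \<phi> \<psi>)
  then show ?case using deg_le_mult by blast
qed

text \<open>Identically vanishing leading coefficients are dropped one after the other; the point at
  which \<phi> is nonzero guarantees that a degree is left.\<close>

lemma deg_le_nonzero:
  assumes "\<phi> \<in> deg_le K n d" "\<phi> \<xi> \<noteq> 0"
  obtains e where "e \<le> d" "\<phi> \<in> deg_eq K n e"
  using assms
proof (induction d arbitrary: thesis)
  case 0
  then have "\<phi> \<in> deg_eq K n 0"
    by (fastforce simp: deg_le_def deg_eq_def upoly_def)
  with 0 show ?case by blast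
next
  case (Suc d)
  then obtain a where a: "coef_funs K n (Suc d) a" "\<phi> = upoly n (Suc d) a" by (auto simp: deg_le_def)
  show ?case
  proof (cases "\<exists>\<xi>. a (Suc d) \<xi> \<noteq> 0")
    case True
    then have "\<phi> \<in> deg_eq K n (Suc d)" using a by (auto simp: deg_eq_def)
    then show ?thesis using Suc.prems(1) by blast
  next
    case False
    then have "\<phi> = upoly n d a" unfolding a upoly_def [abs_def] by auto
    then have "\<phi> \<in> deg_le K n d" using a by (auto simp: deg_le_def coef_funs_def)
    then show ?thesis using Suc.IH Suc.prems by (metis le_SucI)
  qed
qed

text \<open>Division without inverting the leading coefficient \<open>q d\<close>: each round
  multiplies by it and cancels the top term, and \<open>m\<close> counts the rounds. If
  \<open>e < d\<close>, the quotient is zero and the truncated \<open>e - d\<close> does no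
  harm.\<close>

lemma pseudo_division:
  assumes q: "coef_funs K n d q" "d \<ge> 1" and f: "\<phi> \<in> deg_le K n e"
  shows "\<exists>m B R. B \<in> deg_le K n (e - d) \<and> R \<in> deg_le K n (d - 1) \<and>
           (\<forall>\<xi>. q d \<xi> ^ m * \<phi> \<xi> = upoly n d q \<xi> * B \<xi> + R \<xi>)"
  using f
proof (induction e arbitrary: \<phi> rule: less_induct)
  case (less e)
  have z: "(\<lambda>\<xi>. 0) \<in> deg_le K n k" for k
    using deg_le_mono[of "\<lambda>\<xi>. 0" n 0 k] by (simp add: deg_le_0 polyfun_zero[OF K])
  show ?case
  proof (cases "e < d")
    case True
    then have "\<phi> \<in> deg_le K n (d - 1)" using less.prems by (auto elim: deg_le_mono)
    then show ?thesis using z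
      by (intro exI[of _ 0] exI[of _ "\<lambda>\<xi>. 0"] exI[of _ \<phi>]) auto
  next
    case False
    obtain a where a: "coef_funs K n e a" "\<phi> = upoly n e a" using less.prems by (auto simp: deg_le_def)
    obtain e' where e': "e = Suc e'" using False q(2) by (cases e) auto
    define \<phi>1 where "\<phi>1 = upoly n e' a"
    have \<phi>1: "\<phi>1 \<in> deg_le K n e'" using a e' by (auto simp: \<phi>1_def deg_le_def coef_funs_def)
    have \<phi>_eq: "\<phi> \<xi> = a e \<xi> * \<xi> n ^ e + \<phi>1 \<xi>" for \<xi>
      by (simp add: a(2) \<phi>1_def upoly_def e')
    obtain d' where d': "d = Suc d'" using q(2) by (cases d) auto
    define q1 where "q1 = upoly n d' q"
    have q1: "q1 \<in> deg_le K n d'" using q(1) d' by (auto simp: q1_def deg_le_def coef_funs_def)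
    have q_eq: "upoly n d q \<xi> = q d \<xi> * \<xi> n ^ d + q1 \<xi>" for \<xi>
      by (simp add: q1_def upoly_def d')
    have qd: "q d \<in> polyfun K n" and ae: "a e \<in> polyfun K n"
      using q(1) a(1) by (auto simp: coef_funs_def)
    \<comment> \<open>In \<open>q d \<xi> * \<phi> \<xi> - a e \<xi> * \<xi> n ^ (e - d) * upoly n d
      q \<xi>\<close> the terms of degree \<open>e\<close> cancel; what the two lower parts leave is
      \<psi>.\<close>
    define \<psi> where "\<psi> = (\<lambda>\<xi>. q d \<xi> * \<phi>1 \<xi> - a e \<xi> * (\<xi> n ^ (e - d) * q1 \<xi>))"
    have "(\<lambda>\<xi>. \<xi> n ^ (e - d) * q1 \<xi>) \<in> deg_le K n e'"
      using deg_le_times_var[OF q1, of "e - d"] False d' e' by (auto elim: deg_le_mono)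
    then have \<psi>: "\<psi> \<in> deg_le K n e'" unfolding \<psi>_def
      by (rule deg_le_diff[OF deg_le_scale[OF \<phi>1 qd] deg_le_scale[OF _ ae]])
    obtain m B R where IH: "B \<in> deg_le K n (e' - d)" "R \<in> deg_le K n (d - 1)"
       "\<And>\<xi>. q d \<xi> ^ m * \<psi> \<xi> = upoly n d q \<xi> * B \<xi> + R \<xi>"
      using less.IH[OF _ \<psi>] e' by auto
    define B1 where "B1 = (\<lambda>\<xi>. q d \<xi> ^ m * a e \<xi> * (\<xi> n ^ (e - d) * 1) + B \<xi>)"
    have "(\<lambda>\<xi>. \<xi> n ^ (e - d) * 1) \<in> deg_le K n (0 + (e - d))"
      by (intro deg_le_times_var) (simp add: deg_le_0 polyfun_one[OF K])
    then have "(\<lambda>\<xi>. \<xi> n ^ (e - d) * 1) \<in> deg_le K n (e - d)" by simp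
    then have "(\<lambda>\<xi>. q d \<xi> ^ m * a e \<xi> * (\<xi> n ^ (e - d) * 1)) \<in> deg_le K n (e - d)"
      by (rule deg_le_scale) (intro polyfun_mult polyfun_power[OF K] qd ae)
    then have B1: "B1 \<in> deg_le K n (e - d)" unfolding B1_def
      using IH(1) e' by (intro deg_le_add) (auto elim: deg_le_mono)
    have "q d \<xi> ^ Suc m * \<phi> \<xi> = upoly n d q \<xi> * B1 \<xi> + R \<xi>" for \<xi>
    proof -
      have "\<xi> n ^ e = \<xi> n ^ (e - d) * \<xi> n ^ d" using False by (simp flip: power_add)
      then have *: "q d \<xi> * \<phi> \<xi> = a e \<xi> * \<xi> n ^ (e - d) * upoly n d q \<xi> + \<psi> \<xi>"
        unfolding \<phi>_eq q_eq \<psi>_def by (simp add: algebra_simps)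
      have "q d \<xi> ^ Suc m * \<phi> \<xi> = q d \<xi> ^ m * (q d \<xi> * \<phi> \<xi>)" by simp
      also have "\<dots> = q d \<xi> ^ m * a e \<xi> * \<xi> n ^ (e - d) * upoly n d q \<xi> + q d \<xi> ^ m * \<psi> \<xi>"
        unfolding * by (simp add: algebra_simps)
      also have "\<dots> = upoly n d q \<xi> * B1 \<xi> + R \<xi>"
        unfolding IH(3) B1_def by (simp add: algebra_simps)
      finally show ?thesis .
    qed
    with B1 IH(2) show ?thesis by blast
  qed
qed

end

lemma deg_eq_nonzero:
  fixes \<phi> :: "(nat \<Rightarrow> 'a::field_char_0) \<Rightarrow> 'a"
  assumes "\<phi> \<in> deg_eq K n d"
  shows "\<exists>\<xi>. \<phi> \<xi> \<noteq> 0"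
proof (rule ccontr)
  assume *: "\<not> ?thesis"
  obtain a where a: "coef_funs K n d a" "\<exists>\<xi>. a d \<xi> \<noteq> 0" "\<phi> = upoly n d a"
    using assms by (auto simp: deg_eq_def)
  with * show False using upoly_coeffs_zero[OF a(1), of d] by auto
qed

text \<open>
  A nonzero element of least degree in the ideal generated by \<open>q\<close> and its derivative divides a
  multiple of \<open>q\<close>, hence is free of the last variable if \<open>q\<close> has no proper factor.
\<close>

lemma separable_bezout:
  fixes K :: "'a::field_char_0 set"
  assumes K: "field_subset K" and q: "coef_funs K n d q" "\<exists>\<xi>. q d \<xi> \<noteq> 0" "d \<ge> 1"
    and irred: "\<And>c e R B. c \<in> polyfun K n \<Longrightarrow> \<exists>\<xi>. c \<xi> \<noteq> 0 \<Longrightarrow> 1 \<le> e \<Longrightarrow> e < d \<Longrightarrow> R \<in> deg_eq K n e \<Longrightarrow>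
        B \<in> deg_le K n (d - e) \<Longrightarrow> (\<And>\<xi>. c \<xi> * upoly n d q \<xi> = R \<xi> * B \<xi>) \<Longrightarrow> False"
  defines "s \<equiv> (\<lambda>\<xi>. \<Sum>k\<le>d. of_nat k * q k \<xi> * \<xi> n ^ (k - 1))"
  shows "\<exists>A B c. A \<in> polyfun K (Suc n) \<and> B \<in> polyfun K (Suc n) \<and> c \<in> polyfun K n \<and> (\<exists>\<xi>. c \<xi> \<noteq> 0) \<and>
           (\<forall>\<xi>. A \<xi> * upoly n d q \<xi> + B \<xi> * s \<xi> = c \<xi>)"
proof -
  define E where "E e \<longleftrightarrow> (\<exists>R A B. R \<in> deg_eq K n e \<and> A \<in> polyfun K (Suc n) \<and> B \<in> polyfun K (Suc n) \<and>
     (\<forall>\<xi>. A \<xi> * upoly n d q \<xi> + B \<xi> * s \<xi> = R \<xi>))" for e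
  have upq: "upoly n d q \<in> deg_le K n d" using q(1) by (auto simp: deg_le_def)
  have s_eq: "s = upoly n (d - 1) (\<lambda>k \<xi>. of_nat (Suc k) * q (Suc k) \<xi>)"
  proof
    fix \<xi>
    obtain d' where d': "d = Suc d'" using q(3) by (cases d) auto
    show "s \<xi> = upoly n (d - 1) (\<lambda>k \<xi>. of_nat (Suc k) * q (Suc k) \<xi>) \<xi>"
      unfolding s_def upoly_def d' sum.atMost_Suc_shift by simp
  qed
  \<comment> \<open>By characteristic zero the top coefficient, \<open>d\<close> times
    \<open>q d\<close>, is again nonzero, so the degree is exactly \<open>d - 1\<close>.\<close>
  have s_deg: "s \<in> deg_eq K n (d - 1)"
  proof -
    have 1: "coef_funs K n (d - 1) (\<lambda>k \<xi>. of_nat (Suc k) * q (Suc k) \<xi>)"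
      using q(1,3) unfolding coef_funs_def
      by (auto intro!: polyfun_mult polyfun_const field_subset_of_nat[OF K] simp del: of_nat_Suc)
    have 2: "\<exists>\<xi>. of_nat (Suc (d - 1)) * q (Suc (d - 1)) \<xi> \<noteq> 0"
      using q(2,3) by (auto simp del: of_nat_Suc)
    show ?thesis unfolding s_eq deg_eq_def using 1 2 by blast
  qed
  have E1: "E (d - 1)" unfolding E_def
    by (rule exI[of _ s], rule exI[of _ "\<lambda>\<xi>. 0"], rule exI[of _ "\<lambda>\<xi>. 1"])
       (use s_deg in \<open>simp add: polyfun_zero[OF K] polyfun_one[OF K]\<close>)
  define e where "e = (LEAST e. E e)"
  have Ee: "E e" unfolding e_def by (rule LeastI, rule E1)
  have e_le: "e \<le> d - 1" unfolding e_def by (rule Least_le, rule E1)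
  have e_min: "e \<le> e'" if "E e'" for e' unfolding e_def by (rule Least_le, rule that)
  obtain R A B where R: "R \<in> deg_eq K n e" "A \<in> polyfun K (Suc n)" "B \<in> polyfun K (Suc n)"
     "\<And>\<xi>. A \<xi> * upoly n d q \<xi> + B \<xi> * s \<xi> = R \<xi>" using Ee unfolding E_def by blast
  obtain r where r: "coef_funs K n e r" "\<exists>\<xi>. r e \<xi> \<noteq> 0" "R = upoly n e r"
    using R(1) by (auto simp: deg_eq_def)
  show ?thesis
  \<comment> \<open>In degree zero the element found is free of the last variable and is the
    required \<open>c\<close>.\<close>
  proof (cases "e = 0")
    case True
    then have "R = r 0" using r by (simp add: upoly_def [abs_def])
    with r True have "r 0 \<in> polyfun K n" "\<exists>\<xi>. r 0 \<xi> \<noteq> 0" by (auto simp: coef_funs_def)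
    with R(2-4) show ?thesis unfolding \<open>R = r 0\<close> by blast
  next
    case False
    have re: "r e \<in> polyfun K n" using r(1) by (auto simp: coef_funs_def)
    obtain m B' R' where B': "B' \<in> deg_le K n (d - e)" "R' \<in> deg_le K n (e - 1)"
       "\<And>\<xi>. r e \<xi> ^ m * upoly n d q \<xi> = R \<xi> * B' \<xi> + R' \<xi>"
      using pseudo_division[OF K r(1) _ upq] False r(3) by auto
    \<comment> \<open>The remainder lies in the same ideal and has smaller degree than
      \<open>R\<close>, so minimality of \<open>e\<close> makes it vanish.\<close>
    have R'0: "R' \<xi> = 0" for \<xi>
    proof (rule ccontr)
      assume "R' \<xi> \<noteq> 0"
      with B'(2) obtain e' where e': "e' \<le> e - 1" "R' \<in> deg_eq K n e'"
        using deg_le_nonzero[OF K] by metis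
      have "E e'"
        unfolding E_def
      proof (intro exI conjI allI)
        show "R' \<in> deg_eq K n e'" by fact
        show "(\<lambda>\<xi>. r e \<xi> ^ m - A \<xi> * B' \<xi>) \<in> polyfun K (Suc n)"
          by (intro polyfun_diff[OF K] polyfun_power[OF K] polyfun_mult R(2) polyfun_Suc[OF re]
              deg_le_polyfun[OF K B'(1)])
        show "(\<lambda>\<xi>. - (B \<xi> * B' \<xi>)) \<in> polyfun K (Suc n)"
          by (intro polyfun_minus[OF K] polyfun_mult R(3) deg_le_polyfun[OF K B'(1)])
        fix \<xi>
        have "R' \<xi> = r e \<xi> ^ m * upoly n d q \<xi> - R \<xi> * B' \<xi>" using B'(3)[of \<xi>] by simp
        then show "(r e \<xi> ^ m - A \<xi> * B' \<xi>) * upoly n d q \<xi> + - (B \<xi> * B' \<xi>) * s \<xi> = R' \<xi>"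
          unfolding R(4)[symmetric] by (simp add: algebra_simps)
      qed
      from e_min[OF this] e'(1) False show False by simp
    qed
    have "\<exists>\<xi>. r e \<xi> ^ m \<noteq> 0" using r(2) by auto
    moreover have "1 \<le> e" "e < d" using False e_le q(3) by auto
    moreover have "r e \<xi> ^ m * upoly n d q \<xi> = R \<xi> * B' \<xi>" for \<xi> using B'(3) R'0 by simp
    ultimately have False
      using irred[OF polyfun_power[OF K re, of m] _ _ _ R(1) B'(1)] by blast
    then show ?thesis ..
  qed
qed

section \<open>Differential equations of order one\<close>

definition derivation :: "('a::field \<Rightarrow> 'a) \<Rightarrow> bool" where
  "derivation D \<longleftrightarrow> (\<forall>x y. D (x + y) = D x + D y) \<and> (\<forall>x y. D (x * y) = D x * y + x * D y)"

text \<open>At a jet, a polynomial function becomes a differential polynomial: variable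
  \<open>i\<close> receives the \<open>i\<close>-th derivative.\<close>

definition jet :: "('a \<Rightarrow> 'a) \<Rightarrow> 'a \<Rightarrow> nat \<Rightarrow> 'a" where
  "jet D x i = (D ^^ i) x"

text \<open>Blum's axioms for polynomial functions. Positive degree \<open>d\<close> in variable
  \<open>n\<close> with nonzero leading coefficient says that the equation has order exactly
  \<open>n\<close>; a nonzero \<open>g\<close> in the variables below \<open>n\<close> has lower
  order. For \<open>n = 0\<close> this is algebraic closedness.\<close>

definition blum_closed :: "('a::field \<Rightarrow> 'a) \<Rightarrow> bool" where
  "blum_closed D \<longleftrightarrow>
     (\<forall>n d a g. 1 \<le> d \<longrightarrow> coef_funs UNIV n d a \<longrightarrow> (\<exists>\<xi>. a d \<xi> \<noteq> 0) \<longrightarrow>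
        g \<in> polyfun UNIV n \<longrightarrow> (\<exists>\<xi>. g \<xi> \<noteq> 0) \<longrightarrow>
        (\<exists>x. upoly n d a (jet D x) = 0 \<and> g (jet D x) \<noteq> 0))"

lemma jet_simps: "jet D x 0 = x" "jet D x (Suc 0) = D x" "D (jet D x i) = jet D x (Suc i)"
  by (auto simp: jet_def)

context
  fixes D :: "'a::field_char_0 \<Rightarrow> 'a"
  assumes D: "derivation D"
begin

lemma derivation_add: "D (x + y) = D x + D y"
  and derivation_mult: "D (x * y) = D x * y + x * D y"
  using D by (auto simp: derivation_def)

lemma derivation_zero: "D 0 = 0"
  using derivation_add[of 0 0] by simp

lemma derivation_one: "D 1 = 0"
  using derivation_mult[of 1 1] by simp

lemma derivation_minus: "D (- x) = - D x"
  using derivation_add[of x "- x"] derivation_zero by (simp add: eq_neg_iff_add_eq_0 add.commute)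

lemma derivation_power: "D (x ^ k) = of_nat k * x ^ (k - 1) * D x"
proof (induction k)
  case 0 then show ?case by (simp add: derivation_one)
next
  case (Suc k) then show ?case by (cases k) (simp_all add: derivation_mult algebra_simps)
qed

lemma derivation_sum: "D (sum g A) = (\<Sum>i\<in>A. D (g i))"
  by (induction A rule: infinite_finite_induct) (auto simp: derivation_zero derivation_add)

lemma derivation_inverse: "D (inverse x) = - D x * inverse x * inverse x"
proof (cases "x = 0")
  case True then show ?thesis by (simp add: derivation_zero)
next
  case False
  then have "D (x * inverse x) = 0" by (simp add: derivation_one)
  then have "x * D (inverse x) = - (D x * inverse x)"
    unfolding derivation_mult by (simp add: eq_neg_iff_add_eq_0 add.commute)
  then have "inverse x * (x * D (inverse x)) = inverse x * - (D x * inverse x)" by simp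
  then have "(inverse x * x) * D (inverse x) = inverse x * - (D x * inverse x)" by (simp only: mult.assoc)
  then show ?thesis using False by (simp add: mult_ac)
qed

lemma derivation_polyfun:
  assumes K: "field_subset K" "\<And>c. c \<in> K \<Longrightarrow> D c \<in> K" and \<phi>: "\<phi> \<in> polyfun K n"
  shows "\<exists>T\<in>polyfun K (Suc n). \<forall>x. D (\<phi> (jet D x)) = T (jet D x)"
  using \<phi>
proof (induction rule: polyfun.induct)
  case (polyfun_const c)
  then show ?case by (intro bexI[of _ "\<lambda>_. D c"]) (auto intro: polyfun.intros K)
next
  case (polyfun_var i)
  then show ?case
    by (intro bexI[of _ "\<lambda>\<xi>. \<xi> (Suc i)"]) (auto simp: jet_simps intro: polyfun.polyfun_var)
next
  case (polyfun_add \<phi> \<psi>)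
  then obtain T U where "T \<in> polyfun K (Suc n)" "\<And>x. D (\<phi> (jet D x)) = T (jet D x)"
    "U \<in> polyfun K (Suc n)" "\<And>x. D (\<psi> (jet D x)) = U (jet D x)" by blast
  then show ?case
    by (intro bexI[of _ "\<lambda>\<xi>. T \<xi> + U \<xi>"]) (auto simp: derivation_add intro: polyfun.polyfun_add)
next
  case (polyfun_mult \<phi> \<psi>)
  then obtain T U where *: "T \<in> polyfun K (Suc n)" "\<And>x. D (\<phi> (jet D x)) = T (jet D x)"
    "U \<in> polyfun K (Suc n)" "\<And>x. D (\<psi> (jet D x)) = U (jet D x)" by blast
  have "(\<lambda>\<xi>. T \<xi> * \<psi> \<xi> + \<phi> \<xi> * U \<xi>) \<in> polyfun K (Suc n)"
    by (intro polyfun.polyfun_add polyfun.polyfun_mult * polyfun_Suc polyfun_mult.hyps)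
  then show ?case using *(2,4)
    by (intro bexI[of _ "\<lambda>\<xi>. T \<xi> * \<psi> \<xi> + \<phi> \<xi> * U \<xi>"]) (auto simp: derivation_mult)
qed

text \<open>The new highest derivative enters linearly, because it arises only from differentiating
  the variable \<open>n\<close>; its factor \<open>S\<close> is built as the partial derivative in
  that variable.\<close>

lemma derivation_polyfun_separant:
  assumes K: "field_subset K" "\<And>c. c \<in> K \<Longrightarrow> D c \<in> K" and \<phi>: "\<phi> \<in> polyfun K (Suc n)"
  shows "\<exists>T\<in>polyfun K (Suc n). \<exists>S\<in>polyfun K (Suc n).
           \<forall>x. D (\<phi> (jet D x)) = T (jet D x) + S (jet D x) * jet D x (Suc n)"
  using \<phi>
proof (induction rule: polyfun.induct)
  case (polyfun_const c)
  then show ?case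
    by (intro bexI[of _ "\<lambda>_. D c"] bexI[of _ "\<lambda>_. 0"]) (auto intro: polyfun.intros K polyfun_zero[OF K(1)])
next
  case (polyfun_var i)
  show ?case
  proof (cases "i = n")
    case True
    then show ?thesis
      by (intro bexI[of _ "\<lambda>_. 0"] bexI[of _ "\<lambda>_. 1"])
         (auto simp: jet_simps intro: polyfun_zero[OF K(1)] polyfun_one[OF K(1)])
  next
    case False
    with polyfun_var show ?thesis
      by (intro bexI[of _ "\<lambda>\<xi>. \<xi> (Suc i)"] bexI[of _ "\<lambda>_. 0"])
         (auto simp: jet_simps intro: polyfun_zero[OF K(1)] polyfun.polyfun_var)
  qed
next
  case (polyfun_add \<phi> \<psi>)
  then obtain T S U V where *: "T \<in> polyfun K (Suc n)" "S \<in> polyfun K (Suc n)"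
    "\<And>x. D (\<phi> (jet D x)) = T (jet D x) + S (jet D x) * jet D x (Suc n)"
    "U \<in> polyfun K (Suc n)" "V \<in> polyfun K (Suc n)"
    "\<And>x. D (\<psi> (jet D x)) = U (jet D x) + V (jet D x) * jet D x (Suc n)" by blast
  show ?case
    by (rule bexI[of _ "\<lambda>\<xi>. T \<xi> + U \<xi>"], rule bexI[of _ "\<lambda>\<xi>. S \<xi> + V \<xi>"])
       (auto simp: derivation_add * algebra_simps intro: polyfun.polyfun_add *)
next
  case (polyfun_mult \<phi> \<psi>)
  then obtain T S U V where *: "T \<in> polyfun K (Suc n)" "S \<in> polyfun K (Suc n)"
    "\<And>x. D (\<phi> (jet D x)) = T (jet D x) + S (jet D x) * jet D x (Suc n)"
    "U \<in> polyfun K (Suc n)" "V \<in> polyfun K (Suc n)"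
    "\<And>x. D (\<psi> (jet D x)) = U (jet D x) + V (jet D x) * jet D x (Suc n)" by blast
  have 1: "(\<lambda>\<xi>. T \<xi> * \<psi> \<xi> + \<phi> \<xi> * U \<xi>) \<in> polyfun K (Suc n)"
    "(\<lambda>\<xi>. S \<xi> * \<psi> \<xi> + \<phi> \<xi> * V \<xi>) \<in> polyfun K (Suc n)"
    by (intro polyfun.polyfun_add polyfun.polyfun_mult * polyfun_mult.hyps)+
  have "D (\<phi> (jet D x) * \<psi> (jet D x)) = (T (jet D x) * \<psi> (jet D x) + \<phi> (jet D x) * U (jet D x)) +
     (S (jet D x) * \<psi> (jet D x) + \<phi> (jet D x) * V (jet D x)) * jet D x (Suc n)" for x
    unfolding derivation_mult * by (simp add: algebra_simps)
  then show ?case by (intro bexI[OF _ 1(1)] bexI[OF _ 1(2)]) simp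
qed

text \<open>Here the separant has to be explicit: it must be literally the polynomial that occurs in
  \<open>separable_bezout\<close>.\<close>

lemma derivation_upoly:
  assumes K: "field_subset K" "\<And>c. c \<in> K \<Longrightarrow> D c \<in> K" and q: "coef_funs K n d q"
  shows "\<exists>T\<in>polyfun K (Suc n). \<forall>x. D (upoly n d q (jet D x)) =
     T (jet D x) + (\<Sum>k\<le>d. of_nat k * q k (jet D x) * jet D x n ^ (k - 1)) * jet D x (Suc n)"
proof -
  have "\<forall>k\<le>d. \<exists>T\<in>polyfun K (Suc n). \<forall>x. D (q k (jet D x)) = T (jet D x)"
    using derivation_polyfun[OF K] q by (auto simp: coef_funs_def)
  then obtain T where T: "\<And>k. k \<le> d \<Longrightarrow> T k \<in> polyfun K (Suc n)"
    "\<And>k x. k \<le> d \<Longrightarrow> D (q k (jet D x)) = T k (jet D x)" by metis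
  have 1: "(\<lambda>\<xi>. \<Sum>k\<le>d. T k \<xi> * \<xi> n ^ k) \<in> polyfun K (Suc n)"
    by (intro polyfun_sum[OF K(1)] polyfun_mult polyfun_power[OF K(1)] polyfun_var T) auto
  have 2: "D (upoly n d q (jet D x)) = (\<Sum>k\<le>d. T k (jet D x) * jet D x n ^ k) +
      (\<Sum>k\<le>d. of_nat k * q k (jet D x) * jet D x n ^ (k - 1)) * jet D x (Suc n)" for x
    unfolding upoly_def derivation_sum sum_distrib_right sum.distrib[symmetric]
    by (intro sum.cong refl) (simp add: T derivation_mult derivation_power jet_simps algebra_simps)
  show ?thesis by (rule bexI[OF _ 1]) (use 2 in simp)
qed

text \<open>
  On the solutions of an equation of order one, the separant clears the denominators of all higher
  derivatives.
\<close>

lemma reduce_to_first_order: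
  assumes K: "field_subset K" "\<And>c. c \<in> K \<Longrightarrow> D c \<in> K" and q: "coef_funs K 1 d q"
    and P: "P \<in> polyfun K n"
  defines "s \<equiv> (\<lambda>\<xi>. \<Sum>k\<le>d. of_nat k * q k \<xi> * \<xi> 1 ^ (k - 1))"
  shows "\<exists>N\<in>polyfun K 2. \<exists>m. \<forall>x. upoly 1 d q (jet D x) = 0 \<longrightarrow>
           s (jet D x) ^ m * P (jet D x) = N (jet D x)"
proof -
  define good where "good x \<longleftrightarrow> upoly 1 d q (jet D x) = 0" for x
  \<comment> \<open>The functions of \<open>x\<close> that turn into first-order polynomials on the
    solutions once multiplied by a power of the separant. They form a ring closed under
    \<open>D\<close>, hence contain all differential polynomials.\<close>
  define R where "R \<phi> \<longleftrightarrow> (\<exists>N\<in>polyfun K 2. \<exists>m. \<forall>x. good x \<longrightarrow> s (jet D x) ^ m * \<phi> x = N (jet D x))"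
    for \<phi> :: "'a \<Rightarrow> 'a"
  have s: "s \<in> polyfun K 2"
    unfolding s_def using q
    by (intro polyfun_sum[OF K(1)] polyfun_mult polyfun_power[OF K(1)] polyfun_var polyfun_of_nat[OF K(1)])
       (auto simp: coef_funs_def intro: polyfun_mono)
  obtain T where T: "T \<in> polyfun K 2"
     "\<And>x. D (upoly 1 d q (jet D x)) = T (jet D x) + s (jet D x) * jet D x 2"
    using derivation_upoly[OF K q] by (auto simp: s_def numeral_2_eq_2)
  have sD: "\<exists>N'\<in>polyfun K 2. \<forall>x. good x \<longrightarrow> s (jet D x) * D (N (jet D x)) = N' (jet D x)"
    if N: "N \<in> polyfun K 2" for N
  proof -
    have "N \<in> polyfun K (Suc 1)" using N by (simp add: numeral_2_eq_2)
    from derivation_polyfun_separant[OF K this]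
    obtain U V where UV: "U \<in> polyfun K 2" "V \<in> polyfun K 2"
      "\<And>x. D (N (jet D x)) = U (jet D x) + V (jet D x) * jet D x 2"
      by (auto simp: numeral_2_eq_2)
    \<comment> \<open>Differentiating the equation along a solution gives
      \<open>s (jet D x) * jet D x 2 = - T (jet D x)\<close>, which eliminates the second derivative
      at the cost of one factor \<open>s\<close>.\<close>
    have 1: "s (jet D x) * D (N (jet D x)) = s (jet D x) * U (jet D x) - T (jet D x) * V (jet D x)"
      if "good x" for x
    proof -
      have "s (jet D x) * jet D x 2 = - T (jet D x)"
        using T(2)[of x] that unfolding good_def by (simp add: derivation_zero eq_neg_iff_add_eq_0 add.commute)
      then show ?thesis unfolding UV(3) by (simp add: algebra_simps)
    qed
    have 2: "(\<lambda>\<xi>. s \<xi> * U \<xi> - T \<xi> * V \<xi>) \<in> polyfun K 2"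
      by (intro polyfun_diff[OF K(1)] polyfun_mult s T UV)
    show ?thesis by (rule bexI[OF _ 2]) (use 1 in simp)
  qed
  have R_poly: "R (\<lambda>x. N (jet D x))" if "N \<in> polyfun K 2" for N
    unfolding R_def using that by (intro bexI[of _ N] exI[of _ 0]) auto
  have R_mult: "R (\<lambda>x. \<phi> x * \<psi> x)" if hyps: "R \<phi>" "R \<psi>" for \<phi> \<psi>
  proof -
    obtain N m N' m' where *: "N \<in> polyfun K 2" "\<And>x. good x \<Longrightarrow> s (jet D x) ^ m * \<phi> x = N (jet D x)"
       "N' \<in> polyfun K 2" "\<And>x. good x \<Longrightarrow> s (jet D x) ^ m' * \<psi> x = N' (jet D x)"
      using hyps unfolding R_def by meson
    have "s (jet D x) ^ (m + m') * (\<phi> x * \<psi> x) = N (jet D x) * N' (jet D x)" if "good x" for x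
      unfolding *(2)[OF that, symmetric] *(4)[OF that, symmetric] by (simp add: power_add algebra_simps)
    then show ?thesis unfolding R_def
      by (intro bexI[OF _ polyfun_mult[OF *(1) *(3)]] exI[of _ "m + m'"]) simp
  qed
  have R_add: "R (\<lambda>x. \<phi> x + \<psi> x)" if hyps: "R \<phi>" "R \<psi>" for \<phi> \<psi>
  proof -
    obtain N m N' m' where *: "N \<in> polyfun K 2" "\<And>x. good x \<Longrightarrow> s (jet D x) ^ m * \<phi> x = N (jet D x)"
       "N' \<in> polyfun K 2" "\<And>x. good x \<Longrightarrow> s (jet D x) ^ m' * \<psi> x = N' (jet D x)"
      using hyps unfolding R_def by meson
    have "s (jet D x) ^ (m + m') * (\<phi> x + \<psi> x) = s (jet D x) ^ m' * N (jet D x) + s (jet D x) ^ m * N' (jet D x)"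
      if "good x" for x
      unfolding *(2)[OF that, symmetric] *(4)[OF that, symmetric] by (simp add: power_add algebra_simps)
    moreover have 1: "(\<lambda>\<xi>. s \<xi> ^ m' * N \<xi> + s \<xi> ^ m * N' \<xi>) \<in> polyfun K 2"
      by (intro polyfun_add polyfun_mult polyfun_power[OF K(1)] s *)
    ultimately show ?thesis unfolding R_def by (intro bexI[OF _ 1] exI[of _ "m + m'"]) simp
  qed
  have R_D: "R (\<lambda>x. D (\<phi> x))" if hyps: "R \<phi>" for \<phi>
  proof -
    obtain N m where N: "N \<in> polyfun K 2" "\<And>x. good x \<Longrightarrow> s (jet D x) ^ m * \<phi> x = N (jet D x)"
      using hyps unfolding R_def by meson
    obtain N1 where N1: "N1 \<in> polyfun K 2" "\<And>x. good x \<Longrightarrow> s (jet D x) * D (N (jet D x)) = N1 (jet D x)"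
      using sD[OF N(1)] by blast
    obtain S1 where S1: "S1 \<in> polyfun K 2" "\<And>x. good x \<Longrightarrow> s (jet D x) * D (s (jet D x)) = S1 (jet D x)"
      using sD[OF s] by blast
    \<comment> \<open>Two more factors \<open>s\<close> than before: in the first term one of them
      reduces the derivative of \<open>N\<close>; in the second term one reduces the derivative of
      \<open>s\<close> and the other turns \<open>s ^ (m - 1)\<close> back into
      \<open>s ^ m\<close>.\<close>
    have "s (jet D x) ^ (m + 2) * D (\<phi> x) = s (jet D x) * N1 (jet D x) - of_nat m * S1 (jet D x) * N (jet D x)"
      if g: "good x" for x
    proof -
      have "D (N (jet D x)) = D (s (jet D x) ^ m * \<phi> x)" using N(2)[OF g] by simp
      also have "\<dots> = of_nat m * s (jet D x) ^ (m - 1) * D (s (jet D x)) * \<phi> x + s (jet D x) ^ m * D (\<phi> x)"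
        by (simp add: derivation_mult derivation_power)
      finally have E: "s (jet D x) ^ m * D (\<phi> x) =
          D (N (jet D x)) - of_nat m * s (jet D x) ^ (m - 1) * D (s (jet D x)) * \<phi> x" by simp
      then have "s (jet D x) * s (jet D x) * (s (jet D x) ^ m * D (\<phi> x)) =
          s (jet D x) * (s (jet D x) * D (N (jet D x)))
           - of_nat m * (s (jet D x) * D (s (jet D x))) * (s (jet D x) * s (jet D x) ^ (m - 1) * \<phi> x)"
        by (subst E) (simp add: algebra_simps)
      \<comment> \<open>For \<open>m = 0\<close> the truncated exponent is off, but both sides then
        carry the factor zero.\<close>
      moreover have "of_nat m * (s (jet D x) * s (jet D x) ^ (m - 1) * \<phi> x) = of_nat m * N (jet D x)"
        using N(2)[OF g] by (cases m) auto
      ultimately show ?thesis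
        using N1(2)[OF g] S1(2)[OF g] by (auto simp: power_add power2_eq_square mult_ac)
    qed
    moreover have 1: "(\<lambda>\<xi>. s \<xi> * N1 \<xi> - of_nat m * S1 \<xi> * N \<xi>) \<in> polyfun K 2"
      by (intro polyfun_diff[OF K(1)] polyfun_mult polyfun_of_nat[OF K(1)] s N N1 S1)
    ultimately show ?thesis unfolding R_def by (intro bexI[OF _ 1] exI[of _ "m + 2"]) simp
  qed
  have R_jet: "R (\<lambda>x. jet D x i)" for i
  proof (induction i)
    case 0 then show ?case using R_poly[OF polyfun_var[of 0]] by simp
  next
    case (Suc i) then show ?case using R_D by (simp add: jet_simps flip: jet_simps(3))
  qed
  from P have "R (\<lambda>x. P (jet D x))"
  proof (induction rule: polyfun.induct)
    case (polyfun_const c)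
    then show ?case using R_poly[OF polyfun.polyfun_const] by simp
  next
    case (polyfun_var i) then show ?case using R_jet by simp
  next
    case (polyfun_add \<phi> \<psi>) then show ?case using R_add by simp
  next
    case (polyfun_mult \<phi> \<psi>) then show ?case using R_mult by simp
  qed
  then show ?thesis by (auto simp: R_def good_def)
qed

text \<open>\<open>tr\<close> says that \<open>f\<close> is transcendental over \<open>K\<close>,
  and \<open>rel\<close> that its derivative is algebraic over \<open>K(f)\<close>. Let
  \<open>q\<close> be a relation of least degree in the derivative: whatever has smaller degree and
  vanishes at the jet of \<open>f\<close> vanishes identically. The conditions under which a
  solution of \<open>q\<close> also solves \<open>P\<close> involve variable 0 alone, so Blum's
  axiom of order one can impose them.\<close>

theorem infinite_common_solutions:
  assumes K: "field_subset K" "\<And>c. c \<in> K \<Longrightarrow> D c \<in> K"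
    and blum: "blum_closed D"
    and tr: "\<And>\<phi> \<xi>. \<phi> \<in> polyfun K 1 \<Longrightarrow> \<phi> (jet D f) = 0 \<Longrightarrow> \<phi> \<xi> = 0"
    and rel: "coef_funs K 1 d0 a0" "upoly 1 d0 a0 (jet D f) = 0" "k0 \<le> d0" "a0 k0 (jet D f) \<noteq> 0"
    and P: "P \<in> polyfun K n" "P (jet D f) = 0"
  shows "\<exists>Q\<in>polyfun K 2. (\<exists>\<xi>. Q \<xi> \<noteq> 0) \<and> infinite {x. Q (jet D x) = 0 \<and> P (jet D x) = 0}"
proof -
  define E where "E e \<longleftrightarrow> (\<exists>R. R \<in> deg_eq K 1 e \<and> R (jet D f) = 0)" for e
  have "\<exists>\<xi>. upoly 1 d0 a0 \<xi> \<noteq> 0"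
    using upoly_coeffs_zero[OF rel(1), of k0] rel(3,4) by auto
  moreover have "upoly 1 d0 a0 \<in> deg_le K 1 d0" using rel(1) by (auto simp: deg_le_def)
  ultimately obtain e0 where "upoly 1 d0 a0 \<in> deg_eq K 1 e0" using deg_le_nonzero[OF K(1)] by metis
  then have E0: "E e0" using rel(2) unfolding E_def by blast
  define d where "d = (LEAST e. E e)"
  have Ed: "E d" unfolding d_def by (rule LeastI, rule E0)
  have d_min: "d \<le> e'" if "E e'" for e' unfolding d_def by (rule Least_le, rule that)
  obtain q where q: "coef_funs K 1 d q" "\<exists>\<xi>. q d \<xi> \<noteq> 0" "upoly 1 d q (jet D f) = 0"
    using Ed unfolding E_def deg_eq_def by blast
  \<comment> \<open>Degree zero would be a polynomial relation for \<open>f\<close> itself.\<close>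
  have d1: "1 \<le> d"
  proof (rule ccontr)
    assume "\<not> 1 \<le> d"
    then have "d = 0" by simp
    then have "q 0 \<in> polyfun K 1" "q 0 (jet D f) = 0" using q by (auto simp: coef_funs_def upoly_def)
    from tr[OF this] q(2) \<open>d = 0\<close> show False by simp
  qed
  have zero: "\<phi> \<xi> = 0" if \<phi>: "\<phi> \<in> deg_le K 1 (d - 1)" "\<phi> (jet D f) = 0" for \<phi> \<xi>
  proof (rule ccontr)
    assume "\<phi> \<xi> \<noteq> 0"
    with \<phi>(1) obtain e where "e \<le> d - 1" "\<phi> \<in> deg_eq K 1 e" using deg_le_nonzero[OF K(1)] by metis
    then have "E e" using \<phi>(2) unfolding E_def by blast
    then show False using d_min[of e] d1 \<open>e \<le> d - 1\<close> by linarith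
  qed
  have qd: "q d \<in> polyfun K 1" using q(1) by (auto simp: coef_funs_def)
  have q2: "upoly 1 d q \<in> polyfun K 2"
    using deg_le_polyfun[OF K(1), of "upoly 1 d q" 1 d] q(1) by (auto simp: deg_le_def numeral_2_eq_2)
  have qnz: "\<exists>\<xi>. upoly 1 d q \<xi> \<noteq> 0"
    using deg_eq_nonzero[of "upoly 1 d q" K 1 d] q(1,2) by (auto simp: deg_eq_def)
  define s where "s = (\<lambda>\<xi>. \<Sum>k\<le>d. of_nat k * q k \<xi> * \<xi> 1 ^ (k - 1))"
  have "\<exists>A B c. A \<in> polyfun K (Suc 1) \<and> B \<in> polyfun K (Suc 1) \<and> c \<in> polyfun K 1 \<and> (\<exists>\<xi>. c \<xi> \<noteq> 0) \<and>
           (\<forall>\<xi>. A \<xi> * upoly 1 d q \<xi> + B \<xi> * s \<xi> = c \<xi>)"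
    unfolding s_def
  proof (rule separable_bezout[OF K(1) q(1,2) d1])
    fix c e R B assume *: "c \<in> polyfun K 1" "\<exists>\<xi>. c \<xi> \<noteq> 0" "1 \<le> e" "e < d" "R \<in> deg_eq K 1 e"
        "B \<in> deg_le K 1 (d - e)" "\<And>\<xi>. c \<xi> * upoly 1 d q \<xi> = R \<xi> * B \<xi>"
    have "R (jet D f) \<noteq> 0"
    proof
      assume "R (jet D f) = 0"
      then have "E e" using *(5) unfolding E_def by blast
      then show False using d_min[of e] *(4) by linarith
    qed
    \<comment> \<open>The cofactor \<open>B\<close> has degree below \<open>d\<close> and vanishes
      at the jet of \<open>f\<close>, so it is zero, although \<open>c\<close> and \<open>q\<close>
      are both nonzero polynomials.\<close>
    then have "B (jet D f) = 0" using *(7)[of "jet D f"] q(3) by simp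
    moreover have "B \<in> deg_le K 1 (d - 1)" using deg_le_mono[OF K(1) *(6)] * by simp
    ultimately have "c \<xi> * upoly 1 d q \<xi> = 0" for \<xi> using *(7) zero by simp
    moreover obtain \<xi> where "c \<xi> \<noteq> 0 \<and> upoly 1 d q \<xi> \<noteq> 0"
      using polyfun_common_nonzero[OF *(1) q2] *(2) qnz by blast
    ultimately show False using mult_eq_0_iff by blast
  qed
  then obtain A B c where bez: "c \<in> polyfun K 1" "\<exists>\<xi>. c \<xi> \<noteq> 0"
      "\<And>\<xi>. A \<xi> * upoly 1 d q \<xi> + B \<xi> * s \<xi> = c \<xi>" by blast
  obtain N m where N: "N \<in> polyfun K 2"
     "\<And>x. upoly 1 d q (jet D x) = 0 \<Longrightarrow> s (jet D x) ^ m * P (jet D x) = N (jet D x)"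
    using reduce_to_first_order[OF K q(1) P(1)] unfolding s_def by blast
  have Nf: "N (jet D f) = 0" using N(2)[OF q(3)] P(2) by simp
  obtain eN where "N \<in> deg_le K 1 eN" using polyfun_deg_le[OF K(1), of N 1] N(1) by (auto simp: numeral_2_eq_2)
  from pseudo_division[OF K(1) q(1) d1 this] obtain m' C R where
    C: "R \<in> deg_le K 1 (d - 1)" "\<And>\<xi>. q d \<xi> ^ m' * N \<xi> = upoly 1 d q \<xi> * C \<xi> + R \<xi>" by blast
  have "R (jet D f) = 0" using C(2)[of "jet D f"] Nf q(3) by simp
  \<comment> \<open>The remainder of \<open>N\<close> modulo \<open>q\<close> has degree below
    \<open>d\<close> and vanishes at the jet of \<open>f\<close>, hence identically:
    \<open>q\<close> divides \<open>N\<close> up to a power of its leading coefficient.\<close>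
  then have C2: "q d \<xi> ^ m' * N \<xi> = upoly 1 d q \<xi> * C \<xi>" for \<xi> using zero[OF C(1)] C(2) by simp
  have "infinite {x. upoly 1 d q (jet D x) = 0 \<and> P (jet D x) = 0}"
  proof
    assume fin: "finite {x. upoly 1 d q (jet D x) = 0 \<and> P (jet D x) = 0}" (is "finite ?E")
    \<comment> \<open>Vanishes at each of the finitely many alleged common solutions and is of order
      zero, so Blum's axiom can be asked to avoid all of them.\<close>
    define g1 where "g1 = (\<lambda>\<xi>::nat\<Rightarrow>'a. \<Prod>e\<in>?E. \<xi> 0 - e)"
    have g1: "g1 \<in> polyfun UNIV 1" unfolding g1_def
      by (intro polyfun_prod polyfun_diff field_subset_UNIV polyfun_var polyfun_const) auto
    obtain y where y: "y \<notin> ?E" using fin ex_new_if_finite infinite_UNIV_char_0 by blast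
    have g1nz: "g1 (\<lambda>_. y) \<noteq> 0" using fin y by (auto simp: g1_def)
    obtain \<xi>1 where "c \<xi>1 \<noteq> 0 \<and> q d \<xi>1 \<noteq> 0" using polyfun_common_nonzero[OF bez(1) qd] bez(2) q(2) by blast
    then have "c \<xi>1 * q d \<xi>1 \<noteq> 0" by simp
    from polyfun_common_nonzero[OF polyfun_mult[OF bez(1) qd] g1 this g1nz]
    obtain \<xi>2 where "c \<xi>2 * q d \<xi>2 \<noteq> 0 \<and> g1 \<xi>2 \<noteq> 0" by blast
    then have gnz: "c \<xi>2 * q d \<xi>2 * g1 \<xi>2 \<noteq> 0" by simp
    have "(\<lambda>\<xi>. c \<xi> * q d \<xi> * g1 \<xi>) \<in> polyfun UNIV 1"
      by (intro polyfun_mult g1) (auto intro: polyfun_mono[OF bez(1)] polyfun_mono[OF qd])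
    moreover have "coef_funs UNIV 1 d q" by (rule coef_funs_mono[OF q(1)]) simp
    moreover note blum[unfolded blum_closed_def, rule_format, of d 1 q "\<lambda>\<xi>. c \<xi> * q d \<xi> * g1 \<xi>"]
    ultimately obtain x where x: "upoly 1 d q (jet D x) = 0"
      "c (jet D x) * q d (jet D x) * g1 (jet D x) \<noteq> 0"
      using d1 q(2) gnz by blast
    have "N (jet D x) = 0" using C2[of "jet D x"] x by simp
    \<comment> \<open>At a solution of \<open>q\<close> the Bezout identity reads
      \<open>B * s = c\<close>, and \<open>c\<close> is nonzero at the solution chosen.\<close>
    moreover have "s (jet D x) \<noteq> 0" using bez(3)[of "jet D x"] x by auto
    ultimately have "P (jet D x) = 0" using N(2)[OF x(1)] by simp
    then have "x \<in> ?E" using x(1) by simp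
    then have "g1 (jet D x) = 0" using fin by (auto simp: g1_def jet_simps)
    then show False using x(2) by simp
  qed
  with q2 qnz show ?thesis by blast
qed

end

section \<open>Algebraic closure and towers\<close>

definition alg_over :: "'a::field set \<Rightarrow> 'a \<Rightarrow> bool" where
  "alg_over K x \<longleftrightarrow> (\<exists>n c. (\<forall>k\<le>n. c k \<in> K) \<and> (\<exists>k\<le>n. c k \<noteq> 0) \<and> (\<Sum>k\<le>n. c k * x ^ k) = 0)"

lemma alg_over_mono: "alg_over K x \<Longrightarrow> K \<subseteq> L \<Longrightarrow> alg_over L x"
  unfolding alg_over_def by blast

lemma alg_over_self: "field_subset K \<Longrightarrow> x \<in> K \<Longrightarrow> alg_over K x"
  unfolding alg_over_def
  by (rule exI[of _ 1], rule exI[of _ "\<lambda>k. if k = 0 then - x else 1"])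
     (auto simp: field_subset_one field_subset_minus)

text \<open>The type's field as a structure of \<open>HOL-Algebra\<close>, to use its theory of finite extensions.\<close>

abbreviation type_ring :: "'a::field ring" where
  "type_ring \<equiv> ring_of_type_algebra"

lemma type_ring_simps:
  "carrier (type_ring :: 'a::field ring) = UNIV"
  "x \<otimes>\<^bsub>type_ring\<^esub> y = x * (y::'a)" "x \<oplus>\<^bsub>type_ring\<^esub> y = x + y"
  "\<one>\<^bsub>type_ring\<^esub> = (1::'a)" "\<zero>\<^bsub>type_ring\<^esub> = (0::'a)"
  by (auto simp: ring_of_type_algebra_def)

lemma type_ring_pow: "x [^]\<^bsub>type_ring\<^esub> (n::nat) = (x::'a::field) ^ n"
proof -
  interpret field "type_ring :: 'a ring" by (rule field_from_type_algebra)
  show ?thesis by (induction n) (auto simp: type_ring_simps mult.commute)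
qed

lemma type_ring_uminus: "\<ominus>\<^bsub>type_ring\<^esub> x = - (x::'a::field)"
proof -
  interpret field "type_ring :: 'a ring" by (rule field_from_type_algebra)
  show ?thesis
    using minus_equality[of "- x" x] by (simp add: type_ring_simps)
qed

lemma type_ring_inverse: "(x::'a::field) \<noteq> 0 \<Longrightarrow> inv\<^bsub>type_ring\<^esub> x = inverse x"
proof -
  assume x: "x \<noteq> 0"
  interpret field "type_ring :: 'a ring" by (rule field_from_type_algebra)
  show ?thesis
    using x by (intro comm_inv_char) (auto simp: type_ring_simps)
qed

lemma subfield_type_ring: "subfield K (type_ring :: 'a::field ring) \<longleftrightarrow> field_subset K"
proof
  interpret field "type_ring :: 'a ring" by (rule field_from_type_algebra)
  assume K: "field_subset K"
  show "subfield K (type_ring :: 'a::field ring)"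
  proof (rule subfieldI')
    show "subring K (type_ring :: 'a::field ring)"
      by (rule subringI)
         (simp_all add: type_ring_simps type_ring_uminus field_subset_one[OF K]
             field_subset_add[OF K] field_subset_mult[OF K] field_subset_minus[OF K])
    fix k assume "k \<in> K - {\<zero>\<^bsub>type_ring\<^esub>}"
    then show "inv\<^bsub>type_ring\<^esub> k \<in> K"
      by (simp add: type_ring_inverse type_ring_simps field_subset_inverse[OF K])
  qed
next
  interpret field "type_ring :: 'a ring" by (rule field_from_type_algebra)
  assume K: "subfield K (type_ring :: 'a::field ring)"
  note sub = subringE[OF subfieldE(1)[OF K]]
  have "inverse x \<in> K" if "x \<in> K" for x
  proof (cases "x = 0")
    case True
    then show ?thesis using that by simp
  next
    case False
    then show ?thesis
      using subfield_m_inv(1)[OF K, of x] that by (auto simp: type_ring_simps type_ring_inverse)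
  qed
  then show "field_subset K"
    using sub(3) sub(5) sub(6) sub(7) by (simp add: field_subset_def type_ring_simps type_ring_uminus)
qed

text \<open>\<open>HOL-Algebra\<close> lists the coefficients of a polynomial from the leading one
  downwards, hence the reversal.\<close>

lemma eval_type_ring:
  "ring.eval type_ring (map c (rev [0..<n])) x = (\<Sum>k<n. c k * x ^ k)" for x :: "'a::field"
proof -
  interpret field "type_ring :: 'a ring" by (rule field_from_type_algebra)
  show ?thesis by (induction n) (auto simp: type_ring_simps type_ring_pow)
qed

lemma algebraic_type_ring:
  assumes K: "field_subset K"
  shows "ring.algebraic type_ring over K = (\<lambda>x::'a::field. alg_over K x)"
proof -
  interpret field "type_ring :: 'a ring" by (rule field_from_type_algebra)
  have Ksub: "subring K (type_ring :: 'a ring)"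
    using K subfield_type_ring subfieldE(1) by blast
  show ?thesis
  proof (intro ext iffI)
    fix x :: 'a assume "(algebraic over K) x"
    then obtain p where p: "p \<in> carrier (univ_poly type_ring K)" "p \<noteq> []" "eval p x = \<zero>\<^bsub>type_ring\<^esub>"
      using algebraicE[OF Ksub] by (metis UNIV_I type_ring_simps(1))
    define n where "n = length p - 1"
    have len: "length p = Suc n" using p(2) by (simp add: n_def)
    define c where "c k = p ! (n - k)" for k
    have "p = map c (rev [0..<Suc n])"
      by (rule nth_equalityI) (auto simp: len c_def rev_nth nth_append simp del: upt_Suc)
    then have "(\<Sum>k<Suc n. c k * x ^ k) = 0"
      using p(3) eval_type_ring[of c "Suc n" x] by (simp add: type_ring_simps)
    moreover have "polynomial\<^bsub>type_ring\<^esub> K p" using p(1) by (simp add: univ_poly_carrier)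
    then have pK: "set p \<subseteq> K" "hd p \<noteq> 0" using p(2) by (simp_all add: polynomial_def type_ring_simps)
    have "c k \<in> K" if "k \<le> n" for k
      unfolding c_def using pK(1) len nth_mem[of "n - k" p] by auto
    moreover have "c n \<noteq> 0" using pK(2) p(2) by (simp add: c_def hd_conv_nth)
    ultimately show "alg_over K x" unfolding alg_over_def lessThan_Suc_atMost by blast
  next
    fix x :: 'a assume "alg_over K x"
    then obtain n c where c: "\<forall>k\<le>n. c k \<in> K" "\<exists>k\<le>n. c k \<noteq> 0" "(\<Sum>k\<le>n. c k * x ^ k) = 0"
      unfolding alg_over_def by blast
    define p where "p = map c (rev [0..<Suc n])"
    have "eval p x = \<zero>\<^bsub>type_ring\<^esub>"
      unfolding p_def eval_type_ring using c(3) by (simp add: type_ring_simps lessThan_Suc_atMost)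
    then have 1: "eval (normalize p) x = \<zero>\<^bsub>type_ring\<^esub>"
      using eval_normalize[of p x] by (simp add: type_ring_simps)
    have pK: "set p \<subseteq> K" using c(1) by (auto simp: p_def)
    then have 2: "normalize p \<in> carrier (univ_poly type_ring K)"
      using normalize_gives_polynomial by (simp add: univ_poly_carrier)
    \<comment> \<open>\<open>normalize\<close> strips leading zeros, so an empty result means that
      all coefficients were zero.\<close>
    have "normalize q = [] \<Longrightarrow> set q \<subseteq> {0}" for q :: "'a list"
      by (induction q) (auto simp: type_ring_simps split: if_splits)
    moreover have "set p = c ` {..n}"
      by (simp add: p_def atLeast0LessThan lessThan_Suc_atMost del: upt_Suc)
    ultimately have "normalize p \<noteq> []" using c(2) by blast
    with 1 2 show "(algebraic over K) x" using algebraicI by blast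
  qed
qed

lemma field_subset_alg_over:
  assumes K: "field_subset (K :: 'a::field set)"
  shows "field_subset {x. alg_over K x}"
proof -
  interpret field "type_ring :: 'a ring" by (rule field_from_type_algebra)
  show ?thesis
    using subfield_of_algebraics[of K] K
    by (simp add: subfield_type_ring algebraic_type_ring type_ring_simps)
qed

text \<open>The coefficients of a relation for \<open>x\<close> generate an extension of finite
  dimension over \<open>K\<close>, over which \<open>x\<close> is algebraic; since dimensions
  multiply in towers, \<open>x\<close> lies in an extension of finite dimension over
  \<open>K\<close>.\<close>

lemma alg_over_trans:
  assumes K: "field_subset (K :: 'a::field set)" and x: "alg_over {y. alg_over K y} x"
  shows "alg_over K x"
proof -
  interpret field "type_ring :: 'a ring" by (rule field_from_type_algebra)
  have K': "subfield K (type_ring :: 'a ring)" using K by (simp add: subfield_type_ring)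
  obtain n c where c: "\<forall>k\<le>n. alg_over K (c k)" "\<exists>k\<le>n. c k \<noteq> 0" "(\<Sum>k\<le>n. c k * x ^ k) = 0"
    using x unfolding alg_over_def[of "{y. alg_over K y}"] by blast
  define xs where "xs = map c [0..<Suc n]"
  have alg: "(algebraic over K) y" if "y \<in> set xs" for y
    using that c(1) by (auto simp: xs_def algebraic_type_ring[OF K])
  define F where "F = finite_extension K xs"
  have xsc: "set xs \<subseteq> carrier type_ring" by (simp add: type_ring_simps)
  have F: "subfield F type_ring" unfolding F_def
    by (rule finite_extension_is_subfield[OF K' xsc alg])
  have Fdim: "finite_dimension K F" unfolding F_def
    by (rule finite_extension_finite_dimension(1)[OF K' xsc alg])
  have "set xs \<subseteq> F" unfolding F_def
    using finite_extension_mem[OF subfieldE(1)[OF K'] xsc] by blast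
  moreover have "set xs = c ` {..n}"
    by (simp add: xs_def atLeast0LessThan lessThan_Suc_atMost del: upt_Suc)
  ultimately have "\<forall>k\<le>n. c k \<in> F" by auto
  then have "alg_over F x" using c unfolding alg_over_def by blast
  then have xF: "(algebraic over F) x"
    using F by (simp add: algebraic_type_ring subfield_type_ring)
  have xc: "x \<in> carrier type_ring" by (simp add: type_ring_simps)
  have "finite_dimension F (simple_extension F x)"
    using dimension_simple_extension[OF F xc xF] finite_dimensionI by blast
  then have "finite_dimension K (simple_extension F x)"
    using telescopic_base_dim(1)[OF K' F Fdim] by blast
  moreover have "subring (simple_extension F x) type_ring"
    by (rule simple_extension_is_subring[OF subfieldE(1)[OF F] xc])
  moreover have "x \<in> simple_extension F x"
    by (rule simple_extension_mem[OF subfieldE(1)[OF F] xc])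
  ultimately have "(algebraic over K) x"
    using finite_dimension_imp_algebraic[OF K'] by blast
  then show ?thesis by (simp add: algebraic_type_ring[OF K])
qed

section \<open>Generated fields, relative algebraic closure and exchange\<close>

inductive_set gen_field :: "'a::field set \<Rightarrow> 'a set" for S where
  gen_base: "x \<in> S \<Longrightarrow> x \<in> gen_field S"
| gen_one: "1 \<in> gen_field S"
| gen_add: "x \<in> gen_field S \<Longrightarrow> y \<in> gen_field S \<Longrightarrow> x + y \<in> gen_field S"
| gen_mult: "x \<in> gen_field S \<Longrightarrow> y \<in> gen_field S \<Longrightarrow> x * y \<in> gen_field S"
| gen_minus: "x \<in> gen_field S \<Longrightarrow> - x \<in> gen_field S"
| gen_inverse: "x \<in> gen_field S \<Longrightarrow> inverse x \<in> gen_field S"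

lemma field_subset_gen: "field_subset (gen_field S)"
  unfolding field_subset_def by (auto intro: gen_field.intros)

lemma gen_field_least: "field_subset K \<Longrightarrow> S \<subseteq> K \<Longrightarrow> gen_field S \<subseteq> K"
proof
  fix x assume K: "field_subset K" "S \<subseteq> K" and "x \<in> gen_field S"
  from this(3) show "x \<in> K"
    by (induction rule: gen_field.induct)
       (use K in \<open>auto intro: field_subset_one field_subset_add field_subset_mult
          field_subset_minus field_subset_inverse\<close>)
qed

text \<open>The algebraic closure is taken inside the ambient field. By transitivity of algebraicity
  it is a closure operator, and with the exchange property dependence can be handled as in a
  matroid.\<close>

definition acl :: "'a::field set \<Rightarrow> 'a set" where
  "acl S = {x. alg_over (gen_field S) x}"

lemma field_subset_acl: "field_subset (acl S)"
  unfolding acl_def by (rule field_subset_alg_over[OF field_subset_gen])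

lemma gen_field_subset_acl: "gen_field S \<subseteq> acl S"
  unfolding acl_def using alg_over_self[OF field_subset_gen] by blast

lemma subset_acl: "S \<subseteq> acl S"
  using gen_field_subset_acl gen_base by blast

lemma acl_subset: "S \<subseteq> acl T \<Longrightarrow> acl S \<subseteq> acl T"
proof
  fix x assume "S \<subseteq> acl T" "x \<in> acl S"
  then have "alg_over {y. alg_over (gen_field T) y} x"
    using gen_field_least[OF field_subset_acl, of S T] by (auto simp: acl_def elim: alg_over_mono)
  then show "x \<in> acl T" unfolding acl_def
    using alg_over_trans[OF field_subset_gen] by blast
qed

lemma acl_mono: "S \<subseteq> T \<Longrightarrow> acl S \<subseteq> acl T"
  using acl_subset subset_acl by blast

lemma acl_field: "field_subset K \<Longrightarrow> acl K = {x. alg_over K x}"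
proof -
  assume "field_subset K"
  then have "gen_field K = K" using gen_field_least[of K K] gen_base[of _ K] by blast
  then show ?thesis by (simp add: acl_def)
qed

definition polys_over :: "'a::field set \<Rightarrow> 'a poly set" where
  "polys_over K = {p. \<forall>i. Polynomial.coeff p i \<in> K}"

context
  fixes K :: "'a::field set"
  assumes K: "field_subset K"
begin

lemma polys_over_const: "c \<in> K \<Longrightarrow> [:c:] \<in> polys_over K"
  by (auto simp: polys_over_def coeff_pCons field_subset_zero[OF K] split: nat.splits)

lemma polys_over_X: "[:0, 1:] \<in> polys_over K"
  by (auto simp: polys_over_def coeff_pCons field_subset_zero[OF K] field_subset_one[OF K] split: nat.splits)

lemma polys_over_add: "p \<in> polys_over K \<Longrightarrow> q \<in> polys_over K \<Longrightarrow> p + q \<in> polys_over K"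
  by (auto simp: polys_over_def intro: field_subset_add[OF K])

lemma polys_over_minus: "p \<in> polys_over K \<Longrightarrow> - p \<in> polys_over K"
  by (auto simp: polys_over_def intro: field_subset_minus[OF K])

lemma polys_over_mult: "p \<in> polys_over K \<Longrightarrow> q \<in> polys_over K \<Longrightarrow> p * q \<in> polys_over K"
  by (auto simp: polys_over_def coeff_mult intro!: field_subset_sum[OF K] field_subset_mult[OF K])

lemma polys_over_prod: "(\<And>i. i \<in> A \<Longrightarrow> p i \<in> polys_over K) \<Longrightarrow> prod p A \<in> polys_over K"
  using polys_over_const[OF field_subset_one[OF K]]
  by (induction A rule: infinite_finite_induct) (auto intro: polys_over_mult simp: one_pCons)

text \<open>\<open>u\<close> may be algebraic over \<open>K\<close>, so all that is asked of a
  denominator is a nonzero value at \<open>u\<close>. Inversion exchanges numerator and denominator,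
  except for the value zero, which is its own inverse.\<close>

lemma gen_field_insert:
  assumes "x \<in> gen_field (insert u K)"
  shows "\<exists>p\<in>polys_over K. \<exists>q\<in>polys_over K. poly q u \<noteq> 0 \<and> x = poly p u / poly q u"
  using assms
proof (induction rule: gen_field.induct)
  case (gen_base x)
  show ?case
  proof (cases "x \<in> K")
    case True
    then show ?thesis using polys_over_const[OF True] polys_over_const[OF field_subset_one[OF K]]
      by (intro bexI[of _ "[:x:]"] bexI[of _ "[:1:]"]) auto
  next
    case False
    then show ?thesis using gen_base polys_over_X polys_over_const[OF field_subset_one[OF K]]
      by (intro bexI[of _ "[:0, 1:]"] bexI[of _ "[:1:]"]) auto
  qed
next
  case gen_one
  show ?case using polys_over_const[OF field_subset_one[OF K]]
    by (intro bexI[of _ "[:1:]"]) auto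
next
  case (gen_add x y)
  then obtain p q p' q' where *: "p \<in> polys_over K" "q \<in> polys_over K" "poly q u \<noteq> 0" "x = poly p u / poly q u"
    "p' \<in> polys_over K" "q' \<in> polys_over K" "poly q' u \<noteq> 0" "y = poly p' u / poly q' u" by blast
  show ?case
    by (rule bexI[of _ "p * q' + p' * q"], rule bexI[of _ "q * q'"])
       (use * in \<open>auto simp: add_frac_eq intro: polys_over_add polys_over_mult\<close>)
next
  case (gen_mult x y)
  then obtain p q p' q' where *: "p \<in> polys_over K" "q \<in> polys_over K" "poly q u \<noteq> 0" "x = poly p u / poly q u"
    "p' \<in> polys_over K" "q' \<in> polys_over K" "poly q' u \<noteq> 0" "y = poly p' u / poly q' u" by blast
  show ?case
    by (rule bexI[of _ "p * p'"], rule bexI[of _ "q * q'"])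
       (use * in \<open>auto intro: polys_over_mult\<close>)
next
  case (gen_minus x)
  then obtain p q where *: "p \<in> polys_over K" "q \<in> polys_over K" "poly q u \<noteq> 0" "x = poly p u / poly q u"
    by blast
  show ?case
    by (rule bexI[of _ "- p"], rule bexI[of _ q]) (use * in \<open>auto intro: polys_over_minus\<close>)
next
  case (gen_inverse x)
  then obtain p q where *: "p \<in> polys_over K" "q \<in> polys_over K" "poly q u \<noteq> 0" "x = poly p u / poly q u"
    by blast
  show ?case
  proof (cases "poly p u = 0")
    case True
    then show ?thesis using * by (intro bexI[of _ p] bexI[of _ q]) auto
  next
    case False
    then show ?thesis using * by (intro bexI[of _ q] bexI[of _ p]) auto
  qed
qed

lemma acl_insert_clear_denominators:
  assumes "x \<in> acl (insert u K)"
  shows "\<exists>n C. (\<forall>k\<le>n. C k \<in> polys_over K) \<and> (\<exists>k\<le>n. poly (C k) u \<noteq> 0) \<and> (\<Sum>k\<le>n. poly (C k) u * x ^ k) = 0"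
proof -
  obtain n c where c: "\<forall>k\<le>n. c k \<in> gen_field (insert u K)" "\<exists>k\<le>n. c k \<noteq> 0" "(\<Sum>k\<le>n. c k * x ^ k) = 0"
    using assms unfolding acl_def alg_over_def by blast
  have "\<forall>k\<le>n. \<exists>p q. p \<in> polys_over K \<and> q \<in> polys_over K \<and> poly q u \<noteq> 0 \<and> c k = poly p u / poly q u"
    using gen_field_insert c(1) by blast
  then obtain p q where pq: "\<And>k. k \<le> n \<Longrightarrow> p k \<in> polys_over K" "\<And>k. k \<le> n \<Longrightarrow> q k \<in> polys_over K"
    "\<And>k. k \<le> n \<Longrightarrow> poly (q k) u \<noteq> 0" "\<And>k. k \<le> n \<Longrightarrow> c k = poly (p k) u / poly (q k) u" by metis
  define B where "B = (\<Prod>k\<le>n. poly (q k) u)"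
  have B: "B \<noteq> 0" using pq(3) by (auto simp: B_def)
  define C where "C k = p k * prod q ({..n} - {k})" for k
  have C: "poly (C k) u = B * c k" if "k \<le> n" for k
  proof -
    have "B = poly (q k) u * (\<Prod>j\<in>{..n} - {k}. poly (q j) u)"
      unfolding B_def using that by (intro prod.remove) auto
    then show ?thesis using pq(3,4)[OF that] by (simp add: C_def poly_prod)
  qed
  have "C k \<in> polys_over K" if "k \<le> n" for k
    unfolding C_def using pq that by (intro polys_over_mult polys_over_prod) auto
  moreover have "\<exists>k\<le>n. poly (C k) u \<noteq> 0" using c(2) C B by auto
  moreover have "(\<Sum>k\<le>n. poly (C k) u * x ^ k) = B * (\<Sum>k\<le>n. c k * x ^ k)"
    unfolding sum_distrib_left by (intro sum.cong refl) (simp add: C mult_ac)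
  ultimately show ?thesis using c(3) by auto
qed

text \<open>Steinitz exchange: the relation of \<open>x\<close> over \<open>K(u)\<close>, cleared of
  denominators, is regrouped by powers of \<open>u\<close>. Each new coefficient is a polynomial in
  \<open>x\<close> over \<open>K\<close>, and as \<open>x\<close> is transcendental it vanishes only
  if that polynomial is trivial.\<close>

lemma acl_exchange:
  assumes x: "x \<in> acl (insert u K)" "\<not> alg_over K x"
  shows "u \<in> acl (insert x K)"
proof -
  obtain n C where C: "\<forall>k\<le>n. C k \<in> polys_over K" "\<exists>k\<le>n. poly (C k) u \<noteq> 0"
    "(\<Sum>k\<le>n. poly (C k) u * x ^ k) = 0"
    using acl_insert_clear_denominators[OF x(1)] by blast
  define m where "m = Max ((\<lambda>k. Polynomial.degree (C k)) ` {..n})"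
  have m: "Polynomial.degree (C k) \<le> m" if "k \<le> n" for k
    unfolding m_def using that by (intro Max_ge) auto
  define e where "e i = (\<Sum>k\<le>n. Polynomial.coeff (C k) i * x ^ k)" for i
  have "(\<Sum>i\<le>m. e i * u ^ i) = (\<Sum>i\<le>m. \<Sum>k\<le>n. Polynomial.coeff (C k) i * u ^ i * x ^ k)"
    unfolding e_def sum_distrib_right by (intro sum.cong refl) (simp add: mult_ac)
  also have "\<dots> = (\<Sum>k\<le>n. \<Sum>i\<le>m. Polynomial.coeff (C k) i * u ^ i * x ^ k)"
    by (rule sum.swap)
  also have "\<dots> = (\<Sum>k\<le>n. poly (C k) u * x ^ k)"
  proof (intro sum.cong refl)
    fix k assume "k \<in> {..n}"
    then have "poly (C k) u = (\<Sum>i\<le>m. Polynomial.coeff (C k) i * u ^ i)"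
      unfolding poly_altdef using m[of k]
      by (intro sum.mono_neutral_left) (auto simp: coeff_eq_0)
    then show "(\<Sum>i\<le>m. Polynomial.coeff (C k) i * u ^ i * x ^ k) = poly (C k) u * x ^ k"
      by (simp add: sum_distrib_right)
  qed
  finally have "(\<Sum>i\<le>m. e i * u ^ i) = 0" using C(3) by simp
  moreover have "\<forall>i\<le>m. e i \<in> gen_field (insert x K)"
    unfolding e_def using C(1)
    by (intro allI impI field_subset_sum[OF field_subset_gen] field_subset_mult[OF field_subset_gen]
         field_subset_power[OF field_subset_gen] gen_base) (auto simp: polys_over_def)
  moreover have "\<exists>i\<le>m. e i \<noteq> 0"
  proof -
    obtain k where k: "k \<le> n" "C k \<noteq> 0" using C(2) by (metis poly_0)
    \<comment> \<open>At this index \<open>C k\<close> contributes its leading coefficient, so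
      \<open>e\<close> is the value at \<open>x\<close> of a nontrivial polynomial.\<close>
    have "e (Polynomial.degree (C k)) \<noteq> 0"
    proof
      assume "e (Polynomial.degree (C k)) = 0"
      then have "alg_over K x" unfolding alg_over_def e_def
        using C(1) k by (intro exI[of _ n] exI[of _ "\<lambda>j. Polynomial.coeff (C j) (Polynomial.degree (C k))"])
          (auto simp: polys_over_def)
      then show False using x(2) by simp
    qed
    then show ?thesis using m[OF k(1)] by blast
  qed
  ultimately show ?thesis unfolding acl_def alg_over_def by blast
qed

lemma polyfun_1_poly: "\<phi> \<in> polyfun K 1 \<Longrightarrow> \<exists>p\<in>polys_over K. \<forall>\<xi>. \<phi> \<xi> = poly p (\<xi> 0)"
proof (induction rule: polyfun.induct)
  case (polyfun_const c)
  then show ?case using polys_over_const by (intro bexI[of _ "[:c:]"]) auto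
next
  case (polyfun_var i)
  then show ?case using polys_over_X by (intro bexI[of _ "[:0, 1:]"]) auto
next
  case (polyfun_add \<phi> \<psi>)
  then obtain p q where "p \<in> polys_over K" "\<forall>\<xi>. \<phi> \<xi> = poly p (\<xi> 0)" "q \<in> polys_over K" "\<forall>\<xi>. \<psi> \<xi> = poly q (\<xi> 0)"
    by blast
  then show ?case by (intro bexI[of _ "p + q"]) (auto intro: polys_over_add)
next
  case (polyfun_mult \<phi> \<psi>)
  then obtain p q where "p \<in> polys_over K" "\<forall>\<xi>. \<phi> \<xi> = poly p (\<xi> 0)" "q \<in> polys_over K" "\<forall>\<xi>. \<psi> \<xi> = poly q (\<xi> 0)"
    by blast
  then show ?case by (intro bexI[of _ "p * q"]) (auto intro: polys_over_mult)
qed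

lemma poly_polyfun_1: "p \<in> polys_over K \<Longrightarrow> (\<lambda>\<xi>. poly p (\<xi> 0)) \<in> polyfun K 1"
  unfolding poly_altdef polys_over_def
  by (intro polyfun_sum[OF K] polyfun_mult polyfun_power[OF K] polyfun_const polyfun_var) auto

end

text \<open>Differentiate a relation of least degree for \<open>x\<close>. The factor of
  \<open>D x\<close> is a polynomial in \<open>x\<close> of smaller degree with nonzero leading
  coefficient, hence nonzero by minimality, and \<open>D x\<close> can be solved for.\<close>

lemma acl_derivation_closed:
  fixes D :: "'a::field_char_0 \<Rightarrow> 'a"
  assumes D: "derivation D" and S: "\<And>x. x \<in> S \<Longrightarrow> D x \<in> acl S" and x: "x \<in> acl S"
  shows "D x \<in> acl S"
proof -
  note F = field_subset_acl[of S]
  have gen: "D y \<in> acl S" if "y \<in> gen_field S" for y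
    using that
  proof (induction rule: gen_field.induct)
    case (gen_mult x y)
    have "x \<in> acl S" "y \<in> acl S" using gen_mult.hyps gen_field_subset_acl by blast+
    with gen_mult.IH show ?case
      by (auto simp: derivation_mult[OF D] intro: field_subset_add[OF F] field_subset_mult[OF F])
  next
    case (gen_inverse x)
    have "x \<in> acl S" using gen_inverse.hyps gen_field_subset_acl by blast
    with gen_inverse.IH show ?case
      unfolding derivation_inverse[OF D]
      by (intro field_subset_mult[OF F] field_subset_minus[OF F] field_subset_inverse[OF F])
  qed (auto simp: S derivation_add[OF D] derivation_one[OF D] derivation_minus[OF D]
        field_subset_zero[OF F] intro: field_subset_add[OF F] field_subset_minus[OF F])
  define E where "E n \<longleftrightarrow> (\<exists>c. (\<forall>k\<le>n. c k \<in> gen_field S) \<and> c n \<noteq> 0 \<and> (\<Sum>k\<le>n. c k * x ^ k) = 0)" for n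
  \<comment> \<open>Algebraicity does not tell which coefficient is nonzero; cutting the relation
    after the last nonzero one yields a degree on which minimality can be used.\<close>
  have shrink: "\<exists>m\<le>n. c m \<noteq> 0 \<and> (\<forall>k\<le>n. m < k \<longrightarrow> c k = 0)" if "\<exists>k\<le>n. c k \<noteq> 0" for n and c :: "nat \<Rightarrow> 'a"
  proof (intro exI[of _ "Max {k. k \<le> n \<and> c k \<noteq> 0}"] conjI allI impI)
    have fin: "finite {k. k \<le> n \<and> c k \<noteq> 0}" by simp
    have "Max {k. k \<le> n \<and> c k \<noteq> 0} \<in> {k. k \<le> n \<and> c k \<noteq> 0}" using that by (intro Max_in fin) auto
    then show "Max {k. k \<le> n \<and> c k \<noteq> 0} \<le> n" "c (Max {k. k \<le> n \<and> c k \<noteq> 0}) \<noteq> 0" by auto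
    fix k assume "k \<le> n" "Max {k. k \<le> n \<and> c k \<noteq> 0} < k"
    show "c k = 0"
    proof (rule ccontr)
      assume "c k \<noteq> 0"
      then have "k \<le> Max {k. k \<le> n \<and> c k \<noteq> 0}" using \<open>k \<le> n\<close> by (intro Max_ge fin) simp
      then show False using \<open>Max {k. k \<le> n \<and> c k \<noteq> 0} < k\<close> by simp
    qed
  qed
  have ex: "\<exists>m\<le>n. E m" if hyps: "\<forall>k\<le>n. c k \<in> gen_field S" "\<exists>k\<le>n. c k \<noteq> 0" "(\<Sum>k\<le>n. c k * x ^ k) = 0" for n c
  proof -
    obtain m where m: "m \<le> n" "c m \<noteq> 0" "\<forall>k\<le>n. m < k \<longrightarrow> c k = 0" using shrink[OF hyps(2)] by blast
    have "(\<Sum>k\<le>n. c k * x ^ k) = (\<Sum>k\<le>m. c k * x ^ k)"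
      using m by (intro sum.mono_neutral_right) auto
    then have "E m" unfolding E_def using hyps m by (intro exI[of _ c]) auto
    then show ?thesis using m(1) by blast
  qed
  obtain n0 where "E n0" using x ex unfolding acl_def alg_over_def by blast
  define n where "n = (LEAST n. E n)"
  have En: "E n" unfolding n_def by (rule LeastI, rule \<open>E n0\<close>)
  have n_min: "n \<le> m" if "E m" for m unfolding n_def by (rule Least_le, rule that)
  obtain c where c: "\<forall>k\<le>n. c k \<in> gen_field S" "c n \<noteq> 0" "(\<Sum>k\<le>n. c k * x ^ k) = 0"
    using En unfolding E_def by blast
  obtain n' where n': "n = Suc n'" using c by (cases n) auto
  define s where "s = (\<Sum>k\<le>n'. of_nat (Suc k) * c (Suc k) * x ^ k)"
  have "s \<noteq> 0"
  proof
    assume "s = 0"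
    then have "\<exists>m\<le>n'. E m"
      by (intro ex[of n' "\<lambda>k. of_nat (Suc k) * c (Suc k)"])
         (use c n' in \<open>auto simp: s_def intro!: field_subset_mult[OF field_subset_gen]
            field_subset_of_nat[OF field_subset_gen] exI[of _ n'] simp del: of_nat_Suc\<close>)
    then show False using n_min n' by force
  qed
  define t where "t = (\<Sum>k\<le>n. D (c k) * x ^ k)"
  have "0 = D (\<Sum>k\<le>n. c k * x ^ k)" unfolding c(3) by (simp add: derivation_zero[OF D])
  also have "\<dots> = t + (\<Sum>k\<le>n. of_nat k * c k * x ^ (k - 1)) * D x"
    unfolding derivation_sum[OF D] t_def sum_distrib_right sum.distrib[symmetric]
    by (intro sum.cong refl) (simp add: derivation_mult[OF D] derivation_power[OF D] algebra_simps)
  also have "(\<Sum>k\<le>n. of_nat k * c k * x ^ (k - 1)) = s"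
    unfolding n' s_def by (subst sum.atMost_Suc_shift) simp
  finally have "D x = - t / s" using \<open>s \<noteq> 0\<close> by (simp add: field_simps eq_neg_iff_add_eq_0)
  moreover have "t \<in> acl S" unfolding t_def using c(1) gen x
    by (intro field_subset_sum[OF F] field_subset_mult[OF F] field_subset_power[OF F]) auto
  moreover have "s \<in> acl S" unfolding s_def using c(1) gen_field_subset_acl[of S] x n'
    by (intro field_subset_sum[OF F] field_subset_mult[OF F] field_subset_power[OF F]
        field_subset_of_nat[OF F]) auto
  ultimately show ?thesis
    by (simp add: field_subset_divide[OF F] field_subset_minus[OF F])
qed

text \<open>
  The step of the tower at which \<open>f\<close> becomes algebraic adjoins one element \<open>u\<close>, and by the exchange
  property \<open>u\<close> is then algebraic over \<open>f\<close>; hence so is the derivative of \<open>f\<close>.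
\<close>

theorem tower_infinite_common_solutions:
  fixes D :: "'a::field_char_0 \<Rightarrow> 'a" and u :: "nat \<Rightarrow> 'a"
  assumes D: "derivation D" and blum: "blum_closed D"
    and L: "field_subset L" "\<And>x. x \<in> L \<Longrightarrow> D x \<in> L"
    and u: "\<And>i. i < l \<Longrightarrow> D (u i) \<in> gen_field (L \<union> u ` {..i})"
    and f: "f \<in> acl (L \<union> u ` {..<l})" "\<not> alg_over L f"
    and P: "P \<in> polyfun L n" "P (jet D f) = 0"
  shows "\<exists>Q\<in>polyfun UNIV 2. (\<exists>\<xi>. Q \<xi> \<noteq> 0) \<and> infinite {x. Q (jet D x) = 0 \<and> P (jet D x) = 0}"
proof -
  define S where "S j = L \<union> u ` {..<j}" for j :: nat
  \<comment> \<open>The number of chain members after which \<open>f\<close> first becomes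
    algebraic; it is positive because \<open>f\<close> is transcendental over
    \<open>L\<close>.\<close>
  define j where "j = (LEAST j. f \<in> acl (S j))"
  have "f \<in> acl (S l)" using f(1) by (simp add: S_def)
  then have fj: "f \<in> acl (S j)" unfolding j_def by (rule LeastI[of "\<lambda>j. f \<in> acl (S j)"])
  have jl: "j \<le> l" unfolding j_def by (rule Least_le) fact
  have "f \<notin> acl (S 0)" using f(2) L(1) by (simp add: S_def acl_field)
  then obtain i where i: "j = Suc i" using fj by (cases j) auto
  have fi: "f \<notin> acl (S i)" unfolding i using not_less_Least[of i "\<lambda>j. f \<in> acl (S j)"] i unfolding j_def by auto
  \<comment> \<open>This is the triangular form of the chain: the derivative of \<open>u m\<close>
    lies in the field generated by the members up to \<open>m\<close>, so each stage of the tower is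
    closed under \<open>D\<close>.\<close>
  have Dcl: "D x \<in> acl (S k)" if "x \<in> acl (S k)" "k \<le> l" for x k
  proof (rule acl_derivation_closed[OF D _ that(1)])
    fix y assume y: "y \<in> S k"
    show "D y \<in> acl (S k)"
    proof (cases "y \<in> L")
      case True
      then have "D y \<in> S k" using L(2) by (simp add: S_def)
      then show ?thesis using subset_acl by blast
    next
      case False
      then obtain m where m: "m < k" "y = u m" using y by (auto simp: S_def)
      have "L \<union> u ` {..m} \<subseteq> S k" using m(1) by (auto simp: S_def)
      then have "gen_field (L \<union> u ` {..m}) \<subseteq> acl (S k)"
        using gen_field_subset_acl[of "L \<union> u ` {..m}"] acl_mono by blast
      then show ?thesis using u[of m] m that(2) by auto
    qed
  qed
  \<comment> \<open>The previous stage is closed algebraically, so that \<open>f \<notin> K\<close>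
    already says that \<open>f\<close> is transcendental over \<open>K\<close>.\<close>
  define K where "K = acl (S i)"
  have K: "field_subset K" unfolding K_def by (rule field_subset_acl)
  have DK: "D x \<in> K" if "x \<in> K" for x using Dcl[of x i] that jl i by (simp add: K_def)
  have KK: "acl K = K" unfolding K_def using acl_subset[of "acl (S i)" "S i"] subset_acl[of "acl (S i)"] by auto
  have ftr: "\<not> alg_over K f" using fi KK K acl_field[OF K] by (auto simp: K_def)
  have LK: "L \<subseteq> K" using subset_acl[of "S i"] by (auto simp: K_def S_def)
  have Sj: "S j \<subseteq> insert (u i) K" using subset_acl[of "S i"] by (auto simp: K_def S_def i lessThan_Suc)
  have "u i \<in> acl (insert f K)"
    using acl_exchange[OF K _ ftr] fj acl_mono[OF Sj] by blast
  then have "insert (u i) K \<subseteq> acl (insert f K)" using subset_acl[of "insert f K"] by blast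
  then have "acl (S j) \<subseteq> acl (insert f K)" using acl_subset Sj by (meson order_trans)
  then have "D f \<in> acl (insert f K)" using Dcl[OF fj jl] by blast
  from acl_insert_clear_denominators[OF K this]
  obtain d C where C: "\<forall>k\<le>d. C k \<in> polys_over K" "\<exists>k\<le>d. poly (C k) f \<noteq> 0"
    "(\<Sum>k\<le>d. poly (C k) f * D f ^ k) = 0" by blast
  \<comment> \<open>The coefficients in \<open>K[f]\<close> become polynomials in variable 0, read
    at the jet of \<open>f\<close>.\<close>
  define a where "a k = (\<lambda>\<xi>::nat\<Rightarrow>'a. poly (C k) (\<xi> 0))" for k
  obtain k0 where k0: "k0 \<le> d" "poly (C k0) f \<noteq> 0" using C(2) by blast
  have "\<exists>Q\<in>polyfun K 2. (\<exists>\<xi>. Q \<xi> \<noteq> 0) \<and> infinite {x. Q (jet D x) = 0 \<and> P (jet D x) = 0}"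
  proof (rule infinite_common_solutions[OF D K DK blum])
    fix \<phi> \<xi> assume \<phi>: "\<phi> \<in> polyfun K 1" "\<phi> (jet D f) = 0"
    obtain p where p: "p \<in> polys_over K" "\<And>\<xi>. \<phi> \<xi> = poly p (\<xi> 0)" using polyfun_1_poly[OF K \<phi>(1)] by blast
    have "p = 0"
    proof (rule ccontr)
      assume "p \<noteq> 0"
      then have "\<exists>k\<le>Polynomial.degree p. Polynomial.coeff p k \<noteq> 0" by force
      then have "alg_over K f" unfolding alg_over_def
        using p \<phi>(2)
        by (intro exI[of _ "Polynomial.degree p"] exI[of _ "Polynomial.coeff p"])
           (auto simp: polys_over_def poly_altdef jet_simps)
      then show False using ftr by simp
    qed
    then show "\<phi> \<xi> = 0" using p by simp
  next
    show "coef_funs K 1 d a" unfolding coef_funs_def a_def using C(1) poly_polyfun_1[OF K] by blast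
    show "upoly 1 d a (jet D f) = 0" using C(3) by (simp add: upoly_def a_def jet_simps)
    show "k0 \<le> d" by fact
    show "a k0 (jet D f) \<noteq> 0" using k0 by (simp add: a_def jet_simps)
    show "P \<in> polyfun K n" using P(1) LK by (auto intro: polyfun_mono)
    show "P (jet D f) = 0" by fact
  qed
  then show ?thesis by (meson polyfun_mono subset_UNIV order_refl)
qed

section \<open>Picard iteration\<close>

lemma primitive_ball:
  assumes "g holomorphic_on ball z0 r"
  shows "\<exists>p. p z0 = 0 \<and> (\<forall>z\<in>ball z0 r. (p has_field_derivative g z) (at z))"
proof -
  obtain p where p: "\<And>z. z \<in> ball z0 r \<Longrightarrow> (p has_field_derivative g z) (at z within ball z0 r)"
    using holomorphic_convex_primitive'[OF convex_ball open_ball assms] by blast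
  have "((\<lambda>z. p z - p z0) has_field_derivative g z) (at z)" if "z \<in> ball z0 r" for z
    using p[OF that] that by (auto intro!: derivative_eq_intros simp: at_within_open[OF _ open_ball])
  then show ?thesis by (intro exI[of _ "\<lambda>z. p z - p z0"]) auto
qed

text \<open>Picard iteration on a disc so small that the integral operator contracts by a factor of 2.\<close>

theorem holomorphic_picard:
  fixes G :: "nat \<Rightarrow> complex \<Rightarrow> (nat \<Rightarrow> complex) \<Rightarrow> complex"
  assumes r0: "r0 > 0" and \<rho>: "\<rho> > 0"
    and bdd: "\<And>i z w. i \<le> n \<Longrightarrow> z \<in> ball z0 r0 \<Longrightarrow> (\<forall>j\<le>n. cmod (w j - c j) \<le> \<rho>) \<Longrightarrow> cmod (G i z w) \<le> Mb"
    and lip: "\<And>i z w v \<delta>. i \<le> n \<Longrightarrow> z \<in> ball z0 r0 \<Longrightarrow> (\<forall>j\<le>n. cmod (w j - c j) \<le> \<rho>) \<Longrightarrow>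
        (\<forall>j\<le>n. cmod (v j - c j) \<le> \<rho>) \<Longrightarrow> (\<forall>j\<le>n. cmod (w j - v j) \<le> \<delta>) \<Longrightarrow>
        cmod (G i z w - G i z v) \<le> L * \<delta>"
    and hol: "\<And>i r x. i \<le> n \<Longrightarrow> 0 < r \<Longrightarrow> r \<le> r0 \<Longrightarrow> (\<forall>j\<le>n. x j holomorphic_on ball z0 r) \<Longrightarrow>
        (\<forall>j\<le>n. \<forall>z\<in>ball z0 r. cmod (x j z - c j) \<le> \<rho>) \<Longrightarrow>
        (\<lambda>z. G i z (\<lambda>j. x j z)) holomorphic_on ball z0 r"
  shows "\<exists>r x. 0 < r \<and> r \<le> r0 \<and> (\<forall>i\<le>n. x i z0 = c i \<and>
           (\<forall>z\<in>ball z0 r. cmod (x i z - c i) \<le> \<rho>) \<and>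
           (\<forall>z\<in>ball z0 r. (x i has_field_derivative G i z (\<lambda>j. x j z)) (at z)))"
proof -
  \<comment> \<open>The maximum with 1 makes \<open>M\<close> and \<open>L'\<close> positive. In the
    radius, \<open>\<rho> / M\<close> keeps all iterates within distance \<rho> of the initial
    values, and \<open>1 / (2 * L')\<close> yields the contraction.\<close>
  define M where "M = max Mb 1"
  define L' where "L' = max L 1"
  define r where "r = min r0 (min (\<rho> / M) (1 / (2 * L')))"
  have M: "M \<ge> 1" "Mb \<le> M" and L': "L' \<ge> 1" "L \<le> L'" by (auto simp: M_def L'_def)
  have r: "r > 0" "r \<le> r0" "r \<le> \<rho> / M" "r \<le> 1 / (2 * L')" using r0 \<rho> M L' by (auto simp: r_def)
  have Mr: "M * r \<le> \<rho>" using r(3) M by (simp add: field_simps)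
  have Lr: "L' * r \<le> 1 / 2" using r(4) L' by (simp add: field_simps)
  let ?B = "ball z0 r"
  have Bsub: "?B \<subseteq> ball z0 r0" using r by (simp add: subset_ball)
  define prim where "prim g = (SOME p. p z0 = 0 \<and> (\<forall>z\<in>?B. (p has_field_derivative g z) (at z)))" for g
  have prim: "prim g z0 = 0" "\<And>z. z \<in> ?B \<Longrightarrow> (prim g has_field_derivative g z) (at z)"
    if "g holomorphic_on ?B" for g
    using someI_ex[OF primitive_ball[OF that]] unfolding prim_def by blast+
  have prim_hol: "prim g holomorphic_on ?B" if "g holomorphic_on ?B" for g
    using prim(2)[OF that] unfolding holomorphic_on_open[OF open_ball] by blast
  have prim_diff: "cmod (prim g z - prim h z) \<le> K * r"
    if gh: "g holomorphic_on ?B" "h holomorphic_on ?B" "\<And>z. z \<in> ?B \<Longrightarrow> cmod (g z - h z) \<le> K" "z \<in> ?B" "0 \<le> K"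
    for g h z K
  proof -
    have "cmod ((prim g z - prim h z) - (prim g z0 - prim h z0)) \<le> K * cmod (z - z0)"
    proof (rule field_differentiable_bound[where S = ?B and f = "\<lambda>z. prim g z - prim h z" and f' = "\<lambda>z. g z - h z"])
      fix w assume w: "w \<in> ?B"
      show "((\<lambda>z. prim g z - prim h z) has_field_derivative g w - h w) (at w within ?B)"
        using prim(2)[OF gh(1) w] prim(2)[OF gh(2) w]
        by (auto intro!: derivative_eq_intros intro: has_field_derivative_at_within)
      show "cmod (g w - h w) \<le> K" using gh(3) w .
    qed (use r gh in auto)
    then have "cmod (prim g z - prim h z) \<le> K * cmod (z - z0)"
      using prim(1)[OF gh(1)] prim(1)[OF gh(2)] by simp
    also have "\<dots> \<le> K * r" using gh(4,5) by (intro mult_left_mono) (auto simp: dist_norm norm_minus_commute)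
    finally show ?thesis .
  qed
  have prim_bound: "cmod (prim g z) \<le> K * r"
    if gh: "g holomorphic_on ?B" "\<And>z. z \<in> ?B \<Longrightarrow> cmod (g z) \<le> K" "z \<in> ?B" "0 \<le> K" for g z K
  proof -
    have "cmod (prim g z - prim g z0) \<le> K * cmod (z - z0)"
      using r gh by (intro field_differentiable_bound[where S = ?B and f' = g])
         (auto intro: has_field_derivative_at_within[OF prim(2)[OF gh(1)]])
    also have "\<dots> \<le> K * r" using gh(3,4) by (intro mult_left_mono) (auto simp: dist_norm norm_minus_commute)
    finally show ?thesis using prim(1)[OF gh(1)] by simp
  qed
  define \<phi> where "\<phi> = rec_nat (\<lambda>i z. c i) (\<lambda>k x i z. c i + prim (\<lambda>z. G i z (\<lambda>j. x j z)) z)"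
  have \<phi>0: "\<phi> 0 = (\<lambda>i z. c i)" and \<phi>S: "\<phi> (Suc k) = (\<lambda>i z. c i + prim (\<lambda>z. G i z (\<lambda>j. \<phi> k j z)) z)" for k
    by (simp_all add: \<phi>_def)
  define good where "good x \<longleftrightarrow> (\<forall>i\<le>n. x i holomorphic_on ?B \<and> (\<forall>z\<in>?B. cmod (x i z - c i) \<le> \<rho>))" for x
  have Ghol: "(\<lambda>z. G i z (\<lambda>j. x j z)) holomorphic_on ?B" if "good x" "i \<le> n" for x i
    using that r by (intro hol) (auto simp: good_def)
  have Gbdd: "cmod (G i z (\<lambda>j. x j z)) \<le> M" if "good x" "i \<le> n" "z \<in> ?B" for x i z
    using bdd[of i z "\<lambda>j. x j z"] that M Bsub by (force simp: good_def)
  have Glip: "cmod (G i z (\<lambda>j. x j z) - G i z (\<lambda>j. y j z)) \<le> L' * \<delta>"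
    if "good x" "good y" "i \<le> n" "z \<in> ?B" "\<And>j. j \<le> n \<Longrightarrow> cmod (x j z - y j z) \<le> \<delta>" "0 \<le> \<delta>" for x y i z \<delta>
  proof -
    have "cmod (G i z (\<lambda>j. x j z) - G i z (\<lambda>j. y j z)) \<le> L * \<delta>"
      using that Bsub by (intro lip) (auto simp: good_def)
    also have "\<dots> \<le> L' * \<delta>" using L'(2) that(6) by (rule mult_right_mono)
    finally show ?thesis .
  qed
  have good\<phi>: "good (\<phi> k)" for k
  proof (induction k)
    case 0 then show ?case using \<rho> by (auto simp: good_def \<phi>0)
  next
    case (Suc k)
    have "cmod (\<phi> (Suc k) i z - c i) \<le> \<rho>" if "i \<le> n" "z \<in> ?B" for i z
      using prim_bound[OF Ghol[OF Suc that(1)] Gbdd[OF Suc that(1)] that(2)] M Mr by (simp add: \<phi>S)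
    moreover have "\<phi> (Suc k) i holomorphic_on ?B" if "i \<le> n" for i
      unfolding \<phi>S by (intro holomorphic_intros prim_hol Ghol Suc that)
    ultimately show ?case by (auto simp: good_def)
  qed
  have step: "cmod (\<phi> (Suc k) i z - \<phi> k i z) \<le> \<rho> * (1 / 2) ^ k" if "i \<le> n" "z \<in> ?B" for i z k
    using that
  proof (induction k arbitrary: i z)
    case 0
    then show ?case using good\<phi>[of 1] by (auto simp: good_def \<phi>0)
  next
    case (Suc k)
    have "cmod (\<phi> (Suc (Suc k)) i z - \<phi> (Suc k) i z) \<le> (L' * (\<rho> * (1 / 2) ^ k)) * r"
    proof -
      have "cmod (prim (\<lambda>z. G i z (\<lambda>j. \<phi> (Suc k) j z)) z - prim (\<lambda>z. G i z (\<lambda>j. \<phi> k j z)) z) \<le> (L' * (\<rho> * (1 / 2) ^ k)) * r"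
        using Suc \<rho> L' by (intro prim_diff Ghol Glip good\<phi>) auto
      then show ?thesis by (simp only: \<phi>S add_diff_cancel_left)
    qed
    also have "\<dots> = (L' * r) * (\<rho> * (1 / 2) ^ k)" by (simp add: mult_ac)
    also have "\<dots> \<le> (1 / 2) * (\<rho> * (1 / 2) ^ k)" using Lr \<rho> by (intro mult_right_mono) auto
    finally show ?case by simp
  qed
  \<comment> \<open>The limit is written as a telescoping series with geometric majorant, so that
    the Weierstrass test gives uniform convergence.\<close>
  define x where "x i z = c i + suminf (\<lambda>m. \<phi> (Suc m) i z - \<phi> m i z)" for i z
  have ulim: "uniform_limit ?B (\<lambda>k. \<phi> k i) (x i) sequentially" if "i \<le> n" for i
  proof -
    have "uniform_limit ?B (\<lambda>k z. \<Sum>m<k. \<phi> (Suc m) i z - \<phi> m i z) (\<lambda>z. suminf (\<lambda>m. \<phi> (Suc m) i z - \<phi> m i z)) sequentially"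
      by (rule Weierstrass_m_test[of _ _ "\<lambda>m. \<rho> * (1 / 2) ^ m"])
         (use step that in \<open>auto intro!: summable_mult summable_geometric\<close>)
    then have "uniform_limit ?B (\<lambda>k z. c i + (\<Sum>m<k. \<phi> (Suc m) i z - \<phi> m i z)) (x i) sequentially"
      unfolding x_def by (intro uniform_limit_intros)
    moreover have "c i + (\<Sum>m<k. \<phi> (Suc m) i z - \<phi> m i z) = \<phi> k i z" for k z
      by (subst sum_lessThan_telescope) (simp add: \<phi>0)
    ultimately show ?thesis by simp
  qed
  have lim: "(\<lambda>k. \<phi> k i z) \<longlonglongrightarrow> x i z" if "i \<le> n" "z \<in> ?B" for i z
    using tendsto_uniform_limitI[OF ulim[OF that(1)] that(2)] .
  have goodx: "good x"
    unfolding good_def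
  proof (intro allI impI conjI ballI)
    fix i assume i: "i \<le> n"
    show "x i holomorphic_on ?B"
    proof (rule holomorphic_uniform_sequence[of _ "\<lambda>k. \<phi> k i"])
      show "\<phi> k i holomorphic_on ?B" for k using good\<phi>[of k] i by (auto simp: good_def)
      fix z assume "z \<in> ?B"
      then obtain d where "d > 0" "cball z d \<subseteq> ?B" using open_ball open_contains_cball by blast
      then show "\<exists>d>0. cball z d \<subseteq> ?B \<and> uniform_limit (cball z d) (\<lambda>k. \<phi> k i) (x i) sequentially"
        using uniform_limit_on_subset[OF ulim[OF i]] by blast
    qed auto
    fix z assume z: "z \<in> ?B"
    have "(\<lambda>k. cmod (\<phi> k i z - c i)) \<longlonglongrightarrow> cmod (x i z - c i)"
      by (intro tendsto_intros lim i z)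
    then show "cmod (x i z - c i) \<le> \<rho>"
      by (rule Lim_bounded[where M = 0]) (use good\<phi> i z in \<open>auto simp: good_def\<close>)
  qed
  \<comment> \<open>Both sides are limits of the same sequence of iterates: the left by
    construction, the right because the integral operator is Lipschitz and the iterates converge
    uniformly.\<close>
  have fix_eq: "x i z = c i + prim (\<lambda>z. G i z (\<lambda>j. x j z)) z" if iz: "i \<le> n" "z \<in> ?B" for i z
  proof -
    have "(\<lambda>k. \<phi> (Suc k) i z) \<longlonglongrightarrow> c i + prim (\<lambda>z. G i z (\<lambda>j. x j z)) z"
    proof (rule LIMSEQ_I)
      fix e :: real assume e: "e > 0"
      have "\<forall>i\<in>{..n}. eventually (\<lambda>k. \<forall>z\<in>?B. dist (\<phi> k i z) (x i z) < e) sequentially"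
        using ulim e by (auto simp: uniform_limit_iff)
      then have "eventually (\<lambda>k. \<forall>i\<in>{..n}. \<forall>z\<in>?B. dist (\<phi> k i z) (x i z) < e) sequentially"
        by (intro eventually_ball_finite) auto
      then obtain N where N: "\<And>k i z. k \<ge> N \<Longrightarrow> i \<le> n \<Longrightarrow> z \<in> ?B \<Longrightarrow> dist (\<phi> k i z) (x i z) < e"
        unfolding eventually_sequentially by (meson atMost_iff)
      have "cmod (\<phi> (Suc k) i z - (c i + prim (\<lambda>z. G i z (\<lambda>j. x j z)) z)) < e" if k: "k \<ge> N" for k
      proof -
        have "cmod (prim (\<lambda>z. G i z (\<lambda>j. \<phi> k j z)) z - prim (\<lambda>z. G i z (\<lambda>j. x j z)) z) \<le> (L' * e) * r"
        proof (rule prim_diff)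
          fix w assume w: "w \<in> ?B"
          show "cmod (G i w (\<lambda>j. \<phi> k j w) - G i w (\<lambda>j. x j w)) \<le> L' * e"
            by (rule Glip[OF good\<phi> goodx iz(1) w]) (use N[OF k _ w] e in \<open>auto simp: dist_norm less_imp_le\<close>)
        qed (use Ghol good\<phi> goodx iz e L' in auto)
        also have "\<dots> = (L' * r) * e" by simp
        also have "\<dots> \<le> (1 / 2) * e" using Lr e by (intro mult_right_mono) auto
        also have "\<dots> < e" using e by simp
        finally show ?thesis by (simp only: \<phi>S add_diff_cancel_left)
      qed
      then show "\<exists>N. \<forall>k\<ge>N. cmod (\<phi> (Suc k) i z - (c i + prim (\<lambda>z. G i z (\<lambda>j. x j z)) z)) < e" by blast
    qed
    moreover have "(\<lambda>k. \<phi> (Suc k) i z) \<longlonglongrightarrow> x i z"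
      using lim[OF iz] by (rule LIMSEQ_Suc)
    ultimately show ?thesis using LIMSEQ_unique by blast
  qed
  have "x i z0 = c i \<and> (\<forall>z\<in>?B. cmod (x i z - c i) \<le> \<rho>) \<and> (\<forall>z\<in>?B. (x i has_field_derivative G i z (\<lambda>j. x j z)) (at z))" if i: "i \<le> n" for i
  proof (intro conjI)
    show "\<forall>z\<in>?B. cmod (x i z - c i) \<le> \<rho>" using goodx i by (simp add: good_def)
    show "x i z0 = c i" using fix_eq[OF i, of z0] prim(1)[OF Ghol[OF goodx i]] r by simp
    show "\<forall>z\<in>?B. (x i has_field_derivative G i z (\<lambda>j. x j z)) (at z)"
    proof
      fix z assume z: "z \<in> ?B"
      have "((\<lambda>z. c i + prim (\<lambda>z. G i z (\<lambda>j. x j z)) z) has_field_derivative G i z (\<lambda>j. x j z)) (at z)"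
        using prim(2)[OF Ghol[OF goodx i] z] by (auto intro!: derivative_eq_intros)
      then show "(x i has_field_derivative G i z (\<lambda>j. x j z)) (at z)"
        by (rule has_field_derivative_transform_within_open[OF _ open_ball z]) (use fix_eq[OF i] in simp)
    qed
  qed
  then show ?thesis using r(1,2) by blast
qed

section \<open>Germs along a generic filter\<close>

definition open_filter :: "complex set set \<Rightarrow> bool" where
  "open_filter F \<longleftrightarrow> (\<forall>U\<in>F. open U \<and> U \<noteq> {}) \<and> (\<forall>U\<in>F. \<forall>V\<in>F. U \<inter> V \<in> F) \<and>
     (\<forall>U\<in>F. \<forall>V. open V \<longrightarrow> U \<subseteq> V \<longrightarrow> V \<in> F)"

lemma open_filterD:
  assumes "open_filter F"
  shows "U \<in> F \<Longrightarrow> open U" "U \<in> F \<Longrightarrow> U \<noteq> {}" "U \<in> F \<Longrightarrow> V \<in> F \<Longrightarrow> U \<inter> V \<in> F"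
    "U \<in> F \<Longrightarrow> open V \<Longrightarrow> U \<subseteq> V \<Longrightarrow> V \<in> F"
  using assms unfolding open_filter_def by blast+

text \<open>Zorn's lemma, started at the open supersets of the unit disc. A maximal filter decides
  every open set: one that meets all members can be adjoined and is therefore a member
  already.\<close>

lemma maximal_open_filter:
  "\<exists>F. open_filter F \<and> ball 0 1 \<in> F \<and> (\<forall>U. open U \<longrightarrow> U \<in> F \<or> (\<exists>V\<in>F. U \<inter> V = {}))"
proof -
  define A where "A = {F. open_filter F \<and> ball 0 1 \<in> F}"
  have "open_filter {U. open U \<and> ball 0 1 \<subseteq> U}"
    unfolding open_filter_def
  proof (intro conjI ballI allI impI)
    fix U :: "complex set" assume U: "U \<in> {U. open U \<and> ball 0 1 \<subseteq> U}"
    then show "open U" by simp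
    have "0 \<in> ball 0 (1::real)" by simp
    with U show "U \<noteq> {}" by fastforce
    show "U \<inter> V \<in> {U. open U \<and> ball 0 1 \<subseteq> U}" if "V \<in> {U. open U \<and> ball 0 1 \<subseteq> U}" for V
      using U that by (simp add: open_Int)
    show "V \<in> {U. open U \<and> ball 0 1 \<subseteq> U}" if "open V" "U \<subseteq> V" for V
      using U that by (simp add: order_trans[OF _ that(2)])
  qed
  then have "{U. open U \<and> ball 0 1 \<subseteq> U} \<in> A" by (simp add: A_def)
  then have ne: "A \<noteq> {}" by blast
  have chain: "\<Union>C \<in> A" if C: "C \<noteq> {}" "subset.chain A C" for C
  proof -
    have sub: "C \<subseteq> A" and ch: "\<And>F G. F \<in> C \<Longrightarrow> G \<in> C \<Longrightarrow> F \<subseteq> G \<or> G \<subseteq> F"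
      using C(2) unfolding subset_chain_def by simp_all
    have u1: "U \<inter> V \<in> \<Union>C" if UV: "U \<in> \<Union>C" "V \<in> \<Union>C" for U V
    proof -
      obtain F G where FG: "F \<in> C" "U \<in> F" "G \<in> C" "V \<in> G" using UV by blast
      then have "\<exists>H\<in>C. U \<in> H \<and> V \<in> H" using ch[OF FG(1,3)] by blast
      then obtain H where H: "H \<in> C" "U \<in> H" "V \<in> H" by blast
      then have "open_filter H" using sub unfolding A_def by blast
      then have "U \<inter> V \<in> H" using H(2,3) by (rule open_filterD)
      then show ?thesis using H(1) by blast
    qed
    have u2: "open U \<and> U \<noteq> {}" if UC: "U \<in> \<Union>C" for U
    proof -
      obtain F where F: "F \<in> C" "U \<in> F" using UC by blast
      then have "open_filter F" using sub unfolding A_def by blast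
      then show ?thesis using F(2) open_filterD(1,2) by blast
    qed
    have u3: "V \<in> \<Union>C" if UV: "U \<in> \<Union>C" "open V" "U \<subseteq> V" for U V
    proof -
      obtain F where F: "F \<in> C" "U \<in> F" using UV by blast
      then have "open_filter F" using sub unfolding A_def by blast
      then have "V \<in> F" using F(2) UV(2,3) by (rule open_filterD)
      then show ?thesis using F(1) by blast
    qed
    have "open_filter (\<Union>C)" unfolding open_filter_def
    proof (intro conjI ballI allI impI)
      fix U assume U: "U \<in> \<Union>C"
      show "open U" "U \<noteq> {}" using u2[OF U] by simp_all
      show "U \<inter> V \<in> \<Union>C" if "V \<in> \<Union>C" for V using u1[OF U that] .
      show "V \<in> \<Union>C" if "open V" "U \<subseteq> V" for V using u3[OF U that] .
    qed
    moreover have "ball 0 1 \<in> \<Union>C" using C(1) sub unfolding A_def by blast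
    ultimately show ?thesis by (simp add: A_def)
  qed
  obtain F where "F \<in> A" "\<forall>G\<in>A. F \<subseteq> G \<longrightarrow> G = F"
    using subset_Zorn_nonempty[OF ne chain] by (rule bexE)
  then have F: "F \<in> A" "\<And>G. G \<in> A \<Longrightarrow> F \<subseteq> G \<Longrightarrow> G = F" by simp_all
  have filt: "open_filter F" and b: "ball 0 1 \<in> F" using F(1) unfolding A_def by simp_all
  have "U \<in> F \<or> (\<exists>V\<in>F. U \<inter> V = {})" if "open U" for U
  proof (rule ccontr)
    assume *: "\<not> ?thesis"
    \<comment> \<open>The filter generated by \<open>F\<close> and \<open>U\<close>; it is proper
      because \<open>U\<close> is assumed to meet every member of \<open>F\<close>.\<close>
    define G where "G = {W. open W \<and> (\<exists>V\<in>F. U \<inter> V \<subseteq> W)}"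
    have FG: "F \<subseteq> G"
    proof
      fix W assume "W \<in> F"
      moreover from this have "open W" using filt open_filterD(1) by blast
      ultimately show "W \<in> G" unfolding G_def by blast
    qed
    have "open_filter G"
      unfolding open_filter_def
    proof (intro conjI ballI allI impI)
      fix W assume W: "W \<in> G"
      then show "open W" by (simp add: G_def)
      obtain V where "V \<in> F" "U \<inter> V \<subseteq> W" using W by (auto simp: G_def)
      moreover have "U \<inter> V \<noteq> {}" using * \<open>V \<in> F\<close> by simp
      ultimately show "W \<noteq> {}" by (metis subset_empty)
    next
      fix W W' assume "W \<in> G" "W' \<in> G"
      then obtain V V' where V: "V \<in> F" "U \<inter> V \<subseteq> W" "V' \<in> F" "U \<inter> V' \<subseteq> W'" "open W" "open W'"
        by (auto simp: G_def)
      have "V \<inter> V' \<in> F" using filt V(1,3) by (rule open_filterD)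
      moreover have "U \<inter> (V \<inter> V') \<subseteq> W \<inter> W'" using V(2,4) by blast
      moreover have "open (W \<inter> W')" using V(5,6) by (rule open_Int)
      ultimately have "open (W \<inter> W') \<and> (\<exists>V\<in>F. U \<inter> V \<subseteq> W \<inter> W')" by (intro conjI bexI)
      then show "W \<inter> W' \<in> G" unfolding G_def by (rule CollectI)
    next
      fix W W' assume "W \<in> G" "open W'" "W \<subseteq> W'"
      moreover from this obtain V where "V \<in> F" "U \<inter> V \<subseteq> W" unfolding G_def by blast
      ultimately have "open W' \<and> (\<exists>V\<in>F. U \<inter> V \<subseteq> W')" by (intro conjI bexI[of _ V]) simp_all
      then show "W' \<in> G" unfolding G_def by (rule CollectI)
    qed
    moreover have "ball 0 1 \<in> G" using b FG by blast
    ultimately have "G = F" using F(2)[of G] FG by (simp add: A_def)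
    moreover have "U \<in> G" unfolding G_def by (intro CollectI conjI that bexI[OF _ b]) simp
    ultimately show False using * by simp
  qed
  then show ?thesis using filt b by blast
qed

text \<open>One such filter, fixed once and for all. As it contains the unit disc, any disc of the
  plane can be studied along it after rescaling.\<close>

definition generic :: "complex set set" where
  "generic = (SOME F. open_filter F \<and> ball 0 1 \<in> F \<and> (\<forall>U. open U \<longrightarrow> U \<in> F \<or> (\<exists>V\<in>F. U \<inter> V = {})))"

lemma generic_filter: "open_filter generic"
  and generic_ball: "ball 0 1 \<in> generic"
  and generic_maximal: "open U \<Longrightarrow> U \<notin> generic \<Longrightarrow> \<exists>V\<in>generic. U \<inter> V = {}"
proof -
  have *: "open_filter generic \<and> ball 0 1 \<in> generic \<and> (\<forall>U. open U \<longrightarrow> U \<in> generic \<or> (\<exists>V\<in>generic. U \<inter> V = {}))"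
    unfolding generic_def by (rule someI_ex[OF maximal_open_filter])
  show "open_filter generic" "ball 0 1 \<in> generic" using * by simp_all
  show "open U \<Longrightarrow> U \<notin> generic \<Longrightarrow> \<exists>V\<in>generic. U \<inter> V = {}" using * by blast
qed

lemma generic_open: "U \<in> generic \<Longrightarrow> open U"
  and generic_nonempty: "U \<in> generic \<Longrightarrow> U \<noteq> {}"
  and generic_Int: "U \<in> generic \<Longrightarrow> V \<in> generic \<Longrightarrow> U \<inter> V \<in> generic"
  using open_filterD[OF generic_filter] by blast+

text \<open>If \<open>D\<close> were missing, it would be disjoint from some member
  \<open>V\<close>, but it meets the nonempty open set \<open>U \<inter> V\<close>. In this way
  constructions that succeed on dense open sets enter the field of germs.\<close>

lemma generic_dense:
  assumes U: "U \<in> generic" and D: "open D" "\<And>W. open W \<Longrightarrow> W \<noteq> {} \<Longrightarrow> W \<subseteq> U \<Longrightarrow> W \<inter> D \<noteq> {}"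
  shows "D \<in> generic"
proof (rule ccontr)
  assume "D \<notin> generic"
  then obtain V where V: "V \<in> generic" "D \<inter> V = {}" using generic_maximal D(1) by blast
  have "U \<inter> V \<in> generic" using U V(1) by (rule generic_Int)
  then show False using D(2)[of "U \<inter> V"] generic_open generic_nonempty V(2) by blast
qed

text \<open>Holomorphy is part of the relation, which is therefore a partial equivalence: the
  functions related to themselves are those holomorphic on some member.\<close>

definition germ_rel :: "(complex \<Rightarrow> complex) \<Rightarrow> (complex \<Rightarrow> complex) \<Rightarrow> bool" where
  "germ_rel f g \<longleftrightarrow> (\<exists>U\<in>generic. f holomorphic_on U \<and> g holomorphic_on U \<and> (\<forall>z\<in>U. f z = g z))"

abbreviation germ_fun :: "(complex \<Rightarrow> complex) \<Rightarrow> bool" where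
  "germ_fun f \<equiv> germ_rel f f"

lemma germ_fun_def: "germ_fun f \<longleftrightarrow> (\<exists>U\<in>generic. f holomorphic_on U)"
  by (auto simp: germ_rel_def)

lemma germ_rel_sym: "germ_rel f g \<Longrightarrow> germ_rel g f"
  unfolding germ_rel_def by (metis (no_types, lifting))

lemma germ_rel_trans: "germ_rel f g \<Longrightarrow> germ_rel g h \<Longrightarrow> germ_rel f h"
proof -
  assume "germ_rel f g" "germ_rel g h"
  then obtain U V where *: "U \<in> generic" "f holomorphic_on U" "\<forall>z\<in>U. f z = g z"
    "V \<in> generic" "h holomorphic_on V" "\<forall>z\<in>V. g z = h z" unfolding germ_rel_def by blast
  have "f holomorphic_on U \<inter> V" by (rule holomorphic_on_subset[OF *(2)]) simp
  moreover have "h holomorphic_on U \<inter> V" by (rule holomorphic_on_subset[OF *(5)]) simp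
  ultimately show "germ_rel f h" unfolding germ_rel_def using * generic_Int
    by (intro bexI[of _ "U \<inter> V"]) auto
qed

lemma germ_rel_common:
  assumes "germ_rel f g" "germ_rel f' g'"
  obtains U where "U \<in> generic" "f holomorphic_on U" "g holomorphic_on U" "\<forall>z\<in>U. f z = g z"
    "f' holomorphic_on U" "g' holomorphic_on U" "\<forall>z\<in>U. f' z = g' z"
proof -
  obtain U V where *: "U \<in> generic" "f holomorphic_on U" "g holomorphic_on U" "\<forall>z\<in>U. f z = g z"
    "V \<in> generic" "f' holomorphic_on V" "g' holomorphic_on V" "\<forall>z\<in>V. f' z = g' z"
    using assms unfolding germ_rel_def by blast
  show thesis
    by (rule that[of "U \<inter> V"]) (use * generic_Int in \<open>auto elim: holomorphic_on_subset\<close>)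
qed

quotient_type gfun = "complex \<Rightarrow> complex" / partial: germ_rel
proof (rule part_equivpI)
  show "\<exists>f. germ_rel f f"
    using generic_ball by (intro exI[of _ "\<lambda>_. 0"]) (auto simp: germ_rel_def)
  show "symp germ_rel" using germ_rel_sym by (auto intro: sympI)
  show "transp germ_rel" using germ_rel_trans by (auto intro: transpI)
qed

lemma germ_rel_const: "germ_rel (\<lambda>_. c) (\<lambda>_. c)"
  unfolding germ_rel_def by (rule bexI[OF _ generic_ball]) simp

lemma germ_rel_add: "germ_rel f g \<Longrightarrow> germ_rel f' g' \<Longrightarrow> germ_rel (\<lambda>z. f z + f' z) (\<lambda>z. g z + g' z)"
  by (erule (1) germ_rel_common) (unfold germ_rel_def, auto intro!: bexI holomorphic_intros)

lemma germ_rel_mult: "germ_rel f g \<Longrightarrow> germ_rel f' g' \<Longrightarrow> germ_rel (\<lambda>z. f z * f' z) (\<lambda>z. g z * g' z)"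
  by (erule (1) germ_rel_common) (unfold germ_rel_def, auto intro!: bexI holomorphic_intros)

lemma germ_rel_minus: "germ_rel f g \<Longrightarrow> germ_rel (\<lambda>z. - f z) (\<lambda>z. - g z)"
  unfolding germ_rel_def by (auto intro!: bexI holomorphic_intros)

lemma germ_rel_deriv: "germ_rel f g \<Longrightarrow> germ_rel (deriv f) (deriv g)"
proof -
  assume "germ_rel f g"
  then obtain U where U: "U \<in> generic" "f holomorphic_on U" "g holomorphic_on U" "\<forall>z\<in>U. f z = g z"
    unfolding germ_rel_def by blast
  have "deriv f z = deriv g z" if z: "z \<in> U" for z
  proof (rule deriv_cong_ev)
    show "\<forall>\<^sub>F x in nhds z. f x = g x"
      using U z generic_open[OF U(1)] by (auto simp: eventually_nhds)
  qed simp
  then show ?thesis unfolding germ_rel_def using U generic_open[OF U(1)]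
    by (intro bexI[of _ U]) (auto intro: holomorphic_deriv)
qed

text \<open>
  A function on \<open>U\<close> is nonzero on an open set and zero on the interior of its zero set, and the
  union of the two is dense in \<open>U\<close>.
\<close>

lemma germ_dichotomy:
  assumes "germ_fun f"
  shows "\<exists>U\<in>generic. f holomorphic_on U \<and> (\<exists>Z N. open Z \<and> open N \<and> U = Z \<union> N \<and>
           (\<forall>z\<in>Z. f z = 0) \<and> (\<forall>z\<in>N. f z \<noteq> 0))"
proof -
  obtain U where U: "U \<in> generic" "f holomorphic_on U" using assms by (auto simp: germ_fun_def)
  note oU = generic_open[OF U(1)]
  define N where "N = {z\<in>U. f z \<noteq> 0}"
  define Z where "Z = interior {z\<in>U. f z = 0}"
  have oN: "open N"
  proof -
    have "N = U \<inter> f -` (- {0})" by (auto simp: N_def)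
    then show ?thesis
      using continuous_open_preimage[OF holomorphic_on_imp_continuous_on[OF U(2)] oU, of "- {0}"] by auto
  qed
  have "Z \<union> N \<in> generic"
  proof (rule generic_dense[OF U(1)])
    show "open (Z \<union> N)" using oN by (auto simp: Z_def)
    fix W assume W: "open W" "W \<noteq> {}" "W \<subseteq> U"
    show "W \<inter> (Z \<union> N) \<noteq> {}"
    proof
      assume e: "W \<inter> (Z \<union> N) = {}"
      then have "W \<subseteq> {z\<in>U. f z = 0}" using W(3) by (auto simp: N_def)
      then have "W \<subseteq> Z" unfolding Z_def using W(1) by (rule interior_maximal)
      then show False using e W(2) by blast
    qed
  qed
  moreover have Zsub: "Z \<subseteq> {z\<in>U. f z = 0}" unfolding Z_def by (rule interior_subset)
  then have "f holomorphic_on Z \<union> N"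
    by (intro holomorphic_on_subset[OF U(2)]) (auto simp: N_def)
  moreover have "open Z" "\<forall>z\<in>Z. f z = 0" "\<forall>z\<in>N. f z \<noteq> 0" using Zsub by (auto simp: Z_def N_def)
  ultimately show ?thesis using oN by (intro bexI[of _ "Z \<union> N"] conjI exI[of _ Z] exI[of _ N]) simp_all
qed

text \<open>On \<open>Z\<close> the inverse is constantly \<open>inverse 0 = 0\<close>, on
  \<open>N\<close> it is a true reciprocal. Both sets are open, so holomorphy on each of them is
  enough.\<close>

lemma germ_fun_inverse:
  assumes "germ_fun f"
  shows "germ_fun (\<lambda>z. inverse (f z))"
proof -
  obtain Z N where *: "Z \<union> N \<in> generic" "f holomorphic_on Z \<union> N" "open Z" "open N"
    "\<forall>z\<in>Z. f z = 0" "\<forall>z\<in>N. f z \<noteq> 0" using germ_dichotomy[OF assms] by blast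
  have "(\<lambda>z. inverse (f z)) holomorphic_on N"
    using *(6) by (intro holomorphic_intros holomorphic_on_subset[OF *(2)]) auto
  moreover have "(\<lambda>z. inverse (f z)) holomorphic_on Z"
    by (rule holomorphic_transform[of "\<lambda>_. 0"]) (use *(5) in auto)
  ultimately have "(\<lambda>z. inverse (f z)) holomorphic_on Z \<union> N"
    using *(3,4) by (intro holomorphic_on_Un) auto
  then show ?thesis unfolding germ_fun_def using *(1) by blast
qed

lemma germ_rel_inverse:
  assumes "germ_rel f g"
  shows "germ_rel (\<lambda>z. inverse (f z)) (\<lambda>z. inverse (g z))"
proof -
  have fg: "germ_fun f" "germ_fun g" using assms germ_rel_sym germ_rel_trans by blast+
  obtain U where U: "U \<in> generic" "(\<lambda>z. inverse (f z)) holomorphic_on U" "(\<lambda>z. inverse (g z)) holomorphic_on U"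
    using germ_rel_common[OF germ_fun_inverse[OF fg(1)] germ_fun_inverse[OF fg(2)]] by metis
  obtain V where V: "V \<in> generic" "\<forall>z\<in>V. f z = g z" using assms unfolding germ_rel_def by blast
  show ?thesis unfolding germ_rel_def using U V generic_Int
    by (intro bexI[of _ "U \<inter> V"]) (auto elim: holomorphic_on_subset)
qed

text \<open>The filter decides \<open>Z\<close>: either \<open>Z\<close> is a member, and the germ
  is zero, or \<open>Z\<close> misses a member, on which, after shrinking, the function has no
  zeros. Nonzero germs are thus invertible although members need not be connected.\<close>

lemma germ_rel_zero_or_inverse:
  assumes "germ_fun f"
  shows "germ_rel f (\<lambda>_. 0) \<or> germ_rel (\<lambda>z. inverse (f z) * f z) (\<lambda>_. 1)"
proof -
  obtain Z N where *: "Z \<union> N \<in> generic" "f holomorphic_on Z \<union> N" "open Z" "open N"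
    "\<forall>z\<in>Z. f z = 0" "\<forall>z\<in>N. f z \<noteq> 0" using germ_dichotomy[OF assms] by blast
  show ?thesis
  proof (cases "Z \<in> generic")
    case True
    then have "germ_rel f (\<lambda>_. 0)" unfolding germ_rel_def
      using *(5) by (intro bexI[of _ Z]) (auto intro: holomorphic_on_subset[OF *(2)])
    then show ?thesis ..
  next
    case False
    then obtain V where V: "V \<in> generic" "Z \<inter> V = {}" using generic_maximal *(3) by blast
    have W: "(Z \<union> N) \<inter> V \<in> generic" using *(1) V(1) by (rule generic_Int)
    have N: "(Z \<union> N) \<inter> V \<subseteq> N" using V(2) by blast
    have "(\<lambda>z. inverse (f z)) holomorphic_on (Z \<union> N) \<inter> V"
      using *(6) N by (intro holomorphic_intros holomorphic_on_subset[OF *(2)]) auto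
    moreover have "f holomorphic_on (Z \<union> N) \<inter> V" by (rule holomorphic_on_subset[OF *(2)]) blast
    ultimately have "germ_rel (\<lambda>z. inverse (f z) * f z) (\<lambda>_. 1)" unfolding germ_rel_def
      using *(6) N by (intro bexI[OF _ W]) (auto intro!: holomorphic_intros)
    then show ?thesis ..
  qed
qed

instantiation gfun :: field
begin

lift_definition zero_gfun :: gfun is "\<lambda>_. 0" by (rule germ_rel_const)
lift_definition one_gfun :: gfun is "\<lambda>_. 1" by (rule germ_rel_const)
lift_definition plus_gfun :: "gfun \<Rightarrow> gfun \<Rightarrow> gfun" is "\<lambda>f g z. f z + g z" by (rule germ_rel_add)
lift_definition times_gfun :: "gfun \<Rightarrow> gfun \<Rightarrow> gfun" is "\<lambda>f g z. f z * g z" by (rule germ_rel_mult)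
lift_definition uminus_gfun :: "gfun \<Rightarrow> gfun" is "\<lambda>f z. - f z" by (rule germ_rel_minus)
lift_definition inverse_gfun :: "gfun \<Rightarrow> gfun" is "\<lambda>f z. inverse (f z)" by (rule germ_rel_inverse)
definition minus_gfun :: "gfun \<Rightarrow> gfun \<Rightarrow> gfun" where "minus_gfun x y = x + - y"
definition divide_gfun :: "gfun \<Rightarrow> gfun \<Rightarrow> gfun" where "divide_gfun x y = x * inverse y"

instance
proof
  fix a b c :: gfun
  show "a + b + c = a + (b + c)"
    by transfer (unfold add.assoc, intro germ_rel_add)
  show "a + b = b + a"
    by transfer (subst add.commute, intro germ_rel_add)
  show "0 + a = a" by transfer simp
  show "- a + a = 0" by transfer (simp add: germ_rel_const)
  show "a - b = a + - b" by (simp add: minus_gfun_def)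
  show "a * b * c = a * (b * c)"
    by transfer (unfold mult.assoc, intro germ_rel_mult)
  show "a * b = b * a"
    by transfer (subst mult.commute, intro germ_rel_mult)
  show "1 * a = a" by transfer simp
  show "(a + b) * c = a * c + b * c"
    by transfer (unfold distrib_right, intro germ_rel_add germ_rel_mult)
  show "(0::gfun) \<noteq> 1"
    by transfer (auto simp: germ_rel_def dest: generic_nonempty)
  show "a \<noteq> 0 \<Longrightarrow> inverse a * a = 1"
    by transfer (use germ_rel_zero_or_inverse in blast)
  show "divide a b = a * inverse b" by (simp add: divide_gfun_def)
  show "inverse (0::gfun) = 0" by transfer (simp add: germ_rel_const)
qed

end

definition germ :: "(complex \<Rightarrow> complex) \<Rightarrow> gfun" where
  "germ f = abs_gfun f"

lemma germ_eq_iff: "germ_fun f \<Longrightarrow> germ_fun g \<Longrightarrow> germ f = germ g \<longleftrightarrow> germ_rel f g"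
  unfolding germ_def using Quotient3_gfun Quotient3_rel by metis

lemma germ_exists: "\<exists>f. germ_fun f \<and> germ f = x"
  unfolding germ_def using Quotient3_gfun Quotient3_abs_rep Quotient3_rep_reflp by metis

lemma germ_add: "germ_fun f \<Longrightarrow> germ_fun g \<Longrightarrow> germ f + germ g = germ (\<lambda>z. f z + g z)"
  unfolding germ_def by (rule plus_gfun.abs_eq)

lemma germ_mult: "germ_fun f \<Longrightarrow> germ_fun g \<Longrightarrow> germ f * germ g = germ (\<lambda>z. f z * g z)"
  unfolding germ_def by (rule times_gfun.abs_eq)

lemma germ_minus: "germ_fun f \<Longrightarrow> - germ f = germ (\<lambda>z. - f z)"
  unfolding germ_def by (rule uminus_gfun.abs_eq)

lemma germ_inverse: "germ_fun f \<Longrightarrow> inverse (germ f) = germ (\<lambda>z. inverse (f z))"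
  unfolding germ_def by (rule inverse_gfun.abs_eq)

lemma germ_zero: "0 = germ (\<lambda>_. 0)"
  unfolding germ_def by (rule zero_gfun.abs_eq)

lemma germ_one: "1 = germ (\<lambda>_. 1)"
  unfolding germ_def by (rule one_gfun.abs_eq)

lemma germ_const_eq_iff: "germ (\<lambda>_. c) = germ (\<lambda>_. d) \<longleftrightarrow> c = d"
  by (subst germ_eq_iff) (auto simp: germ_rel_const, auto simp: germ_rel_def dest: generic_nonempty)

lemma germ_of_nat: "of_nat n = germ (\<lambda>_. of_nat n)"
  by (induction n) (auto simp: germ_zero germ_one germ_add germ_rel_const)

instance gfun :: field_char_0
proof
  show "inj (of_nat :: nat \<Rightarrow> gfun)"
    by (rule injI) (simp add: germ_of_nat germ_const_eq_iff)
qed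

lift_definition gderiv :: "gfun \<Rightarrow> gfun" is deriv by (rule germ_rel_deriv)

lemma germ_deriv: "germ_fun f \<Longrightarrow> gderiv (germ f) = germ (deriv f)"
  unfolding germ_def by (rule gderiv.abs_eq)

lemma germ_funI: "U \<in> generic \<Longrightarrow> f holomorphic_on U \<Longrightarrow> germ_fun f"
  by (auto simp: germ_fun_def)

lemma germ_eqI: "U \<in> generic \<Longrightarrow> f holomorphic_on U \<Longrightarrow> (\<And>z. z \<in> U \<Longrightarrow> f z = g z) \<Longrightarrow> germ f = germ g"
proof -
  assume *: "U \<in> generic" "f holomorphic_on U" "\<And>z. z \<in> U \<Longrightarrow> f z = g z"
  then have "g holomorphic_on U" by (metis holomorphic_transform)
  with * show ?thesis by (subst germ_eq_iff) (auto simp: germ_rel_def)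
qed

lemma germ_fun_intros:
  "germ_fun (\<lambda>_. c)"
  "germ_fun f \<Longrightarrow> germ_fun g \<Longrightarrow> germ_fun (\<lambda>z. f z + g z)"
  "germ_fun f \<Longrightarrow> germ_fun g \<Longrightarrow> germ_fun (\<lambda>z. f z * g z)"
  "germ_fun f \<Longrightarrow> germ_fun (deriv f)"
  by (auto intro: germ_rel_const germ_rel_add germ_rel_mult germ_rel_deriv)

lemma derivation_gderiv: "derivation gderiv"
  unfolding derivation_def
proof (intro conjI allI)
  fix x y :: gfun
  obtain f g where fg: "germ_fun f" "germ f = x" "germ_fun g" "germ g = y" using germ_exists by metis
  obtain U where U: "U \<in> generic" "f holomorphic_on U" "g holomorphic_on U"
    using germ_rel_common[OF fg(1,3)] by metis
  note oU = generic_open[OF U(1)]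
  have d: "f field_differentiable at z" "g field_differentiable at z" if "z \<in> U" for z
    using U oU that by (auto intro: holomorphic_on_imp_differentiable_at)
  have h: "deriv f holomorphic_on U" "deriv g holomorphic_on U" using U oU by (auto intro: holomorphic_deriv)
  have "germ (\<lambda>z. deriv f z + deriv g z) = germ (deriv (\<lambda>z. f z + g z))"
    by (rule germ_eqI[OF U(1)]) (use h d in \<open>auto intro!: holomorphic_intros\<close>)
  then show "gderiv (x + y) = gderiv x + gderiv y"
    unfolding fg(2,4)[symmetric] using fg(1,3) by (simp add: germ_add germ_deriv germ_fun_intros)
  have "germ (\<lambda>z. deriv f z * g z + f z * deriv g z) = germ (deriv (\<lambda>z. f z * g z))"
    by (rule germ_eqI[OF U(1)]) (use h U d in \<open>auto intro!: holomorphic_intros simp: deriv_mult\<close>)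
  then show "gderiv (x * y) = gderiv x * y + x * gderiv y"
    unfolding fg(2,4)[symmetric] using fg(1,3) by (simp add: germ_add germ_mult germ_deriv germ_fun_intros)
qed

text \<open>
  Gluing along a maximal disjoint family of open sets, whose union is dense.
\<close>

lemma generic_glue:
  fixes R :: "('i \<Rightarrow> complex \<Rightarrow> complex) \<Rightarrow> complex \<Rightarrow> bool"
  assumes U: "U \<in> generic"
    and local: "\<And>x y z N. open N \<Longrightarrow> z \<in> N \<Longrightarrow> (\<forall>w\<in>N. \<forall>i. x i w = y i w) \<Longrightarrow> R x z \<Longrightarrow> R y z"
    and ex: "\<And>W. open W \<Longrightarrow> W \<noteq> {} \<Longrightarrow> W \<subseteq> U \<Longrightarrow>
       \<exists>B x. open B \<and> B \<noteq> {} \<and> B \<subseteq> W \<and> (\<forall>i. x i holomorphic_on B) \<and> (\<forall>z\<in>B. R x z)"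
  shows "\<exists>D\<in>generic. \<exists>x. (\<forall>i. x i holomorphic_on D) \<and> (\<forall>z\<in>D. R x z)"
proof -
  \<comment> \<open>The open sets on which a solution exists. The family taken from them is pairwise
    disjoint, so that the local solutions cannot conflict.\<close>
  define Q where "Q B \<longleftrightarrow> open B \<and> B \<noteq> {} \<and> (\<exists>x. (\<forall>i. x i holomorphic_on B) \<and> (\<forall>z\<in>B. R x z))" for B
  define A where "A = {C. (\<forall>B\<in>C. Q B) \<and> (\<forall>B\<in>C. \<forall>B'\<in>C. B \<noteq> B' \<longrightarrow> B \<inter> B' = {})}"
  have "{} \<in> A" by (simp add: A_def)
  then have ne: "A \<noteq> {}" by blast
  have chain: "\<Union>C \<in> A" if C: "C \<noteq> {}" "subset.chain A C" for C
  proof -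
    have sub: "C \<subseteq> A" and ch: "\<And>F G. F \<in> C \<Longrightarrow> G \<in> C \<Longrightarrow> F \<subseteq> G \<or> G \<subseteq> F"
      using C(2) unfolding subset_chain_def by simp_all
    have "B \<inter> B' = {}" if BB: "B \<in> \<Union>C" "B' \<in> \<Union>C" "B \<noteq> B'" for B B'
    proof -
      obtain F G where FG: "F \<in> C" "B \<in> F" "G \<in> C" "B' \<in> G" using BB by blast
      then have "\<exists>H\<in>C. B \<in> H \<and> B' \<in> H" using ch[OF FG(1,3)] by blast
      then obtain H where H: "H \<in> C" "B \<in> H" "B' \<in> H" by blast
      then have "H \<in> A" using sub by blast
      then show ?thesis using H(2,3) BB(3) unfolding A_def by blast
    qed
    moreover have "Q B" if BC: "B \<in> \<Union>C" for B
    proof -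
      obtain F where F: "F \<in> C" "B \<in> F" using BC by blast
      then have "F \<in> A" using sub by blast
      then show ?thesis using F(2) unfolding A_def by blast
    qed
    ultimately show ?thesis unfolding A_def by (intro CollectI conjI ballI impI)
  qed
  obtain C where "C \<in> A" "\<forall>G\<in>A. C \<subseteq> G \<longrightarrow> G = C"
    using subset_Zorn_nonempty[OF ne chain] by (rule bexE)
  then have C: "C \<in> A" "\<And>G. G \<in> A \<Longrightarrow> C \<subseteq> G \<Longrightarrow> G = C" by simp_all
  have CQ: "\<And>B. B \<in> C \<Longrightarrow> Q B" and dis: "\<And>B B'. B \<in> C \<Longrightarrow> B' \<in> C \<Longrightarrow> B \<noteq> B' \<Longrightarrow> B \<inter> B' = {}"
    using C(1) by (auto simp: A_def)
  have "\<And>B. B \<in> C \<Longrightarrow> \<exists>x. (\<forall>i. x i holomorphic_on B) \<and> (\<forall>z\<in>B. R x z)" using CQ by (simp add: Q_def)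
  then obtain Y where Y: "\<And>B i. B \<in> C \<Longrightarrow> Y B i holomorphic_on B" "\<And>B z. B \<in> C \<Longrightarrow> z \<in> B \<Longrightarrow> R (Y B) z" by metis
  \<comment> \<open>On the union of the family the set containing \<open>z\<close> is unique;
    elsewhere the value is arbitrary.\<close>
  define x where "x i z = Y (THE B. B \<in> C \<and> z \<in> B) i z" for i z
  have x: "x i z = Y B i z" if "B \<in> C" "z \<in> B" for B i z
  proof -
    have "(THE B. B \<in> C \<and> z \<in> B) = B" using that dis by (intro the_equality) blast+
    then show ?thesis by (simp add: x_def)
  qed
  have oC: "open B" if "B \<in> C" for B using CQ[OF that] by (simp add: Q_def)
  have xh: "x i holomorphic_on B" if "B \<in> C" for B i
    using holomorphic_transform[OF Y(1)[OF that], of i "x i"] x[OF that] by simp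
  have "\<Union>C \<in> generic"
  proof (rule generic_dense[OF U])
    show "open (\<Union>C)" using oC by blast
    fix W assume W: "open W" "W \<noteq> {}" "W \<subseteq> U"
    show "W \<inter> \<Union>C \<noteq> {}"
    proof
      assume e: "W \<inter> \<Union>C = {}"
      \<comment> \<open>A nonempty open set missed by the union would contain a further set with a
        solution, against maximality of the family.\<close>
      obtain B x where B: "open B" "B \<noteq> {}" "B \<subseteq> W" "\<forall>i. x i holomorphic_on B" "\<forall>z\<in>B. R x z"
        using ex[OF W] by blast
      then have QB: "Q B" unfolding Q_def by (intro conjI exI[of _ x])
      have disj: "B \<inter> B' = {}" if "B' \<in> C" for B' using e B(3) that by blast
      have "insert B C \<in> A"
        unfolding A_def
      proof (intro CollectI conjI ballI impI)
        show "Q B'" if "B' \<in> insert B C" for B' using that QB CQ by (elim insertE) simp_all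
        show "B1 \<inter> B2 = {}" if "B1 \<in> insert B C" "B2 \<in> insert B C" "B1 \<noteq> B2" for B1 B2
          using that disj[of B1] disj[of B2] dis[of B1 B2] by (elim insertE) (simp_all add: Int_commute)
      qed
      then have "B \<in> C" using C(2)[of "insert B C"] by blast
      then show False using e B by blast
    qed
  qed
  moreover have "x i holomorphic_on \<Union>C" for i
  proof -
    have "open (\<Union>C)" using oC by blast
    then show ?thesis using xh[of _ i] oC by (auto simp: holomorphic_on_open)
  qed
  moreover have "R x z" if zC: "z \<in> \<Union>C" for z
  proof -
    obtain B where B: "B \<in> C" "z \<in> B" using zC by blast
    show ?thesis by (rule local[OF oC[OF B(1)] B(2) _ Y(2)[OF B]]) (use x[OF B(1)] in simp)
  qed
  ultimately show ?thesis by blast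
qed

section \<open>Local solutions of differential equations\<close>

text \<open>The concrete counterpart of \<open>polyfun\<close> over germs: the coefficients are
  functions holomorphic on \<open>U\<close>, and \<open>z\<close> is the point at which they are
  evaluated.\<close>

inductive_set holpoly :: "complex set \<Rightarrow> nat \<Rightarrow> (complex \<Rightarrow> (nat \<Rightarrow> complex) \<Rightarrow> complex) set"
  for U :: "complex set" and n :: nat where
  holpoly_coeff: "f holomorphic_on U \<Longrightarrow> (\<lambda>z \<xi>. f z) \<in> holpoly U n"
| holpoly_var: "i < n \<Longrightarrow> (\<lambda>z \<xi>. \<xi> i) \<in> holpoly U n"
| holpoly_add: "\<phi> \<in> holpoly U n \<Longrightarrow> \<psi> \<in> holpoly U n \<Longrightarrow> (\<lambda>z \<xi>. \<phi> z \<xi> + \<psi> z \<xi>) \<in> holpoly U n"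
| holpoly_mult: "\<phi> \<in> holpoly U n \<Longrightarrow> \<psi> \<in> holpoly U n \<Longrightarrow> (\<lambda>z \<xi>. \<phi> z \<xi> * \<psi> z \<xi>) \<in> holpoly U n"

lemma holpoly_mono: "\<phi> \<in> holpoly U n \<Longrightarrow> V \<subseteq> U \<Longrightarrow> n \<le> m \<Longrightarrow> \<phi> \<in> holpoly V m"
  by (induction rule: holpoly.induct) (auto intro: holpoly.intros holomorphic_on_subset)

lemma holpoly_cong: "\<phi> \<in> holpoly U n \<Longrightarrow> (\<And>i. i < n \<Longrightarrow> \<xi> i = \<eta> i) \<Longrightarrow> \<phi> z \<xi> = \<phi> z \<eta>"
  by (induction rule: holpoly.induct) auto

lemma holpoly_const: "(\<lambda>z \<xi>. c) \<in> holpoly U n"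
  by (rule holpoly_coeff) simp

lemma holpoly_power: "\<phi> \<in> holpoly U n \<Longrightarrow> (\<lambda>z \<xi>. \<phi> z \<xi> ^ m) \<in> holpoly U n"
  by (induction m) (auto intro: holpoly_const holpoly_mult)

lemma holpoly_sum: "(\<And>i. i \<in> A \<Longrightarrow> \<phi> i \<in> holpoly U n) \<Longrightarrow> (\<lambda>z \<xi>. \<Sum>i\<in>A. \<phi> i z \<xi>) \<in> holpoly U n"
  by (induction A rule: infinite_finite_induct) (auto intro: holpoly_const holpoly_add)

lemma holpoly_holomorphic:
  assumes "\<phi> \<in> holpoly U n" "V \<subseteq> U" "\<And>i. i < n \<Longrightarrow> x i holomorphic_on V"
  shows "(\<lambda>z. \<phi> z (\<lambda>i. x i z)) holomorphic_on V"
  using assms by (induction rule: holpoly.induct) (auto intro: holomorphic_intros holomorphic_on_subset)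

text \<open>The chain rule along a curve whose coordinates are successive derivatives, the last
  having derivative \<open>y\<close>. The first property pins down \<open>S\<close> as the partial
  derivative in variable \<open>n\<close>; \<open>T\<close> collects the other terms.\<close>

lemma holpoly_derivative:
  assumes U: "open U" and \<phi>: "\<phi> \<in> holpoly U (Suc n)"
  shows "\<exists>T\<in>holpoly U (Suc n). \<exists>S\<in>holpoly U (Suc n).
    (\<forall>z \<xi> t. ((\<lambda>t. \<phi> z (\<xi>(n := t))) has_field_derivative S z (\<xi>(n := t))) (at t)) \<and>
    (\<forall>z\<in>U. \<forall>x y. (\<forall>i<n. (x i has_field_derivative x (Suc i) z) (at z)) \<longrightarrow> (x n has_field_derivative y) (at z) \<longrightarrow>
       ((\<lambda>w. \<phi> w (\<lambda>i. x i w)) has_field_derivative T z (\<lambda>i. x i z) + S z (\<lambda>i. x i z) * y) (at z))"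
  using \<phi>
proof (induction rule: holpoly.induct)
  case (holpoly_coeff f)
  have "(f has_field_derivative deriv f z) (at z)" if "z \<in> U" for z
    using holpoly_coeff U that by (simp add: holomorphic_derivI)
  moreover have "deriv f holomorphic_on U" using holpoly_coeff U by (rule holomorphic_deriv)
  ultimately show ?case
    by (intro bexI[of _ "\<lambda>z \<xi>. deriv f z"] bexI[of _ "\<lambda>z \<xi>. 0"] holpoly.holpoly_coeff holpoly_const) auto
next
  case (holpoly_var i)
  show ?case
  proof (cases "i = n")
    case True
    then show ?thesis
      by (intro bexI[of _ "\<lambda>z \<xi>. 0"] bexI[of _ "\<lambda>z \<xi>. 1"] holpoly_const) auto
  next
    case False
    then have "Suc i < Suc n" using holpoly_var by simp
    then show ?thesis using False
      by (intro bexI[of _ "\<lambda>z \<xi>. \<xi> (Suc i)"] bexI[of _ "\<lambda>z \<xi>. 0"] holpoly_const holpoly.holpoly_var) auto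
  qed
next
  case (holpoly_add \<phi> \<psi>)
  obtain T S where T: "T \<in> holpoly U (Suc n)" "S \<in> holpoly U (Suc n)"
    "\<And>z \<xi> t. ((\<lambda>t. \<phi> z (\<xi>(n := t))) has_field_derivative S z (\<xi>(n := t))) (at t)"
    "\<And>z x y. z \<in> U \<Longrightarrow> (\<forall>i<n. (x i has_field_derivative x (Suc i) z) (at z)) \<Longrightarrow> (x n has_field_derivative y) (at z) \<Longrightarrow>
       ((\<lambda>w. \<phi> w (\<lambda>i. x i w)) has_field_derivative T z (\<lambda>i. x i z) + S z (\<lambda>i. x i z) * y) (at z)"
    using holpoly_add.IH(1) by blast
  obtain T' S' where T': "T' \<in> holpoly U (Suc n)" "S' \<in> holpoly U (Suc n)"
    "\<And>z \<xi> t. ((\<lambda>t. \<psi> z (\<xi>(n := t))) has_field_derivative S' z (\<xi>(n := t))) (at t)"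
    "\<And>z x y. z \<in> U \<Longrightarrow> (\<forall>i<n. (x i has_field_derivative x (Suc i) z) (at z)) \<Longrightarrow> (x n has_field_derivative y) (at z) \<Longrightarrow>
       ((\<lambda>w. \<psi> w (\<lambda>i. x i w)) has_field_derivative T' z (\<lambda>i. x i z) + S' z (\<lambda>i. x i z) * y) (at z)"
    using holpoly_add.IH(2) by blast
  have 1: "(\<lambda>z \<xi>. T z \<xi> + T' z \<xi>) \<in> holpoly U (Suc n)" "(\<lambda>z \<xi>. S z \<xi> + S' z \<xi>) \<in> holpoly U (Suc n)"
    by (intro holpoly.holpoly_add T T')+
  show ?case
  proof (rule bexI[OF _ 1(1)], rule bexI[OF _ 1(2)], intro conjI allI ballI impI)
    fix z \<xi> t
    show "((\<lambda>t. \<phi> z (\<xi>(n := t)) + \<psi> z (\<xi>(n := t))) has_field_derivative S z (\<xi>(n := t)) + S' z (\<xi>(n := t))) (at t)"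
      by (intro DERIV_add T T')
  next
    fix z x y assume *: "z \<in> U" "\<forall>i<n. (x i has_field_derivative x (Suc i) z) (at z)" "(x n has_field_derivative y) (at z)"
    show "((\<lambda>w. \<phi> w (\<lambda>i. x i w) + \<psi> w (\<lambda>i. x i w)) has_field_derivative
           T z (\<lambda>i. x i z) + T' z (\<lambda>i. x i z) + (S z (\<lambda>i. x i z) + S' z (\<lambda>i. x i z)) * y) (at z)"
      by (rule DERIV_cong[OF DERIV_add[OF T(4)[OF *] T'(4)[OF *]]]) (simp add: algebra_simps)
  qed
next
  case (holpoly_mult \<phi> \<psi>)
  obtain T S where T: "T \<in> holpoly U (Suc n)" "S \<in> holpoly U (Suc n)"
    "\<And>z \<xi> t. ((\<lambda>t. \<phi> z (\<xi>(n := t))) has_field_derivative S z (\<xi>(n := t))) (at t)"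
    "\<And>z x y. z \<in> U \<Longrightarrow> (\<forall>i<n. (x i has_field_derivative x (Suc i) z) (at z)) \<Longrightarrow> (x n has_field_derivative y) (at z) \<Longrightarrow>
       ((\<lambda>w. \<phi> w (\<lambda>i. x i w)) has_field_derivative T z (\<lambda>i. x i z) + S z (\<lambda>i. x i z) * y) (at z)"
    using holpoly_mult.IH(1) by blast
  obtain T' S' where T': "T' \<in> holpoly U (Suc n)" "S' \<in> holpoly U (Suc n)"
    "\<And>z \<xi> t. ((\<lambda>t. \<psi> z (\<xi>(n := t))) has_field_derivative S' z (\<xi>(n := t))) (at t)"
    "\<And>z x y. z \<in> U \<Longrightarrow> (\<forall>i<n. (x i has_field_derivative x (Suc i) z) (at z)) \<Longrightarrow> (x n has_field_derivative y) (at z) \<Longrightarrow>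
       ((\<lambda>w. \<psi> w (\<lambda>i. x i w)) has_field_derivative T' z (\<lambda>i. x i z) + S' z (\<lambda>i. x i z) * y) (at z)"
    using holpoly_mult.IH(2) by blast
  have 1: "(\<lambda>z \<xi>. T z \<xi> * \<psi> z \<xi> + \<phi> z \<xi> * T' z \<xi>) \<in> holpoly U (Suc n)"
      "(\<lambda>z \<xi>. S z \<xi> * \<psi> z \<xi> + \<phi> z \<xi> * S' z \<xi>) \<in> holpoly U (Suc n)"
    by (intro holpoly.holpoly_add holpoly.holpoly_mult T T' holpoly_mult.hyps)+
  show ?case
  proof (rule bexI[OF _ 1(1)], rule bexI[OF _ 1(2)], intro conjI allI ballI impI)
    fix z \<xi> t
    show "((\<lambda>t. \<phi> z (\<xi>(n := t)) * \<psi> z (\<xi>(n := t))) has_field_derivative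
        S z (\<xi>(n := t)) * \<psi> z (\<xi>(n := t)) + \<phi> z (\<xi>(n := t)) * S' z (\<xi>(n := t))) (at t)"
      by (rule DERIV_cong[OF DERIV_mult[OF T(3) T'(3)]]) (simp add: algebra_simps)
  next
    fix z x y assume *: "z \<in> U" "\<forall>i<n. (x i has_field_derivative x (Suc i) z) (at z)" "(x n has_field_derivative y) (at z)"
    show "((\<lambda>w. \<phi> w (\<lambda>i. x i w) * \<psi> w (\<lambda>i. x i w)) has_field_derivative
           T z (\<lambda>i. x i z) * \<psi> z (\<lambda>i. x i z) + \<phi> z (\<lambda>i. x i z) * T' z (\<lambda>i. x i z) +
           (S z (\<lambda>i. x i z) * \<psi> z (\<lambda>i. x i z) + \<phi> z (\<lambda>i. x i z) * S' z (\<lambda>i. x i z)) * y) (at z)"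
      by (rule DERIV_cong[OF DERIV_mult[OF T(4)[OF *] T'(4)[OF *]]]) (simp add: algebra_simps)
  qed
qed

definition polydisc :: "nat \<Rightarrow> (nat \<Rightarrow> complex) \<Rightarrow> real \<Rightarrow> (nat \<Rightarrow> complex) set" where
  "polydisc n c \<rho> = {w. \<forall>j<n. cmod (w j - c j) \<le> \<rho>}"

text \<open>Bounds and Lipschitz constants in the form that Picard iteration asks for. Coefficients
  are bounded by compactness of the closed disc, and a difference of products is split in the usual
  way.\<close>

lemma holpoly_bounds:
  assumes \<phi>: "\<phi> \<in> holpoly U n" and r: "cball z0 r \<subseteq> U"
  shows "\<exists>M L. 0 \<le> M \<and> 0 \<le> L \<and> (\<forall>z\<in>cball z0 r. \<forall>w\<in>polydisc n c \<rho>. cmod (\<phi> z w) \<le> M) \<and>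
     (\<forall>z\<in>cball z0 r. \<forall>w\<in>polydisc n c \<rho>. \<forall>v\<in>polydisc n c \<rho>. \<forall>\<delta>\<ge>0. (\<forall>j<n. cmod (w j - v j) \<le> \<delta>) \<longrightarrow>
         cmod (\<phi> z w - \<phi> z v) \<le> L * \<delta>)"
  using \<phi>
proof (induction rule: holpoly.induct)
  case (holpoly_coeff f)
  have "compact (f ` cball z0 r)"
    using holpoly_coeff r by (intro compact_continuous_image holomorphic_on_imp_continuous_on)
       (auto elim: holomorphic_on_subset)
  then obtain M where "\<forall>y\<in>f ` cball z0 r. cmod y \<le> M" using compact_imp_bounded bounded_iff by blast
  then show ?case by (intro exI[of _ "max M 0"] exI[of _ 0]) auto
next
  case (holpoly_var i)
  have "cmod (w i) \<le> cmod (c i) + \<rho>" if "w \<in> polydisc n c \<rho>" for w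
    using norm_triangle_sub[of "w i" "c i"] that holpoly_var by (force simp: polydisc_def)
  then have "cmod (w i) \<le> max (cmod (c i) + \<rho>) 0" if "w \<in> polydisc n c \<rho>" for w
    using that by (simp add: le_max_iff_disj)
  then show ?case using holpoly_var by (intro exI[of _ "max (cmod (c i) + \<rho>) 0"] exI[of _ 1]) auto
next
  case (holpoly_add \<phi> \<psi>)
  obtain M L where M: "0 \<le> M" "0 \<le> L" "\<And>z w. z\<in>cball z0 r \<Longrightarrow> w\<in>polydisc n c \<rho> \<Longrightarrow> cmod (\<phi> z w) \<le> M"
    "\<And>z w v \<delta>. z\<in>cball z0 r \<Longrightarrow> w\<in>polydisc n c \<rho> \<Longrightarrow> v\<in>polydisc n c \<rho> \<Longrightarrow> \<delta>\<ge>0 \<Longrightarrow> (\<forall>j<n. cmod (w j - v j) \<le> \<delta>) \<Longrightarrow>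
         cmod (\<phi> z w - \<phi> z v) \<le> L * \<delta>" using holpoly_add.IH(1) by metis
  obtain M' L' where M': "0 \<le> M'" "0 \<le> L'" "\<And>z w. z\<in>cball z0 r \<Longrightarrow> w\<in>polydisc n c \<rho> \<Longrightarrow> cmod (\<psi> z w) \<le> M'"
    "\<And>z w v \<delta>. z\<in>cball z0 r \<Longrightarrow> w\<in>polydisc n c \<rho> \<Longrightarrow> v\<in>polydisc n c \<rho> \<Longrightarrow> \<delta>\<ge>0 \<Longrightarrow> (\<forall>j<n. cmod (w j - v j) \<le> \<delta>) \<Longrightarrow>
         cmod (\<psi> z w - \<psi> z v) \<le> L' * \<delta>" using holpoly_add.IH(2) by metis
  show ?case
  proof (rule exI[of _ "M + M'"], rule exI[of _ "L + L'"], intro conjI allI ballI impI)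
    fix z w assume *: "z\<in>cball z0 r" "w\<in>polydisc n c \<rho>"
    show "cmod (\<phi> z w + \<psi> z w) \<le> M + M'"
      using M(3)[OF *] M'(3)[OF *] by (rule norm_triangle_mono)
    fix v \<delta> assume **: "v\<in>polydisc n c \<rho>" "\<delta>\<ge>0" "\<forall>j<n. cmod (w j - v j) \<le> \<delta>"
    have E: "\<phi> z w + \<psi> z w - (\<phi> z v + \<psi> z v) = (\<phi> z w - \<phi> z v) + (\<psi> z w - \<psi> z v)" by simp
    show "cmod (\<phi> z w + \<psi> z w - (\<phi> z v + \<psi> z v)) \<le> (L + L') * \<delta>"
      unfolding E distrib_right by (rule norm_triangle_mono[OF M(4)[OF * **] M'(4)[OF * **]])
  qed (use M M' in auto)
next
  case (holpoly_mult \<phi> \<psi>)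
  obtain M L where M: "0 \<le> M" "0 \<le> L" "\<And>z w. z\<in>cball z0 r \<Longrightarrow> w\<in>polydisc n c \<rho> \<Longrightarrow> cmod (\<phi> z w) \<le> M"
    "\<And>z w v \<delta>. z\<in>cball z0 r \<Longrightarrow> w\<in>polydisc n c \<rho> \<Longrightarrow> v\<in>polydisc n c \<rho> \<Longrightarrow> \<delta>\<ge>0 \<Longrightarrow> (\<forall>j<n. cmod (w j - v j) \<le> \<delta>) \<Longrightarrow>
         cmod (\<phi> z w - \<phi> z v) \<le> L * \<delta>" using holpoly_mult.IH(1) by metis
  obtain M' L' where M': "0 \<le> M'" "0 \<le> L'" "\<And>z w. z\<in>cball z0 r \<Longrightarrow> w\<in>polydisc n c \<rho> \<Longrightarrow> cmod (\<psi> z w) \<le> M'"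
    "\<And>z w v \<delta>. z\<in>cball z0 r \<Longrightarrow> w\<in>polydisc n c \<rho> \<Longrightarrow> v\<in>polydisc n c \<rho> \<Longrightarrow> \<delta>\<ge>0 \<Longrightarrow> (\<forall>j<n. cmod (w j - v j) \<le> \<delta>) \<Longrightarrow>
         cmod (\<psi> z w - \<psi> z v) \<le> L' * \<delta>" using holpoly_mult.IH(2) by metis
  show ?case
  proof (rule exI[of _ "M * M'"], rule exI[of _ "L * M' + M * L'"], intro conjI allI ballI impI)
    fix z w assume *: "z\<in>cball z0 r" "w\<in>polydisc n c \<rho>"
    show "cmod (\<phi> z w * \<psi> z w) \<le> M * M'"
      unfolding norm_mult using M(1) by (intro mult_mono M(3)[OF *] M'(3)[OF *]) auto
    fix v \<delta> assume **: "v\<in>polydisc n c \<rho>" "\<delta>\<ge>0" "\<forall>j<n. cmod (w j - v j) \<le> \<delta>"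
    have "\<phi> z w * \<psi> z w - \<phi> z v * \<psi> z v = (\<phi> z w - \<phi> z v) * \<psi> z w + \<phi> z v * (\<psi> z w - \<psi> z v)"
      by (simp add: algebra_simps)
    moreover have "cmod ((\<phi> z w - \<phi> z v) * \<psi> z w) \<le> (L * \<delta>) * M'"
      unfolding norm_mult using M M' ** by (intro mult_mono M(4)[OF * **] M'(3)[OF *]) auto
    moreover have "cmod (\<phi> z v * (\<psi> z w - \<psi> z v)) \<le> M * (L' * \<delta>)"
      unfolding norm_mult using M M' ** * by (intro mult_mono M'(4)[OF * **] M(3)) auto
    ultimately have "cmod (\<phi> z w * \<psi> z w - \<phi> z v * \<psi> z v) \<le> (L * \<delta>) * M' + M * (L' * \<delta>)"
      using norm_triangle_mono by metis
    then show "cmod (\<phi> z w * \<psi> z w - \<phi> z v * \<psi> z v) \<le> (L * M' + M * L') * \<delta>"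
      by (simp add: algebra_simps)
  qed (use M M' in auto)
qed

text \<open>
  Differentiating \<open>\<phi> = 0\<close> along a solution gives an explicit equation of order \<open>n + 1\<close>, whose
  solutions keep \<open>\<phi>\<close> constant.
\<close>

theorem holpoly_ode_local:
  assumes U: "open U" "z0 \<in> U" and \<phi>: "\<phi> \<in> holpoly U (Suc n)"
    and S: "\<And>z \<xi> t. ((\<lambda>t. \<phi> z (\<xi>(n := t))) has_field_derivative S z (\<xi>(n := t))) (at t)"
    and c: "\<phi> z0 c = 0" "S z0 c \<noteq> 0"
  shows "\<exists>r>0. \<exists>x. ball z0 r \<subseteq> U \<and> x holomorphic_on ball z0 r \<and>
     (\<forall>z\<in>ball z0 r. \<phi> z (\<lambda>i. (deriv ^^ i) x z) = 0) \<and> (\<forall>i\<le>n. (deriv ^^ i) x z0 = c i)"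
proof -
  obtain T S' where T: "T \<in> holpoly U (Suc n)" and S': "S' \<in> holpoly U (Suc n)"
    and S'd: "\<And>z \<xi> t. ((\<lambda>t. \<phi> z (\<xi>(n := t))) has_field_derivative S' z (\<xi>(n := t))) (at t)"
    and total: "\<And>z x y. z \<in> U \<Longrightarrow> (\<forall>i<n. (x i has_field_derivative x (Suc i) z) (at z)) \<Longrightarrow>
       (x n has_field_derivative y) (at z) \<Longrightarrow>
       ((\<lambda>w. \<phi> w (\<lambda>i. x i w)) has_field_derivative T z (\<lambda>i. x i z) + S' z (\<lambda>i. x i z) * y) (at z)"
    using holpoly_derivative[OF U(1) \<phi>] by blast
  \<comment> \<open>\<open>S\<close> and \<open>S'\<close> are both the partial derivative in
    variable \<open>n\<close>, so the assumption on \<open>S\<close> at the initial values carries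
    over to \<open>S'\<close>.\<close>
  have "S' z0 (c(n := c n)) = S z0 (c(n := c n))" by (rule DERIV_unique[OF S'd S])
  then have S'0: "S' z0 c \<noteq> 0" using c(2) by simp
  define \<sigma> where "\<sigma> = cmod (S' z0 c)"
  have \<sigma>: "\<sigma> > 0" using S'0 by (simp add: \<sigma>_def)
  obtain r1 where r1: "r1 > 0" "cball z0 r1 \<subseteq> U" using U open_contains_cball by blast
  obtain MT LT where MT: "0 \<le> MT" "0 \<le> LT"
    "\<And>z w. z\<in>cball z0 r1 \<Longrightarrow> w\<in>polydisc (Suc n) c 1 \<Longrightarrow> cmod (T z w) \<le> MT"
    "\<And>z w v \<delta>. z\<in>cball z0 r1 \<Longrightarrow> w\<in>polydisc (Suc n) c 1 \<Longrightarrow> v\<in>polydisc (Suc n) c 1 \<Longrightarrow> \<delta>\<ge>0 \<Longrightarrow>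
        (\<forall>j<Suc n. cmod (w j - v j) \<le> \<delta>) \<Longrightarrow> cmod (T z w - T z v) \<le> LT * \<delta>"
    using holpoly_bounds[OF T r1(2), of c 1] by metis
  obtain MS LS where MS: "0 \<le> MS" "0 \<le> LS"
    "\<And>z w. z\<in>cball z0 r1 \<Longrightarrow> w\<in>polydisc (Suc n) c 1 \<Longrightarrow> cmod (S' z w) \<le> MS"
    "\<And>z w v \<delta>. z\<in>cball z0 r1 \<Longrightarrow> w\<in>polydisc (Suc n) c 1 \<Longrightarrow> v\<in>polydisc (Suc n) c 1 \<Longrightarrow> \<delta>\<ge>0 \<Longrightarrow>
        (\<forall>j<Suc n. cmod (w j - v j) \<le> \<delta>) \<Longrightarrow> cmod (S' z w - S' z v) \<le> LS * \<delta>"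
    using holpoly_bounds[OF S' r1(2), of c 1] by metis
  \<comment> \<open>Moving the variables by \<rho> changes \<open>S'\<close> by at most
    \<open>\<sigma> / 4\<close>, and moving the point by less than \<open>r2\<close> costs another
    \<open>\<sigma> / 4\<close>; so the modulus of \<open>S'\<close> stays above
    \<open>\<sigma> / 2\<close>. The summand 1 avoids a division by zero.\<close>
  define \<rho> where "\<rho> = min 1 (\<sigma> / (4 * (LS + 1)))"
  have \<rho>: "0 < \<rho>" "\<rho> \<le> 1" "\<rho> \<le> \<sigma> / (4 * (LS + 1))" using \<sigma> MS(2) by (auto simp: \<rho>_def)
  have LS\<rho>: "LS * \<rho> \<le> \<sigma> / 4"
  proof -
    have "LS * \<rho> \<le> (LS + 1) * \<rho>" using \<rho> by (intro mult_right_mono) auto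
    also have "\<dots> \<le> \<sigma> / 4" using \<rho>(3) MS(2) by (simp add: field_simps)
    finally show ?thesis .
  qed
  have "(\<lambda>z. S' z (\<lambda>i. (\<lambda>_. c i) z)) holomorphic_on U"
    by (rule holpoly_holomorphic[OF S']) auto
  then have "continuous_on U (\<lambda>z. S' z c)" using holomorphic_on_imp_continuous_on by simp
  then obtain r2 where r2: "r2 > 0" "\<And>z. z \<in> U \<Longrightarrow> dist z z0 < r2 \<Longrightarrow> dist (S' z c) (S' z0 c) < \<sigma> / 4"
    using U(2) \<sigma> unfolding continuous_on_iff by (metis divide_pos_pos zero_less_numeral)
  define r0 where "r0 = min r1 r2"
  have r0: "r0 > 0" using r1 r2 by (simp add: r0_def)
  have B: "z \<in> cball z0 r1" "z \<in> U" "dist z z0 < r2" if "z \<in> ball z0 r0" for z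
    using that r1 by (auto simp: r0_def dist_commute)
  have pd: "w \<in> polydisc (Suc n) c 1" if "\<forall>j\<le>n. cmod (w j - c j) \<le> \<rho>" for w
    using that \<rho>(2) by (force simp: polydisc_def less_Suc_eq_le)
  have cpd: "c \<in> polydisc (Suc n) c 1" by (simp add: polydisc_def)
  have Slow: "cmod (S' z w) \<ge> \<sigma> / 2" if z: "z \<in> ball z0 r0" and w: "\<forall>j\<le>n. cmod (w j - c j) \<le> \<rho>" for z w
  proof -
    have "cmod (S' z w - S' z c) \<le> LS * \<rho>"
      using w \<rho>(1) by (intro MS(4) B(1)[OF z] pd cpd) (auto simp: less_Suc_eq_le)
    moreover have "cmod (S' z c - S' z0 c) < \<sigma> / 4" using r2(2)[OF B(2,3)[OF z]] by (simp add: dist_norm)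
    moreover have "cmod (S' z0 c) \<le> cmod (S' z w) + cmod (S' z w - S' z c) + cmod (S' z c - S' z0 c)"
    proof -
      have "S' z0 c = S' z w - (S' z w - S' z c) - (S' z c - S' z0 c)" by simp
      then show ?thesis by (smt (verit) norm_triangle_ineq4)
    qed
    ultimately show ?thesis using LS\<rho> unfolding \<sigma>_def[symmetric] by linarith
  qed
  \<comment> \<open>The explicit equation of order \<open>n + 1\<close> as a first-order system; the
    last component is what makes the total derivative of \<phi> vanish.\<close>
  define G where "G i z w = (if i < n then w (Suc i) else - T z w / S' z w)" for i z and w :: "nat \<Rightarrow> complex"
  define C where "C = (\<Sum>j\<le>n. cmod (c j))"
  define Mb where "Mb = max (C + 1) (MT / (\<sigma> / 2))"
  define L where "L = max 1 ((LT * MS + MT * LS) / ((\<sigma> / 2) * (\<sigma> / 2)))"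
  have "\<exists>r x. 0 < r \<and> r \<le> r0 \<and> (\<forall>i\<le>n. x i z0 = c i \<and>
           (\<forall>z\<in>ball z0 r. cmod (x i z - c i) \<le> \<rho>) \<and>
           (\<forall>z\<in>ball z0 r. (x i has_field_derivative G i z (\<lambda>j. x j z)) (at z)))"
  proof (rule holomorphic_picard[OF r0 \<rho>(1), where Mb = Mb and L = L])
    fix i z w assume *: "i \<le> n" "z \<in> ball z0 r0" "\<forall>j\<le>n. cmod (w j - c j) \<le> \<rho>"
    show "cmod (G i z w) \<le> Mb"
    proof (cases "i < n")
      case True
      have "cmod (w (Suc i)) \<le> cmod (c (Suc i)) + cmod (w (Suc i) - c (Suc i))" by (rule norm_triangle_sub)
      moreover have "cmod (w (Suc i) - c (Suc i)) \<le> \<rho>" using *(3) True by simp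
      moreover have "cmod (c (Suc i)) \<le> C" unfolding C_def using True by (intro member_le_sum) auto
      ultimately have "cmod (w (Suc i)) \<le> C + 1" using \<rho>(2) by linarith
      then show ?thesis using True by (simp add: G_def Mb_def)
    next
      case False
      have "cmod (T z w) / cmod (S' z w) \<le> MT / (\<sigma> / 2)"
        using MT(1,3) B[OF *(2)] pd[OF *(3)] Slow[OF *(2,3)] \<sigma> by (intro frac_le) auto
      then show ?thesis using False by (simp add: G_def Mb_def norm_divide)
    qed
    fix v \<delta> assume **: "\<forall>j\<le>n. cmod (v j - c j) \<le> \<rho>" "\<forall>j\<le>n. cmod (w j - v j) \<le> \<delta>"
    have \<delta>: "\<delta> \<ge> 0" using **(2) norm_ge_zero order_trans by blast
    show "cmod (G i z w - G i z v) \<le> L * \<delta>"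
    proof (cases "i < n")
      case True
      then have "cmod (G i z w - G i z v) \<le> 1 * \<delta>" using **(2) by (simp add: G_def)
      also have "\<dots> \<le> L * \<delta>" using \<delta> by (intro mult_right_mono) (auto simp: L_def)
      finally show ?thesis .
    next
      case False
      note Sw = Slow[OF *(2,3)] and Sv = Slow[OF *(2) **(1)]
      note zz = B(1)[OF *(2)] and pw = pd[OF *(3)] and pv = pd[OF **(1)]
      have dj: "\<forall>j<Suc n. cmod (w j - v j) \<le> \<delta>" using **(2) by (simp add: less_Suc_eq_le)
      have nz: "S' z w \<noteq> 0" "S' z v \<noteq> 0" using Sw Sv \<sigma> by auto
      \<comment> \<open>A difference of quotients over the common denominator: the lower bound on
        \<open>S'\<close> combines with the bounds on \<open>T\<close> and \<open>S'\<close> to a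
        Lipschitz constant.\<close>
      have "G i z w - G i z v = - ((T z w - T z v) * S' z v - T z v * (S' z w - S' z v)) / (S' z w * S' z v)"
        using False nz by (simp add: G_def field_simps)
      then have "cmod (G i z w - G i z v) =
          cmod ((T z w - T z v) * S' z v - T z v * (S' z w - S' z v)) / (cmod (S' z w) * cmod (S' z v))"
        by (simp add: norm_divide norm_mult norm_minus_commute)
      also have "\<dots> \<le> ((LT * MS + MT * LS) * \<delta>) / ((\<sigma> / 2) * (\<sigma> / 2))"
      proof (rule frac_le)
        have "cmod ((T z w - T z v) * S' z v) \<le> (LT * \<delta>) * MS"
          unfolding norm_mult using MT(2) \<delta>
          by (intro mult_mono MT(4)[OF zz pw pv \<delta> dj] MS(3)[OF zz pv]) auto
        moreover have "cmod (T z v * (S' z w - S' z v)) \<le> MT * (LS * \<delta>)"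
          unfolding norm_mult using MT(1)
          by (intro mult_mono MS(4)[OF zz pw pv \<delta> dj] MT(3)[OF zz pv]) auto
        ultimately show "cmod ((T z w - T z v) * S' z v - T z v * (S' z w - S' z v)) \<le> (LT * MS + MT * LS) * \<delta>"
          using norm_triangle_ineq4[of "(T z w - T z v) * S' z v" "T z v * (S' z w - S' z v)"]
          by (simp add: algebra_simps)
        show "(\<sigma> / 2) * (\<sigma> / 2) \<le> cmod (S' z w) * cmod (S' z v)"
          using Sw Sv \<sigma> by (intro mult_mono) auto
        show "0 \<le> (LT * MS + MT * LS) * \<delta>" using MT MS \<delta> by simp
        show "0 < (\<sigma> / 2) * (\<sigma> / 2)" using \<sigma> by simp
      qed
      also have "\<dots> = ((LT * MS + MT * LS) / ((\<sigma> / 2) * (\<sigma> / 2))) * \<delta>" by simp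
      also have "\<dots> \<le> L * \<delta>" using \<delta> by (intro mult_right_mono) (auto simp: L_def)
      finally show ?thesis .
    qed
  next
    fix i r x assume *: "i \<le> n" "0 < r" "r \<le> r0" "\<forall>j\<le>n. x j holomorphic_on ball z0 r"
      "\<forall>j\<le>n. \<forall>z\<in>ball z0 r. cmod (x j z - c j) \<le> \<rho>"
    have sub: "ball z0 r \<subseteq> ball z0 r0" using *(3) by (rule subset_ball)
    then have subU: "ball z0 r \<subseteq> U" using B(2) by blast
    show "(\<lambda>z. G i z (\<lambda>j. x j z)) holomorphic_on ball z0 r"
    proof (cases "i < n")
      case True
      then show ?thesis using *(4) by (simp add: G_def)
    next
      case False
      have h: "(\<lambda>z. T z (\<lambda>j. x j z)) holomorphic_on ball z0 r" "(\<lambda>z. S' z (\<lambda>j. x j z)) holomorphic_on ball z0 r"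
        using *(4) by (auto intro!: holpoly_holomorphic[OF T subU] holpoly_holomorphic[OF S' subU] simp: less_Suc_eq_le)
      have "S' z (\<lambda>j. x j z) \<noteq> 0" if "z \<in> ball z0 r" for z
        using Slow[of z "\<lambda>j. x j z"] that sub *(5) \<sigma> by fastforce
      then have "(\<lambda>z. - T z (\<lambda>j. x j z) / S' z (\<lambda>j. x j z)) holomorphic_on ball z0 r"
        by (intro holomorphic_on_divide holomorphic_on_minus h)
      then show ?thesis using False by (simp add: G_def)
    qed
  qed
  then obtain r x where r: "0 < r" "r \<le> r0" and x0: "\<And>i. i \<le> n \<Longrightarrow> x i z0 = c i"
     and x\<rho>: "\<And>i z. i \<le> n \<Longrightarrow> z \<in> ball z0 r \<Longrightarrow> cmod (x i z - c i) \<le> \<rho>"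
     and dx: "\<And>i z. i \<le> n \<Longrightarrow> z \<in> ball z0 r \<Longrightarrow> (x i has_field_derivative G i z (\<lambda>j. x j z)) (at z)" by blast
  have sub: "ball z0 r \<subseteq> ball z0 r0" using r(2) by (rule subset_ball)
  have subU: "ball z0 r \<subseteq> U" using sub B(2) by blast
  have xh: "x 0 holomorphic_on ball z0 r"
    unfolding holomorphic_on_open[OF open_ball] using dx[of 0] by blast
  have dd: "(deriv ^^ i) (x 0) z = x i z" if "i \<le> n" "z \<in> ball z0 r" for i z
    using that
  proof (induction i arbitrary: z)
    case (Suc i)
    have "deriv ((deriv ^^ i) (x 0)) z = deriv (x i) z"
    proof (rule deriv_cong_ev)
      show "\<forall>\<^sub>F w in nhds z. (deriv ^^ i) (x 0) w = x i w"
        unfolding eventually_nhds using Suc by (intro exI[of _ "ball z0 r"]) auto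
    qed simp
    also have "\<dots> = x (Suc i) z"
      using DERIV_imp_deriv[OF dx[of i z]] Suc.prems by (simp add: G_def)
    finally show ?case by simp
  qed simp
  \<comment> \<open>Along the solution the total derivative is
    \<open>T + S' * (- T / S')\<close>.\<close>
  have "((\<lambda>w. \<phi> w (\<lambda>i. x i w)) has_field_derivative 0) (at z within ball z0 r)" if z: "z \<in> ball z0 r" for z
  proof -
    have nz: "S' z (\<lambda>i. x i z) \<noteq> 0" using Slow[of z "\<lambda>j. x j z"] z sub x\<rho> \<sigma> by fastforce
    have 1: "\<forall>i<n. (x i has_field_derivative x (Suc i) z) (at z)"
    proof (intro allI impI)
      fix i assume "i < n"
      then show "(x i has_field_derivative x (Suc i) z) (at z)" using dx[of i z] z by (simp add: G_def)
    qed
    have 2: "(x n has_field_derivative - T z (\<lambda>i. x i z) / S' z (\<lambda>i. x i z)) (at z)"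
      using dx[of n z] z by (simp add: G_def)
    have "z \<in> U" using z subU by blast
    from total[OF this 1 2] have "((\<lambda>w. \<phi> w (\<lambda>i. x i w)) has_field_derivative 0) (at z)"
      using nz by simp
    then show ?thesis by (rule has_field_derivative_at_within)
  qed
  from has_field_derivative_zero_constant[OF convex_ball this]
  obtain k where k: "\<And>z. z \<in> ball z0 r \<Longrightarrow> \<phi> z (\<lambda>i. x i z) = k" by blast
  have "\<phi> z0 (\<lambda>i. x i z0) = \<phi> z0 c" by (rule holpoly_cong[OF \<phi>]) (simp add: x0)
  then have "k = 0" using k[of z0] r(1) c(1) by simp
  have "\<phi> z (\<lambda>i. (deriv ^^ i) (x 0) z) = 0" if z: "z \<in> ball z0 r" for z
  proof -
    have "\<phi> z (\<lambda>i. (deriv ^^ i) (x 0) z) = \<phi> z (\<lambda>i. x i z)"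
      by (rule holpoly_cong[OF \<phi>]) (use dd[OF _ z] in \<open>simp add: less_Suc_eq_le\<close>)
    then show ?thesis using k[OF z] \<open>k = 0\<close> by simp
  qed
  moreover have "\<forall>i\<le>n. (deriv ^^ i) (x 0) z0 = c i" using dd[of _ z0] r(1) x0 by simp
  ultimately show ?thesis using r(1) subU xh by blast
qed

section \<open>The field of germs is differentially closed\<close>

text \<open>\<phi>' computes \<phi> on representatives, whichever representatives of the first
  \<open>n\<close> arguments are taken. This is the bridge from polynomials over germs to functions
  that can be evaluated at points.\<close>

definition realizes :: "nat \<Rightarrow> ((nat \<Rightarrow> gfun) \<Rightarrow> gfun) \<Rightarrow> (complex \<Rightarrow> (nat \<Rightarrow> complex) \<Rightarrow> complex) \<Rightarrow> bool" where
  "realizes n \<phi> \<phi>' \<longleftrightarrow> (\<forall>f. (\<forall>i<n. germ_fun (f i)) \<longrightarrow>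
     germ_fun (\<lambda>z. \<phi>' z (\<lambda>i. f i z)) \<and> (\<forall>x. (\<forall>i<n. x i = germ (f i)) \<longrightarrow> \<phi> x = germ (\<lambda>z. \<phi>' z (\<lambda>i. f i z))))"

lemma realizesD:
  assumes "realizes n \<phi> \<phi>'" "\<And>i. i < n \<Longrightarrow> germ_fun (f i)"
  shows "germ_fun (\<lambda>z. \<phi>' z (\<lambda>i. f i z))"
    "(\<And>i. i < n \<Longrightarrow> x i = germ (f i)) \<Longrightarrow> \<phi> x = germ (\<lambda>z. \<phi>' z (\<lambda>i. f i z))"
  using assms unfolding realizes_def by blast+

lemma realizes_const: "germ_fun f \<Longrightarrow> realizes n (\<lambda>_. germ f) (\<lambda>z \<xi>. f z)"
  by (auto simp: realizes_def)

lemma realizes_var: "i < n \<Longrightarrow> realizes n (\<lambda>x. x i) (\<lambda>z \<xi>. \<xi> i)"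
  by (auto simp: realizes_def)

lemma realizes_add:
  assumes "realizes n \<phi> \<phi>'" "realizes n \<psi> \<psi>'"
  shows "realizes n (\<lambda>x. \<phi> x + \<psi> x) (\<lambda>z \<xi>. \<phi>' z \<xi> + \<psi>' z \<xi>)"
  unfolding realizes_def
proof (intro allI impI conjI)
  fix f assume f: "\<forall>i<n. germ_fun (f i)"
  note h = realizesD[OF assms(1), of f] realizesD[OF assms(2), of f]
  show "germ_fun (\<lambda>z. \<phi>' z (\<lambda>i. f i z) + \<psi>' z (\<lambda>i. f i z))" using f by (intro germ_fun_intros h) auto
  fix x assume "\<forall>i<n. x i = germ (f i)"
  then show "\<phi> x + \<psi> x = germ (\<lambda>z. \<phi>' z (\<lambda>i. f i z) + \<psi>' z (\<lambda>i. f i z))"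
    using f h by (simp add: germ_add)
qed

lemma realizes_mult:
  assumes "realizes n \<phi> \<phi>'" "realizes n \<psi> \<psi>'"
  shows "realizes n (\<lambda>x. \<phi> x * \<psi> x) (\<lambda>z \<xi>. \<phi>' z \<xi> * \<psi>' z \<xi>)"
  unfolding realizes_def
proof (intro allI impI conjI)
  fix f assume f: "\<forall>i<n. germ_fun (f i)"
  note h = realizesD[OF assms(1), of f] realizesD[OF assms(2), of f]
  show "germ_fun (\<lambda>z. \<phi>' z (\<lambda>i. f i z) * \<psi>' z (\<lambda>i. f i z))" using f by (intro germ_fun_intros h) auto
  fix x assume "\<forall>i<n. x i = germ (f i)"
  then show "\<phi> x * \<psi> x = germ (\<lambda>z. \<phi>' z (\<lambda>i. f i z) * \<psi>' z (\<lambda>i. f i z))"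
    using f h by (simp add: germ_mult)
qed

lemma realizes_of_nat: "realizes n (\<lambda>_. of_nat k) (\<lambda>z \<xi>. of_nat k)"
  unfolding germ_of_nat by (rule realizes_const) (rule germ_fun_intros)

lemma realizes_power: "realizes n \<phi> \<phi>' \<Longrightarrow> realizes n (\<lambda>x. \<phi> x ^ m) (\<lambda>z \<xi>. \<phi>' z \<xi> ^ m)"
proof (induction m)
  case 0 then show ?case using realizes_of_nat[of n 1] by simp
next
  case (Suc m) then show ?case by (auto intro: realizes_mult)
qed

lemma realizes_sum: "(\<And>i. i \<in> A \<Longrightarrow> realizes n (\<phi> i) (\<phi>' i)) \<Longrightarrow> realizes n (\<lambda>x. \<Sum>i\<in>A. \<phi> i x) (\<lambda>z \<xi>. \<Sum>i\<in>A. \<phi>' i z \<xi>)"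
proof (induction A rule: infinite_finite_induct)
  case (insert a A) then show ?case by (auto intro: realizes_add)
qed (use realizes_of_nat[of n 0] in auto)

lemma realizes_mono: "realizes n \<phi> \<phi>' \<Longrightarrow> n \<le> m \<Longrightarrow> realizes m \<phi> \<phi>'"
  unfolding realizes_def by (meson order_less_le_trans)

lemma polyfun_realizes:
  "\<phi> \<in> polyfun UNIV n \<Longrightarrow> \<exists>U\<in>generic. \<exists>\<phi>'\<in>holpoly U n. realizes n \<phi> \<phi>'"
proof (induction rule: polyfun.induct)
  case (polyfun_const c)
  obtain f where f: "germ_fun f" "germ f = c" using germ_exists by blast
  then obtain U where U: "U \<in> generic" "f holomorphic_on U" by (auto simp: germ_fun_def)
  have "(\<lambda>z \<xi>. f z) \<in> holpoly U n" by (rule holpoly_coeff) fact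
  moreover have "realizes n (\<lambda>x. c) (\<lambda>z \<xi>. f z)" using realizes_const[OF f(1)] f(2) by simp
  ultimately show ?case using U(1) by blast
next
  case (polyfun_var i)
  then show ?case using generic_ball realizes_var holpoly_var by blast
next
  case (polyfun_add \<phi> \<psi>)
  then obtain U \<phi>' V \<psi>' where *: "U \<in> generic" "\<phi>' \<in> holpoly U n" "realizes n \<phi> \<phi>'"
    "V \<in> generic" "\<psi>' \<in> holpoly V n" "realizes n \<psi> \<psi>'" by blast
  have "(\<lambda>z \<xi>. \<phi>' z \<xi> + \<psi>' z \<xi>) \<in> holpoly (U \<inter> V) n"
    by (intro holpoly_add holpoly_mono[OF *(2)] holpoly_mono[OF *(5)]) auto
  then show ?case
    by (intro bexI[OF _ generic_Int[OF *(1,4)]] bexI) (rule realizes_add[OF *(3,6)])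
next
  case (polyfun_mult \<phi> \<psi>)
  then obtain U \<phi>' V \<psi>' where *: "U \<in> generic" "\<phi>' \<in> holpoly U n" "realizes n \<phi> \<phi>'"
    "V \<in> generic" "\<psi>' \<in> holpoly V n" "realizes n \<psi> \<psi>'" by blast
  have "(\<lambda>z \<xi>. \<phi>' z \<xi> * \<psi>' z \<xi>) \<in> holpoly (U \<inter> V) n"
    by (intro holpoly_mult holpoly_mono[OF *(2)] holpoly_mono[OF *(5)]) auto
  then show ?case
    by (intro bexI[OF _ generic_Int[OF *(1,4)]] bexI) (rule realizes_mult[OF *(3,6)])
qed

text \<open>The product of the function with its inverse is 1 on a member, which rules out zeros
  there.\<close>

lemma germ_nonzero:
  assumes "germ_fun f" "germ f \<noteq> 0"
  shows "\<exists>U\<in>generic. f holomorphic_on U \<and> (\<forall>z\<in>U. f z \<noteq> 0)"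
proof -
  have "\<not> germ_rel f (\<lambda>_. 0)"
    using assms germ_eq_iff[OF assms(1) germ_fun_intros(1), of 0] germ_zero by simp
  then have "germ_rel (\<lambda>z. inverse (f z) * f z) (\<lambda>_. 1)" using germ_rel_zero_or_inverse[OF assms(1)] by blast
  then obtain U where U: "U \<in> generic" "\<forall>z\<in>U. inverse (f z) * f z = 1" unfolding germ_rel_def by blast
  obtain V where V: "V \<in> generic" "f holomorphic_on V" using assms(1) by (auto simp: germ_fun_def)
  have "f holomorphic_on U \<inter> V" by (rule holomorphic_on_subset[OF V(2)]) simp
  moreover have "\<forall>z\<in>U \<inter> V. f z \<noteq> 0" using U(2) by force
  ultimately show ?thesis using generic_Int[OF U(1) V(1)] by blast
qed

lemma germ_eq_zero:
  assumes "germ_fun f" "germ f = 0"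
  shows "\<exists>U\<in>generic. \<forall>z\<in>U. f z = 0"
proof -
  have "germ_rel f (\<lambda>_. 0)"
    using assms germ_eq_iff[OF assms(1) germ_fun_intros(1), of 0] germ_zero by simp
  then show ?thesis unfolding germ_rel_def by blast
qed

lemma holpoly_nonzero_open:
  assumes "open U" "\<phi> \<in> holpoly U n" "\<And>i. i < n \<Longrightarrow> x i holomorphic_on U"
  shows "open {z\<in>U. \<phi> z (\<lambda>i. x i z) \<noteq> 0}"
proof -
  have "continuous_on U (\<lambda>z. \<phi> z (\<lambda>i. x i z))"
    using holpoly_holomorphic[OF assms(2) order_refl] assms(3) holomorphic_on_imp_continuous_on by blast
  then have "open (U \<inter> (\<lambda>z. \<phi> z (\<lambda>i. x i z)) -` (- {0}))"
    using assms(1) by (intro continuous_open_preimage) auto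
  also have "U \<inter> (\<lambda>z. \<phi> z (\<lambda>i. x i z)) -` (- {0}) = {z\<in>U. \<phi> z (\<lambda>i. x i z) \<noteq> 0}" by auto
  finally show ?thesis .
qed

text \<open>
  If the realization were nonzero at a dense set of points, then gluing constants would produce
  germs at which the polynomial does not vanish.
\<close>

lemma realizes_zero:
  assumes U: "U \<in> generic" and \<phi>': "\<phi>' \<in> holpoly U n" and r: "realizes n \<phi> \<phi>'" and zero: "\<And>x. \<phi> x = 0"
  shows "\<exists>V\<in>generic. V \<subseteq> U \<and> (\<forall>z\<in>V. \<forall>\<xi>. \<phi>' z \<xi> = 0)"
proof -
  \<comment> \<open>The points at which some choice of constants gives a nonzero value, an open set.
    If the filter rejects it, a member avoids it.\<close>
  define E where "E = (\<Union>\<xi>. {z\<in>U. \<phi>' z \<xi> \<noteq> 0})"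
  have open1: "open {z\<in>U. \<phi>' z \<xi> \<noteq> 0}" for \<xi>
    using holpoly_nonzero_open[OF generic_open[OF U] \<phi>', of "\<lambda>i _. \<xi> i"] by simp
  then have oE: "open E" unfolding E_def by blast
  have "E \<notin> generic"
  proof
    assume E: "E \<in> generic"
    have "\<exists>D\<in>generic. \<exists>x. (\<forall>i. x i holomorphic_on D) \<and> (\<forall>z\<in>D. \<phi>' z (\<lambda>i. x i z) \<noteq> 0)"
    proof (rule generic_glue[OF E])
      fix x y :: "nat \<Rightarrow> complex \<Rightarrow> complex" and z N
      assume "z \<in> N" "\<forall>w\<in>N. \<forall>i. x i w = y i w" "\<phi>' z (\<lambda>i. x i z) \<noteq> 0"
      then show "\<phi>' z (\<lambda>i. y i z) \<noteq> 0" by simp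
    next
      fix W assume W: "open W" "W \<noteq> {}" "W \<subseteq> E"
      then obtain z \<xi> where z: "z \<in> W" "z \<in> U" "\<phi>' z \<xi> \<noteq> 0" unfolding E_def by blast
      define B where "B = W \<inter> {z\<in>U. \<phi>' z \<xi> \<noteq> 0}"
      have "open B" unfolding B_def by (rule open_Int[OF W(1) open1])
      moreover have "z \<in> B" using z by (simp add: B_def)
      moreover have "B \<subseteq> W" by (simp add: B_def)
      moreover have "\<forall>i. (\<lambda>_. \<xi> i) holomorphic_on B" by simp
      moreover have "\<forall>z\<in>B. \<phi>' z (\<lambda>i. \<xi> i) \<noteq> 0" by (simp add: B_def)
      ultimately show "\<exists>B x. open B \<and> B \<noteq> {} \<and> B \<subseteq> W \<and> (\<forall>i. x i holomorphic_on B) \<and> (\<forall>z\<in>B. \<phi>' z (\<lambda>i. x i z) \<noteq> 0)"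
        by (intro exI[of _ B] exI[of _ "\<lambda>i _. \<xi> i"]) auto
    qed
    then obtain D x where D: "D \<in> generic" "\<And>i. x i holomorphic_on D" "\<And>z. z \<in> D \<Longrightarrow> \<phi>' z (\<lambda>i. x i z) \<noteq> 0" by blast
    have gx: "germ_fun (x i)" for i using D(1,2) by (rule germ_funI)
    have "germ (\<lambda>z. \<phi>' z (\<lambda>i. x i z)) = 0"
      using realizesD(2)[OF r, of x "\<lambda>i. germ (x i)"] gx zero by simp
    from germ_eq_zero[OF realizesD(1)[OF r gx] this]
    obtain V where V: "V \<in> generic" "\<And>z. z \<in> V \<Longrightarrow> \<phi>' z (\<lambda>i. x i z) = 0" by blast
    have "D \<inter> V \<noteq> {}" using generic_nonempty[OF generic_Int[OF D(1) V(1)]] .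
    then show False using D(3) V(2) by blast
  qed
  then obtain V where V: "V \<in> generic" "E \<inter> V = {}" using generic_maximal oE by blast
  have "\<forall>z\<in>U \<inter> V. \<forall>\<xi>. \<phi>' z \<xi> = 0" using V(2) unfolding E_def by blast
  then show ?thesis using generic_Int[OF U V(1)] by blast
qed

lemma germ_jet:
  assumes "D \<in> generic" "x holomorphic_on D"
  shows "jet gderiv (germ x) i = germ ((deriv ^^ i) x)" "(deriv ^^ i) x holomorphic_on D"
proof -
  have h: "(deriv ^^ i) x holomorphic_on D" for i
    using assms generic_open by (induction i) (auto intro: holomorphic_deriv)
  then show "(deriv ^^ i) x holomorphic_on D" .
  show "jet gderiv (germ x) i = germ ((deriv ^^ i) x)"
    by (induction i) (auto simp: jet_def germ_deriv[OF germ_funI[OF assms(1) h]])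
qed

text \<open>Higher derivatives at a point depend on the function near that point only, as the
  locality condition of \<open>generic_glue\<close> demands.\<close>

lemma higher_deriv_local:
  "open N \<Longrightarrow> z \<in> N \<Longrightarrow> (\<forall>w\<in>N. x w = y w) \<Longrightarrow> (deriv ^^ i) x z = (deriv ^^ i) (y :: complex \<Rightarrow> complex) z"
proof (induction i arbitrary: z)
  case (Suc i)
  have "deriv ((deriv ^^ i) x) z = deriv ((deriv ^^ i) y) z"
  proof (rule deriv_cong_ev)
    show "\<forall>\<^sub>F w in nhds z. (deriv ^^ i) x w = (deriv ^^ i) y w"
      unfolding eventually_nhds using Suc by (intro exI[of _ N]) auto
  qed simp
  then show ?case by simp
qed simp

text \<open>The fundamental theorem of algebra supplies the initial value of the highest
  derivative.\<close>

lemma upoly_root: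
  assumes "1 \<le> d" "c d \<noteq> (0::complex)"
  shows "\<exists>t. (\<Sum>k\<le>d. c k * t ^ k) = 0"
proof -
  define p where "p = (\<Sum>k\<le>d. Polynomial.monom (c k) k)"
  have cf: "Polynomial.coeff p j = (\<Sum>k\<le>d. if k = j then c k else 0)" for j
    unfolding p_def Polynomial.coeff_sum by (simp add: Polynomial.coeff_monom)
  then have "Polynomial.coeff p d \<noteq> 0" using assms by simp
  then have "Polynomial.degree p \<noteq> 0" using assms(1) le_degree[of p d] by fastforce
  then have "\<not> constant (poly p)" by (simp add: constant_degree)
  then obtain t where "poly p t = 0" using fundamental_theorem_of_algebra by blast
  then show ?thesis by (auto simp: p_def poly_sum Polynomial.poly_monom)
qed

text \<open>In any small open set pick a point: the values there of representatives of
  \<open>x0\<close> serve as lower derivatives, and a root of the equation as the highest one. The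
  Bezout identity makes the separant nonzero at these initial values, so
  \<open>holpoly_ode_local\<close> applies, and the local solutions are glued.\<close>

lemma blum_gderiv_separable:
  assumes q: "coef_funs UNIV n e q" "1 \<le> e"
    and A: "A \<in> polyfun UNIV (Suc n)" and B: "B \<in> polyfun UNIV (Suc n)" and c: "c \<in> polyfun UNIV n"
    and bez: "\<And>\<xi>. A \<xi> * upoly n e q \<xi> + B \<xi> * (\<Sum>k\<le>e. of_nat k * q k \<xi> * \<xi> n ^ (k - 1)) = c \<xi>"
    and g: "g \<in> polyfun UNIV n" and nz: "q e x0 * c x0 * g x0 \<noteq> 0"
  shows "\<exists>x. upoly n e q (jet gderiv x) = 0 \<and> g (jet gderiv x) \<noteq> 0"
proof -
  have "\<forall>k\<in>{..e}. \<exists>U\<in>generic. \<exists>\<phi>'\<in>holpoly U n. realizes n (q k) \<phi>'"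
    using q(1) polyfun_realizes by (auto simp: coef_funs_def)
  then obtain Uq q' where Uq: "\<And>k. k \<le> e \<Longrightarrow> Uq k \<in> generic" and q': "\<And>k. k \<le> e \<Longrightarrow> q' k \<in> holpoly (Uq k) n"
     "\<And>k. k \<le> e \<Longrightarrow> realizes n (q k) (q' k)" by (metis atMost_iff)
  obtain UA A' where A': "UA \<in> generic" "A' \<in> holpoly UA (Suc n)" "realizes (Suc n) A A'" using polyfun_realizes[OF A] by blast
  obtain UB B' where B': "UB \<in> generic" "B' \<in> holpoly UB (Suc n)" "realizes (Suc n) B B'" using polyfun_realizes[OF B] by blast
  obtain Uc c' where c': "Uc \<in> generic" "c' \<in> holpoly Uc n" "realizes n c c'" using polyfun_realizes[OF c] by blast
  obtain Ug g' where g': "Ug \<in> generic" "g' \<in> holpoly Ug n" "realizes n g g'" using polyfun_realizes[OF g] by blast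
  define U1 where "U1 = (\<Inter>k\<in>{..e}. Uq k)"
  have U1: "U1 \<in> generic"
  proof -
    have "(\<Inter>k\<in>{..m}. Uq k) \<in> generic" if "m \<le> e" for m
      using that by (induction m) (auto simp: atMost_Suc Uq intro: generic_Int)
    then show ?thesis by (simp add: U1_def)
  qed
  define U where "U = U1 \<inter> (UA \<inter> (UB \<inter> (Uc \<inter> Ug)))"
  have U: "U \<in> generic" unfolding U_def by (intro generic_Int U1 A' B' c' g')
  have hq: "q' k \<in> holpoly U n" if "k \<le> e" for k
    by (rule holpoly_mono[OF q'(1)[OF that]]) (use that in \<open>auto simp: U_def U1_def\<close>)
  have hA: "A' \<in> holpoly U (Suc n)" by (rule holpoly_mono[OF A'(2)]) (auto simp: U_def)
  have hB: "B' \<in> holpoly U (Suc n)" by (rule holpoly_mono[OF B'(2)]) (auto simp: U_def)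
  have hc: "c' \<in> holpoly U n" by (rule holpoly_mono[OF c'(2)]) (auto simp: U_def)
  have hg: "g' \<in> holpoly U n" by (rule holpoly_mono[OF g'(2)]) (auto simp: U_def)
  define p where "p z \<xi> = (\<Sum>k\<le>e. q' k z \<xi> * \<xi> n ^ k)" for z \<xi>
  define s where "s z \<xi> = (\<Sum>k\<le>e. of_nat k * q' k z \<xi> * \<xi> n ^ (k - 1))" for z \<xi>
  have hq': "q' k \<in> holpoly U (Suc n)" if "k \<le> e" for k by (rule holpoly_mono[OF hq[OF that]]) auto
  have hp: "p \<in> holpoly U (Suc n)"
    unfolding p_def [abs_def] by (intro holpoly_sum holpoly_mult holpoly_power holpoly_var hq') auto
  have hs: "s \<in> holpoly U (Suc n)"
    unfolding s_def [abs_def] by (intro holpoly_sum holpoly_mult holpoly_power holpoly_var holpoly_const hq') auto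
  have rq: "realizes (Suc n) (q k) (q' k)" if "k \<le> e" for k by (rule realizes_mono[OF q'(2)[OF that]]) auto
  have rp: "realizes (Suc n) (upoly n e q) p"
    unfolding p_def [abs_def] upoly_def [abs_def]
    by (intro realizes_sum realizes_mult realizes_power realizes_var rq) auto
  have rs: "realizes (Suc n) (\<lambda>\<xi>. \<Sum>k\<le>e. of_nat k * q k \<xi> * \<xi> n ^ (k - 1)) s"
    unfolding s_def [abs_def]
    by (intro realizes_sum realizes_mult realizes_power realizes_var realizes_of_nat rq) auto
  have minus_one: "realizes (Suc n) (\<lambda>_. - 1) (\<lambda>z \<xi>. - 1)"
  proof -
    have "- 1 = germ (\<lambda>z. - 1)" by (simp add: germ_one germ_minus germ_fun_intros)
    then show ?thesis using realizes_const[OF germ_fun_intros(1), of "Suc n" "- 1"] by simp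
  qed
  \<comment> \<open>Bezout as an identity of germs for all arguments; \<open>realizes_zero\<close>
    turns it into an identity at all points of a member and for all complex values of the
    variables.\<close>
  have rz: "realizes (Suc n) (\<lambda>\<xi>. (A \<xi> * upoly n e q \<xi> + B \<xi> * (\<Sum>k\<le>e. of_nat k * q k \<xi> * \<xi> n ^ (k - 1))) + (- 1) * c \<xi>)
      (\<lambda>z \<xi>. (A' z \<xi> * p z \<xi> + B' z \<xi> * s z \<xi>) + (- 1) * c' z \<xi>)"
    by (intro realizes_add realizes_mult A' B' rp rs minus_one realizes_mono[OF c'(3)]) simp
  have hz: "(\<lambda>z \<xi>. (A' z \<xi> * p z \<xi> + B' z \<xi> * s z \<xi>) + (- 1) * c' z \<xi>) \<in> holpoly U (Suc n)"
    by (intro holpoly_add holpoly_mult hA hB hp hs holpoly_const holpoly_mono[OF hc]) auto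
  obtain V where V: "V \<in> generic" "V \<subseteq> U" "\<And>z \<xi>. z \<in> V \<Longrightarrow> (A' z \<xi> * p z \<xi> + B' z \<xi> * s z \<xi>) + (- 1) * c' z \<xi> = 0"
    using realizes_zero[OF U hz rz] bez by auto
  \<comment> \<open>All nonvanishing conditions in one product. It involves the variables below
    \<open>n\<close>, so initial values for the lower derivatives settle it.\<close>
  define \<Phi> where "\<Phi> \<xi> = q e \<xi> * c \<xi> * g \<xi>" for \<xi>
  define \<Phi>' where "\<Phi>' z \<xi> = q' e z \<xi> * c' z \<xi> * g' z \<xi>" for z \<xi>
  have h\<Phi>: "\<Phi>' \<in> holpoly U n" unfolding \<Phi>'_def [abs_def] by (intro holpoly_mult hq hc hg) auto
  have r\<Phi>: "realizes n \<Phi> \<Phi>'" unfolding \<Phi>'_def [abs_def] \<Phi>_def [abs_def]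
    by (intro realizes_mult q' c' g') auto
  have "\<forall>i. \<exists>f. germ_fun f \<and> germ f = x0 i" using germ_exists by blast
  then obtain f where f: "\<And>i. germ_fun (f i)" "\<And>i. germ (f i) = x0 i" by metis
  have "germ (\<lambda>z. \<Phi>' z (\<lambda>i. f i z)) = \<Phi> x0"
    using realizesD(2)[OF r\<Phi>, of f x0] f by simp
  also have "\<dots> \<noteq> 0" using nz by (simp add: \<Phi>_def)
  finally obtain V2 where V2: "V2 \<in> generic" "\<And>z. z \<in> V2 \<Longrightarrow> \<Phi>' z (\<lambda>i. f i z) \<noteq> 0"
    using germ_nonzero[OF realizesD(1)[OF r\<Phi>]] f by blast
  define W0 where "W0 = V \<inter> V2"
  have W0: "W0 \<in> generic" unfolding W0_def by (intro generic_Int V V2)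
  \<comment> \<open>A single function is glued, hence the index type \<open>unit\<close>; its
    derivatives are determined by it and must not be glued separately.\<close>
  define R where "R x z \<longleftrightarrow> p z (\<lambda>i. (deriv ^^ i) (x ()) z) = 0 \<and> \<Phi>' z (\<lambda>i. (deriv ^^ i) (x ()) z) \<noteq> 0" for x :: "unit \<Rightarrow> complex \<Rightarrow> complex" and z
  have "\<exists>D\<in>generic. \<exists>x. (\<forall>i. x i holomorphic_on D) \<and> (\<forall>z\<in>D. R x z)"
  proof (rule generic_glue[OF W0])
    fix x y :: "unit \<Rightarrow> complex \<Rightarrow> complex" and z N
    assume N: "open N" "z \<in> N" "\<forall>w\<in>N. \<forall>i. x i w = y i w" and R: "R x z"
    have "(deriv ^^ i) (x ()) z = (deriv ^^ i) (y ()) z" for i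
      using N by (intro higher_deriv_local[of N]) auto
    with R show "R y z" unfolding R_def by simp
  next
    fix W assume W: "open W" "W \<noteq> {}" "W \<subseteq> W0"
    then obtain z0 where z0: "z0 \<in> W" by blast
    have z0': "z0 \<in> V" "z0 \<in> V2" "z0 \<in> U" using z0 W V by (auto simp: W0_def)
    have WU: "W \<subseteq> U" using W V by (auto simp: W0_def)
    define b where "b i = f i z0" for i
    have \<Phi>b: "\<Phi>' z0 b \<noteq> 0" using V2(2)[OF z0'(2)] by (simp add: b_def [abs_def])
    then have "q' e z0 b \<noteq> 0" by (simp add: \<Phi>'_def)
    then obtain t where t: "(\<Sum>k\<le>e. q' k z0 b * t ^ k) = 0"
      using upoly_root[OF q(2), of "\<lambda>k. q' k z0 b"] by blast
    \<comment> \<open>Changing the entry in position \<open>n\<close> affects neither the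
      coefficients \<open>q' k\<close> nor \<Phi>', which involve the variables below
      \<open>n\<close>.\<close>
    define b' where "b' = b(n := t)"
    have qb: "q' k z0 b' = q' k z0 b" if "k \<le> e" for k
      by (rule holpoly_cong[OF hq[OF that]]) (simp add: b'_def)
    have pb: "p z0 b' = 0" using t qb by (simp add: p_def b'_def)
    have \<Phi>b': "\<Phi>' z0 b' \<noteq> 0" using \<Phi>b holpoly_cong[OF h\<Phi>, of b b'] by (simp add: b'_def)
    have "c' z0 b' \<noteq> 0" using \<Phi>b' by (simp add: \<Phi>'_def)
    then have sb: "s z0 b' \<noteq> 0" using V(3)[OF z0'(1), of b'] pb by auto
    have ds: "((\<lambda>t. p z (\<xi>(n := t))) has_field_derivative s z (\<xi>(n := t))) (at t)" for z \<xi> t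
    proof -
      have qc: "q' k z (\<xi>(n := t)) = q' k z \<xi>" if "k \<le> e" for k t
        by (rule holpoly_cong[OF hq[OF that]]) simp
      have "((\<lambda>t. \<Sum>k\<le>e. q' k z \<xi> * t ^ k) has_field_derivative (\<Sum>k\<le>e. of_nat k * q' k z \<xi> * t ^ (k - 1))) (at t)"
        by (rule DERIV_sum) (auto intro!: derivative_eq_intros simp: mult_ac)
      moreover have "p z (\<xi>(n := t)) = (\<Sum>k\<le>e. q' k z \<xi> * t ^ k)" for t
        unfolding p_def by (intro sum.cong) (auto simp: qc)
      moreover have "s z (\<xi>(n := t)) = (\<Sum>k\<le>e. of_nat k * q' k z \<xi> * t ^ (k - 1))"
        unfolding s_def by (intro sum.cong) (auto simp: qc)
      ultimately show ?thesis by simp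
    qed
    obtain r x where r: "r > 0" "ball z0 r \<subseteq> W" and x: "x holomorphic_on ball z0 r"
       "\<forall>z\<in>ball z0 r. p z (\<lambda>i. (deriv ^^ i) x z) = 0" "\<forall>i\<le>n. (deriv ^^ i) x z0 = b' i"
      using holpoly_ode_local[OF W(1) z0 holpoly_mono[OF hp WU order_refl] ds pb sb] by blast
    have dh: "(deriv ^^ i) x holomorphic_on ball z0 r" for i
      using x(1) by (induction i) (auto intro: holomorphic_deriv)
    \<comment> \<open>The inequation holds at \<open>z0\<close> by the choice of initial values; an
      open set around it keeps the inequation everywhere.\<close>
    define Bn where "Bn = {z\<in>ball z0 r. \<Phi>' z (\<lambda>i. (deriv ^^ i) x z) \<noteq> 0}"
    have "open Bn" unfolding Bn_def
      using r(2) WU by (intro holpoly_nonzero_open holpoly_mono[OF h\<Phi>] dh) auto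
    moreover have "z0 \<in> Bn"
    proof -
      have "\<Phi>' z0 (\<lambda>i. (deriv ^^ i) x z0) = \<Phi>' z0 b'"
        by (rule holpoly_cong[OF h\<Phi>]) (use x(3) in simp)
      then show ?thesis using \<Phi>b' r(1) by (simp add: Bn_def)
    qed
    moreover have "Bn \<subseteq> ball z0 r" by (auto simp: Bn_def)
    moreover from this have "x holomorphic_on Bn" by (rule holomorphic_on_subset[OF x(1)])
    moreover have "\<forall>z\<in>Bn. R (\<lambda>_. x) z" using x(2) by (auto simp: R_def Bn_def)
    ultimately show "\<exists>B x. open B \<and> B \<noteq> {} \<and> B \<subseteq> W \<and> (\<forall>i. x i holomorphic_on B) \<and> (\<forall>z\<in>B. R x z)"
      using r(2) by (intro exI[of _ Bn] exI[of _ "\<lambda>_. x"]) auto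
  qed
  then obtain D x' where D: "D \<in> generic" "\<And>i. x' i holomorphic_on D" "\<And>z. z \<in> D \<Longrightarrow> R x' z" by blast
  define x where "x = x' ()"
  have hx: "x holomorphic_on D" using D(2) by (simp add: x_def)
  have gx: "germ_fun ((deriv ^^ i) x)" for i using germ_funI[OF D(1) germ_jet(2)[OF D(1) hx]] .
  have jx: "jet gderiv (germ x) i = germ ((deriv ^^ i) x)" for i using germ_jet(1)[OF D(1) hx] .
  have "upoly n e q (jet gderiv (germ x)) = germ (\<lambda>z. p z (\<lambda>i. (deriv ^^ i) x z))"
    by (rule realizesD(2)[OF rp gx jx])
  also have "\<dots> = germ (\<lambda>_. 0)"
    by (rule germ_eqI[symmetric, OF D(1)]) (use D(3) in \<open>auto simp: R_def x_def\<close>)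
  finally have 1: "upoly n e q (jet gderiv (germ x)) = 0" by (simp add: germ_zero)
  have "\<Phi> (jet gderiv (germ x)) \<noteq> 0"
  proof
    assume z: "\<Phi> (jet gderiv (germ x)) = 0"
    have "germ (\<lambda>z. \<Phi>' z (\<lambda>i. (deriv ^^ i) x z)) = \<Phi> (jet gderiv (germ x))"
      by (rule realizesD(2)[OF r\<Phi> gx jx, symmetric])
    then have "germ (\<lambda>z. \<Phi>' z (\<lambda>i. (deriv ^^ i) x z)) = 0" using z by simp
    from germ_eq_zero[OF realizesD(1)[OF r\<Phi> gx] this]
    obtain V3 where V3: "V3 \<in> generic" "\<And>z. z \<in> V3 \<Longrightarrow> \<Phi>' z (\<lambda>i. (deriv ^^ i) x z) = 0" by blast
    have "D \<inter> V3 \<noteq> {}" using generic_nonempty[OF generic_Int[OF D(1) V3(1)]] .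
    then obtain z where "z \<in> D" "z \<in> V3" by blast
    then show False using D(3)[of z] V3(2)[of z] unfolding R_def x_def by simp
  qed
  then have "g (jet gderiv (germ x)) \<noteq> 0" by (simp add: \<Phi>_def)
  with 1 show ?thesis by blast
qed

text \<open>Solving an equation requires a nonzero separant, which an arbitrary \<open>a\<close> may
  fail to have. Among the factors of positive degree of multiples of \<open>a\<close> by polynomials
  free of variable \<open>n\<close>, one of least degree satisfies \<open>separable_bezout\<close>,
  and its solutions off the zeros of the multiplier \<open>c\<close> solve \<open>a\<close>.\<close>

theorem blum_closed_gderiv: "blum_closed gderiv"
  unfolding blum_closed_def
proof (intro allI impI)
  fix n d and a :: "nat \<Rightarrow> (nat \<Rightarrow> gfun) \<Rightarrow> gfun" and g :: "(nat \<Rightarrow> gfun) \<Rightarrow> gfun"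
  assume d: "1 \<le> d" and a: "coef_funs UNIV n d a" "\<exists>\<xi>. a d \<xi> \<noteq> 0" and g: "g \<in> polyfun UNIV n" "\<exists>\<xi>. g \<xi> \<noteq> 0"
  note K = field_subset_UNIV[where 'a = gfun]
  define E where "E e \<longleftrightarrow> 1 \<le> e \<and> (\<exists>q B c. coef_funs UNIV n e q \<and> (\<exists>\<xi>. q e \<xi> \<noteq> 0) \<and>
     c \<in> polyfun UNIV n \<and> (\<exists>\<xi>. c \<xi> \<noteq> 0) \<and> (\<forall>\<xi>. upoly n e q \<xi> * B \<xi> = c \<xi> * upoly n d a \<xi>))" for e
  have "E d" unfolding E_def
    by (rule conjI[OF d], rule exI[of _ a], rule exI[of _ "\<lambda>\<xi>. 1"], rule exI[of _ "\<lambda>\<xi>. 1"])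
       (use d a polyfun_one[OF K, of n] in simp)
  define e where "e = (LEAST e. E e)"
  have "E e" unfolding e_def by (rule LeastI) fact
  have e_min: "e \<le> e'" if "E e'" for e' unfolding e_def by (rule Least_le, rule that)
  obtain q B c where e: "1 \<le> e" and q: "coef_funs UNIV n e q" "\<exists>\<xi>. q e \<xi> \<noteq> 0" and c: "c \<in> polyfun UNIV n" "\<exists>\<xi>. c \<xi> \<noteq> 0"
    and qB: "\<And>\<xi>. upoly n e q \<xi> * B \<xi> = c \<xi> * upoly n d a \<xi>"
    using \<open>E e\<close> unfolding E_def by blast
  have "\<exists>A B c. A \<in> polyfun UNIV (Suc n) \<and> B \<in> polyfun UNIV (Suc n) \<and> c \<in> polyfun UNIV n \<and> (\<exists>\<xi>. c \<xi> \<noteq> 0) \<and>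
           (\<forall>\<xi>. A \<xi> * upoly n e q \<xi> + B \<xi> * (\<Sum>k\<le>e. of_nat k * q k \<xi> * \<xi> n ^ (k - 1)) = c \<xi>)"
  proof (rule separable_bezout[OF K q e])
    fix c' e' R B' assume *: "c' \<in> polyfun UNIV n" "\<exists>\<xi>. c' \<xi> \<noteq> 0" "1 \<le> e'" "e' < e" "R \<in> deg_eq UNIV n e'"
        "\<And>\<xi>. c' \<xi> * upoly n e q \<xi> = R \<xi> * B' \<xi>"
    obtain r where r: "coef_funs UNIV n e' r" "\<exists>\<xi>. r e' \<xi> \<noteq> 0" "R = upoly n e' r" using *(5) by (auto simp: deg_eq_def)
    obtain \<xi>1 where "c' \<xi>1 \<noteq> 0 \<and> c \<xi>1 \<noteq> 0" using polyfun_common_nonzero[OF *(1) c(1)] *(2) c(2) by blast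
    then have nz: "\<exists>\<xi>. c' \<xi> * c \<xi> \<noteq> 0" by (intro exI[of _ \<xi>1]) simp
    \<comment> \<open>A factor of a multiple of \<open>q\<close> is again a factor of a multiple of
      \<open>a\<close>, here of smaller degree than \<open>q\<close>.\<close>
    have "upoly n e' r \<xi> * (B' \<xi> * B \<xi>) = c' \<xi> * c \<xi> * upoly n d a \<xi>" for \<xi>
      using *(6)[of \<xi>] qB[of \<xi>] unfolding r(3) by (metis mult.assoc mult.left_commute)
    then have "E e'" unfolding E_def
      using *(3) r(1,2) nz polyfun_mult[OF *(1) c(1)]
      by (intro conjI exI[of _ r] exI[of _ "\<lambda>\<xi>. B' \<xi> * B \<xi>"] exI[of _ "\<lambda>\<xi>. c' \<xi> * c \<xi>"]) auto
    then show False using e_min[of e'] *(4) by linarith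
  qed
  then obtain A' B' c' where bez: "A' \<in> polyfun UNIV (Suc n)" "B' \<in> polyfun UNIV (Suc n)" "c' \<in> polyfun UNIV n" "\<exists>\<xi>. c' \<xi> \<noteq> 0"
    "\<And>\<xi>. A' \<xi> * upoly n e q \<xi> + B' \<xi> * (\<Sum>k\<le>e. of_nat k * q k \<xi> * \<xi> n ^ (k - 1)) = c' \<xi>" by blast
  have qe: "q e \<in> polyfun UNIV n" using q(1) by (simp add: coef_funs_def)
  obtain \<xi>1 where 1: "g \<xi>1 \<noteq> 0 \<and> c \<xi>1 \<noteq> 0" using polyfun_common_nonzero[OF g(1) c(1)] g(2) c(2) by blast
  obtain \<xi>2 where 2: "q e \<xi>2 \<noteq> 0 \<and> c' \<xi>2 \<noteq> 0" using polyfun_common_nonzero[OF qe bez(3)] q(2) bez(4) by blast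
  have gc: "(\<lambda>\<xi>. g \<xi> * c \<xi>) \<in> polyfun UNIV n" by (intro polyfun_mult g c)
  \<comment> \<open>A priori the four polynomials are nonzero at different points; restricting to
    lines through pairs of points yields a common one.\<close>
  have "\<exists>\<xi>. (g \<xi> * c \<xi>) \<noteq> 0 \<and> (q e \<xi> * c' \<xi>) \<noteq> 0"
    by (rule polyfun_common_nonzero[OF gc polyfun_mult[OF qe bez(3)]]) (use 1 2 in auto)
  then obtain \<xi>3 where "q e \<xi>3 * c' \<xi>3 * (g \<xi>3 * c \<xi>3) \<noteq> 0" by auto
  from blum_gderiv_separable[OF q(1) e bez(1-3,5) gc this]
  obtain x where x: "upoly n e q (jet gderiv x) = 0" "g (jet gderiv x) * c (jet gderiv x) \<noteq> 0" by blast
  then show "\<exists>x. upoly n d a (jet gderiv x) = 0 \<and> g (jet gderiv x) \<noteq> 0"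
    using qB[of "jet gderiv x"] by (intro exI[of _ x]) auto
qed

text \<open>Rescaling a disc to the unit disc multiplies the derivation by a constant. Jets for the
  two derivations differ by powers of \<kappa>, so an equation for one becomes an equation of the
  same order for the other.\<close>

lemma blum_closed_scale:
  fixes D :: "'a::field_char_0 \<Rightarrow> 'a"
  assumes D: "derivation D" and blum: "blum_closed D" and \<kappa>: "D \<kappa> = 0" "\<kappa> \<noteq> 0"
  shows "blum_closed (\<lambda>x. \<kappa> * D x)"
  unfolding blum_closed_def
proof (intro allI impI)
  fix n d and a :: "nat \<Rightarrow> (nat \<Rightarrow> 'a) \<Rightarrow> 'a" and g :: "(nat \<Rightarrow> 'a) \<Rightarrow> 'a"
  assume d: "1 \<le> d" and a: "coef_funs UNIV n d a" "\<exists>\<xi>. a d \<xi> \<noteq> 0" and g: "g \<in> polyfun UNIV n" "\<exists>\<xi>. g \<xi> \<noteq> 0"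
  note K = field_subset_UNIV[where 'a = 'a]
  have Dk: "D (\<kappa> ^ i * x) = \<kappa> ^ i * D x" for i x
    by (simp add: derivation_mult[OF D] derivation_power[OF D] \<kappa>)
  have jet: "jet (\<lambda>x. \<kappa> * D x) x = (\<lambda>i. \<kappa> ^ i * jet D x i)" for x
  proof
    fix i show "jet (\<lambda>x. \<kappa> * D x) x i = \<kappa> ^ i * jet D x i"
      by (induction i) (auto simp: jet_def Dk)
  qed
  \<comment> \<open>The factor \<open>\<kappa> ^ (n * k)\<close> comes from
    \<open>(\<kappa> ^ n * \<xi> n) ^ k\<close>, the power of the highest variable.\<close>
  define a' where "a' k \<xi> = \<kappa> ^ (n * k) * a k (\<lambda>i. \<kappa> ^ i * \<xi> i)" for k \<xi>
  define g' where "g' \<xi> = g (\<lambda>i. \<kappa> ^ i * \<xi> i)" for \<xi>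
  have inv: "(\<lambda>i. \<kappa> ^ i * (\<xi> i / \<kappa> ^ i)) = \<xi>" for \<xi> using \<kappa>(2) by auto
  have "coef_funs UNIV n d a'"
    unfolding coef_funs_def
  proof (intro allI impI)
    fix k assume "k \<le> d"
    then have "a k \<in> polyfun UNIV n" using a(1) by (simp add: coef_funs_def)
    note 1 = polyfun_scale[OF K this, of "\<lambda>i. \<kappa> ^ i", OF UNIV_I]
    have 2: "(\<lambda>\<xi>. \<kappa> ^ (n * k)) \<in> polyfun UNIV n" by (rule polyfun_const) (rule UNIV_I)
    have eq: "a' k = (\<lambda>\<xi>. \<kappa> ^ (n * k) * a k (\<lambda>i. \<kappa> ^ i * \<xi> i))" by (simp add: a'_def fun_eq_iff)
    show "a' k \<in> polyfun UNIV n"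
      unfolding eq by (rule polyfun_mult[of "\<lambda>\<xi>. \<kappa> ^ (n * k)" UNIV n "\<lambda>\<xi>. a k (\<lambda>i. \<kappa> ^ i * \<xi> i)", OF 2 1])
  qed
  moreover have "\<exists>\<xi>. a' d \<xi> \<noteq> 0"
  proof -
    obtain \<xi> where "a d \<xi> \<noteq> 0" using a(2) by blast
    then have "a' d (\<lambda>i. \<xi> i / \<kappa> ^ i) \<noteq> 0" unfolding a'_def inv using \<kappa>(2) by simp
    then show ?thesis by blast
  qed
  moreover have "g' \<in> polyfun UNIV n" unfolding g'_def [abs_def]
    by (rule polyfun_scale[OF K g(1), of "\<lambda>i. \<kappa> ^ i", OF UNIV_I])
  moreover have "\<exists>\<xi>. g' \<xi> \<noteq> 0"
  proof -
    obtain \<xi> where "g \<xi> \<noteq> 0" using g(2) by blast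
    then have "g' (\<lambda>i. \<xi> i / \<kappa> ^ i) \<noteq> 0" unfolding g'_def inv .
    then show ?thesis by blast
  qed
  ultimately obtain x where x: "upoly n d a' (jet D x) = 0" "g' (jet D x) \<noteq> 0"
    using blum[unfolded blum_closed_def, rule_format, of d n a' g'] d by blast
  have "upoly n d a (jet (\<lambda>x. \<kappa> * D x) x) = upoly n d a' (jet D x)"
    unfolding upoly_def a'_def jet by (intro sum.cong refl) (simp add: power_mult_distrib mult_ac flip: power_mult)
  moreover have "g (jet (\<lambda>x. \<kappa> * D x) x) = g' (jet D x)" unfolding g'_def jet ..
  ultimately show "\<exists>x. upoly n d a (jet (\<lambda>x. \<kappa> * D x) x) = 0 \<and> g (jet (\<lambda>x. \<kappa> * D x) x) \<noteq> 0"
    using x by (intro exI[of _ x]) simp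
qed

section \<open>Transport to the universe\<close>

text \<open>Linear independence of distinct monomials. Those sharing one exponent of the last
  variable still differ in an earlier one, so induction makes their joint coefficient nonzero; then
  a value of the last variable is chosen.\<close>

lemma sum_monomials_nonzero:
  fixes c :: "'i \<Rightarrow> 'a::field_char_0" and ex :: "'i \<Rightarrow> nat \<Rightarrow> nat"
  assumes "finite A" "A \<noteq> {}" "\<And>j. j \<in> A \<Longrightarrow> c j \<noteq> 0"
    and "\<And>j k. j \<in> A \<Longrightarrow> k \<in> A \<Longrightarrow> j \<noteq> k \<Longrightarrow> \<exists>i<n. ex j i \<noteq> ex k i"
  shows "\<exists>\<xi>. (\<Sum>j\<in>A. c j * (\<Prod>i<n. \<xi> i ^ ex j i)) \<noteq> 0"
  using assms
proof (induction n arbitrary: A)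
  case 0
  then obtain j where "j \<in> A" by blast
  then have "A = {j}" using 0 by auto
  then show ?case using 0(3) by simp
next
  case (Suc n)
  obtain j0 where j0: "j0 \<in> A" using Suc.prems by blast
  define A0 where "A0 = {j\<in>A. ex j n = ex j0 n}"
  have "\<exists>\<xi>. (\<Sum>j\<in>A0. c j * (\<Prod>i<n. \<xi> i ^ ex j i)) \<noteq> 0"
  proof (rule Suc.IH)
    show "finite A0" "A0 \<noteq> {}" using Suc.prems j0 by (auto simp: A0_def)
    show "c j \<noteq> 0" if "j \<in> A0" for j using that Suc.prems by (auto simp: A0_def)
    show "\<exists>i<n. ex j i \<noteq> ex k i" if "j \<in> A0" "k \<in> A0" "j \<noteq> k" for j k
      using that Suc.prems(4)[of j k] by (auto simp: A0_def less_Suc_eq)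
  qed
  then obtain \<xi> where \<xi>: "(\<Sum>j\<in>A0. c j * (\<Prod>i<n. \<xi> i ^ ex j i)) \<noteq> 0" by blast
  define p where "p = (\<Sum>j\<in>A. Polynomial.monom (c j * (\<Prod>i<n. \<xi> i ^ ex j i)) (ex j n))"
  have "Polynomial.coeff p (ex j0 n) = (\<Sum>j\<in>A0. c j * (\<Prod>i<n. \<xi> i ^ ex j i))"
    unfolding p_def Polynomial.coeff_sum A0_def
    using Suc.prems(1) by (auto simp: Polynomial.coeff_monom sum.If_cases intro!: sum.cong)
  then have "p \<noteq> 0" using \<xi> by auto
  then obtain t where t: "poly p t \<noteq> 0" using poly_all_0_iff_0[of p] by auto
  have "(\<Sum>j\<in>A. c j * (\<Prod>i<Suc n. (\<xi>(n := t)) i ^ ex j i)) = poly p t"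
    unfolding p_def poly_sum Polynomial.poly_monom
    by (intro sum.cong refl) (simp add: mult_ac cong: prod.cong_simp)
  then show ?case using t by (intro exI[of _ "\<xi>(n := t)"]) simp
qed

text \<open>The common shape of \<open>mpoly_eval\<close>, \<open>dpoly_eval\<close> and the sum in
  \<open>ade_solution_on\<close>, with the set of monomials and the coefficients as separate
  arguments.\<close>

definition monomials_eval :: "(nat \<Rightarrow>\<^sub>0 nat) set \<Rightarrow> ((nat \<Rightarrow>\<^sub>0 nat) \<Rightarrow> 'a::comm_ring_1) \<Rightarrow> (nat \<Rightarrow> 'a) \<Rightarrow> 'a" where
  "monomials_eval A c \<xi> = (\<Sum>m\<in>A. c m * (\<Prod>i\<in>Poly_Mapping.keys m. \<xi> i ^ Poly_Mapping.lookup m i))"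

lemma monomials_eval_lessThan:
  assumes "(\<Union>m\<in>A. Poly_Mapping.keys m) \<subseteq> {..<n}"
  shows "monomials_eval A c \<xi> = (\<Sum>m\<in>A. c m * (\<Prod>i<n. \<xi> i ^ Poly_Mapping.lookup m i))"
  unfolding monomials_eval_def
proof (intro sum.cong refl)
  fix m assume "m \<in> A"
  then have "Poly_Mapping.keys m \<subseteq> {..<n}" using assms by blast
  then have "(\<Prod>i\<in>Poly_Mapping.keys m. \<xi> i ^ Poly_Mapping.lookup m i) = (\<Prod>i<n. \<xi> i ^ Poly_Mapping.lookup m i)"
    by (intro prod.mono_neutral_left) (auto simp: in_keys_iff)
  then show "c m * (\<Prod>i\<in>Poly_Mapping.keys m. \<xi> i ^ Poly_Mapping.lookup m i) = c m * (\<Prod>i<n. \<xi> i ^ Poly_Mapping.lookup m i)"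
    by simp
qed

lemma monomials_eval_polyfun:
  assumes K: "field_subset K" and "(\<Union>m\<in>A. Poly_Mapping.keys m) \<subseteq> {..<n}" "\<And>m. m \<in> A \<Longrightarrow> c m \<in> K"
  shows "monomials_eval A c \<in> polyfun K n"
proof -
  have "monomials_eval A c = (\<lambda>\<xi>. \<Sum>m\<in>A. c m * (\<Prod>i<n. \<xi> i ^ Poly_Mapping.lookup m i))"
    by (rule ext) (rule monomials_eval_lessThan[OF assms(2)])
  moreover have "\<dots> \<in> polyfun K n"
    by (intro polyfun_sum[OF K] polyfun_mult polyfun_prod[OF K] polyfun_power[OF K] polyfun_const
        polyfun_var assms(3)) auto
  ultimately show ?thesis by simp
qed

lemma monomial_ext:
  assumes "Poly_Mapping.keys m \<subseteq> {..<n}" "Poly_Mapping.keys m' \<subseteq> {..<n}" "m \<noteq> m'"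
  shows "\<exists>i<n. Poly_Mapping.lookup m i \<noteq> Poly_Mapping.lookup m' i"
proof (rule ccontr)
  assume *: "\<not> ?thesis"
  have "Poly_Mapping.lookup m i = Poly_Mapping.lookup m' i" for i
  proof (cases "i < n")
    case False
    then have "i \<notin> Poly_Mapping.keys m" "i \<notin> Poly_Mapping.keys m'" using assms(1,2) by auto
    then show ?thesis by (simp add: in_keys_iff)
  qed (use * in blast)
  then have "m = m'" by (intro poly_mapping_eqI)
  then show False using assms(3) by simp
qed

lemma monomials_eval_nonzero:
  fixes c :: "(nat \<Rightarrow>\<^sub>0 nat) \<Rightarrow> 'a::field_char_0"
  assumes "finite A" "A \<noteq> {}" "(\<Union>m\<in>A. Poly_Mapping.keys m) \<subseteq> {..<n}" "\<And>m. m \<in> A \<Longrightarrow> c m \<noteq> 0"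
  shows "\<exists>\<xi>. monomials_eval A c \<xi> \<noteq> 0"
  unfolding monomials_eval_lessThan[OF assms(3)]
proof (rule sum_monomials_nonzero[OF assms(1,2,4)])
  fix m m' assume "m \<in> A" "m' \<in> A" "m \<noteq> m'"
  then show "\<exists>i<n. Poly_Mapping.lookup m i \<noteq> Poly_Mapping.lookup m' i"
    using assms(3) by (intro monomial_ext) auto
qed

text \<open>Group the monomials by their exponent in variable \<open>n\<close>. Those with the
  largest exponent \<open>d\<close> remain distinct when that variable is removed, so the leading
  coefficient is nonzero.\<close>

lemma monomials_eval_upoly:
  fixes c :: "(nat \<Rightarrow>\<^sub>0 nat) \<Rightarrow> 'a::field_char_0"
  assumes fin: "finite A" and vars: "(\<Union>m\<in>A. Poly_Mapping.keys m) \<subseteq> {..n}" "n \<in> (\<Union>m\<in>A. Poly_Mapping.keys m)"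
    and c: "\<And>m. m \<in> A \<Longrightarrow> c m \<noteq> 0"
  shows "\<exists>d a. 1 \<le> d \<and> coef_funs UNIV n d a \<and> (\<exists>\<xi>. a d \<xi> \<noteq> 0) \<and> (\<forall>\<xi>. monomials_eval A c \<xi> = upoly n d a \<xi>)"
proof -
  define L where "L m = Poly_Mapping.lookup m n" for m :: "nat \<Rightarrow>\<^sub>0 nat"
  define d where "d = Max (L ` A)"
  define a where "a k \<xi> = (\<Sum>m\<in>{m\<in>A. L m = k}. c m * (\<Prod>i<n. \<xi> i ^ Poly_Mapping.lookup m i))" for k \<xi>
  obtain m0 where m0: "m0 \<in> A" "n \<in> Poly_Mapping.keys m0" using vars(2) by blast
  have Ld: "L m \<le> d" if "m \<in> A" for m unfolding d_def using fin that by simp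
  have "1 \<le> L m0" using m0(2) by (simp add: L_def in_keys_iff)
  then have d1: "1 \<le> d" using Ld[OF m0(1)] by simp
  have "d \<in> L ` A" unfolding d_def using fin m0(1) by (intro Max_in) auto
  then have ne: "{m\<in>A. L m = d} \<noteq> {}" by auto
  have vars': "Poly_Mapping.keys m \<subseteq> {..<Suc n}" if "m \<in> A" for m using vars(1) that by (auto simp: less_Suc_eq_le)
  have "\<exists>\<xi>. a d \<xi> \<noteq> 0"
    unfolding a_def
  proof (rule sum_monomials_nonzero)
    fix j k assume *: "j \<in> {m\<in>A. L m = d}" "k \<in> {m\<in>A. L m = d}" "j \<noteq> k"
    then obtain i where "i < Suc n" "Poly_Mapping.lookup j i \<noteq> Poly_Mapping.lookup k i"
      using monomial_ext[OF vars' vars', of j k] by auto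
    moreover have "Poly_Mapping.lookup j n = Poly_Mapping.lookup k n" using * by (simp add: L_def)
    ultimately show "\<exists>i<n. Poly_Mapping.lookup j i \<noteq> Poly_Mapping.lookup k i" using less_Suc_eq by blast
  qed (use fin ne c in auto)
  moreover have "coef_funs UNIV n d a"
    unfolding coef_funs_def a_def [abs_def]
    by (intro allI impI polyfun_sum[OF field_subset_UNIV] polyfun_mult polyfun_prod[OF field_subset_UNIV]
         polyfun_power[OF field_subset_UNIV] polyfun_const polyfun_var) auto
  moreover have "monomials_eval A c \<xi> = upoly n d a \<xi>" for \<xi>
  proof -
    have "monomials_eval A c \<xi> = (\<Sum>m\<in>A. c m * (\<Prod>i<Suc n. \<xi> i ^ Poly_Mapping.lookup m i))"
      by (rule monomials_eval_lessThan) (use vars' in blast)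
    also have "\<dots> = (\<Sum>k\<le>d. \<Sum>m\<in>{m\<in>A. L m = k}. c m * (\<Prod>i<Suc n. \<xi> i ^ Poly_Mapping.lookup m i))"
      by (rule sum.group[symmetric]) (use fin Ld in auto)
    also have "\<dots> = upoly n d a \<xi>"
      unfolding upoly_def a_def sum_distrib_right
      by (intro sum.cong refl) (auto simp: L_def mult_ac)
    finally show ?thesis .
  qed
  ultimately show ?thesis using d1 by blast
qed

text \<open>The models in \<open>strongly_minimal_ade\<close> live on subsets of a fixed type; the
  field of germs is copied there along an injection \<open>e\<close>, with carrier its
  range.\<close>

definition transport :: "('a::field \<Rightarrow> 'b) \<Rightarrow> 'b ring" where
  "transport e = \<lparr>carrier = range e, monoid.mult = (\<lambda>x y. e (inv_into UNIV e x * inv_into UNIV e y)), one = e 1,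
     ring.zero = e 0, add = (\<lambda>x y. e (inv_into UNIV e x + inv_into UNIV e y))\<rparr>"

definition transport_deriv :: "('a \<Rightarrow> 'b) \<Rightarrow> ('a \<Rightarrow> 'a) \<Rightarrow> 'b \<Rightarrow> 'b" where
  "transport_deriv e D x = e (D (inv_into UNIV e x))"

context
  fixes e :: "'a::field_char_0 \<Rightarrow> 'b"
  assumes e: "inj e"
begin

lemma transport_simps:
  "carrier (transport e) = range e"
  "e x \<otimes>\<^bsub>transport e\<^esub> e y = e (x * y)" "e x \<oplus>\<^bsub>transport e\<^esub> e y = e (x + y)"
  "\<one>\<^bsub>transport e\<^esub> = e 1" "\<zero>\<^bsub>transport e\<^esub> = e 0"
  using e by (auto simp: transport_def)

lemma transport_eq_iff: "e x = e y \<longleftrightarrow> x = y"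
  using e by (auto dest: injD)

lemma transport_field: "field (transport e)"
proof -
  have "cring (transport e)"
  proof (rule cringI)
    show "abelian_group (transport e)"
    proof (rule abelian_groupI)
      fix x assume "x \<in> carrier (transport e)"
      then obtain a where "x = e a" by (auto simp: transport_simps)
      then show "\<exists>y\<in>carrier (transport e). y \<oplus>\<^bsub>transport e\<^esub> x = \<zero>\<^bsub>transport e\<^esub>"
        by (intro bexI[of _ "e (- a)"]) (auto simp: transport_simps)
    qed (auto simp: transport_simps add_ac)
    show "comm_monoid (transport e)"
      by (rule comm_monoidI) (auto simp: transport_simps mult_ac)
  qed (auto simp: transport_simps distrib_right)
  then show ?thesis
  proof (rule cring.cring_fieldI2)
    show "\<zero>\<^bsub>transport e\<^esub> \<noteq> \<one>\<^bsub>transport e\<^esub>" by (simp add: transport_simps transport_eq_iff)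
    fix x assume "x \<in> carrier (transport e)" "x \<noteq> \<zero>\<^bsub>transport e\<^esub>"
    then obtain a where "x = e a" "a \<noteq> 0" by (auto simp: transport_simps)
    then show "\<exists>y\<in>carrier (transport e). x \<otimes>\<^bsub>transport e\<^esub> y = \<one>\<^bsub>transport e\<^esub>"
      by (intro bexI[of _ "e (inverse a)"]) (auto simp: transport_simps)
  qed
qed

lemma transport_pow: "e x [^]\<^bsub>transport e\<^esub> (n::nat) = e (x ^ n)"
proof -
  interpret field "transport e" by (rule transport_field)
  show ?thesis by (induction n) (simp_all add: transport_simps mult.commute)
qed

lemma transport_finsum: "(\<Oplus>\<^bsub>transport e\<^esub>i\<in>A. e (g i)) = e (\<Sum>i\<in>A. g i)"
proof -
  interpret field "transport e" by (rule transport_field)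
  show ?thesis
  proof (induction A rule: infinite_finite_induct)
    case (insert x F)
    then show ?case by (subst finsum_insert) (auto simp: transport_simps)
  qed (auto simp: transport_simps finsum_infinite)
qed

lemma transport_finprod: "(\<Otimes>\<^bsub>transport e\<^esub>i\<in>A. e (g i)) = e (\<Prod>i\<in>A. g i)"
proof -
  interpret field "transport e" by (rule transport_field)
  show ?thesis
  proof (induction A rule: infinite_finite_induct)
    case (insert x F)
    then show ?case by (subst finprod_insert) (auto simp: transport_simps)
  qed (auto simp: transport_simps finprod_infinite)
qed

lemma transport_add_pow: "[(n::nat)] \<cdot>\<^bsub>transport e\<^esub> e 1 = e (of_nat n)"
proof -
  interpret field "transport e" by (rule transport_field)
  show ?thesis by (induction n) (simp_all add: transport_simps add.commute)
qed

lemma transport_deriv_e: "transport_deriv e D (e x) = e (D x)"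
  using e by (simp add: transport_deriv_def)

lemma transport_deriv_funpow: "(transport_deriv e D ^^ i) (e x) = e (jet D x i)"
  by (induction i) (simp_all add: jet_def transport_deriv_e)

lemma transport_dpoly_eval:
  assumes "range p \<subseteq> range e"
  shows "dpoly_eval (transport e) (transport_deriv e D) p (e x) =
    e (monomials_eval (dpoly_support (transport e) p) (\<lambda>m. inv_into UNIV e (p m)) (jet D x))"
proof -
  have pm: "p m = e (inv_into UNIV e (p m))" for m
  proof -
    have "p m \<in> range e" using assms by blast
    then show ?thesis by (simp only: f_inv_into_f)
  qed
  have "p m \<otimes>\<^bsub>transport e\<^esub> (\<Otimes>\<^bsub>transport e\<^esub>i\<in>Poly_Mapping.keys m.
      (transport_deriv e D ^^ i) (e x) [^]\<^bsub>transport e\<^esub> Poly_Mapping.lookup m i) =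
      e (inv_into UNIV e (p m) * (\<Prod>i\<in>Poly_Mapping.keys m. jet D x i ^ Poly_Mapping.lookup m i))" for m
    by (subst pm) (simp add: transport_deriv_funpow transport_pow transport_finprod transport_simps)
  then show ?thesis
    unfolding dpoly_eval_def monomials_eval_def by (simp add: transport_finsum)
qed

lemma transport_support:
  "range p \<subseteq> range e \<Longrightarrow> m \<in> dpoly_support (transport e) p \<longleftrightarrow> inv_into UNIV e (p m) \<noteq> 0"
proof -
  assume "range p \<subseteq> range e"
  then obtain a where "p m = e a" by blast
  then show ?thesis using e by (simp add: dpoly_support_def transport_simps transport_eq_iff)
qed

text \<open>The two forms of Blum's axioms match: coefficient functions on monomials are regrouped
  as \<open>upoly\<close> for the equation and read as \<open>polyfun\<close> for the
  inequation.\<close>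

lemma transport_differentially_closed:
  assumes D: "derivation D" and blum: "blum_closed D"
  shows "differentially_closed_field (transport e) (transport_deriv e D)"
proof -
  interpret field "transport e" by (rule transport_field)
  interpret differential_field "transport e" "transport_deriv e D"
  proof (unfold_locales)
    show "transport_deriv e D x \<in> carrier (transport e)" for x
      by (simp add: transport_deriv_def transport_simps)
    show "transport_deriv e D (x \<oplus>\<^bsub>transport e\<^esub> y) = transport_deriv e D x \<oplus>\<^bsub>transport e\<^esub> transport_deriv e D y"
      if "x \<in> carrier (transport e)" "y \<in> carrier (transport e)" for x y
      using that by (auto simp: transport_simps transport_deriv_e derivation_add[OF D])
    show "transport_deriv e D (x \<otimes>\<^bsub>transport e\<^esub> y) =
       transport_deriv e D x \<otimes>\<^bsub>transport e\<^esub> y \<oplus>\<^bsub>transport e\<^esub> x \<otimes>\<^bsub>transport e\<^esub> transport_deriv e D y"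
      if "x \<in> carrier (transport e)" "y \<in> carrier (transport e)" for x y
      using that by (auto simp: transport_simps transport_deriv_e derivation_mult[OF D])
    show "[n] \<cdot>\<^bsub>transport e\<^esub> \<one>\<^bsub>transport e\<^esub> \<noteq> \<zero>\<^bsub>transport e\<^esub>" if "n \<noteq> 0" for n :: nat
      using that by (simp add: transport_simps transport_add_pow transport_eq_iff)
  qed
  show ?thesis
  proof (unfold_locales)
    fix p g n
    assume pg: "p \<in> dpolys (transport e)" "g \<in> dpolys (transport e)"
      and n: "n \<in> dpoly_vars (transport e) p" "dpoly_vars (transport e) p \<subseteq> {..n}"
      and g: "dpoly_support (transport e) g \<noteq> {}" "dpoly_vars (transport e) g \<subseteq> {..<n}"
    define A where "A = dpoly_support (transport e) p"
    define B where "B = dpoly_support (transport e) g"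
    have rp: "range p \<subseteq> range e" "finite A" and rg: "range g \<subseteq> range e" "finite B"
      using pg by (simp_all add: dpolys_def transport_simps A_def B_def)
    have cp: "inv_into UNIV e (p m) \<noteq> 0" if "m \<in> A" for m using transport_support[OF rp(1)] that by (simp add: A_def)
    have cg: "inv_into UNIV e (g m) \<noteq> 0" if "m \<in> B" for m using transport_support[OF rg(1)] that by (simp add: B_def)
    obtain d a where a: "1 \<le> d" "coef_funs UNIV n d a" "\<exists>\<xi>. a d \<xi> \<noteq> 0"
      "\<And>\<xi>. monomials_eval A (\<lambda>m. inv_into UNIV e (p m)) \<xi> = upoly n d a \<xi>"
      using monomials_eval_upoly[OF rp(2), of n "\<lambda>m. inv_into UNIV e (p m)"] n cp by (auto simp: dpoly_vars_def A_def)
    define G where "G = monomials_eval B (\<lambda>m. inv_into UNIV e (g m))"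
    have vB: "(\<Union>m\<in>B. Poly_Mapping.keys m) \<subseteq> {..<n}" using g(2) by (simp add: dpoly_vars_def B_def)
    have "G \<in> polyfun UNIV n" unfolding G_def
      by (rule monomials_eval_polyfun[OF field_subset_UNIV vB]) simp
    moreover have "\<exists>\<xi>. G \<xi> \<noteq> 0" unfolding G_def
      by (rule monomials_eval_nonzero[OF rg(2) _ vB]) (use cg g(1) in \<open>auto simp: B_def\<close>)
    ultimately obtain x where x: "upoly n d a (jet D x) = 0" "G (jet D x) \<noteq> 0"
      using blum[unfolded blum_closed_def, rule_format, OF a(1-3)] by blast
    show "\<exists>x\<in>carrier (transport e). dpoly_eval (transport e) (transport_deriv e D) p x = \<zero>\<^bsub>transport e\<^esub> \<and>
            dpoly_eval (transport e) (transport_deriv e D) g x \<noteq> \<zero>\<^bsub>transport e\<^esub>"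
    proof (rule bexI[of _ "e x"])
      show "e x \<in> carrier (transport e)" by (simp add: transport_simps)
      show "dpoly_eval (transport e) (transport_deriv e D) p (e x) = \<zero>\<^bsub>transport e\<^esub> \<and>
            dpoly_eval (transport e) (transport_deriv e D) g (e x) \<noteq> \<zero>\<^bsub>transport e\<^esub>"
        unfolding transport_dpoly_eval[OF rp(1)] transport_dpoly_eval[OF rg(1)]
        using x a(4) by (simp add: transport_simps transport_eq_iff A_def B_def G_def)
    qed
  qed
qed

text \<open>The assignment sends every variable to the same element, as in
  \<open>definable_set\<close>, so one variable under iterated \<open>Deriv\<close> yields all
  entries of the jet.\<close>

lemma polyfun_dterm:
  assumes "\<phi> \<in> polyfun UNIV n"
  shows "\<exists>t. set_dterm t \<subseteq> range e \<and>
     (\<forall>x. dterm_val (transport e) (transport_deriv e D) (\<lambda>_. e x) t = e (\<phi> (jet D x)))"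
  using assms
proof (induction rule: polyfun.induct)
  case (polyfun_const c)
  then show ?case by (intro exI[of _ "Param (e c)"]) auto
next
  case (polyfun_var i)
  have "\<exists>t. set_dterm t \<subseteq> range e \<and>
     (\<forall>x. dterm_val (transport e) (transport_deriv e D) (\<lambda>_. e x) t = e (jet D x i))"
  proof (induction i)
    case 0
    then show ?case by (intro exI[of _ "Var 0"]) (simp add: jet_simps)
  next
    case (Suc i)
    then obtain t where "set_dterm t \<subseteq> range e"
      "\<And>x. dterm_val (transport e) (transport_deriv e D) (\<lambda>_. e x) t = e (jet D x i)" by blast
    then show ?case by (intro exI[of _ "Deriv t"]) (simp add: jet_simps transport_deriv_e)
  qed
  then show ?case .
next
  case (polyfun_add \<phi> \<psi>)
  then obtain t u where "set_dterm t \<subseteq> range e" "set_dterm u \<subseteq> range e"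
    "\<And>x. dterm_val (transport e) (transport_deriv e D) (\<lambda>_. e x) t = e (\<phi> (jet D x))"
    "\<And>x. dterm_val (transport e) (transport_deriv e D) (\<lambda>_. e x) u = e (\<psi> (jet D x))" by blast
  then show ?case by (intro exI[of _ "Plus t u"]) (simp add: transport_simps)
next
  case (polyfun_mult \<phi> \<psi>)
  then obtain t u where "set_dterm t \<subseteq> range e" "set_dterm u \<subseteq> range e"
    "\<And>x. dterm_val (transport e) (transport_deriv e D) (\<lambda>_. e x) t = e (\<phi> (jet D x))"
    "\<And>x. dterm_val (transport e) (transport_deriv e D) (\<lambda>_. e x) u = e (\<psi> (jet D x))" by blast
  then show ?case by (intro exI[of _ "Times t u"]) (simp add: transport_simps)
qed

lemma polyfun_definable:
  assumes "\<phi> \<in> polyfun UNIV n"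
  shows "definable_set (transport e) (transport_deriv e D) (e ` {x. \<phi> (jet D x) = 0})"
proof -
  obtain t where t: "set_dterm t \<subseteq> range e"
     "\<And>x. dterm_val (transport e) (transport_deriv e D) (\<lambda>_. e x) t = e (\<phi> (jet D x))"
    using polyfun_dterm[OF assms] by blast
  show ?thesis
    unfolding definable_set_def
    by (intro exI[of _ "Equal t (Param (e 0))"]) (use t in \<open>auto simp: transport_simps transport_eq_iff\<close>)
qed

end

text \<open>\<open>Q\<close> cuts the solution set of \<open>P\<close> into two parts, one of which
  is finite. It cannot be the part off \<open>Q\<close>: finitely many elements are excluded by an
  inequation of order zero, whose product with \<open>Q\<close> has order at most one, below that of
  \<open>P\<close>, so Blum's axiom gives a further solution.\<close>

theorem strongly_minimal_first_order_finite:
  fixes D :: "'a::field_char_0 \<Rightarrow> 'a" and e :: "'a \<Rightarrow> universe" and j :: "ratfun \<Rightarrow> 'a"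
  assumes e: "inj e" and D: "derivation D" and blum: "blum_closed D"
    and j: "j 1 = 1" "\<And>r s. j (r + s) = j r + j s" "\<And>r s. j (r * s) = j r * j s" "\<And>r. j (rat_deriv r) = D (j r)"
    and P: "strongly_minimal_ade P" "ade_order P h" "h > 1"
    and Q: "Q \<in> polyfun UNIV 2" "\<exists>\<xi>. Q \<xi> \<noteq> 0"
  shows "finite {x. Q (jet D x) = 0 \<and>
           monomials_eval (Poly_Mapping.keys P) (\<lambda>m. j (Poly_Mapping.lookup P m)) (jet D x) = 0}"
proof (rule ccontr)
  assume inf: "infinite {x. Q (jet D x) = 0 \<and>
           monomials_eval (Poly_Mapping.keys P) (\<lambda>m. j (Poly_Mapping.lookup P m)) (jet D x) = 0}"
  define p where "p = monomials_eval (Poly_Mapping.keys P) (\<lambda>m. j (Poly_Mapping.lookup P m))"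
  have j0: "j 0 = 0" using j(2)[of 0 0] by simp
  have jnz: "j r \<noteq> 0" if "r \<noteq> 0" for r
  proof
    assume "j r = 0"
    then have "j (r * inverse r) = 0" by (simp add: j(3))
    then show False using that j(1) by simp
  qed
  have "dcf_over_ratfun (transport e) (transport_deriv e D) (e \<circ> j)"
    unfolding dcf_over_ratfun_def
  proof (intro conjI allI)
    show "differentially_closed_field (transport e) (transport_deriv e D)"
      by (rule transport_differentially_closed[OF e D blum])
    show "e \<circ> j \<in> ring_hom type_ring (transport e)"
      by (rule ring_hom_memI) (auto simp: type_ring_simps transport_simps[OF e] j)
    show "(e \<circ> j) (rat_deriv r) = transport_deriv e D ((e \<circ> j) r)" for r
      by (simp add: transport_deriv_e[OF e] j)
  qed
  then have min: "minimal_set (transport e) (transport_deriv e D) (solution_set (transport e) (transport_deriv e D) (e \<circ> j) P)"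
    using P(1) unfolding strongly_minimal_ade_def by blast
  define q where "q m = (e \<circ> j) (Poly_Mapping.lookup P m)" for m
  have rq: "range q \<subseteq> range e" by (auto simp: q_def)
  have inv_q: "inv_into UNIV e (q m) = j (Poly_Mapping.lookup P m)" for m using e by (simp add: q_def)
  have "dpoly_support (transport e) q = Poly_Mapping.keys P"
    using transport_support[OF e rq] jnz j0 by (auto simp: inv_q in_keys_iff)
  then have S: "solution_set (transport e) (transport_deriv e D) (e \<circ> j) P = e ` {x. p (jet D x) = 0}"
    unfolding solution_set_def q_def[symmetric] using transport_dpoly_eval[OF e rq, of D]
    by (auto simp: transport_simps[OF e] transport_eq_iff[OF e] inv_q p_def)
  define S1 where "S1 = {x. p (jet D x) = 0}"
  define T1 where "T1 = {x. Q (jet D x) = 0}"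
  have inj: "inj_on e \<xi>" for \<xi> using e by (meson inj_on_subset subset_UNIV)
  have "finite (e ` S1 \<inter> e ` T1) \<or> finite (e ` S1 - e ` T1)"
    using min polyfun_definable[OF e Q(1), of D] unfolding minimal_set_def S S1_def T1_def by blast
  then have "finite (e ` (S1 \<inter> T1)) \<or> finite (e ` (S1 - T1))"
    by (simp add: image_Int[OF e] image_set_diff[OF e])
  moreover have "S1 \<inter> T1 = {x. Q (jet D x) = 0 \<and> p (jet D x) = 0}" by (auto simp: S1_def T1_def)
  ultimately have fin: "finite (S1 - T1)" using inf inj finite_imageD unfolding p_def by metis
  have "\<exists>d a. 1 \<le> d \<and> coef_funs UNIV h d a \<and> (\<exists>\<xi>. a d \<xi> \<noteq> 0) \<and> (\<forall>\<xi>. p \<xi> = upoly h d a \<xi>)"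
    unfolding p_def
    by (rule monomials_eval_upoly) (use P(2) jnz in \<open>auto simp: ade_order_def mpoly_vars_def in_keys_iff\<close>)
  then obtain d a where a: "1 \<le> d" "coef_funs UNIV h d a" "\<exists>\<xi>. a d \<xi> \<noteq> 0" "\<And>\<xi>. p \<xi> = upoly h d a \<xi>" by blast
  define g1 where "g1 = (\<lambda>\<xi>::nat\<Rightarrow>'a. \<Prod>y\<in>S1 - T1. \<xi> 0 - y)"
  have g1: "g1 \<in> polyfun UNIV 2" unfolding g1_def
    by (intro polyfun_prod polyfun_diff field_subset_UNIV polyfun_var polyfun_const) auto
  obtain y where y: "y \<notin> S1 - T1" using fin ex_new_if_finite infinite_UNIV_char_0 by blast
  have g1nz: "g1 (\<lambda>_. y) \<noteq> 0" using fin y by (auto simp: g1_def)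
  obtain \<xi>1 where "Q \<xi>1 \<noteq> 0" using Q(2) by blast
  from polyfun_common_nonzero[OF Q(1) g1 this g1nz] obtain \<xi>2 where "Q \<xi>2 \<noteq> 0 \<and> g1 \<xi>2 \<noteq> 0" by blast
  then have nz: "Q \<xi>2 * g1 \<xi>2 \<noteq> 0" by simp
  \<comment> \<open>Here \<open>h > 1\<close> enters: \<open>Q\<close> involves the variables 0 and
    1, and both must lie below \<open>h\<close>.\<close>
  have "(\<lambda>\<xi>. Q \<xi> * g1 \<xi>) \<in> polyfun UNIV h"
    by (rule polyfun_mono[OF polyfun_mult[OF Q(1) g1]]) (use P(3) in auto)
  from blum[unfolded blum_closed_def, rule_format, OF a(1-3) this] nz
  obtain x where x: "upoly h d a (jet D x) = 0" "Q (jet D x) * g1 (jet D x) \<noteq> 0" by blast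
  then have "x \<in> S1 - T1" using a(4) by (simp add: S1_def T1_def)
  then have "g1 (jet D x) = 0" using fin by (auto simp: g1_def jet_simps)
  then show False using x(2) by simp
qed

text \<open>A germ is determined by the graph of a chosen representative, and the points of a graph,
  being pairs of complex numbers, are coded by complex numbers.\<close>

lemma ex_inj_gfun: "\<exists>e :: gfun \<Rightarrow> universe. inj e"
proof -
  have "infinite (UNIV :: complex set)" by (rule infinite_UNIV_char_0)
  then have "(card_of ((UNIV :: complex set) \<times> (UNIV :: complex set)), card_of (UNIV :: complex set)) \<in> ordIso"
    by (rule card_of_Times_same_infinite)
  then obtain pr :: "complex \<times> complex \<Rightarrow> complex" where "bij_betw pr (UNIV \<times> UNIV) UNIV"
    using card_of_ordIso by blast
  then have pr: "inj pr" by (simp add: bij_betw_def)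
  have "\<forall>x. \<exists>f. germ f = x" using germ_exists by blast
  then obtain f where f: "\<And>x. germ (f x) = x" by metis
  define e where "e x = {pr (z, f x z) | z. True}" for x
  have "inj e"
  proof (rule injI)
    fix x y assume xy: "e x = e y"
    have "f x z = f y z" for z
    proof -
      have "pr (z, f x z) \<in> e y" using xy by (auto simp: e_def)
      then obtain w where "pr (z, f x z) = pr (w, f y w)" by (auto simp: e_def)
      then show ?thesis using pr by (auto dest: injD)
    qed
    then have "f x = f y" by blast
    then show "x = y" using f by metis
  qed
  then show ?thesis by blast
qed

section \<open>Real analytic functions on squares\<close>

text \<open>Analyticity on a real interval with controlled radius: one holomorphic extension serves
  the whole disc over the interval.\<close>

definition line_ext :: "(real \<Rightarrow> complex) \<Rightarrow> real \<Rightarrow> real \<Rightarrow> bool" where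
  "line_ext g a r \<longleftrightarrow> (\<exists>G. G holomorphic_on ball (of_real a) r \<and> (\<forall>x. \<bar>x - a\<bar> < r \<longrightarrow> G (of_real x) = g x))"

lemma of_real_mem_ball: "complex_of_real x \<in> ball (of_real a) r \<longleftrightarrow> \<bar>x - a\<bar> < r"
  by (simp add: dist_of_real dist_real_def abs_minus_commute)

lemma line_ext_mono: "line_ext g a r \<Longrightarrow> s \<le> r \<Longrightarrow> line_ext g a s"
proof -
  assume "line_ext g a r" "s \<le> r"
  then obtain G where G: "G holomorphic_on ball (of_real a) r" "\<forall>x. \<bar>x - a\<bar> < r \<longrightarrow> G (of_real x) = g x"
    unfolding line_ext_def by blast
  have "G holomorphic_on ball (of_real a) s"
    by (rule holomorphic_on_subset[OF G(1) subset_ball[OF \<open>s \<le> r\<close>]])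
  then show ?thesis unfolding line_ext_def using G(2) \<open>s \<le> r\<close> by (intro exI[of _ G]) auto
qed

lemma line_ext_const: "line_ext (\<lambda>x. c) a r"
  unfolding line_ext_def by (intro exI[of _ "\<lambda>_. c"]) auto

lemma line_ext_of_real: "line_ext (\<lambda>x. of_real x) a r"
  unfolding line_ext_def by (intro exI[of _ "\<lambda>z. z"]) auto

lemma line_ext_add: "line_ext g a r \<Longrightarrow> line_ext h a r \<Longrightarrow> line_ext (\<lambda>x. g x + h x) a r"
proof -
  assume "line_ext g a r" "line_ext h a r"
  then obtain G H where "G holomorphic_on ball (of_real a) r" "\<forall>x. \<bar>x - a\<bar> < r \<longrightarrow> G (of_real x) = g x"
    "H holomorphic_on ball (of_real a) r" "\<forall>x. \<bar>x - a\<bar> < r \<longrightarrow> H (of_real x) = h x"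
    unfolding line_ext_def by blast
  then show ?thesis unfolding line_ext_def
    by (intro exI[of _ "\<lambda>z. G z + H z"]) (auto intro: holomorphic_intros)
qed

lemma line_ext_mult: "line_ext g a r \<Longrightarrow> line_ext h a r \<Longrightarrow> line_ext (\<lambda>x. g x * h x) a r"
proof -
  assume "line_ext g a r" "line_ext h a r"
  then obtain G H where "G holomorphic_on ball (of_real a) r" "\<forall>x. \<bar>x - a\<bar> < r \<longrightarrow> G (of_real x) = g x"
    "H holomorphic_on ball (of_real a) r" "\<forall>x. \<bar>x - a\<bar> < r \<longrightarrow> H (of_real x) = h x"
    unfolding line_ext_def by blast
  then show ?thesis unfolding line_ext_def
    by (intro exI[of _ "\<lambda>z. G z * H z"]) (auto intro: holomorphic_intros)
qed

lemma real_islimpt_identity: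
  assumes G: "G holomorphic_on ball (of_real a) r" and x0: "x0 islimpt T" "\<bar>x0 - a\<bar> < r"
    and T: "\<And>x. x \<in> T \<Longrightarrow> \<bar>x - a\<bar> < r" "\<And>x. x \<in> T \<Longrightarrow> G (of_real x) = 0" and z: "z \<in> ball (of_real a) r"
  shows "G z = 0"
proof (rule analytic_continuation[OF G open_ball connected_ball])
  show "of_real ` T \<subseteq> ball (complex_of_real a) r" using T(1) by (auto simp: of_real_mem_ball simp del: mem_ball)
  show "of_real x0 \<in> ball (complex_of_real a) r" using x0(2) by (simp add: of_real_mem_ball del: mem_ball)
  show "complex_of_real x0 islimpt of_real ` T"
    unfolding islimpt_approachable
  proof (intro allI impI)
    fix e :: real assume "e > 0"
    then obtain x where "x \<in> T" "x \<noteq> x0" "dist x x0 < e" using x0(1) unfolding islimpt_approachable by blast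
    then show "\<exists>x'\<in>of_real ` T. x' \<noteq> complex_of_real x0 \<and> dist x' (complex_of_real x0) < e"
      by (intro bexI[of _ "of_real x"]) (auto simp: dist_of_real)
  qed
  show "G w = 0" if "w \<in> of_real ` T" for w using that T(2) by blast
qed (rule z)

lemma line_ext_identity:
  assumes g: "line_ext g a r" and x0: "x0 islimpt T" "\<bar>x0 - a\<bar> < r"
    and T: "\<And>x. x \<in> T \<Longrightarrow> \<bar>x - a\<bar> < r" "\<And>x. x \<in> T \<Longrightarrow> g x = 0" and x: "\<bar>x - a\<bar> < r"
  shows "g x = 0"
proof -
  obtain G where G: "G holomorphic_on ball (of_real a) r" "\<And>x. \<bar>x - a\<bar> < r \<Longrightarrow> G (of_real x) = g x"
    using g unfolding line_ext_def by blast
  have "G (of_real x) = 0"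
    by (rule real_islimpt_identity[OF G(1) x0 T(1)]) (use G(2) T x in \<open>auto simp: of_real_mem_ball simp del: mem_ball\<close>)
  then show ?thesis using G(2)[OF x] by simp
qed

lemma interval_islimpt: "e > 0 \<Longrightarrow> (x::real) islimpt {y. \<bar>y - x\<bar> < e}"
proof -
  assume "e > 0"
  have "{y. \<bar>y - x\<bar> < e} = ball x e" by (auto simp: dist_real_def)
  then show ?thesis using \<open>e > 0\<close> by (simp add: islimpt_ball)
qed

text \<open>Around a point where \<open>g\<close> is nonzero there is an interval on which
  \<open>h\<close> must vanish; the identity theorem carries this to the whole interval.\<close>

lemma line_ext_product_zero:
  assumes g: "line_ext g a r" and h: "line_ext h a r" and gh: "\<And>x. \<bar>x - a\<bar> < r \<Longrightarrow> g x * h x = 0"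
  shows "(\<forall>x. \<bar>x - a\<bar> < r \<longrightarrow> g x = 0) \<or> (\<forall>x. \<bar>x - a\<bar> < r \<longrightarrow> h x = 0)"
proof (rule ccontr)
  assume "\<not> ?thesis"
  then obtain x1 x2 where x1: "\<bar>x1 - a\<bar> < r" "g x1 \<noteq> 0" and x2: "\<bar>x2 - a\<bar> < r" "h x2 \<noteq> 0" by blast
  obtain G where G: "G holomorphic_on ball (of_real a) r" "\<And>x. \<bar>x - a\<bar> < r \<Longrightarrow> G (of_real x) = g x"
    using g unfolding line_ext_def by blast
  have "continuous_on {x. \<bar>x - a\<bar> < r} (\<lambda>x. G (complex_of_real x))"
    by (intro continuous_on_compose2[OF holomorphic_on_imp_continuous_on[OF G(1)]] continuous_intros)
       (auto simp: of_real_mem_ball simp del: mem_ball)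
  moreover have op: "open {x. \<bar>x - a\<bar> < r}"
  proof -
    have "{x. \<bar>x - a\<bar> < r} = ball a r" by (auto simp: dist_real_def)
    then show ?thesis by simp
  qed
  ultimately have "open ({x. \<bar>x - a\<bar> < r} \<inter> (\<lambda>x. G (complex_of_real x)) -` (- {0}))"
    by (intro continuous_open_preimage) auto
  moreover have "x1 \<in> {x. \<bar>x - a\<bar> < r} \<inter> (\<lambda>x. G (complex_of_real x)) -` (- {0})" using x1 G(2) by simp
  ultimately obtain e where e: "e > 0" "ball x1 e \<subseteq> {x. \<bar>x - a\<bar> < r} \<inter> (\<lambda>x. G (complex_of_real x)) -` (- {0})"
    using open_contains_ball by blast
  have "h x2 = 0"
  proof (rule line_ext_identity[OF h interval_islimpt[OF e(1)] x1(1)])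
    fix x assume "x \<in> {y. \<bar>y - x1\<bar> < e}"
    then have "x \<in> ball x1 e" by (simp add: dist_real_def abs_minus_commute)
    then have *: "\<bar>x - a\<bar> < r" "G (of_real x) \<noteq> 0" using e(2) by auto
    then show "\<bar>x - a\<bar> < r" "h x = 0" using gh[of x] G(2)[of x] by auto
  qed (rule x2(1))
  then show False using x2(2) by simp
qed

text \<open>Separate analyticity in both real variables, with one radius for all lines crossing the
  square. It follows from a double power series, is stable under sums and products, and supports an
  identity theorem.\<close>

definition square_analytic :: "(complex \<Rightarrow> complex) \<Rightarrow> complex set \<Rightarrow> bool" where
  "square_analytic g V \<longleftrightarrow> (\<forall>a\<in>V. \<exists>r>0.
     (\<forall>y. \<bar>y - Im a\<bar> < r \<longrightarrow> line_ext (\<lambda>x. g (Complex x y)) (Re a) r) \<and>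
     (\<forall>x. \<bar>x - Re a\<bar> < r \<longrightarrow> line_ext (\<lambda>y. g (Complex x y)) (Im a) r))"

lemma square_analytic_const: "square_analytic (\<lambda>_. c) V"
  unfolding square_analytic_def by (intro ballI exI[of _ 1]) (auto intro: line_ext_const)

lemma square_analytic_ident: "square_analytic (\<lambda>z. z) V"
proof -
  have "line_ext (\<lambda>x. Complex x y) a r" "line_ext (\<lambda>y. Complex x y) a r" for x y a r
    using line_ext_add[OF line_ext_of_real line_ext_const[of "\<i> * of_real y"], of a r]
      line_ext_add[OF line_ext_const[of "of_real x"] line_ext_mult[OF line_ext_const[of \<i>] line_ext_of_real], of a r]
    by (simp_all add: complex_eq[symmetric] Complex_eq)
  then show ?thesis unfolding square_analytic_def by (intro ballI exI[of _ 1]) auto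
qed

lemma square_analytic_binop:
  assumes g: "square_analytic g V" and h: "square_analytic h V"
    and op: "\<And>g h a r. line_ext g a r \<Longrightarrow> line_ext h a r \<Longrightarrow> line_ext (\<lambda>x. f (g x) (h x)) a r"
  shows "square_analytic (\<lambda>z. f (g z) (h z)) V"
  unfolding square_analytic_def
proof
  fix a assume a: "a \<in> V"
  obtain r where r: "r > 0" "\<And>y. \<bar>y - Im a\<bar> < r \<Longrightarrow> line_ext (\<lambda>x. g (Complex x y)) (Re a) r"
    "\<And>x. \<bar>x - Re a\<bar> < r \<Longrightarrow> line_ext (\<lambda>y. g (Complex x y)) (Im a) r"
    using g a unfolding square_analytic_def by blast
  obtain s where s: "s > 0" "\<And>y. \<bar>y - Im a\<bar> < s \<Longrightarrow> line_ext (\<lambda>x. h (Complex x y)) (Re a) s"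
    "\<And>x. \<bar>x - Re a\<bar> < s \<Longrightarrow> line_ext (\<lambda>y. h (Complex x y)) (Im a) s"
    using h a unfolding square_analytic_def by blast
  show "\<exists>r>0. (\<forall>y. \<bar>y - Im a\<bar> < r \<longrightarrow> line_ext (\<lambda>x. f (g (Complex x y)) (h (Complex x y))) (Re a) r) \<and>
     (\<forall>x. \<bar>x - Re a\<bar> < r \<longrightarrow> line_ext (\<lambda>y. f (g (Complex x y)) (h (Complex x y))) (Im a) r)"
  proof (intro exI[of _ "min r s"] conjI allI impI)
    fix y assume y: "\<bar>y - Im a\<bar> < min r s"
    show "line_ext (\<lambda>x. f (g (Complex x y)) (h (Complex x y))) (Re a) (min r s)"
      by (rule op; rule line_ext_mono) (use r s y in auto)
  next
    fix x assume x: "\<bar>x - Re a\<bar> < min r s"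
    show "line_ext (\<lambda>y. f (g (Complex x y)) (h (Complex x y))) (Im a) (min r s)"
      by (rule op; rule line_ext_mono) (use r s x in auto)
  qed (use r s in auto)
qed

lemma square_analytic_add: "square_analytic g V \<Longrightarrow> square_analytic h V \<Longrightarrow> square_analytic (\<lambda>z. g z + h z) V"
  by (rule square_analytic_binop[where f = "(+)"]) (auto intro: line_ext_add)

lemma square_analytic_mult: "square_analytic g V \<Longrightarrow> square_analytic h V \<Longrightarrow> square_analytic (\<lambda>z. g z * h z) V"
  by (rule square_analytic_binop[where f = "(*)"]) (auto intro: line_ext_mult)

lemma square_analytic_power: "square_analytic g V \<Longrightarrow> square_analytic (\<lambda>z. g z ^ n) V"
  by (induction n) (auto intro: square_analytic_const square_analytic_mult)

lemma square_analytic_sum: "(\<And>i. i \<in> A \<Longrightarrow> square_analytic (g i) V) \<Longrightarrow> square_analytic (\<lambda>z. \<Sum>i\<in>A. g i z) V"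
  by (induction A rule: infinite_finite_induct) (auto intro: square_analytic_const square_analytic_add)

lemma square_analytic_prod: "(\<And>i. i \<in> A \<Longrightarrow> square_analytic (g i) V) \<Longrightarrow> square_analytic (\<lambda>z. \<Prod>i\<in>A. g i z) V"
  by (induction A rule: infinite_finite_induct) (auto intro: square_analytic_const square_analytic_mult)

definition square :: "complex \<Rightarrow> real \<Rightarrow> complex set" where
  "square a r = {w. \<bar>Re w - Re a\<bar> < r \<and> \<bar>Im w - Im a\<bar> < r}"

lemma open_square: "open (square a r)"
proof -
  have "square a r = (\<lambda>w. \<bar>Re w - Re a\<bar>) -` {..<r} \<inter> (\<lambda>w. \<bar>Im w - Im a\<bar>) -` {..<r}"
    by (auto simp: square_def)
  moreover have "open ((\<lambda>w. \<bar>Re w - Re a\<bar>) -` {..<r})" "open ((\<lambda>w. \<bar>Im w - Im a\<bar>) -` {..<r})"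
    by (intro open_vimage continuous_intros open_lessThan)+
  ultimately show ?thesis by auto
qed

lemma square_in_open:
  assumes "open V" "a \<in> V"
  shows "\<exists>r>0. square a r \<subseteq> V"
proof -
  obtain e where e: "e > 0" "ball a e \<subseteq> V" using assms open_contains_ball by blast
  have "square a (e / 2) \<subseteq> ball a e"
  proof
    fix w assume "w \<in> square a (e / 2)"
    then have "cmod (w - a) < e" using cmod_le[of "w - a"] by (simp add: square_def)
    then show "w \<in> ball a e" by (simp add: dist_norm norm_minus_commute)
  qed
  then show ?thesis using e by (intro exI[of _ "e / 2"]) auto
qed

lemma square_analytic_radius:
  assumes "square_analytic g V" "open V" "a \<in> V"
  obtains r where "r > 0" "square a r \<subseteq> V" "\<And>y. \<bar>y - Im a\<bar> < r \<Longrightarrow> line_ext (\<lambda>x. g (Complex x y)) (Re a) r"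
    "\<And>x. \<bar>x - Re a\<bar> < r \<Longrightarrow> line_ext (\<lambda>y. g (Complex x y)) (Im a) r"
proof -
  obtain r where r: "r > 0" "\<And>y. \<bar>y - Im a\<bar> < r \<Longrightarrow> line_ext (\<lambda>x. g (Complex x y)) (Re a) r"
    "\<And>x. \<bar>x - Re a\<bar> < r \<Longrightarrow> line_ext (\<lambda>y. g (Complex x y)) (Im a) r"
    using assms unfolding square_analytic_def by blast
  obtain s where s: "s > 0" "square a s \<subseteq> V" using square_in_open assms by blast
  show thesis
  proof (rule that[of "min r s"])
    show "square a (min r s) \<subseteq> V" using s(2) by (auto simp: square_def)
    show "line_ext (\<lambda>x. g (Complex x y)) (Re a) (min r s)" if "\<bar>y - Im a\<bar> < min r s" for y
      by (rule line_ext_mono[OF r(2)]) (use that in auto)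
    show "line_ext (\<lambda>y. g (Complex x y)) (Im a) (min r s)" if "\<bar>x - Re a\<bar> < min r s" for x
      by (rule line_ext_mono[OF r(3)]) (use that in auto)
  qed (use r s in auto)
qed

text \<open>Inside a square, zeros spread from a small square along horizontal lines to a strip, and
  from the strip along vertical lines to the whole square. So the interior of the zero set is
  relatively closed in \<open>V\<close>, and connectedness concludes.\<close>

lemma square_analytic_identity:
  assumes g: "square_analytic g V" and V: "open V" "connected V"
    and W: "open W" "W \<noteq> {}" "W \<subseteq> V" "\<And>w. w \<in> W \<Longrightarrow> g w = 0" and v: "v \<in> V"
  shows "g v = 0"
proof -
  define Z where "Z = interior {w\<in>V. g w = 0}"
  have Zsub: "Z \<subseteq> {w\<in>V. g w = 0}" unfolding Z_def by (rule interior_subset)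
  have "W \<subseteq> Z" unfolding Z_def using W by (intro interior_maximal) auto
  then have Zne: "Z \<noteq> {}" using W(2) by blast
  have key: "\<exists>N. open N \<and> a \<in> N \<and> N \<subseteq> V \<and> (N \<inter> Z \<noteq> {} \<longrightarrow> N \<subseteq> Z)" if a: "a \<in> V" for a
  proof -
    obtain r where r: "r > 0" "square a r \<subseteq> V" and hor: "\<And>y. \<bar>y - Im a\<bar> < r \<Longrightarrow> line_ext (\<lambda>x. g (Complex x y)) (Re a) r"
      and ver: "\<And>x. \<bar>x - Re a\<bar> < r \<Longrightarrow> line_ext (\<lambda>y. g (Complex x y)) (Im a) r"
      using square_analytic_radius[OF g V(1) a] by metis
    have "square a r \<subseteq> Z" if ne: "square a r \<inter> Z \<noteq> {}"
    proof -
      obtain w0 where w0: "w0 \<in> square a r" "w0 \<in> Z" using ne by blast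
      have "open (square a r \<inter> Z)" by (auto simp: open_square Z_def)
      then obtain e where e: "e > 0" "square w0 e \<subseteq> square a r \<inter> Z" using square_in_open w0 by blast
      have 1: "g (Complex x y) = 0" if y: "\<bar>y - Im w0\<bar> < e" and x: "\<bar>x - Re a\<bar> < r" for x y
      proof -
        have sq: "Complex t y \<in> square a r \<inter> Z" if t: "\<bar>t - Re w0\<bar> < e" for t
        proof -
          have "Complex t y \<in> square w0 e" using t y by (simp add: square_def)
          then show ?thesis using e(2) by blast
        qed
        have "\<bar>y - Im a\<bar> < r" using sq[of "Re w0"] e(1) by (simp add: square_def)
        from hor[OF this] show ?thesis
        proof (rule line_ext_identity[OF _ interval_islimpt[OF e(1), of "Re w0"] _ _ _ x])
          show "\<bar>Re w0 - Re a\<bar> < r" using w0(1) by (simp add: square_def)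
          fix t assume "t \<in> {s. \<bar>s - Re w0\<bar> < e}"
          then have "Complex t y \<in> square a r \<inter> Z" using sq by simp
          then show "\<bar>t - Re a\<bar> < r" "g (Complex t y) = 0" using Zsub by (auto simp: square_def)
        qed
      qed
      have 2: "g (Complex x y) = 0" if x: "\<bar>x - Re a\<bar> < r" and y: "\<bar>y - Im a\<bar> < r" for x y
      proof (rule line_ext_identity[OF ver[OF x] interval_islimpt[OF e(1), of "Im w0"] _ _ _ y])
        show "\<bar>Im w0 - Im a\<bar> < r" using w0(1) by (simp add: square_def)
        fix t assume t: "t \<in> {s. \<bar>s - Im w0\<bar> < e}"
        then have "Complex (Re w0) t \<in> square w0 e" using e(1) by (simp add: square_def)
        then have "Complex (Re w0) t \<in> square a r" using e(2) by blast
        then show "\<bar>t - Im a\<bar> < r" by (simp add: square_def)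
        show "g (Complex x t) = 0" using 1 t x by simp
      qed
      have "g w = 0" if "w \<in> square a r" for w
        using 2[of "Re w" "Im w"] that by (simp add: square_def)
      then have "square a r \<subseteq> {w\<in>V. g w = 0}" using r(2) by blast
      then show ?thesis unfolding Z_def using open_square by (rule interior_maximal)
    qed
    moreover have "a \<in> square a r" using r(1) by (simp add: square_def)
    ultimately show ?thesis using open_square r(2) by blast
  qed
  have "open (V - Z)"
    unfolding open_subopen[of "V - Z"]
  proof
    fix a assume "a \<in> V - Z"
    then obtain N where N: "open N" "a \<in> N" "N \<subseteq> V" "N \<inter> Z \<noteq> {} \<longrightarrow> N \<subseteq> Z" using key by blast
    then have "N \<subseteq> V - Z" using \<open>a \<in> V - Z\<close> by blast
    then show "\<exists>T. open T \<and> a \<in> T \<and> T \<subseteq> V - Z" using N by blast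
  qed
  moreover have "open Z" by (simp add: Z_def)
  ultimately have "V - Z = {}"
    using connectedD[OF V(2), of Z "V - Z"] Zne Zsub by blast
  then show ?thesis using v Zsub by blast
qed

text \<open>On each horizontal segment one of the two factors vanishes, so one of them does so at
  infinitely many heights. These accumulate, and the identity theorem on vertical lines makes that
  factor zero on a square.\<close>

lemma square_analytic_product_zero:
  assumes g: "square_analytic g V" and h: "square_analytic h V" and V: "open V" "connected V"
    and gh: "\<And>w. w \<in> V \<Longrightarrow> g w * h w = 0"
  shows "(\<forall>w\<in>V. g w = 0) \<or> (\<forall>w\<in>V. h w = 0)"
proof (cases "V = {}")
  case False
  then obtain a where a: "a \<in> V" by blast
  obtain r1 where r1: "r1 > 0" "square a r1 \<subseteq> V"
     "\<And>y. \<bar>y - Im a\<bar> < r1 \<Longrightarrow> line_ext (\<lambda>x. g (Complex x y)) (Re a) r1"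
     "\<And>x. \<bar>x - Re a\<bar> < r1 \<Longrightarrow> line_ext (\<lambda>y. g (Complex x y)) (Im a) r1"
    using square_analytic_radius[OF g V(1) a] by metis
  obtain r2 where r2: "r2 > 0" "square a r2 \<subseteq> V"
     "\<And>y. \<bar>y - Im a\<bar> < r2 \<Longrightarrow> line_ext (\<lambda>x. h (Complex x y)) (Re a) r2"
     "\<And>x. \<bar>x - Re a\<bar> < r2 \<Longrightarrow> line_ext (\<lambda>y. h (Complex x y)) (Im a) r2"
    using square_analytic_radius[OF h V(1) a] by metis
  define r where "r = min r1 r2"
  have r: "r > 0" using r1 r2 by (simp add: r_def)
  have sq: "Complex x y \<in> V" if "\<bar>x - Re a\<bar> < r" "\<bar>y - Im a\<bar> < r" for x y
    using r1(2) that by (auto simp: square_def r_def)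
  have hor: "line_ext (\<lambda>x. g (Complex x y)) (Re a) r" "line_ext (\<lambda>x. h (Complex x y)) (Re a) r" if "\<bar>y - Im a\<bar> < r" for y
    using r1(3)[of y] r2(3)[of y] that by (auto simp: r_def elim: line_ext_mono)
  have ver: "line_ext (\<lambda>y. g (Complex x y)) (Im a) r" "line_ext (\<lambda>y. h (Complex x y)) (Im a) r" if "\<bar>x - Re a\<bar> < r" for x
    using r1(4)[of x] r2(4)[of x] that by (auto simp: r_def elim: line_ext_mono)
  \<comment> \<open>A compact interval, so that an infinite set of heights accumulates; half the
    size keeps the accumulation point inside the open square.\<close>
  define I where "I = {Im a - r / 2..Im a + r / 2}"
  have Ir: "\<bar>y - Im a\<bar> < r" if "y \<in> I" for y using that r by (auto simp: I_def abs_real_def)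
  define A where "A = {y\<in>I. \<forall>x. \<bar>x - Re a\<bar> < r \<longrightarrow> g (Complex x y) = 0}"
  define B where "B = {y\<in>I. \<forall>x. \<bar>x - Re a\<bar> < r \<longrightarrow> h (Complex x y) = 0}"
  have "y \<in> A \<union> B" if y: "y \<in> I" for y
    using line_ext_product_zero[OF hor[OF Ir[OF y]]] gh sq Ir[OF y] y by (auto simp: A_def B_def)
  then have "I \<subseteq> A \<union> B" by blast
  moreover have "infinite I" using r by (simp add: I_def infinite_Icc)
  ultimately have inf: "infinite A \<or> infinite B" using finite_subset by blast
  have BW: "\<exists>y0\<in>I. y0 islimpt T" if "infinite T" "T \<subseteq> I" for T
    using that compact_Icc[of "Im a - r / 2" "Im a + r / 2"]
    unfolding compact_eq_Bolzano_Weierstrass I_def by blast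
  have fin: "\<forall>w\<in>V. f w = 0"
    if f: "square_analytic f V" and fv: "\<And>x. \<bar>x - Re a\<bar> < r \<Longrightarrow> line_ext (\<lambda>y. f (Complex x y)) (Im a) r"
      and T: "infinite T" "T \<subseteq> I" "\<And>x y. y \<in> T \<Longrightarrow> \<bar>x - Re a\<bar> < r \<Longrightarrow> f (Complex x y) = 0" for f T
  proof
    fix w assume w: "w \<in> V"
    obtain y0 where y0: "y0 \<in> I" "y0 islimpt T" using BW[OF T(1,2)] by blast
    have z: "f (Complex x y) = 0" if x: "\<bar>x - Re a\<bar> < r" and y: "\<bar>y - Im a\<bar> < r" for x y
      by (rule line_ext_identity[OF fv[OF x] y0(2) Ir[OF y0(1)] _ _ y]) (use T x Ir in auto)
    show "f w = 0"
    proof (rule square_analytic_identity[OF f V open_square _ _ _ w])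
      show "square a r \<noteq> {}" using r by (auto simp: square_def intro!: exI[of _ a])
      show "square a r \<subseteq> V" using r1(2) by (auto simp: square_def r_def)
      show "f w = 0" if "w \<in> square a r" for w
        using z[of "Re w" "Im w"] that by (simp add: square_def)
    qed
  qed
  from inf show ?thesis
  proof
    assume inf: "infinite A"
    have "\<forall>w\<in>V. g w = 0"
    proof (rule fin[OF g ver(1) inf])
      show "A \<subseteq> I" by (auto simp: A_def)
      show "g (Complex x y) = 0" if "y \<in> A" "\<bar>x - Re a\<bar> < r" for x y using that by (simp add: A_def)
    qed
    then show ?thesis by blast
  next
    assume inf: "infinite B"
    have "\<forall>w\<in>V. h w = 0"
    proof (rule fin[OF h ver(2) inf])
      show "B \<subseteq> I" by (auto simp: B_def)
      show "h (Complex x y) = 0" if "y \<in> B" "\<bar>x - Re a\<bar> < r" for x y using that by (simp add: B_def)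
    qed
    then show ?thesis by blast
  qed
qed auto

text \<open>Provides the base point, at which all denominators and a chosen numerator of both
  algebraic relations are nonzero at once.\<close>

lemma square_analytic_common_nonzero:
  assumes V: "open V" "connected V" "V \<noteq> {}" and fin: "finite A"
    and g: "\<And>i. i \<in> A \<Longrightarrow> square_analytic (g i) V" "\<And>i. i \<in> A \<Longrightarrow> \<exists>w\<in>V. g i w \<noteq> 0"
  shows "\<exists>w\<in>V. \<forall>i\<in>A. g i w \<noteq> 0"
proof -
  have "\<exists>w\<in>V. (\<Prod>i\<in>A. g i w) \<noteq> 0"
    using fin g
  proof (induction A rule: finite_induct)
    case empty then show ?case using V(3) by auto
  next
    case (insert i A)
    have 1: "square_analytic (\<lambda>w. \<Prod>i\<in>A. g i w) V" using insert.prems by (intro square_analytic_prod) auto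
    have "\<exists>w\<in>V. (\<Prod>i\<in>A. g i w) \<noteq> 0" using insert by auto
    moreover have "\<exists>w\<in>V. g i w \<noteq> 0" using insert.prems by auto
    moreover have "square_analytic (g i) V" using insert.prems by auto
    ultimately have "\<exists>w\<in>V. g i w * (\<Prod>i\<in>A. g i w) \<noteq> 0"
      using square_analytic_product_zero[OF _ 1 V(1,2), of "g i"] by blast
    then show ?case using insert.hyps by simp
  qed
  then show ?thesis using fin by auto
qed

text \<open>Summing over \<open>k\<close> leaves a power series in \<open>x - a\<close>. It
  converges at all real points of the interval, hence on the complex disc of the same radius, and
  its sum there is the extension.\<close>

lemma double_series_ext:
  fixes c :: "nat \<times> nat \<Rightarrow> real"
  assumes r: "r > 0" and s: "\<And>x. \<bar>x - a\<bar> < r \<Longrightarrow> ((\<lambda>(j, k). c (j, k) * (x - a) ^ j * t ^ k) has_sum g x) UNIV"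
  shows "line_ext (\<lambda>x. of_real (g x)) a r"
proof -
  have row: "(\<lambda>k. c (j, k) * t ^ k) summable_on UNIV" for j
  proof -
    \<comment> \<open>A nonzero offset below \<open>r\<close>: its powers can be divided out, which
      makes each row summable by itself.\<close>
    have "\<bar>(a + r / 2) - a\<bar> < r" using r by simp
    from s[OF this] have "((\<lambda>(j, k). c (j, k) * (r / 2) ^ j * t ^ k) has_sum g (a + r / 2)) (UNIV \<times> UNIV)"
      by simp
    then have "(\<lambda>(j, k). c (j, k) * (r / 2) ^ j * t ^ k) summable_on UNIV \<times> UNIV"
      by (rule has_sum_imp_summable)
    then have "(\<lambda>k. c (j, k) * (r / 2) ^ j * t ^ k) summable_on UNIV"
      using summable_on_SigmaD1[of "\<lambda>j k. c (j, k) * (r / 2) ^ j * t ^ k" UNIV "\<lambda>_. UNIV" j] by simp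
    then have "(\<lambda>k. (2 / r) ^ j * (c (j, k) * (r / 2) ^ j * t ^ k)) summable_on UNIV"
      by (rule summable_on_cmult_right)
    moreover have "(2 / r) ^ j * (c (j, k) * (r / 2) ^ j * t ^ k) = c (j, k) * t ^ k" for k
      using r by (simp add: power_divide field_simps)
    ultimately show ?thesis by simp
  qed
  define C where "C j = (\<Sum>\<^sub>\<infinity>k. c (j, k) * t ^ k)" for j
  have sums: "(\<lambda>j. C j * (x - a) ^ j) sums g x" if x: "\<bar>x - a\<bar> < r" for x
  proof -
    have "((\<lambda>j. C j * (x - a) ^ j) has_sum g x) UNIV"
    proof (rule has_sum_SigmaD[where B = "\<lambda>_. UNIV" and f = "\<lambda>(j, k). c (j, k) * (x - a) ^ j * t ^ k"])
      show "((\<lambda>(j, k). c (j, k) * (x - a) ^ j * t ^ k) has_sum g x) (UNIV \<times> UNIV)" using s[OF x] by simp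
      fix j :: nat
      have "((\<lambda>k. c (j, k) * t ^ k) has_sum C j) UNIV" unfolding C_def using row by (rule has_sum_infsum)
      from has_sum_cmult_left[OF this, of "(x - a) ^ j"]
      show "((\<lambda>k. case (j, k) of (j, k) \<Rightarrow> c (j, k) * (x - a) ^ j * t ^ k) has_sum C j * (x - a) ^ j) UNIV"
        by (simp add: mult_ac)
    qed
    then show ?thesis by (rule has_sum_imp_sums)
  qed
  define G where "G z = suminf (\<lambda>j. complex_of_real (C j) * (z - of_real a) ^ j)" for z
  have Gsums: "(\<lambda>j. complex_of_real (C j) * (z - of_real a) ^ j) sums G z" if z: "z \<in> ball (of_real a) r" for z
  proof -
    have "cmod (z - of_real a) < r" using z by (simp add: dist_norm norm_minus_commute)
    \<comment> \<open>Convergence at the real point \<open>a + \<rho>\<close> implies convergence at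
      all complex points closer to \<open>a\<close>.\<close>
    then obtain \<rho> where \<rho>: "cmod (z - of_real a) < \<rho>" "\<rho> < r" using dense by blast
    have \<rho>0: "\<rho> > 0" using \<rho>(1) norm_ge_zero[of "z - of_real a"] by linarith
    have "summable (\<lambda>j. C j * \<rho> ^ j)" using sums[of "a + \<rho>"] \<rho>(2) \<rho>0 by (auto simp: sums_iff)
    then have "summable (\<lambda>j. complex_of_real (C j * \<rho> ^ j))" by (rule summable_of_real)
    then have "summable (\<lambda>j. complex_of_real (C j) * of_real \<rho> ^ j)" by simp
    then have "summable (\<lambda>j. complex_of_real (C j) * (z - of_real a) ^ j)"
      by (rule powser_inside) (use \<rho>(1) \<rho>0 in simp)
    then show ?thesis unfolding G_def by (rule summable_sums)
  qed
  then have "G holomorphic_on ball (of_real a) r" by (rule power_series_holomorphic)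
  moreover have "G (of_real x) = of_real (g x)" if x: "\<bar>x - a\<bar> < r" for x
  proof -
    have "(\<lambda>j. complex_of_real (C j * (x - a) ^ j)) sums of_real (g x)" using sums[OF x] by (rule sums_of_real)
    then have "(\<lambda>j. complex_of_real (C j) * (of_real x - of_real a) ^ j) sums of_real (g x)" by simp
    moreover have "complex_of_real x \<in> ball (of_real a) r" using x by (simp add: of_real_mem_ball del: mem_ball)
    ultimately show ?thesis using Gsums sums_unique2 by blast
  qed
  ultimately show ?thesis unfolding line_ext_def by blast
qed

lemma real_analytic_square_analytic:
  assumes "real_analytic_on g V"
  shows "square_analytic (\<lambda>z. of_real (g z)) V"
  unfolding square_analytic_def
proof
  fix a assume "a \<in> V"
  then obtain r c where r: "r > 0" and c: "\<And>w. w \<in> ball a r \<Longrightarrow>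
     ((\<lambda>(j, k). c (j, k) * (Re w - Re a) ^ j * (Im w - Im a) ^ k) has_sum g w) UNIV"
    using assms unfolding real_analytic_on_def by blast
  \<comment> \<open>The distance to \<open>a\<close> is at most the sum of the two offsets, hence
    the half radius.\<close>
  have ball: "Complex x y \<in> ball a r" if "\<bar>x - Re a\<bar> < r / 2" "\<bar>y - Im a\<bar> < r / 2" for x y
    using cmod_le[of "Complex x y - a"] that by (simp add: dist_norm norm_minus_commute)
  show "\<exists>r>0. (\<forall>y. \<bar>y - Im a\<bar> < r \<longrightarrow> line_ext (\<lambda>x. of_real (g (Complex x y))) (Re a) r) \<and>
     (\<forall>x. \<bar>x - Re a\<bar> < r \<longrightarrow> line_ext (\<lambda>y. of_real (g (Complex x y))) (Im a) r)"
  proof (intro exI[of _ "r / 2"] conjI allI impI)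
    show "r / 2 > 0" using r by simp
    fix y assume y: "\<bar>y - Im a\<bar> < r / 2"
    show "line_ext (\<lambda>x. of_real (g (Complex x y))) (Re a) (r / 2)"
      by (rule double_series_ext[where c = c and t = "y - Im a"]) (use r c[OF ball[OF _ y]] in auto)
  next
    fix x assume x: "\<bar>x - Re a\<bar> < r / 2"
    \<comment> \<open>On vertical lines the two indices exchange roles; unconditional summation
      allows the reordering.\<close>
    have "((\<lambda>(k, j). c (j, k) * (y - Im a) ^ k * (x - Re a) ^ j) has_sum g (Complex x y)) UNIV"
      if y: "\<bar>y - Im a\<bar> < r / 2" for y
    proof -
      have "((\<lambda>(j, k). c (j, k) * (x - Re a) ^ j * (y - Im a) ^ k) has_sum g (Complex x y)) (range prod.swap)"
        using c[OF ball[OF x y]] by simp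
      then have "((\<lambda>(j, k). c (j, k) * (x - Re a) ^ j * (y - Im a) ^ k) \<circ> prod.swap has_sum g (Complex x y)) UNIV"
        by (subst (asm) has_sum_reindex) auto
      then show ?thesis by (simp add: o_def case_prod_unfold prod.swap_def mult_ac)
    qed
    then show "line_ext (\<lambda>y. of_real (g (Complex x y))) (Im a) (r / 2)"
      using double_series_ext[where c = "\<lambda>(k, j). c (j, k)" and t = "x - Re a" and a = "Im a" and r = "r / 2"] r
      by (simp add: case_prod_unfold)
  qed
qed

section \<open>Germs on a disc\<close>

definition cst :: "complex \<Rightarrow> gfun" where
  "cst c = germ (\<lambda>_. c)"

lemma cst_simps: "cst 0 = 0" "cst 1 = 1" "cst (a + b) = cst a + cst b" "cst (a * b) = cst a * cst b"
  "cst (- a) = - cst a"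
  by (simp_all add: cst_def germ_zero germ_one germ_add germ_mult germ_minus germ_fun_intros)

lemma cst_eq_iff: "cst a = cst b \<longleftrightarrow> a = b"
  by (simp add: cst_def germ_const_eq_iff)

lemma cst_inverse: "cst (inverse a) = inverse (cst a)"
  by (simp add: cst_def germ_inverse germ_fun_intros)

lemma gderiv_cst: "gderiv (cst c) = 0"
  by (simp add: cst_def germ_deriv germ_fun_intros germ_zero)

lemma field_subset_cst: "field_subset (range cst)"
  unfolding field_subset_def
  by (auto simp flip: cst_simps cst_inverse)

lemma germ_sum:
  assumes "\<And>i. i \<in> A \<Longrightarrow> germ_fun (f i)"
  shows "germ_fun (\<lambda>z. \<Sum>i\<in>A. f i z)" "(\<Sum>i\<in>A. germ (f i)) = germ (\<lambda>z. \<Sum>i\<in>A. f i z)"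
proof -
  have "germ_fun (\<lambda>z. \<Sum>i\<in>A. f i z) \<and> (\<Sum>i\<in>A. germ (f i)) = germ (\<lambda>z. \<Sum>i\<in>A. f i z)"
    using assms
    by (induction A rule: infinite_finite_induct) (auto simp: germ_zero germ_add intro: germ_fun_intros)
  then show "germ_fun (\<lambda>z. \<Sum>i\<in>A. f i z)" "(\<Sum>i\<in>A. germ (f i)) = germ (\<lambda>z. \<Sum>i\<in>A. f i z)" by auto
qed

lemma germ_prod:
  assumes "\<And>i. i \<in> A \<Longrightarrow> germ_fun (f i)"
  shows "germ_fun (\<lambda>z. \<Prod>i\<in>A. f i z)" "(\<Prod>i\<in>A. germ (f i)) = germ (\<lambda>z. \<Prod>i\<in>A. f i z)"
proof -
  have "germ_fun (\<lambda>z. \<Prod>i\<in>A. f i z) \<and> (\<Prod>i\<in>A. germ (f i)) = germ (\<lambda>z. \<Prod>i\<in>A. f i z)"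
    using assms
    by (induction A rule: infinite_finite_induct) (auto simp: germ_one germ_mult intro: germ_fun_intros)
  then show "germ_fun (\<lambda>z. \<Prod>i\<in>A. f i z)" "(\<Prod>i\<in>A. germ (f i)) = germ (\<lambda>z. \<Prod>i\<in>A. f i z)" by auto
qed

lemma germ_power:
  assumes "germ_fun f"
  shows "germ_fun (\<lambda>z. f z ^ n)" "germ f ^ n = germ (\<lambda>z. f z ^ n)"
  using germ_prod[of "{..<n}" "\<lambda>_. f"] assms by simp_all

lemma germ_monomials_eval:
  assumes "\<And>m. m \<in> A \<Longrightarrow> germ_fun (c m)" "\<And>i. germ_fun (g i)"
  shows "germ_fun (\<lambda>z. monomials_eval A (\<lambda>m. c m z) (\<lambda>i. g i z))"
    "monomials_eval A (\<lambda>m. germ (c m)) (\<lambda>i. germ (g i)) = germ (\<lambda>z. monomials_eval A (\<lambda>m. c m z) (\<lambda>i. g i z))"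
proof -
  have 1: "germ_fun (\<lambda>z. \<Prod>i\<in>Poly_Mapping.keys m. g i z ^ Poly_Mapping.lookup m i)"
    "(\<Prod>i\<in>Poly_Mapping.keys m. germ (g i) ^ Poly_Mapping.lookup m i) =
       germ (\<lambda>z. \<Prod>i\<in>Poly_Mapping.keys m. g i z ^ Poly_Mapping.lookup m i)" for m
    using germ_prod[of "Poly_Mapping.keys m" "\<lambda>i z. g i z ^ Poly_Mapping.lookup m i"] germ_power assms(2) by auto
  have 2: "germ_fun (\<lambda>z. c m z * (\<Prod>i\<in>Poly_Mapping.keys m. g i z ^ Poly_Mapping.lookup m i))"
    "germ (c m) * (\<Prod>i\<in>Poly_Mapping.keys m. germ (g i) ^ Poly_Mapping.lookup m i) =
       germ (\<lambda>z. c m z * (\<Prod>i\<in>Poly_Mapping.keys m. g i z ^ Poly_Mapping.lookup m i))" if "m \<in> A" for m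
    using assms(1)[OF that] 1 by (auto simp: germ_mult intro: germ_fun_intros)
  show "germ_fun (\<lambda>z. monomials_eval A (\<lambda>m. c m z) (\<lambda>i. g i z))"
    unfolding monomials_eval_def by (rule germ_sum(1)) (rule 2)
  show "monomials_eval A (\<lambda>m. germ (c m)) (\<lambda>i. germ (g i)) = germ (\<lambda>z. monomials_eval A (\<lambda>m. c m z) (\<lambda>i. g i z))"
    unfolding monomials_eval_def using 2
      germ_sum(2)[of A "\<lambda>m z. c m z * (\<Prod>i\<in>Poly_Mapping.keys m. g i z ^ Poly_Mapping.lookup m i)"] by simp
qed

text \<open>A member of the filter meets the unit disc in a nonempty open set and the disc is
  connected, so a germ determines a function holomorphic on the whole disc.\<close>

lemma germ_ball_zero:
  assumes "h holomorphic_on ball 0 1" "germ h = 0" "z \<in> ball 0 1"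
  shows "h z = 0"
proof -
  obtain V where V: "V \<in> generic" "\<And>z. z \<in> V \<Longrightarrow> h z = 0"
    using germ_eq_zero[OF germ_funI[OF generic_ball assms(1)] assms(2)] by blast
  have W: "V \<inter> ball 0 1 \<in> generic" by (rule generic_Int[OF V(1) generic_ball])
  show ?thesis
    by (rule analytic_continuation_open[of "V \<inter> ball 0 1" "ball 0 1" h "\<lambda>_. 0"])
       (use generic_open[OF W] generic_nonempty[OF W] V(2) assms in auto)
qed

lemma derivation_scale: "derivation D \<Longrightarrow> derivation (\<lambda>x. \<kappa> * D x)"
  by (auto simp: derivation_def algebra_simps)

text \<open>A polynomial in one variable as a polynomial in variable 0; the condition on
  \<open>m\<close> says that no other variable occurs. It serves to produce the witnesses of
  \<open>algebraic_over_funs\<close>.\<close>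

definition poly_mpoly :: "'a::comm_ring_1 poly \<Rightarrow> 'a mpoly" where
  "poly_mpoly p = Abs_poly_mapping (\<lambda>m. if m = Poly_Mapping.single 0 (Poly_Mapping.lookup m 0)
      then Polynomial.coeff p (Poly_Mapping.lookup m 0) else 0)"

lemma keys_poly_mpoly: "Poly_Mapping.keys (poly_mpoly p) = Poly_Mapping.single 0 ` {i. Polynomial.coeff p i \<noteq> 0}"
  and lookup_poly_mpoly: "Poly_Mapping.lookup (poly_mpoly p) (Poly_Mapping.single 0 i) = Polynomial.coeff p i"
proof -
  let ?f = "\<lambda>m. if m = Poly_Mapping.single 0 (Poly_Mapping.lookup m 0)
      then Polynomial.coeff p (Poly_Mapping.lookup m 0) else 0 :: 'a"
  have supp: "{m. ?f m \<noteq> 0} = Poly_Mapping.single 0 ` {i. Polynomial.coeff p i \<noteq> 0}"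
    by (auto simp: image_iff split: if_splits)
  have "{i. Polynomial.coeff p i \<noteq> 0} \<subseteq> {..Polynomial.degree p}" by (auto simp: le_degree)
  then have "finite {m. ?f m \<noteq> 0}" unfolding supp using finite_subset by blast
  then have l: "Poly_Mapping.lookup (poly_mpoly p) = ?f"
    unfolding poly_mpoly_def by (intro Abs_poly_mapping_inverse) simp
  show "Poly_Mapping.keys (poly_mpoly p) = Poly_Mapping.single 0 ` {i. Polynomial.coeff p i \<noteq> 0}"
    unfolding keys.rep_eq l supp ..
  show "Poly_Mapping.lookup (poly_mpoly p) (Poly_Mapping.single 0 i) = Polynomial.coeff p i"
    unfolding l by simp
qed

lemma mpoly_eval_poly_mpoly: "mpoly_eval (poly_mpoly p) x = poly p (x 0)"
proof -
  have "inj (Poly_Mapping.single (0::nat) :: nat \<Rightarrow> _)"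
    by (rule injI) (metis lookup_single_eq)
  then have "mpoly_eval (poly_mpoly p) x = (\<Sum>i\<in>{i. Polynomial.coeff p i \<noteq> 0}. Polynomial.coeff p i * x 0 ^ i)"
    unfolding mpoly_eval_def keys_poly_mpoly
    by (subst sum.reindex) (auto simp: inj_on_def lookup_poly_mpoly intro!: sum.cong)
  also have "\<dots> = (\<Sum>i\<le>Polynomial.degree p. Polynomial.coeff p i * x 0 ^ i)"
    by (rule sum.mono_neutral_left) (auto simp: le_degree)
  finally show ?thesis by (simp add: poly_altdef)
qed

lemma mpoly_vars_poly_mpoly: "mpoly_vars (poly_mpoly p) \<subseteq> {..<1}"
  unfolding mpoly_vars_def keys_poly_mpoly by (auto split: if_splits)

locale disc =
  fixes w0 :: complex and r :: real
  assumes r: "r > 0"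
begin

definition point :: "complex \<Rightarrow> complex" where
  "point \<eta> = w0 + of_real r * \<eta>"

definition pgerm :: "(complex \<Rightarrow> complex) \<Rightarrow> gfun" where
  "pgerm F = germ (\<lambda>\<eta>. F (point \<eta>))"

text \<open>The chain rule for \<open>point\<close> produces a factor \<open>r\<close>; dividing by
  it makes the derivation act as the derivative in the original variable.\<close>

definition pderivation :: "gfun \<Rightarrow> gfun" where
  "pderivation x = cst (inverse (of_real r)) * gderiv x"

definition poly_germ :: "complex poly \<Rightarrow> gfun" where
  "poly_germ p = pgerm (poly p)"

definition rat_germ :: "ratfun \<Rightarrow> gfun" where
  "rat_germ q = poly_germ (fst (quot_of_fract q)) / poly_germ (snd (quot_of_fract q))"

lemma point_ball: "point \<eta> \<in> ball w0 r \<longleftrightarrow> \<eta> \<in> ball 0 1"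
  using r by (simp add: point_def dist_norm norm_mult)

lemma point_holomorphic: "F holomorphic_on ball w0 r \<Longrightarrow> (\<lambda>\<eta>. F (point \<eta>)) holomorphic_on ball 0 1"
proof -
  assume F: "F holomorphic_on ball w0 r"
  have "point holomorphic_on ball 0 1" unfolding point_def [abs_def] by (intro holomorphic_intros)
  moreover have "point ` ball 0 1 \<subseteq> ball w0 r" using point_ball by blast
  ultimately show ?thesis using holomorphic_on_compose_gen[OF _ F, of point "ball 0 1"] by (simp add: o_def)
qed

lemma pgerm_fun: "F holomorphic_on ball w0 r \<Longrightarrow> germ_fun (\<lambda>\<eta>. F (point \<eta>))"
  by (rule germ_funI[OF generic_ball point_holomorphic])

lemma derivation_pderivation: "derivation pderivation"
  unfolding pderivation_def [abs_def] by (rule derivation_scale[OF derivation_gderiv])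

lemma blum_closed_pderivation: "blum_closed pderivation"
proof -
  have "cst (inverse (of_real r)) \<noteq> 0" using r cst_eq_iff[of _ 0] by (simp add: cst_simps)
  then show ?thesis unfolding pderivation_def [abs_def]
    by (intro blum_closed_scale derivation_gderiv blum_closed_gderiv gderiv_cst)
qed

lemma pderivation_pgerm:
  assumes "F holomorphic_on ball w0 r"
  shows "pderivation (pgerm F) = pgerm (deriv F)"
proof -
  have "((\<lambda>\<eta>. F (point \<eta>)) has_field_derivative deriv F (point \<eta>) * of_real r) (at \<eta>)" if "\<eta> \<in> ball 0 1" for \<eta>
  proof -
    have 1: "(F has_field_derivative deriv F (point \<eta>)) (at (point \<eta>))"
      using holomorphic_derivI[OF assms open_ball] point_ball that by blast
    have 2: "(point has_field_derivative of_real r) (at \<eta>)"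
      unfolding point_def [abs_def] by (auto intro!: derivative_eq_intros)
    show ?thesis using DERIV_chain[OF 1 2] by (simp add: o_def)
  qed
  then have d: "deriv (\<lambda>\<eta>. F (point \<eta>)) \<eta> = deriv F (point \<eta>) * of_real r" if "\<eta> \<in> ball 0 1" for \<eta>
    using that DERIV_imp_deriv by blast
  have h: "deriv F holomorphic_on ball w0 r" using assms by (intro holomorphic_deriv) auto
  have "pderivation (pgerm F) = cst (inverse (of_real r)) * germ (deriv (\<lambda>\<eta>. F (point \<eta>)))"
    unfolding pderivation_def pgerm_def using pgerm_fun[OF assms] by (simp add: germ_deriv)
  also have "\<dots> = germ (\<lambda>\<eta>. inverse (of_real r) * deriv (\<lambda>\<eta>. F (point \<eta>)) \<eta>)"
    unfolding cst_def using pgerm_fun[OF assms] by (intro germ_mult germ_fun_intros)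
  also have "\<dots> = germ (\<lambda>\<eta>. deriv F (point \<eta>))"
    by (rule germ_eqI[symmetric, OF generic_ball point_holomorphic[OF h]]) (use d r in auto)
  finally show ?thesis by (simp add: pgerm_def)
qed

lemma jet_pgerm:
  assumes "F holomorphic_on ball w0 r"
  shows "(deriv ^^ i) F holomorphic_on ball w0 r" "jet pderivation (pgerm F) i = pgerm ((deriv ^^ i) F)"
proof -
  have h: "(deriv ^^ i) F holomorphic_on ball w0 r" for i
    using assms by (induction i) (auto intro: holomorphic_deriv)
  then show "(deriv ^^ i) F holomorphic_on ball w0 r" .
  show "jet pderivation (pgerm F) i = pgerm ((deriv ^^ i) F)"
    by (induction i) (auto simp: jet_def pderivation_pgerm[OF h])
qed

lemma poly_hol: "poly p holomorphic_on ball w0 r" for p :: "complex poly"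
  by (intro holomorphic_intros)

lemma poly_germ_simps: "poly_germ 0 = 0" "poly_germ 1 = 1" "poly_germ [:c:] = cst c"
  "poly_germ (p + q) = poly_germ p + poly_germ q" "poly_germ (p * q) = poly_germ p * poly_germ q"
  "poly_germ (- p) = - poly_germ p" "poly_germ (pderiv p) = pderivation (poly_germ p)"
proof -
  note pf = pgerm_fun[OF poly_hol]
  show "poly_germ 0 = 0" "poly_germ 1 = 1" "poly_germ [:c:] = cst c"
    by (simp_all add: poly_germ_def pgerm_def cst_def germ_zero germ_one)
  show "poly_germ (p + q) = poly_germ p + poly_germ q"
    unfolding poly_germ_def pgerm_def using germ_add[OF pf pf, of p q] by simp
  show "poly_germ (p * q) = poly_germ p * poly_germ q"
    unfolding poly_germ_def pgerm_def using germ_mult[OF pf pf, of p q] by simp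
  show "poly_germ (- p) = - poly_germ p"
    unfolding poly_germ_def pgerm_def using germ_minus[OF pf, of p] by simp
  have "deriv (poly p) = poly (pderiv p)" by (rule ext) (rule DERIV_imp_deriv[OF poly_DERIV])
  then show "poly_germ (pderiv p) = pderivation (poly_germ p)"
    unfolding poly_germ_def by (simp add: pderivation_pgerm[OF poly_hol])
qed

lemma poly_germ_eq_0: "poly_germ p = 0 \<longleftrightarrow> p = 0"
proof
  assume z: "poly_germ p = 0"
  show "p = 0"
  proof (rule ccontr)
    assume "p \<noteq> 0"
    then have fin: "finite {z. poly p z = 0}" by (rule poly_roots_finite)
    have "poly p (point \<eta>) = 0" if "\<eta> \<in> ball 0 1" for \<eta>
      using germ_ball_zero[OF point_holomorphic[OF poly_hol] _ that] z by (simp add: poly_germ_def pgerm_def)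
    then have "point ` ball 0 1 \<subseteq> {z. poly p z = 0}" by blast
    then have "finite (point ` ball 0 1)" using fin by (rule finite_subset)
    moreover have "inj_on point (ball 0 1)" using r by (auto simp: inj_on_def point_def)
    ultimately have "finite (ball (0::complex) 1)" by (rule finite_imageD)
    then have "ball (0::complex) 1 = {}" using finite_imp_not_open by blast
    then show False by simp
  qed
qed (simp add: poly_germ_simps)

lemma snd_quot_nz: "snd (quot_of_fract (q::ratfun)) \<noteq> 0"
  by (rule snd_quot_of_fract_nonzero)

lemma rat_germ_Fract: "b \<noteq> 0 \<Longrightarrow> rat_germ (Fract a b) = poly_germ a / poly_germ b"
proof -
  assume b: "b \<noteq> 0"
  define a' b' where "a' = fst (quot_of_fract (Fract a b))" and "b' = snd (quot_of_fract (Fract a b))"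
  have b': "b' \<noteq> 0" unfolding b'_def by (rule snd_quot_nz)
  have "Fract a' b' = Fract a b" unfolding a'_def b'_def by (rule Fract_quot_of_fract)
  then have "a' * b = a * b'" using b b' by (simp add: eq_fract)
  then have "poly_germ a' * poly_germ b = poly_germ a * poly_germ b'" by (metis poly_germ_simps(5))
  then show ?thesis using b b' unfolding rat_germ_def a'_def[symmetric] b'_def[symmetric]
    by (simp add: frac_eq_eq poly_germ_eq_0)
qed

text \<open>These are the conditions under which \<open>rat_germ\<close> embeds the differential
  field of rational functions, as \<open>dcf_over_ratfun\<close> demands.\<close>

lemma rat_germ_hom: "rat_germ 1 = 1" "rat_germ (q + s) = rat_germ q + rat_germ s" "rat_germ (q * s) = rat_germ q * rat_germ s"
  "rat_germ (rat_deriv q) = pderivation (rat_germ q)"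
proof -
  show "rat_germ 1 = 1" using rat_germ_Fract[of 1 1] by (simp add: One_fract_def poly_germ_simps)
  obtain a b where q: "q = Fract a b" "b \<noteq> 0" by (cases q) auto
  obtain c d where s: "s = Fract c d" "d \<noteq> 0" by (cases s) auto
  show "rat_germ (q + s) = rat_germ q + rat_germ s"
    using q s by (simp add: rat_germ_Fract poly_germ_simps poly_germ_eq_0 add_frac_eq)
  show "rat_germ (q * s) = rat_germ q * rat_germ s"
    using q s by (simp add: rat_germ_Fract poly_germ_simps)
  define a' b' where "a' = fst (quot_of_fract q)" and "b' = snd (quot_of_fract q)"
  have b': "b' \<noteq> 0" unfolding b'_def by (rule snd_quot_nz)
  have 1: "rat_deriv q = Fract (pderiv a' * b' - a' * pderiv b') (b' ^ 2)"
    by (simp add: rat_deriv_def a'_def b'_def case_prod_unfold)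
  have 2: "rat_germ q = poly_germ a' * inverse (poly_germ b')"
    by (simp add: rat_germ_def a'_def b'_def divide_inverse)
  have "poly_germ b' \<noteq> 0" using b' by (simp add: poly_germ_eq_0)
  then show "rat_germ (rat_deriv q) = pderivation (rat_germ q)"
    unfolding 1 2 derivation_mult[OF derivation_pderivation] derivation_inverse[OF derivation_pderivation]
    using b' by (simp add: rat_germ_Fract power2_eq_square poly_germ_simps diff_conv_add_uminus[of "_ * _"] field_simps
       del: add_uminus_conv_diff)
qed

lemma rat_germ_eval: "germ_fun (\<lambda>\<eta>. rat_eval q (point \<eta>))" "rat_germ q = germ (\<lambda>\<eta>. rat_eval q (point \<eta>))"
proof -
  note pf = pgerm_fun[OF poly_hol]
  have e: "rat_eval q z = poly (fst (quot_of_fract q)) z * inverse (poly (snd (quot_of_fract q)) z)" for z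
    by (simp add: rat_eval_def case_prod_unfold divide_inverse)
  show "germ_fun (\<lambda>\<eta>. rat_eval q (point \<eta>))"
    unfolding e by (intro germ_fun_intros germ_fun_inverse pf)
  show "rat_germ q = germ (\<lambda>\<eta>. rat_eval q (point \<eta>))"
    unfolding e rat_germ_def poly_germ_def pgerm_def divide_inverse
    using pf by (simp add: germ_inverse germ_mult germ_fun_inverse)
qed

text \<open>The denominator has a nonzero germ, hence no zeros on some member. The differential
  equation, tested away from the poles, can thus be read as an identity of germs.\<close>

lemma rat_germ_no_pole: "\<exists>U\<in>generic. \<forall>\<eta>\<in>U. \<not> rat_pole q (point \<eta>)"
proof -
  have "poly_germ (snd (quot_of_fract q)) \<noteq> 0" using snd_quot_nz by (simp add: poly_germ_eq_0)
  then show ?thesis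
    using germ_nonzero[OF pgerm_fun[OF poly_hol]] unfolding poly_germ_def pgerm_def rat_pole_def by blast
qed

lemma field_subset_rat_germ: "field_subset (range rat_germ)"
proof -
  have m: "- rat_germ q = rat_germ (Fract (-1) 1 * q)" for q
    unfolding rat_germ_hom by (simp add: rat_germ_Fract poly_germ_simps)
  have i: "inverse (rat_germ q) \<in> range rat_germ" for q
  proof -
    obtain a b where q: "q = Fract a b" "b \<noteq> 0" by (cases q) auto
    show ?thesis
    proof (cases "a = 0")
      case True
      then have "inverse (rat_germ q) = rat_germ q" using q by (simp add: rat_germ_Fract poly_germ_simps)
      then show ?thesis by simp
    next
      case False
      then have "inverse (rat_germ q) = rat_germ (Fract b a)" using q by (simp add: rat_germ_Fract)
      then show ?thesis by simp
    qed
  qed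
  have "1 \<in> range rat_germ" by (metis rangeI rat_germ_hom(1))
  then show ?thesis unfolding field_subset_def using i
    by (auto simp: m simp flip: rat_germ_hom(2,3))
qed

lemma cst_in_rat_germ: "cst c \<in> range rat_germ"
  using rat_germ_Fract[of 1 "[:c:]"] by (metis div_by_1 poly_germ_simps(2,3) rangeI one_neq_zero)

lemma ident_in_rat_germ: "pgerm (\<lambda>z. z) \<in> range rat_germ"
proof -
  have "pgerm (\<lambda>z. z) = poly_germ [:0, 1:]" by (simp add: poly_germ_def pgerm_def)
  also have "\<dots> = rat_germ (Fract [:0, 1:] 1)" by (simp add: rat_germ_Fract poly_germ_simps)
  finally show ?thesis by simp
qed

lemma ade_solution_germ:
  assumes f: "f holomorphic_on ball w0 r" and U: "ball w0 r \<subseteq> U" and sol: "ade_solution_on P f U"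
  shows "monomials_eval (Poly_Mapping.keys P) (\<lambda>m. rat_germ (Poly_Mapping.lookup P m)) (jet pderivation (pgerm f)) = 0"
proof -
  define h where "h \<eta> = monomials_eval (Poly_Mapping.keys P) (\<lambda>m. rat_eval (Poly_Mapping.lookup P m) (point \<eta>))
     (\<lambda>i. (deriv ^^ i) f (point \<eta>))" for \<eta>
  have "\<exists>W\<in>generic. \<forall>m\<in>A. \<forall>\<eta>\<in>W. \<not> rat_pole (Poly_Mapping.lookup P m) (point \<eta>)" if "finite A" for A
    using that
  proof (induction A rule: finite_induct)
    case empty then show ?case using generic_ball by blast
  next
    case (insert m A)
    then obtain W where W: "W \<in> generic" "\<forall>m\<in>A. \<forall>\<eta>\<in>W. \<not> rat_pole (Poly_Mapping.lookup P m) (point \<eta>)" by blast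
    obtain W' where W': "W' \<in> generic" "\<forall>\<eta>\<in>W'. \<not> rat_pole (Poly_Mapping.lookup P m) (point \<eta>)"
      using rat_germ_no_pole by blast
    show ?case using W W' by (intro bexI[OF _ generic_Int[OF W(1) W'(1)]]) auto
  qed
  from this[of "Poly_Mapping.keys P"] obtain W where W: "W \<in> generic"
    "\<forall>m\<in>Poly_Mapping.keys P. \<forall>\<eta>\<in>W. \<not> rat_pole (Poly_Mapping.lookup P m) (point \<eta>)" by auto
  have z: "h \<eta> = 0" if "\<eta> \<in> W \<inter> ball 0 1" for \<eta>
  proof -
    have "point \<eta> \<in> U" using that U point_ball by blast
    then show ?thesis using sol W(2) that unfolding ade_solution_on_def h_def monomials_eval_def by blast
  qed
  have "monomials_eval (Poly_Mapping.keys P) (\<lambda>m. rat_germ (Poly_Mapping.lookup P m)) (jet pderivation (pgerm f)) =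
     monomials_eval (Poly_Mapping.keys P) (\<lambda>m. germ (\<lambda>\<eta>. rat_eval (Poly_Mapping.lookup P m) (point \<eta>)))
       (\<lambda>i. germ (\<lambda>\<eta>. (deriv ^^ i) f (point \<eta>)))"
    using jet_pgerm(2)[OF f] rat_germ_eval(2) by (simp add: pgerm_def monomials_eval_def)
  also have "\<dots> = germ h"
    unfolding h_def by (rule germ_monomials_eval(2)) (intro rat_germ_eval pgerm_fun jet_pgerm f)+
  also have "\<dots> = germ (\<lambda>_. 0)"
    by (rule germ_eqI[symmetric, OF generic_Int[OF W(1) generic_ball]]) (use z in auto)
  finally show ?thesis by (simp add: germ_zero)
qed

text \<open>Presents the rational functions as generated by one element over the constants, the form
  in which denominators can be cleared.\<close>

lemma rat_germ_subset_gen: "range rat_germ \<subseteq> gen_field (insert (pgerm (\<lambda>z. z)) (range cst))"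
proof
  fix x assume "x \<in> range rat_germ"
  then obtain q where x: "x = rat_germ q" by blast
  let ?G = "gen_field (insert (pgerm (\<lambda>z. z)) (range cst))"
  have "poly_germ p \<in> ?G" for p
  proof (induction p)
    case 0 then show ?case using field_subset_zero[OF field_subset_gen] by (simp add: poly_germ_simps)
  next
    case (pCons a p)
    have "pCons a p = [:a:] + [:0, 1:] * p" by simp
    then have "poly_germ (pCons a p) = cst a + poly_germ [:0, 1:] * poly_germ p"
      by (simp only: poly_germ_simps)
    moreover have "poly_germ [:0, 1:] = pgerm (\<lambda>z. z)" by (simp add: poly_germ_def pgerm_def)
    moreover have "cst a \<in> ?G" "pgerm (\<lambda>z. z) \<in> ?G" by (rule gen_base, simp)+
    ultimately show ?case using pCons.IH by (simp add: gen_add gen_mult)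
  qed
  then show "x \<in> ?G" unfolding x rat_germ_def by (intro field_subset_divide[OF field_subset_gen])
qed

text \<open>Transcendence of \<open>f\<close> is given on \<open>U\<close>, whereas the tower lives
  on a small disc. A relation between germs, cleared of denominators, holds on the disc and extends
  to all of \<open>U\<close> by the identity theorem.\<close>

lemma algebraic_germ_imp_algebraic:
  assumes U: "open U" "connected U" "ball w0 r \<subseteq> U" and f: "f holomorphic_on U"
    and alg: "alg_over (range rat_germ) (pgerm f)"
  shows "algebraic_over_funs U [\<lambda>z. z] f"
proof -
  have w0U: "w0 \<in> U" using U(3) r by (simp add: subset_iff)
  have fb: "f holomorphic_on ball w0 r" using f U(3) by (rule holomorphic_on_subset)
  have "pgerm f \<in> acl (insert (pgerm (\<lambda>z. z)) (range cst))"
    unfolding acl_def using alg rat_germ_subset_gen alg_over_mono by blast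
  from acl_insert_clear_denominators[OF field_subset_cst this]
  obtain n C where C: "\<forall>k\<le>n. C k \<in> polys_over (range cst)" "\<exists>k\<le>n. poly (C k) (pgerm (\<lambda>z. z)) \<noteq> 0"
    "(\<Sum>k\<le>n. poly (C k) (pgerm (\<lambda>z. z)) * pgerm f ^ k) = 0" by blast
  \<comment> \<open>A polynomial with constant coefficients, evaluated at the germ of the identity,
    is the germ of a polynomial.\<close>
  have "q \<in> polys_over (range cst) \<Longrightarrow> \<exists>p. poly q (pgerm (\<lambda>z. z)) = poly_germ p" for q
  proof (induction q)
    case 0
    show ?case by (rule exI[of _ 0]) (simp add: poly_germ_simps)
  next
    case (pCons a q)
    have coeffs: "Polynomial.coeff (pCons a q) i \<in> range cst" for i
      using pCons.prems by (simp add: polys_over_def)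
    obtain c where c: "a = cst c" using coeffs[of 0] by auto
    have "q \<in> polys_over (range cst)"
      unfolding polys_over_def using coeffs[of "Suc i" for i] by simp
    then obtain p where p: "poly q (pgerm (\<lambda>z. z)) = poly_germ p" using pCons.IH by blast
    have "pCons c p = [:c:] + [:0, 1:] * p" by simp
    then have "poly_germ (pCons c p) = cst c + poly_germ [:0, 1:] * poly_germ p"
      by (simp only: poly_germ_simps)
    moreover have "poly_germ [:0, 1:] = pgerm (\<lambda>z. z)" by (simp add: poly_germ_def pgerm_def)
    ultimately show ?case using p c by (intro exI[of _ "pCons c p"]) simp
  qed
  then have "\<exists>p. poly (C k) (pgerm (\<lambda>z. z)) = poly_germ p" if "k \<le> n" for k using C(1) that by blast
  then obtain p where p: "\<And>k. k \<le> n \<Longrightarrow> poly (C k) (pgerm (\<lambda>z. z)) = poly_germ (p k)" by metis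
  define H where "H z = (\<Sum>k\<le>n. poly (p k) z * f z ^ k)" for z
  have Hh: "H holomorphic_on U" unfolding H_def [abs_def] by (intro holomorphic_intros f)
  have "germ (\<lambda>\<eta>. H (point \<eta>)) = (\<Sum>k\<le>n. poly_germ (p k) * pgerm f ^ k)"
    unfolding H_def poly_germ_def pgerm_def using pgerm_fun[OF fb] pgerm_fun[OF poly_hol]
    by (subst germ_sum(2)[symmetric]) (auto simp: germ_power germ_mult intro: germ_fun_intros)
  also have "\<dots> = 0" using C(3) p by simp
  finally have "H (point \<eta>) = 0" if "\<eta> \<in> ball 0 1" for \<eta>
    using germ_ball_zero[OF point_holomorphic[OF holomorphic_on_subset[OF Hh U(3)]] _ that] by blast
  moreover have "\<exists>\<eta>\<in>ball 0 1. z = point \<eta>" if "z \<in> ball w0 r" for z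
  proof -
    have "z = point ((z - w0) / of_real r)" using r by (simp add: point_def)
    then show ?thesis using that point_ball by metis
  qed
  ultimately have "H z = 0" if "z \<in> ball w0 r" for z using that by blast
  then have H0: "H z = 0" if "z \<in> U" for z
    using analytic_continuation_open[of "ball w0 r" U H "\<lambda>_. 0" z] U Hh r that by auto
  show ?thesis
    unfolding algebraic_over_funs_def
  \<comment> \<open>The denominators have been cleared, so 1 is taken for all of them.\<close>
  proof (rule exI[of _ n], rule exI[of _ "\<lambda>k. poly_mpoly (p k)"], rule exI[of _ "\<lambda>k. poly_mpoly 1"], intro conjI)
    show "\<forall>k\<le>n. mpoly_vars (poly_mpoly (p k)) \<subseteq> {..<length [\<lambda>z. z]} \<and> mpoly_vars (poly_mpoly (1 :: complex poly)) \<subseteq> {..<length [\<lambda>z. z]}"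
      using mpoly_vars_poly_mpoly[where 'a = complex] by simp
    show "\<forall>k\<le>n. \<exists>w\<in>U. mpoly_eval (poly_mpoly 1) (\<lambda>i. ([\<lambda>z. z] ! i) w) \<noteq> 0"
      using w0U by (auto simp: mpoly_eval_poly_mpoly)
    obtain k where k: "k \<le> n" "p k \<noteq> 0" using C(2) p by (metis poly_germ_eq_0)
    have "\<exists>w\<in>U. poly (p k) w \<noteq> 0"
    proof (rule ccontr)
      assume "\<not> ?thesis"
      then have "U \<subseteq> {z. poly (p k) z = 0}" by blast
      then have "finite U" using poly_roots_finite[OF k(2)] finite_subset by blast
      then have "U = {}" using finite_imp_not_open U(1) by blast
      then show False using w0U by simp
    qed
    then show "\<exists>k\<le>n. \<exists>w\<in>U. mpoly_eval (poly_mpoly (p k)) (\<lambda>i. ([\<lambda>z. z] ! i) w) \<noteq> 0"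
      using k(1) by (auto simp: mpoly_eval_poly_mpoly)
    show "\<forall>w\<in>U. (\<forall>k\<le>n. mpoly_eval (poly_mpoly 1) (\<lambda>i. ([\<lambda>z. z] ! i) w) \<noteq> 0) \<longrightarrow>
       (\<Sum>k\<le>n. mpoly_eval (poly_mpoly (p k)) (\<lambda>i. ([\<lambda>z. z] ! i) w) / mpoly_eval (poly_mpoly 1) (\<lambda>i. ([\<lambda>z. z] ! i) w) * f w ^ k) = 0"
      using H0 by (simp add: mpoly_eval_poly_mpoly H_def)
  qed
qed

end

section \<open>Restriction to a line\<close>

lemma mpoly_eval_monomials: "mpoly_eval p x = monomials_eval (Poly_Mapping.keys p) (Poly_Mapping.lookup p) x"
  by (simp add: mpoly_eval_def monomials_eval_def)

lemma monomials_eval_cong: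
  assumes "\<And>m. m \<in> A \<Longrightarrow> c m = c' m" "\<And>i. i \<in> (\<Union>m\<in>A. Poly_Mapping.keys m) \<Longrightarrow> x i = x' i"
  shows "monomials_eval A c x = monomials_eval A c' x'"
  unfolding monomials_eval_def using assms
  by (intro sum.cong refl arg_cong2[where f = "(*)"] prod.cong arg_cong2[where f = "(^)"]) auto

lemma monomials_eval_in:
  assumes "field_subset K" "\<And>m. m \<in> A \<Longrightarrow> c m \<in> K" "\<And>i. i \<in> (\<Union>m\<in>A. Poly_Mapping.keys m) \<Longrightarrow> x i \<in> K"
  shows "monomials_eval A c x \<in> K"
  unfolding monomials_eval_def using assms
  by (intro field_subset_sum field_subset_mult field_subset_prod field_subset_power) auto

lemma monomials_eval_holomorphic:
  assumes "\<And>m. m \<in> A \<Longrightarrow> c m holomorphic_on S" "\<And>i. x i holomorphic_on S"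
  shows "(\<lambda>z. monomials_eval A (\<lambda>m. c m z) (\<lambda>i. x i z)) holomorphic_on S"
  unfolding monomials_eval_def using assms by (intro holomorphic_intros) auto

lemma of_real_monomials_eval:
  "of_real (monomials_eval A c x) = monomials_eval A (\<lambda>m. of_real (c m)) (\<lambda>i. of_real (x i) :: complex)"
  by (simp add: monomials_eval_def)

lemma square_analytic_mpoly:
  assumes "mpoly_vars a \<subseteq> {..<N}" "\<And>i. i < N \<Longrightarrow> square_analytic (g i) V"
  shows "square_analytic (\<lambda>w. mpoly_eval a (\<lambda>i. g i w)) V"
  unfolding mpoly_eval_def using assms
  by (intro square_analytic_sum square_analytic_mult square_analytic_prod square_analytic_power square_analytic_const)
     (auto simp: mpoly_vars_def)

context disc
begin

text \<open>A translation by \<open>\<i> * Im w0\<close> moves the horizontal diameter to the real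
  axis, where the zeros accumulate at the centre of the disc.\<close>

lemma line_identity:
  assumes H: "H holomorphic_on ball w0 r" and \<epsilon>: "\<epsilon> > 0" "\<epsilon> \<le> r"
    and z: "\<And>x. \<bar>x - Re w0\<bar> < \<epsilon> \<Longrightarrow> H (Complex x (Im w0)) = 0" and w: "w \<in> ball w0 r"
  shows "H w = 0"
proof -
  define s where "s z = z + \<i> * of_real (Im w0)" for z
  have sb: "s z \<in> ball w0 r \<longleftrightarrow> z \<in> ball (of_real (Re w0)) r" for z
  proof -
    have "s z - w0 = z - of_real (Re w0)" by (simp add: s_def complex_eq_iff)
    then show ?thesis by (simp add: dist_norm norm_minus_commute[of w0] norm_minus_commute[of "complex_of_real (Re w0)"])
  qed
  have sx: "s (of_real x) = Complex x (Im w0)" for x by (simp add: s_def complex_eq_iff)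
  have "s holomorphic_on ball (of_real (Re w0)) r" unfolding s_def [abs_def] by (intro holomorphic_intros)
  moreover have "s ` ball (of_real (Re w0)) r \<subseteq> ball w0 r" using sb by blast
  ultimately have "(H \<circ> s) holomorphic_on ball (of_real (Re w0)) r"
    by (rule holomorphic_on_compose_gen[OF _ H])
  then have "(H \<circ> s) (w - \<i> * of_real (Im w0)) = 0"
  proof (rule real_islimpt_identity[OF _ interval_islimpt[OF \<epsilon>(1), of "Re w0"]])
    show "\<bar>Re w0 - Re w0\<bar> < r" using r by simp
    show "\<bar>x - Re w0\<bar> < r" "(H \<circ> s) (of_real x) = 0" if "x \<in> {y. \<bar>y - Re w0\<bar> < \<epsilon>}" for x
      using that \<epsilon>(2) z by (auto simp: sx)
    show "w - \<i> * of_real (Im w0) \<in> ball (of_real (Re w0)) r"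
      using w sb[of "w - \<i> * of_real (Im w0)"] by (simp add: s_def)
  qed
  then show ?thesis by (simp add: s_def)
qed

lemma pgerm_eq_0:
  assumes "H holomorphic_on ball w0 r" "pgerm H = 0" "w \<in> ball w0 r"
  shows "H w = 0"
proof -
  have "w = point ((w - w0) / of_real r)" using r by (simp add: point_def)
  moreover from this have "(w - w0) / of_real r \<in> ball 0 1" using assms(3) point_ball by metis
  ultimately show ?thesis
    using germ_ball_zero[OF point_holomorphic[OF assms(1)]] assms(2) unfolding pgerm_def by metis
qed

lemma pgerm_simps:
  assumes "F holomorphic_on ball w0 r" "H holomorphic_on ball w0 r"
  shows "pgerm (\<lambda>z. F z + H z) = pgerm F + pgerm H" "pgerm (\<lambda>z. F z * H z) = pgerm F * pgerm H"
  using pgerm_fun assms unfolding pgerm_def by (simp_all add: germ_add germ_mult)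

lemma pgerm_const: "pgerm (\<lambda>z. c) = cst c"
  by (simp add: pgerm_def cst_def)

lemma pgerm_power: "F holomorphic_on ball w0 r \<Longrightarrow> pgerm (\<lambda>z. F z ^ n) = pgerm F ^ n"
  using germ_power(2)[OF pgerm_fun, of F n] unfolding pgerm_def by simp

lemma pgerm_sum: "(\<And>i. i \<in> A \<Longrightarrow> F i holomorphic_on ball w0 r) \<Longrightarrow> pgerm (\<lambda>z. \<Sum>i\<in>A. F i z) = (\<Sum>i\<in>A. pgerm (F i))"
  unfolding pgerm_def by (rule germ_sum(2)[symmetric]) (rule pgerm_fun)

lemma pgerm_prod: "(\<And>i. i \<in> A \<Longrightarrow> F i holomorphic_on ball w0 r) \<Longrightarrow> pgerm (\<lambda>z. \<Prod>i\<in>A. F i z) = (\<Prod>i\<in>A. pgerm (F i))"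
  unfolding pgerm_def by (rule germ_prod(2)[symmetric]) (rule pgerm_fun)

lemma pgerm_monomials_eval:
  assumes "\<And>i. x i holomorphic_on ball w0 r"
  shows "pgerm (\<lambda>z. monomials_eval A c (\<lambda>i. x i z)) = monomials_eval A (\<lambda>m. cst (c m)) (\<lambda>i. pgerm (x i))"
  using germ_monomials_eval(2)[of A "\<lambda>m _. c m" "\<lambda>i \<eta>. x i (point \<eta>)"] pgerm_fun[OF assms]
  unfolding pgerm_def cst_def by (simp add: germ_fun_intros)

text \<open>The relation is given on the horizontal diameter where no denominator vanishes. Cleared
  of denominators, it holds on the diameter near \<open>w0\<close>, hence on the disc, and becomes a
  relation of germs; the values at \<open>w0\<close> show that it is nontrivial.\<close>

lemma relation_imp_acl:
  assumes e: "\<And>i. e i holomorphic_on ball w0 r" and h: "h holomorphic_on ball w0 r"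
    and vars: "\<And>k. k \<le> d \<Longrightarrow> mpoly_vars (a k) \<subseteq> {..<N}" "\<And>k. k \<le> d \<Longrightarrow> mpoly_vars (b k) \<subseteq> {..<N}"
    and nz: "\<And>k. k \<le> d \<Longrightarrow> mpoly_eval (b k) (\<lambda>i. e i w0) \<noteq> 0" "k0 \<le> d" "mpoly_eval (a k0) (\<lambda>i. e i w0) \<noteq> 0"
    and rel: "\<And>x. \<bar>x - Re w0\<bar> < r \<Longrightarrow> (\<And>k. k \<le> d \<Longrightarrow> mpoly_eval (b k) (\<lambda>i. e i (Complex x (Im w0))) \<noteq> 0) \<Longrightarrow>
       (\<Sum>k\<le>d. mpoly_eval (a k) (\<lambda>i. e i (Complex x (Im w0))) / mpoly_eval (b k) (\<lambda>i. e i (Complex x (Im w0)))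
          * h (Complex x (Im w0)) ^ k) = 0"
  shows "pgerm h \<in> acl (range cst \<union> (\<lambda>i. pgerm (e i)) ` {..<N})"
proof -
  let ?K = "gen_field (range cst \<union> (\<lambda>i. pgerm (e i)) ` {..<N})"
  define A where "A k z = mpoly_eval (a k) (\<lambda>i. e i z)" for k z
  define B where "B k z = mpoly_eval (b k) (\<lambda>i. e i z)" for k z
  have hol: "(\<lambda>z. mpoly_eval p (\<lambda>i. e i z)) holomorphic_on ball w0 r" for p
    unfolding mpoly_eval_monomials by (rule monomials_eval_holomorphic) (use e in auto)
  have Ah: "A k holomorphic_on ball w0 r" and Bh: "B k holomorphic_on ball w0 r" for k
    using hol by (simp_all add: A_def [abs_def] B_def [abs_def])
  have inK: "pgerm (\<lambda>z. mpoly_eval p (\<lambda>i. e i z)) \<in> ?K" if "mpoly_vars p \<subseteq> {..<N}" for p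
    unfolding mpoly_eval_monomials pgerm_monomials_eval[OF e]
  proof (rule monomials_eval_in[OF field_subset_gen])
    show "cst (Poly_Mapping.lookup p m) \<in> ?K" for m by (rule gen_base) simp
    show "pgerm (e i) \<in> ?K" if "i \<in> (\<Union>m\<in>Poly_Mapping.keys p. Poly_Mapping.keys m)" for i
      by (rule gen_base) (use that \<open>mpoly_vars p \<subseteq> {..<N}\<close> in \<open>auto simp: mpoly_vars_def\<close>)
  qed
  define Q where "Q z = (\<Prod>k\<le>d. B k z)" for z
  have Qh: "Q holomorphic_on ball w0 r" unfolding Q_def [abs_def] by (intro holomorphic_intros Bh)
  define C where "C k z = A k z * (\<Prod>j\<in>{..d} - {k}. B j z)" for k z
  have Ch: "C k holomorphic_on ball w0 r" for k unfolding C_def [abs_def] by (intro holomorphic_intros Ah Bh)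
  define H where "H z = (\<Sum>k\<le>d. C k z * h z ^ k)" for z
  have Hh: "H holomorphic_on ball w0 r" unfolding H_def [abs_def] by (intro holomorphic_intros Ch h)
  have w0: "w0 \<in> ball w0 r" using r by simp
  \<comment> \<open>By continuity no denominator vanishes near \<open>w0\<close>, and a short piece
    of the diameter is enough for \<open>line_identity\<close>.\<close>
  have "Q w0 \<noteq> 0" using nz(1) by (simp add: Q_def B_def)
  moreover have "isCont Q w0"
    using holomorphic_on_imp_continuous_on[OF Qh] w0 by (simp add: continuous_on_eq_continuous_at)
  ultimately obtain \<epsilon> where \<epsilon>: "\<epsilon> > 0" "\<And>z. dist w0 z < \<epsilon> \<Longrightarrow> Q z \<noteq> 0" using continuous_at_avoid by blast
  have Hz: "H w = 0" if "w \<in> ball w0 r" for w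
  proof (rule line_identity[OF Hh _ _ _ that])
    show "min \<epsilon> r > 0" "min \<epsilon> r \<le> r" using \<epsilon> r by auto
    fix x assume x: "\<bar>x - Re w0\<bar> < min \<epsilon> r"
    define z where "z = Complex x (Im w0)"
    have "dist w0 z < \<epsilon>" using x by (simp add: z_def dist_complex_def cmod_def power2_eq_square abs_minus_commute real_sqrt_abs2)
    then have Qz: "Q z \<noteq> 0" by (rule \<epsilon>(2))
    then have Bz: "B k z \<noteq> 0" if "k \<le> d" for k using that by (auto simp: Q_def)
    have "H z = Q z * (\<Sum>k\<le>d. A k z / B k z * h z ^ k)"
      unfolding H_def sum_distrib_left
    proof (intro sum.cong refl)
      fix k assume k: "k \<in> {..d}"
      have "Q z = B k z * (\<Prod>j\<in>{..d} - {k}. B j z)" unfolding Q_def using k by (intro prod.remove) auto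
      then show "C k z * h z ^ k = Q z * (A k z / B k z * h z ^ k)"
        using Bz[of k] k by (simp add: C_def)
    qed
    also have "(\<Sum>k\<le>d. A k z / B k z * h z ^ k) = 0"
      unfolding A_def B_def z_def by (rule rel) (use x Bz in \<open>auto simp: B_def z_def\<close>)
    finally show "H (Complex x (Im w0)) = 0" by (simp add: z_def)
  qed
  have "germ (\<lambda>\<eta>. H (point \<eta>)) = germ (\<lambda>_. 0)"
    by (rule germ_eqI[OF generic_ball point_holomorphic[OF Hh]]) (use Hz point_ball in blast)
  then have "0 = pgerm H" by (simp add: pgerm_def germ_zero)
  also have "pgerm H = (\<Sum>k\<le>d. pgerm (C k) * pgerm h ^ k)"
    unfolding H_def using Ch h
    by (simp add: pgerm_sum pgerm_simps pgerm_power holomorphic_on_mult holomorphic_on_power)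
  finally have sum0: "(\<Sum>k\<le>d. pgerm (C k) * pgerm h ^ k) = 0" by simp
  have CK: "pgerm (C k) \<in> ?K" if "k \<le> d" for k
  proof -
    have "pgerm (C k) = pgerm (A k) * (\<Prod>j\<in>{..d} - {k}. pgerm (B j))"
      unfolding C_def using Ah Bh by (simp add: pgerm_simps pgerm_prod holomorphic_on_prod)
    moreover have "pgerm (A k) \<in> ?K" using inK[OF vars(1)[OF that]] by (simp add: A_def [abs_def])
    moreover have "pgerm (B j) \<in> ?K" if "j \<le> d" for j using inK[OF vars(2)[OF that]] by (simp add: B_def [abs_def])
    ultimately show ?thesis
      by (auto intro!: field_subset_mult[OF field_subset_gen] field_subset_prod[OF field_subset_gen])
  qed
  have C0: "pgerm (C k0) \<noteq> 0"
  proof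
    assume "pgerm (C k0) = 0"
    from pgerm_eq_0[OF Ch this w0] show False using nz by (auto simp: C_def A_def B_def)
  qed
  show ?thesis unfolding acl_def alg_over_def
    by (rule CollectI, rule exI[of _ d], rule exI[of _ "\<lambda>k. pgerm (C k)"]) (use sum0 CK C0 nz(2) in blast)
qed

text \<open>Schwarz reflection in the horizontal line through \<open>w0\<close>: \<open>S\<close> is
  the conjugate of \<open>f\<close> at the reflected point, holomorphic and equal to the conjugate
  of \<open>f\<close> on the line. \<open>R\<close> and \<open>I\<close> are formed from
  \<open>f\<close> and \<open>S\<close> as real and imaginary part are from a number and its
  conjugate.\<close>

lemma real_imag_ext:
  assumes f: "f holomorphic_on ball w0 r"
  shows "\<exists>R I. R holomorphic_on ball w0 r \<and> I holomorphic_on ball w0 r \<and> (\<forall>z. f z = R z + \<i> * I z) \<and>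
    (\<forall>x. R (Complex x (Im w0)) = of_real (Re (f (Complex x (Im w0)))) \<and>
         I (Complex x (Im w0)) = of_real (Im (f (Complex x (Im w0)))))"
proof -
  define B where "B = ball (complex_of_real (Re w0)) r"
  define s where "s z = z + \<i> * of_real (Im w0)" for z
  define t where "t z = z - \<i> * of_real (Im w0)" for z
  have sb: "s z \<in> ball w0 r \<longleftrightarrow> z \<in> B" for z
  proof -
    have "s z - w0 = z - of_real (Re w0)" by (simp add: s_def complex_eq_iff)
    then show ?thesis by (simp add: dist_norm norm_minus_commute[of w0] norm_minus_commute[of "complex_of_real (Re w0)"] B_def)
  qed
  have st: "s (t z) = z" for z by (simp add: s_def t_def)
  have "s holomorphic_on B" unfolding s_def [abs_def] by (intro holomorphic_intros)
  moreover have "s ` B \<subseteq> ball w0 r" using sb by blast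
  ultimately have fs: "(f \<circ> s) holomorphic_on B" by (rule holomorphic_on_compose_gen[OF _ f])
  have "cnj z \<in> B \<longleftrightarrow> z \<in> B" for z
  proof -
    have "cmod (cnj z - of_real (Re w0)) = cmod (z - of_real (Re w0))"
      by (metis complex_cnj_complex_of_real complex_cnj_diff complex_mod_cnj)
    then show ?thesis by (simp add: B_def dist_norm norm_minus_commute[of w0] norm_minus_commute[of "complex_of_real (Re w0)"])
  qed
  then have "cnj ` B = B" by (auto simp: image_iff) (metis complex_cnj_cnj)
  then have cfs: "cnj \<circ> (f \<circ> s) \<circ> cnj holomorphic_on B"
    using holomorphic_on_compose_cnj_cnj[of "f \<circ> s" B] fs by (simp add: B_def)
  define S where "S = (cnj \<circ> (f \<circ> s) \<circ> cnj) \<circ> t"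
  have "t holomorphic_on ball w0 r" unfolding t_def [abs_def] by (intro holomorphic_intros)
  moreover have "t ` ball w0 r \<subseteq> B" using sb st by (metis image_subsetI)
  ultimately have S: "S holomorphic_on ball w0 r" unfolding S_def by (rule holomorphic_on_compose_gen[OF _ cfs])
  have Sx: "S (Complex x (Im w0)) = cnj (f (Complex x (Im w0)))" for x
  proof -
    have "t (Complex x (Im w0)) = of_real x" "s (of_real x) = Complex x (Im w0)"
      by (simp_all add: s_def t_def complex_eq_iff)
    then show ?thesis by (simp add: S_def)
  qed
  show ?thesis
  proof (intro exI conjI allI)
    show "(\<lambda>z. (f z + S z) / 2) holomorphic_on ball w0 r" "(\<lambda>z. (f z - S z) / (2 * \<i>)) holomorphic_on ball w0 r"
      using f S by (auto intro!: holomorphic_intros)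
    show "f z = (f z + S z) / 2 + \<i> * ((f z - S z) / (2 * \<i>))" for z by (simp add: field_simps)
    fix x
    show "(f (Complex x (Im w0)) + S (Complex x (Im w0))) / 2 = of_real (Re (f (Complex x (Im w0))))"
      unfolding Sx complex_add_cnj by simp
    show "(f (Complex x (Im w0)) - S (Complex x (Im w0))) / (2 * \<i>) = of_real (Im (f (Complex x (Im w0))))"
      unfolding Sx complex_diff_cnj by (simp add: field_simps)
  qed
qed

text \<open>On the horizontal line the complex derivative of the extension \<open>e i\<close> is the
  \<open>x\<close>-derivative of the chain member, so the equation of the chain holds there. Both
  sides are holomorphic, so it holds on the disc and passes to germs.\<close>

lemma pfaffian_derivative:
  assumes e: "\<And>k. e k holomorphic_on ball w0 r" and i: "i < length fs"
    and ext: "\<And>k x. k < length fs \<Longrightarrow> \<bar>x - Re w0\<bar> < r \<Longrightarrow> e k (Complex x (Im w0)) = of_real ((fs ! k) (Complex x (Im w0)))"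
    and vars: "mpoly_vars p \<subseteq> {..i + 2}"
    and deriv: "\<And>x. \<bar>x - Re w0\<bar> < r \<Longrightarrow> ((\<lambda>t. (fs ! i) (Complex t (Im w0))) has_real_derivative
         mpoly_eval p (pfaffian_point fs (Complex x (Im w0)))) (at x)"
  shows "pderivation (pgerm (e i)) \<in> gen_field (range rat_germ \<union> (\<lambda>k. pgerm (e k)) ` {..i})"
proof -
  \<comment> \<open>The arguments of the polynomial, extended off the line: the real part becomes
    \<open>z - \<i> * Im w0\<close>, the imaginary part a constant, and from position 2 on come the
    extended chain members.\<close>
  define x where "x k z = (if k = 0 then z + (- \<i> * of_real (Im w0)) else if k = 1 then of_real (Im w0) else e (k - 2) z)" for k z
  have xh: "x k holomorphic_on ball w0 r" for k
    unfolding x_def [abs_def] using e by (cases "k = 0"; cases "k = 1") (auto intro!: holomorphic_intros)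
  define T where "T z = monomials_eval (Poly_Mapping.keys p) (\<lambda>m. of_real (Poly_Mapping.lookup p m)) (\<lambda>k. x k z)" for z
  have Th: "T holomorphic_on ball w0 r"
    unfolding T_def [abs_def] by (rule monomials_eval_holomorphic) (use xh in auto)
  have dh: "deriv (e i) holomorphic_on ball w0 r" using e by (intro holomorphic_deriv) auto
  have line: "deriv (e i) (Complex t (Im w0)) = T (Complex t (Im w0))" if t: "\<bar>t - Re w0\<bar> < r" for t
  proof -
    define z where "z = Complex t (Im w0)"
    have "z - w0 = of_real (t - Re w0)" by (simp add: z_def complex_eq_iff)
    then have "cmod (z - w0) = \<bar>t - Re w0\<bar>" by (simp only: norm_of_real)
    then have zb: "z \<in> ball w0 r" using t by (simp add: dist_norm norm_minus_commute[of w0] norm_minus_commute[of "complex_of_real (Re w0)"])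
    have "(e i has_field_derivative deriv (e i) z) (at z)" using holomorphic_derivI[OF e open_ball zb] .
    moreover have "((\<lambda>w. w + \<i> * of_real (Im w0)) has_field_derivative 1) (at (of_real t))"
      by (auto intro!: derivative_eq_intros)
    moreover have z_eq: "of_real s + \<i> * of_real (Im w0) = Complex s (Im w0)" for s by (simp add: complex_eq_iff)
    ultimately have "((e i \<circ> (\<lambda>w. w + \<i> * of_real (Im w0))) has_field_derivative deriv (e i) z * 1) (at (of_real t))"
      by (intro DERIV_chain) (simp_all add: z_def)
    then have "((\<lambda>s. (e i \<circ> (\<lambda>w. w + \<i> * of_real (Im w0))) (of_real s)) has_vector_derivative deriv (e i) z) (at t)"
      using has_vector_derivative_real_field by fastforce
    then have 1: "((\<lambda>s. e i (Complex s (Im w0))) has_vector_derivative deriv (e i) z) (at t)"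
      by (simp add: z_eq)
    have "((\<lambda>s. complex_of_real ((fs ! i) (Complex s (Im w0)))) has_vector_derivative
        of_real (mpoly_eval p (pfaffian_point fs z))) (at t)"
      using deriv[OF t] unfolding z_def by (intro has_vector_derivative_of_real) (simp add: has_real_derivative_iff_has_vector_derivative)
    then have 2: "((\<lambda>s. e i (Complex s (Im w0))) has_vector_derivative
        of_real (mpoly_eval p (pfaffian_point fs z))) (at t)"
    proof (rule has_vector_derivative_transform_within_open[where S = "ball (Re w0) r"])
      show "t \<in> ball (Re w0) r" using t by (simp add: dist_real_def abs_minus_commute)
      show "complex_of_real ((fs ! i) (Complex s (Im w0))) = e i (Complex s (Im w0))" if "s \<in> ball (Re w0) r" for s
        using ext[OF i, of s] that by (simp add: dist_real_def abs_minus_commute)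
    qed auto
    \<comment> \<open>Two derivatives of the same function of the real parameter: one from the chain
      rule for the holomorphic extension, one from the chain.\<close>
    have "deriv (e i) z = of_real (mpoly_eval p (pfaffian_point fs z))"
      by (rule vector_derivative_unique_at[OF 1 2])
    also have "\<dots> = T z"
      unfolding mpoly_eval_monomials of_real_monomials_eval T_def
    proof (rule monomials_eval_cong[OF refl])
      fix k assume "k \<in> (\<Union>m\<in>Poly_Mapping.keys p. Poly_Mapping.keys m)"
      then have k: "k \<le> i + 2" using vars by (auto simp: mpoly_vars_def)
      show "complex_of_real (pfaffian_point fs z k) = x k z"
        using ext[of "k - 2" t] k i t by (auto simp: pfaffian_point_def x_def z_def complex_eq_iff)
    qed
    finally show ?thesis by (simp add: z_def)
  qed
  have eq: "deriv (e i) z = T z" if "z \<in> ball w0 r" for z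
    using line_identity[of "\<lambda>z. deriv (e i) z - T z" r z] dh Th line r that by (simp add: holomorphic_on_diff)
  have "pderivation (pgerm (e i)) = pgerm (deriv (e i))" by (rule pderivation_pgerm[OF e])
  also have "\<dots> = pgerm T" unfolding pgerm_def
    by (rule germ_eqI[OF generic_ball point_holomorphic[OF dh]]) (use eq point_ball in blast)
  also have "\<dots> = monomials_eval (Poly_Mapping.keys p) (\<lambda>m. cst (of_real (Poly_Mapping.lookup p m))) (\<lambda>k. pgerm (x k))"
    unfolding T_def by (rule pgerm_monomials_eval[OF xh])
  also have "\<dots> \<in> gen_field (range rat_germ \<union> (\<lambda>k. pgerm (e k)) ` {..i})" (is "_ \<in> ?G")
  proof (rule monomials_eval_in[OF field_subset_gen])
    show "cst (of_real (Poly_Mapping.lookup p m)) \<in> ?G" for m using cst_in_rat_germ by (intro gen_base) blast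
    fix k assume "k \<in> (\<Union>m\<in>Poly_Mapping.keys p. Poly_Mapping.keys m)"
    then have k: "k \<le> i + 2" using vars by (auto simp: mpoly_vars_def)
    consider "k = 0" | "k = 1" | "k \<ge> 2" by linarith
    then show "pgerm (x k) \<in> ?G"
    proof cases
      case 1
      have "pgerm (x k) = pgerm (\<lambda>z. z) + cst (- \<i> * of_real (Im w0))"
        unfolding 1 x_def using pgerm_simps(1)[of "\<lambda>z. z" "\<lambda>_. - \<i> * of_real (Im w0)"] by (simp add: pgerm_const)
      moreover have "pgerm (\<lambda>z. z) \<in> ?G" using ident_in_rat_germ by (intro gen_base) blast
      moreover have "cst (- \<i> * of_real (Im w0)) \<in> ?G" using cst_in_rat_germ by (intro gen_base) blast
      ultimately show ?thesis by (simp only: gen_add)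
    next
      case 2
      have "pgerm (x k) = cst (of_real (Im w0))" unfolding 2 x_def by (simp add: pgerm_const)
      then show ?thesis using cst_in_rat_germ by (simp only:) (intro gen_base, blast)
    next
      case 3
      then have "x k = e (k - 2)" by (simp add: x_def [abs_def])
      then show ?thesis using k 3 by (intro gen_base) auto
    qed
  qed
  finally show ?thesis .
qed

end

lemma common_line_ext:
  fixes g :: "nat \<Rightarrow> complex \<Rightarrow> complex"
  assumes V: "open V" "a \<in> V" and g: "\<And>i. i < n \<Longrightarrow> square_analytic (g i) V"
  shows "\<exists>r>0. ball a r \<subseteq> V \<and> (\<forall>i<n. line_ext (\<lambda>x. g i (Complex x (Im a))) (Re a) r)"
  using g
proof (induction n)
  case 0
  then show ?case using V open_contains_ball by blast
next
  case (Suc n)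
  then obtain r where r: "r > 0" "ball a r \<subseteq> V" "\<forall>i<n. line_ext (\<lambda>x. g i (Complex x (Im a))) (Re a) r" by auto
  have "square_analytic (g n) V" using Suc.prems by simp
  from square_analytic_radius[OF this V] obtain s where s: "s > 0"
    "\<And>y. \<bar>y - Im a\<bar> < s \<Longrightarrow> line_ext (\<lambda>x. g n (Complex x y)) (Re a) s" by metis
  have "line_ext (\<lambda>x. g i (Complex x (Im a))) (Re a) (min r s)" if "i < Suc n" for i
  proof (cases "i < n")
    case True
    then show ?thesis using r(3) line_ext_mono[of _ "Re a" r "min r s"] by simp
  next
    case False
    then have "i = n" using that by simp
    then show ?thesis using s line_ext_mono[of _ "Re a" s "min r s"] by simp
  qed
  moreover have "ball a (min r s) \<subseteq> V" using r(2) by auto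
  ultimately show ?case using r(1) s(1) by (intro exI[of _ "min r s"]) auto
qed

theorem theorem3p4:
  fixes U :: "complex set" and f :: "complex \<Rightarrow> complex"
    and P :: "ratfun mpoly" and h :: nat
  assumes "open U" and "connected U"
    and "f analytic_on U"
    and "ade_order P h" and "h > 1"
    and "strongly_minimal_ade P"
    and "ade_solution_on P f U"
    and "\<not> algebraic_over_funs U [\<lambda>z. z] f"
  shows "\<not> (\<exists>V fs. V \<subseteq> U \<and> pfaffian_chain V fs \<and>
            algebraic_over_funs V ((\<lambda>z. z) # map (\<lambda>g z. complex_of_real (g z)) fs)
              (\<lambda>z. complex_of_real (Re (f z))) \<and>
            algebraic_over_funs V ((\<lambda>z. z) # map (\<lambda>g z. complex_of_real (g z)) fs)
              (\<lambda>z. complex_of_real (Im (f z))))"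
proof
  assume "\<exists>V fs. V \<subseteq> U \<and> pfaffian_chain V fs \<and>
            algebraic_over_funs V ((\<lambda>z. z) # map (\<lambda>g z. complex_of_real (g z)) fs)
              (\<lambda>z. complex_of_real (Re (f z))) \<and>
            algebraic_over_funs V ((\<lambda>z. z) # map (\<lambda>g z. complex_of_real (g z)) fs)
              (\<lambda>z. complex_of_real (Im (f z)))"
  then obtain V fs where VU: "V \<subseteq> U" and chain: "pfaffian_chain V fs"
    and algR: "algebraic_over_funs V ((\<lambda>z. z) # map (\<lambda>g z. complex_of_real (g z)) fs) (\<lambda>z. of_real (Re (f z)))"
    and algI: "algebraic_over_funs V ((\<lambda>z. z) # map (\<lambda>g z. complex_of_real (g z)) fs) (\<lambda>z. of_real (Im (f z)))"
    by blast
  define l where "l = length fs"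
  \<comment> \<open>Position 0 holds the identity, so chain member \<open>i\<close> sits in position
    \<open>i + 1\<close>.\<close>
  define gs where "gs = (\<lambda>z. z) # map (\<lambda>g z. complex_of_real (g z)) fs"
  have V: "open V" "connected V" "V \<noteq> {}" and ran: "\<And>i. i < l \<Longrightarrow> real_analytic_on (fs ! i) V"
    using chain by (auto simp: pfaffian_chain_def l_def)
  obtain p where pvars: "\<And>i. i < l \<Longrightarrow> mpoly_vars (p i) \<subseteq> {..i + 2}"
    and pderiv: "\<And>i w. i < l \<Longrightarrow> w \<in> V \<Longrightarrow> ((\<lambda>t. (fs ! i) (Complex t (Im w))) has_real_derivative
              mpoly_eval (p i) (pfaffian_point fs w)) (at (Re w))"
    using chain unfolding pfaffian_chain_def l_def by blast
  have lgs: "length gs = Suc l" by (simp add: gs_def l_def)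
  have gs0: "gs ! 0 = (\<lambda>z. z)" and gsS: "i < l \<Longrightarrow> gs ! Suc i = (\<lambda>z. of_real ((fs ! i) z))" for i
    by (simp_all add: gs_def l_def)
  have sq: "square_analytic (gs ! i) V" if "i < Suc l" for i
    using that square_analytic_ident real_analytic_square_analytic ran by (cases i) (auto simp: gs0 gsS)
  obtain d a b where R0: "\<forall>k\<le>d. mpoly_vars (a k) \<subseteq> {..<Suc l} \<and> mpoly_vars (b k) \<subseteq> {..<Suc l}"
    "\<forall>k\<le>d. \<exists>w\<in>V. mpoly_eval (b k) (\<lambda>i. (gs ! i) w) \<noteq> 0"
    "\<exists>k\<le>d. \<exists>w\<in>V. mpoly_eval (a k) (\<lambda>i. (gs ! i) w) \<noteq> 0"
    "\<forall>w\<in>V. (\<forall>k\<le>d. mpoly_eval (b k) (\<lambda>i. (gs ! i) w) \<noteq> 0) \<longrightarrow>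
       (\<Sum>k\<le>d. mpoly_eval (a k) (\<lambda>i. (gs ! i) w) / mpoly_eval (b k) (\<lambda>i. (gs ! i) w) * of_real (Re (f w)) ^ k) = 0"
    using algR[unfolded algebraic_over_funs_def, folded gs_def, unfolded lgs] by (rule exE, elim exE) (elim conjE, rule that)
  have R: "\<And>k. k \<le> d \<Longrightarrow> mpoly_vars (a k) \<subseteq> {..<Suc l}" "\<And>k. k \<le> d \<Longrightarrow> mpoly_vars (b k) \<subseteq> {..<Suc l}"
    "\<And>k. k \<le> d \<Longrightarrow> \<exists>w\<in>V. mpoly_eval (b k) (\<lambda>i. (gs ! i) w) \<noteq> 0"
    using R0(1,2) by simp_all
  note Rr = R0(4)[rule_format]
  obtain d' a' b' where I0: "\<forall>k\<le>d'. mpoly_vars (a' k) \<subseteq> {..<Suc l} \<and> mpoly_vars (b' k) \<subseteq> {..<Suc l}"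
    "\<forall>k\<le>d'. \<exists>w\<in>V. mpoly_eval (b' k) (\<lambda>i. (gs ! i) w) \<noteq> 0"
    "\<exists>k\<le>d'. \<exists>w\<in>V. mpoly_eval (a' k) (\<lambda>i. (gs ! i) w) \<noteq> 0"
    "\<forall>w\<in>V. (\<forall>k\<le>d'. mpoly_eval (b' k) (\<lambda>i. (gs ! i) w) \<noteq> 0) \<longrightarrow>
       (\<Sum>k\<le>d'. mpoly_eval (a' k) (\<lambda>i. (gs ! i) w) / mpoly_eval (b' k) (\<lambda>i. (gs ! i) w) * of_real (Im (f w)) ^ k) = 0"
    using algI[unfolded algebraic_over_funs_def, folded gs_def, unfolded lgs] by (rule exE, elim exE) (elim conjE, rule that)
  have I: "\<And>k. k \<le> d' \<Longrightarrow> mpoly_vars (a' k) \<subseteq> {..<Suc l}" "\<And>k. k \<le> d' \<Longrightarrow> mpoly_vars (b' k) \<subseteq> {..<Suc l}"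
    "\<And>k. k \<le> d' \<Longrightarrow> \<exists>w\<in>V. mpoly_eval (b' k) (\<lambda>i. (gs ! i) w) \<noteq> 0"
    using I0(1,2) by simp_all
  note Ir = I0(4)[rule_format]
  obtain k0 where k0: "k0 \<le> d" "\<exists>w\<in>V. mpoly_eval (a k0) (\<lambda>i. (gs ! i) w) \<noteq> 0" using R0(3) by blast
  obtain k0' where k0': "k0' \<le> d'" "\<exists>w\<in>V. mpoly_eval (a' k0') (\<lambda>i. (gs ! i) w) \<noteq> 0" using I0(3) by blast
  \<comment> \<open>What must not vanish at the base point: all denominators, and one numerator from
    each relation, so that both relations stay nontrivial on the line.\<close>
  define M where "M = insert (a k0) (insert (a' k0') (b ` {..d} \<union> b' ` {..d'}))"
  have "\<exists>w\<in>V. \<forall>m\<in>M. mpoly_eval m (\<lambda>i. (gs ! i) w) \<noteq> 0"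
  proof (rule square_analytic_common_nonzero[OF V])
    show "finite M" by (simp add: M_def)
    fix m assume m: "m \<in> M"
    have "mpoly_vars m \<subseteq> {..<Suc l}" using m R(1)[OF k0(1)] I(1)[OF k0'(1)] R(2) I(2)
      unfolding M_def by (elim insertE UnE imageE) simp_all
    then show "square_analytic (\<lambda>w. mpoly_eval m (\<lambda>i. (gs ! i) w)) V" by (rule square_analytic_mpoly) (rule sq)
    show "\<exists>w\<in>V. mpoly_eval m (\<lambda>i. (gs ! i) w) \<noteq> 0" using m R(3) I(3) k0(2) k0'(2)
      unfolding M_def by (elim insertE UnE imageE) simp_all
  qed
  then obtain w0 where w0: "w0 \<in> V" "\<And>m. m \<in> M \<Longrightarrow> mpoly_eval m (\<lambda>i. (gs ! i) w0) \<noteq> 0" by blast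
  obtain r where rV: "r > 0" "ball w0 r \<subseteq> V"
    and le: "\<And>i. i < l \<Longrightarrow> line_ext (\<lambda>x. (gs ! Suc i) (Complex x (Im w0))) (Re w0) r"
    using common_line_ext[OF V(1) w0(1), of l "\<lambda>i. gs ! Suc i"] sq by auto
  interpret disc w0 r by unfold_locales (rule rV(1))
  have "\<forall>i<l. \<exists>G. G holomorphic_on ball w0 r \<and>
     (\<forall>x. \<bar>x - Re w0\<bar> < r \<longrightarrow> G (Complex x (Im w0)) = of_real ((fs ! i) (Complex x (Im w0))))"
  proof (intro allI impI)
    fix i assume i: "i < l"
    obtain G where G: "G holomorphic_on ball (of_real (Re w0)) r"
      "\<And>x. \<bar>x - Re w0\<bar> < r \<Longrightarrow> G (of_real x) = of_real ((fs ! i) (Complex x (Im w0)))"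
      using le[OF i] unfolding line_ext_def gsS[OF i] by blast
    define t where "t z = z - \<i> * of_real (Im w0)" for z
    have "t holomorphic_on ball w0 r" unfolding t_def [abs_def] by (intro holomorphic_intros)
    moreover have "t ` ball w0 r \<subseteq> ball (of_real (Re w0)) r"
    proof
      fix y assume "y \<in> t ` ball w0 r"
      then obtain z where z: "z \<in> ball w0 r" "y = t z" by blast
      have "t z - of_real (Re w0) = z - w0" by (simp add: t_def complex_eq_iff)
      then show "y \<in> ball (of_real (Re w0)) r" using z by (simp add: dist_norm norm_minus_commute[of w0] norm_minus_commute[of "complex_of_real (Re w0)"])
    qed
    ultimately have "(G \<circ> t) holomorphic_on ball w0 r" by (rule holomorphic_on_compose_gen[OF _ G(1)])
    moreover have "t (Complex x (Im w0)) = of_real x" for x by (simp add: t_def complex_eq_iff)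
    ultimately show "\<exists>G. G holomorphic_on ball w0 r \<and>
     (\<forall>x. \<bar>x - Re w0\<bar> < r \<longrightarrow> G (Complex x (Im w0)) = of_real ((fs ! i) (Complex x (Im w0))))"
      using G(2) by (intro exI[of _ "G \<circ> t"]) simp
  qed
  then obtain G where G: "\<And>i. i < l \<Longrightarrow> G i holomorphic_on ball w0 r"
     "\<And>i x. i < l \<Longrightarrow> \<bar>x - Re w0\<bar> < r \<Longrightarrow> G i (Complex x (Im w0)) = of_real ((fs ! i) (Complex x (Im w0)))"
    by metis
  \<comment> \<open>The value zero beyond the end of the chain makes every \<open>E i\<close>
    holomorphic on the disc, as \<open>pfaffian_derivative\<close> demands.\<close>
  define E where "E i = (if i < l then G i else (\<lambda>_. 0))" for i
  have Eh: "E i holomorphic_on ball w0 r" for i using G(1) by (simp add: E_def)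
  define e where "e i = (case i of 0 \<Rightarrow> (\<lambda>z. z) | Suc j \<Rightarrow> E j)" for i
  have eh: "e i holomorphic_on ball w0 r" for i using Eh by (cases i) (auto simp: e_def)
  have eg: "e i (Complex x (Im w0)) = (gs ! i) (Complex x (Im w0))" if "i < Suc l" "\<bar>x - Re w0\<bar> < r" for i x
    using that G(2) by (cases i) (auto simp: e_def E_def gs0 gsS)
  have ev: "mpoly_eval m (\<lambda>i. e i (Complex x (Im w0))) = mpoly_eval m (\<lambda>i. (gs ! i) (Complex x (Im w0)))"
    if "mpoly_vars m \<subseteq> {..<Suc l}" "\<bar>x - Re w0\<bar> < r" for m x
    unfolding mpoly_eval_monomials
    by (rule monomials_eval_cong[OF refl]) (use that eg in \<open>auto simp: mpoly_vars_def\<close>)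
  have ev0: "mpoly_eval m (\<lambda>i. e i w0) = mpoly_eval m (\<lambda>i. (gs ! i) w0)" if "mpoly_vars m \<subseteq> {..<Suc l}" for m
    using ev[OF that, of "Re w0"] rV(1) by simp
  have lineV: "Complex x (Im w0) \<in> V" if "\<bar>x - Re w0\<bar> < r" for x
  proof -
    have "Complex x (Im w0) - w0 = of_real (x - Re w0)" by (simp add: complex_eq_iff)
    then have "cmod (Complex x (Im w0) - w0) = \<bar>x - Re w0\<bar>" by (simp only: norm_of_real)
    then show ?thesis using that rV(2) by (auto simp: dist_norm norm_minus_commute[of w0] norm_minus_commute[of "complex_of_real (Re w0)"])
  qed
  have fU: "f holomorphic_on U" using assms(3) by (rule analytic_imp_holomorphic)
  have bU: "ball w0 r \<subseteq> U" using rV(2) VU by blast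
  have fb: "f holomorphic_on ball w0 r" using fU bU by (rule holomorphic_on_subset)
  obtain Rf If where RI: "Rf holomorphic_on ball w0 r" "If holomorphic_on ball w0 r" "\<And>z. f z = Rf z + \<i> * If z"
    "\<And>x. Rf (Complex x (Im w0)) = of_real (Re (f (Complex x (Im w0))))"
    "\<And>x. If (Complex x (Im w0)) = of_real (Im (f (Complex x (Im w0))))"
    using real_imag_ext[OF fb] by blast
  let ?L = "range rat_germ"
  define u where "u i = pgerm (E i)" for i
  let ?S = "range cst \<union> (\<lambda>i. pgerm (e i)) ` {..<Suc l}"
  have "pgerm Rf \<in> acl ?S"
  proof (rule relation_imp_acl[OF eh RI(1) R(1,2) _ k0(1)])
    show "mpoly_eval (b k) (\<lambda>i. e i w0) \<noteq> 0" if "k \<le> d" for k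
      using w0(2)[of "b k"] that ev0[OF R(2)[OF that]] by (simp add: M_def)
    show "mpoly_eval (a k0) (\<lambda>i. e i w0) \<noteq> 0" using w0(2)[of "a k0"] ev0[OF R(1)[OF k0(1)]] by (simp add: M_def)
    fix x assume x: "\<bar>x - Re w0\<bar> < r" and nz: "\<And>k. k \<le> d \<Longrightarrow> mpoly_eval (b k) (\<lambda>i. e i (Complex x (Im w0))) \<noteq> 0"
    have "mpoly_eval (b k) (\<lambda>i. (gs ! i) (Complex x (Im w0))) \<noteq> 0" if "k \<le> d" for k
      using nz[OF that] ev[OF R(2)[OF that] x] by simp
    from Rr[OF lineV[OF x] this]
    show "(\<Sum>k\<le>d. mpoly_eval (a k) (\<lambda>i. e i (Complex x (Im w0))) / mpoly_eval (b k) (\<lambda>i. e i (Complex x (Im w0)))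
          * Rf (Complex x (Im w0)) ^ k) = 0"
      using ev[OF R(1) x] ev[OF R(2) x] by (simp add: RI(4))
  qed
  moreover have "pgerm If \<in> acl ?S"
  proof (rule relation_imp_acl[OF eh RI(2) I(1,2) _ k0'(1)])
    show "mpoly_eval (b' k) (\<lambda>i. e i w0) \<noteq> 0" if "k \<le> d'" for k
      using w0(2)[of "b' k"] that ev0[OF I(2)[OF that]] by (simp add: M_def)
    show "mpoly_eval (a' k0') (\<lambda>i. e i w0) \<noteq> 0" using w0(2)[of "a' k0'"] ev0[OF I(1)[OF k0'(1)]] by (simp add: M_def)
    fix x assume x: "\<bar>x - Re w0\<bar> < r" and nz: "\<And>k. k \<le> d' \<Longrightarrow> mpoly_eval (b' k) (\<lambda>i. e i (Complex x (Im w0))) \<noteq> 0"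
    have "mpoly_eval (b' k) (\<lambda>i. (gs ! i) (Complex x (Im w0))) \<noteq> 0" if "k \<le> d'" for k
      using nz[OF that] ev[OF I(2)[OF that] x] by simp
    from Ir[OF lineV[OF x] this]
    show "(\<Sum>k\<le>d'. mpoly_eval (a' k) (\<lambda>i. e i (Complex x (Im w0))) / mpoly_eval (b' k) (\<lambda>i. e i (Complex x (Im w0)))
          * If (Complex x (Im w0)) ^ k) = 0"
      using ev[OF I(1) x] ev[OF I(2) x] by (simp add: RI(5))
  qed
  moreover have "?S \<subseteq> ?L \<union> u ` {..<l}"
  proof
    fix y assume "y \<in> ?S"
    then consider c where "y = cst c" | i where "i < Suc l" "y = pgerm (e i)" by blast
    then show "y \<in> ?L \<union> u ` {..<l}"
    proof cases
      case 1 then show ?thesis using cst_in_rat_germ by simp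
    next
      case (2 i)
      then show ?thesis using ident_in_rat_germ by (cases i) (auto simp: e_def u_def)
    qed
  qed
  ultimately have RIacl: "pgerm Rf \<in> acl (?L \<union> u ` {..<l})" "pgerm If \<in> acl (?L \<union> u ` {..<l})"
    using acl_mono by blast+
  \<comment> \<open>The constant \<open>\<i>\<close> is available, so \<open>f\<close>, being
    \<open>Rf + \<i> * If\<close>, is algebraic over the tower along with its two parts.\<close>
  have "cst \<i> \<in> acl (?L \<union> u ` {..<l})" using subset_acl[of "?L \<union> u ` {..<l}"] cst_in_rat_germ by blast
  moreover have "f = (\<lambda>z. Rf z + \<i> * If z)" using RI(3) by blast
  then have "pgerm f = pgerm Rf + cst \<i> * pgerm If"
    using pgerm_simps(1)[OF RI(1), of "\<lambda>z. \<i> * If z"] pgerm_simps(2)[of "\<lambda>_. \<i>" If] RI(2)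
    by (simp add: pgerm_const holomorphic_on_mult)
  ultimately have facl: "pgerm f \<in> acl (?L \<union> u ` {..<l})"
    using RIacl by (simp add: field_subset_add[OF field_subset_acl] field_subset_mult[OF field_subset_acl])
  have ftr: "\<not> alg_over ?L (pgerm f)"
    using algebraic_germ_imp_algebraic[OF assms(1,2) bU fU] assms(8) by blast
  have ud: "pderivation (u i) \<in> gen_field (?L \<union> u ` {..i})" if i: "i < l" for i
    unfolding u_def
  proof (rule pfaffian_derivative[OF Eh])
    show "i < length fs" using i by (simp add: l_def)
    show "E k (Complex x (Im w0)) = of_real ((fs ! k) (Complex x (Im w0)))" if "k < length fs" "\<bar>x - Re w0\<bar> < r" for k x
      using that G(2) by (simp add: E_def l_def)
    show "mpoly_vars (p i) \<subseteq> {..i + 2}" by (rule pvars[OF i])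
    show "((\<lambda>t. (fs ! i) (Complex t (Im w0))) has_real_derivative
         mpoly_eval (p i) (pfaffian_point fs (Complex x (Im w0)))) (at x)" if "\<bar>x - Re w0\<bar> < r" for x
      using pderiv[OF i lineV[OF that]] by simp
  qed
  define PP where "PP = monomials_eval (Poly_Mapping.keys P) (\<lambda>m. rat_germ (Poly_Mapping.lookup P m))"
  have PPf: "PP (jet pderivation (pgerm f)) = 0"
    unfolding PP_def by (rule ade_solution_germ[OF fb bU assms(7)])
  have PPp: "PP \<in> polyfun ?L (Suc h)"
    unfolding PP_def by (rule monomials_eval_polyfun[OF field_subset_rat_germ])
      (use assms(4) in \<open>auto simp: ade_order_def mpoly_vars_def less_Suc_eq_le\<close>)
  have Ld: "pderivation x \<in> ?L" if "x \<in> ?L" for x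
    using that by (auto simp flip: rat_germ_hom(4))
  obtain Q where Q: "Q \<in> polyfun UNIV 2" "\<exists>\<xi>. Q \<xi> \<noteq> 0"
     "infinite {x. Q (jet pderivation x) = 0 \<and> PP (jet pderivation x) = 0}"
    using tower_infinite_common_solutions[OF derivation_pderivation blum_closed_pderivation field_subset_rat_germ
        Ld ud facl ftr PPp PPf] by blast
  \<comment> \<open>Once germs are coded in \<open>universe\<close>, strong minimality makes the
    common solutions of \<open>P\<close> and this \<open>Q\<close> finite.\<close>
  obtain enc :: "gfun \<Rightarrow> universe" where "inj enc" using ex_inj_gfun by blast
  from strongly_minimal_first_order_finite[OF this derivation_pderivation blum_closed_pderivation rat_germ_hom
     assms(6,4,5) Q(1,2)]
  show False using Q(3) by (simp add: PP_def)
qed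

end
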